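(* Let $k$ be a perfect field and $I\subseteq k[x_0,\ldots,x_n]$ a homogeneous unmixed radical ideal of dimension $d$, with $d\ge0$. Then \[h_I(m)\le\binom{m+\deg I+d}{d+1}-\binom{m+d}{d+1}\qquad\text{for all } m\ge1.\]
   Context: An ideal is unmixed if all its associated primes have the same dimension. The dimension of a homogeneous ideal is the dimension of the projective variety it defines in $\mathbb P^n(\bar k)$. $h_I(m):=\dim_k(k[x_0,\ldots,x_n]/I)_m$. If $I$ has dimension $d\ge0$ and Hilbert polynomial with leading term $a_dt^d$, then $\deg I:=d!\,a_d$. *)

theory Defs
  imports Complex_Main "HOL-Library.Poly_Mapping" "HOL-Computational_Algebra.Polynomial"
begin

text \<open>Polynomial ring k[x_v : v in 'v] over a finite variable type 'v
  (n+1 = CARD('v) variables): finitely supported maps from monomials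
  (exponent vectors 'v =>0 nat) to coefficients.\<close>
type_synonym ('v, 'k) mpoly = "('v \<Rightarrow>\<^sub>0 nat) \<Rightarrow>\<^sub>0 'k"

definition perfect_field :: "'k::field itself \<Rightarrow> bool" where
  "perfect_field _ \<longleftrightarrow> CHAR('k) = 0 \<or> (\<forall>y::'k. \<exists>x. x ^ CHAR('k) = y)"

definition mdeg :: "('v::finite \<Rightarrow>\<^sub>0 nat) \<Rightarrow> nat" where
  "mdeg t = (\<Sum>v\<in>UNIV. Poly_Mapping.lookup t v)"

definition const :: "'k::field \<Rightarrow> ('v, 'k) mpoly" where
  "const c = Poly_Mapping.single 0 c"

definition homog_part :: "nat \<Rightarrow> ('v::finite, 'k::field) mpoly \<Rightarrow> ('v, 'k) mpoly" where
  "homog_part m f = Poly_Mapping.mapp (\<lambda>t c. if mdeg t = m then c else 0) f"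

definition graded_piece :: "nat \<Rightarrow> ('v::finite, 'k::field) mpoly set" where
  "graded_piece m = {f. \<forall>t\<in>Poly_Mapping.keys f. mdeg t = m}"

definition is_ideal :: "'a::comm_ring_1 set \<Rightarrow> bool" where
  "is_ideal I \<longleftrightarrow> 0 \<in> I \<and> (\<forall>a\<in>I. \<forall>b\<in>I. a + b \<in> I) \<and> (\<forall>a\<in>I. \<forall>r. r * a \<in> I)"

definition homogeneous_ideal :: "('v::finite, 'k::field) mpoly set \<Rightarrow> bool" where
  "homogeneous_ideal I \<longleftrightarrow> is_ideal I \<and> (\<forall>f\<in>I. \<forall>m. homog_part m f \<in> I)"

definition prime_ideal :: "'a::comm_ring_1 set \<Rightarrow> bool" where
  "prime_ideal P \<longleftrightarrow> is_ideal P \<and> P \<noteq> UNIV \<and> (\<forall>a b. a * b \<in> P \<longrightarrow> a \<in> P \<or> b \<in> P)"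

definition radical_ideal :: "'a::comm_ring_1 set \<Rightarrow> bool" where
  "radical_ideal I \<longleftrightarrow> is_ideal I \<and> (\<forall>f n. f ^ n \<in> I \<longrightarrow> f \<in> I)"

definition associated_primes :: "'a::comm_ring_1 set \<Rightarrow> 'a set set" where
  "associated_primes I = {P. prime_ideal P \<and> (\<exists>f. P = {g. g * f \<in> I})}"

definition krull_dim_quot :: "'a::comm_ring_1 set \<Rightarrow> nat" where
  "krull_dim_quot I = Sup {r. \<exists>P::nat \<Rightarrow> 'a set.
      (\<forall>i\<le>r. prime_ideal (P i) \<and> I \<subseteq> P i) \<and> (\<forall>i<r. P i \<subset> P (Suc i))}"

text \<open>Dimension of (the projective variety of) a homogeneous ideal:
  Krull dimension of the quotient minus one (-1 for the empty variety).\<close>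
definition proj_dim :: "('v::finite, 'k::field) mpoly set \<Rightarrow> int" where
  "proj_dim I = int (krull_dim_quot I) - 1"

definition unmixed :: "'a::comm_ring_1 set \<Rightarrow> bool" where
  "unmixed I \<longleftrightarrow> (\<forall>P\<in>associated_primes I. \<forall>Q\<in>associated_primes I.
      krull_dim_quot P = krull_dim_quot Q)"

text \<open>Hilbert function h_I(m) = dim_k (k[x]/I)_m, the minimal size of a set of
  degree-m homogeneous polynomials spanning R_m modulo I.\<close>
definition hilbert_fun :: "('v::finite, 'k::field) mpoly set \<Rightarrow> nat \<Rightarrow> nat" where
  "hilbert_fun I m = (LEAST c. \<exists>S. finite S \<and> card S = c \<and> S \<subseteq> graded_piece m \<and>
      (\<forall>f\<in>graded_piece m. \<exists>a. f - (\<Sum>s\<in>S. const (a s) * s) \<in> I))"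

definition is_hilbert_poly :: "('v::finite, 'k::field) mpoly set \<Rightarrow> real poly \<Rightarrow> bool" where
  "is_hilbert_poly I p \<longleftrightarrow> (\<exists>m0. \<forall>m\<ge>m0. real (hilbert_fun I m) = poly p (real m))"

definition hilbert_poly :: "('v::finite, 'k::field) mpoly set \<Rightarrow> real poly" where
  "hilbert_poly I = (THE p. is_hilbert_poly I p)"

definition ideal_degree :: "('v::finite, 'k::field) mpoly set \<Rightarrow> real" where
  "ideal_degree I = fact (nat (proj_dim I)) * coeff (hilbert_poly I) (nat (proj_dim I))"

end

theory Submission
  imports Defs "HOL-Library.Countable" "HOL-Computational_Algebra.Fraction_Field"
    "HOL-Algebra.Algebraic_Closure_Type" "Jordan_Normal_Form.Determinant"
begin

text \<open>The ideal is an intersection of homogeneous primes \<open>P\<close> of the same dimension \<open>d\<close>, and both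
  sides of the inequality behave well under intersection: Hilbert functions are subadditive,
  degrees add up, and a sum of blocks of increasing terms is at most one long block. So it suffices
  to show, for a homogeneous prime \<open>P\<close> and some \<open>D\<close>, that \<open>D * C(m+d, d) \<le> h(m + c)\<close> and
  \<open>h(m) \<le> \<Sum>j<D. C(m+j+d, d)\<close>: the lower bound identifies \<open>D\<close> with the degree, and
  the sum telescopes to the right-hand side.

  Evaluating at a generic point \<open>x\<close> of \<open>P\<close>, dehomogenized, turns \<open>h(m)\<close> into the dimension of the space
  \<open>V x m\<close> of polynomial expressions of degree at most \<open>m\<close> in \<open>x\<close>. After a base change to an infinite
  field, repeated linear projections yield algebraically independent linear combinations \<open>y\<close>
  of \<open>x\<close>, over which \<open>x\<close> is integral and, by perfectness, separable, of degree \<open>D\<close>. There is a basis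
  \<open>b\<close> of the extension with \<open>b j\<close> of degree at most \<open>j\<close>, after reordering, and the map
  \<open>u \<mapsto> \<Sum>j. trace (u * b j) * b j\<close> is injective because the trace form is nondegenerate. Traces of
  elements of \<open>V x m\<close> are polynomials of degree at most \<open>m\<close> in \<open>y\<close>, which bounds \<open>dim (V x m)\<close> by the
  number of monomials of degree at most \<open>m + j\<close>, summed over \<open>j < D\<close>.\<close>

section \<open>Dimensions modulo subspaces\<close>

text \<open>The upper bound hinges on the trace not raising degrees: polynomial rings are completely
  integrally closed with control of degrees, and all powers of a trace share one denominator. Upper
  and lower bound carry the same D, so the degree is never computed geometrically; it is read off as
  a limit at the end. Two obstacles shape the rest. Over a finite field a direction avoiding a
  hypersurface need not exist, so scalars are extended to rational functions. In positive
  characteristic these are not perfect, hence separability is carried by Mac Lane's criterion, which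
  holds after the extension because the original field is perfect. Moreover the dimension is defined
  by chains of arbitrary primes, while the components and Hilbert functions are homogeneous; the
  growth exponent of the cumulative Hilbert function links the two. Field extensions live as subsets
  of one fixed field, with bases, coordinates and traces relative to subfields; quotient rings are
  replaced by dimensions modulo a subspace.\<close>

definition subfld :: "'a::field set \<Rightarrow> bool" where
  "subfld E \<longleftrightarrow> 0 \<in> E \<and> 1 \<in> E \<and> (\<forall>a\<in>E. \<forall>b\<in>E. a + b \<in> E \<and> a * b \<in> E) \<and> (\<forall>a\<in>E. - a \<in> E \<and> inverse a \<in> E)"

lemma subfld_UNIV [simp]: "subfld UNIV" by (simp add: subfld_def)

lemma subfld_closed:
  assumes "subfld E"
  shows "0 \<in> E" "1 \<in> E" "a \<in> E \<Longrightarrow> b \<in> E \<Longrightarrow> a + b \<in> E" "a \<in> E \<Longrightarrow> b \<in> E \<Longrightarrow> a * b \<in> E"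
    "a \<in> E \<Longrightarrow> - a \<in> E" "a \<in> E \<Longrightarrow> inverse a \<in> E"
    "a \<in> E \<Longrightarrow> b \<in> E \<Longrightarrow> a - b \<in> E" "a \<in> E \<Longrightarrow> b \<in> E \<Longrightarrow> a / b \<in> E" "a \<in> E \<Longrightarrow> a ^ n \<in> E"
proof -
  show *: "0 \<in> E" "1 \<in> E" "a \<in> E \<Longrightarrow> b \<in> E \<Longrightarrow> a + b \<in> E" "a \<in> E \<Longrightarrow> b \<in> E \<Longrightarrow> a * b \<in> E"
    "a \<in> E \<Longrightarrow> - a \<in> E" "a \<in> E \<Longrightarrow> inverse a \<in> E" for a b
    using assms by (auto simp: subfld_def)
  show "a \<in> E \<Longrightarrow> b \<in> E \<Longrightarrow> a - b \<in> E"
    using *(3,5) by (metis add_uminus_conv_diff)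
  show "a \<in> E \<Longrightarrow> b \<in> E \<Longrightarrow> a / b \<in> E"
    using *(4,6) by (simp add: divide_inverse)
  show "a \<in> E \<Longrightarrow> a ^ n \<in> E" by (induction n) (auto intro: *)
qed

lemma subfld_sum: "subfld E \<Longrightarrow> (\<And>i. i \<in> S \<Longrightarrow> f i \<in> E) \<Longrightarrow> sum f S \<in> E"
  by (induction S rule: infinite_finite_induct) (auto intro: subfld_closed)

text \<open>Gaussian elimination over the subfield \<open>E\<close>. The solution has to stay in
  \<open>E\<close>: with \<open>E = UNIV\<close> this serves the exchange argument, with the base
  field of a finite extension the construction of inverses.\<close>

lemma homogeneous_system:
  fixes M :: "'i \<Rightarrow> 'j \<Rightarrow> 'a::field"
  assumes "subfld E" "finite J" "finite I" "card J < card I" "\<And>i j. i \<in> I \<Longrightarrow> j \<in> J \<Longrightarrow> M i j \<in> E"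
  shows "\<exists>a. (\<forall>i\<in>I. a i \<in> E) \<and> (\<exists>i\<in>I. a i \<noteq> 0) \<and> (\<forall>j\<in>J. (\<Sum>i\<in>I. a i * M i j) = 0)"
  using assms(2-)
proof (induction J arbitrary: I M rule: finite_induct)
  case empty
  then have "I \<noteq> {}" by auto
  then show ?case
    by (intro exI[of _ "\<lambda>_. 1"]) (auto intro: subfld_closed assms(1))
next
  case (insert s J)
  note E = subfld_closed[OF assms(1)]
  show ?case
  proof (cases "\<forall>i\<in>I. M i s = 0")
    case True
    have "\<exists>a. (\<forall>i\<in>I. a i \<in> E) \<and> (\<exists>i\<in>I. a i \<noteq> 0) \<and> (\<forall>j\<in>J. (\<Sum>i\<in>I. a i * M i j) = 0)"
      by (rule insert.IH) (use insert in auto)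
    then obtain a where "\<forall>i\<in>I. a i \<in> E" "\<exists>i\<in>I. a i \<noteq> 0" "\<forall>j\<in>J. (\<Sum>i\<in>I. a i * M i j) = 0"
      by blast
    then show ?thesis using True by (intro exI[of _ a]) auto
  next
    case False
    then obtain p where p: "p \<in> I" "M p s \<noteq> 0" by auto
    \<comment> \<open>Equation \<open>s\<close> is solved for the unknown \<open>p\<close>;
      \<open>M'\<close> is what the other equations become after substitution, and \<open>c\<close>
      below is the value this forces on \<open>p\<close>.\<close>
    define M' where "M' i j = M i j - M i s / M p s * M p j" for i j
    have "\<exists>a. (\<forall>i\<in>I-{p}. a i \<in> E) \<and> (\<exists>i\<in>I-{p}. a i \<noteq> 0) \<and> (\<forall>j\<in>J. (\<Sum>i\<in>I-{p}. a i * M' i j) = 0)"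
      by (rule insert.IH) (use insert p in \<open>auto simp: M'_def intro!: E\<close>)
    then obtain a where a: "\<forall>i\<in>I-{p}. a i \<in> E" "\<exists>i\<in>I-{p}. a i \<noteq> 0"
      "\<forall>j\<in>J. (\<Sum>i\<in>I-{p}. a i * M' i j) = 0" by blast
    define c where "c = - (\<Sum>i\<in>I-{p}. a i * M i s) / M p s"
    have cE: "c \<in> E"
      unfolding c_def using a(1) insert.prems(3) p
      by (intro E subfld_sum[OF assms(1)]) auto
    define b where "b = a(p := c)"
    have split: "(\<Sum>i\<in>I. b i * M i j) = c * M p j + (\<Sum>i\<in>I-{p}. a i * M i j)" for j
      using sum.remove[OF insert.prems(1) p(1), of "\<lambda>i. b i * M i j"]
      by (simp add: b_def)
    have "(\<Sum>i\<in>I. b i * M i s) = 0"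
      unfolding split c_def using p by simp
    moreover have "(\<Sum>i\<in>I. b i * M i j) = 0" if "j \<in> J" for j
    proof -
      have "(\<Sum>i\<in>I-{p}. a i * M' i j) = 0" using a that by auto
      then have "(\<Sum>i\<in>I-{p}. a i * M i j) = (\<Sum>i\<in>I-{p}. a i * M i s) / M p s * M p j"
        by (simp add: M'_def right_diff_distrib sum_subtractf sum_distrib_right sum_divide_distrib mult.assoc)
      then show ?thesis unfolding split c_def by simp
    qed
    ultimately show ?thesis
      using a cE by (intro exI[of _ b]) (auto simp: b_def)
  qed
qed

text \<open>A ring with a unital homomorphism from a field into it is a vector space over that
  field. Keeping the map explicit lets one theory of dimension serve polynomial rings, function
  fields and base changes alike.\<close>

locale scalar_hom =
  fixes \<iota> :: "'f::field \<Rightarrow> 'r::comm_ring_1"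
  assumes hom_add: "\<iota> (a + b) = \<iota> a + \<iota> b"
    and hom_mult: "\<iota> (a * b) = \<iota> a * \<iota> b"
    and hom_one [simp]: "\<iota> 1 = 1"
begin

lemma hom_zero [simp]: "\<iota> 0 = 0"
  using hom_add[of 0 0] by simp

lemma hom_uminus: "\<iota> (- a) = - \<iota> a"
  using hom_add[of a "-a"] by (simp add: add_eq_0_iff2)

lemma hom_diff: "\<iota> (a - b) = \<iota> a - \<iota> b"
  using hom_add[of a "-b"] by (simp add: hom_uminus)

lemma hom_sum: "\<iota> (sum f S) = (\<Sum>i\<in>S. \<iota> (f i))"
  by (induction S rule: infinite_finite_induct) (auto simp: hom_add)

lemma hom_power: "\<iota> (a ^ n) = \<iota> a ^ n"
  by (induction n) (auto simp: hom_mult)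

lemma hom_of_nat: "\<iota> (of_nat n) = of_nat n"
  by (induction n) (auto simp: hom_add)

lemma hom_eq_0: "\<iota> a = 0 \<longleftrightarrow> a = 0"
proof
  assume "\<iota> a = 0"
  show "a = 0"
  proof (rule ccontr)
    assume "a \<noteq> 0"
    then have "\<iota> (a * inverse a) = 1" by simp
    then show False using \<open>\<iota> a = 0\<close> by (simp add: hom_mult)
  qed
qed simp

lemma hom_inj: "\<iota> a = \<iota> b \<longleftrightarrow> a = b"
  using hom_eq_0[of "a - b"] by (simp add: hom_diff)

definition linsub :: "'r set \<Rightarrow> bool" where
  "linsub U \<longleftrightarrow> 0 \<in> U \<and> (\<forall>x\<in>U. \<forall>y\<in>U. x + y \<in> U) \<and> (\<forall>c. \<forall>x\<in>U. \<iota> c * x \<in> U)"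

lemma linsub_closed:
  assumes "linsub U"
  shows "0 \<in> U" "x \<in> U \<Longrightarrow> y \<in> U \<Longrightarrow> x + y \<in> U" "x \<in> U \<Longrightarrow> \<iota> c * x \<in> U"
    "x \<in> U \<Longrightarrow> - x \<in> U" "x \<in> U \<Longrightarrow> y \<in> U \<Longrightarrow> x - y \<in> U"
proof -
  show *: "0 \<in> U" "x \<in> U \<Longrightarrow> y \<in> U \<Longrightarrow> x + y \<in> U" "x \<in> U \<Longrightarrow> \<iota> c * x \<in> U" for x y c
    using assms by (auto simp: linsub_def)
  show **: "x \<in> U \<Longrightarrow> - x \<in> U" for x
    using *(3)[of x "-1"] by (simp add: hom_uminus)
  show "x \<in> U \<Longrightarrow> y \<in> U \<Longrightarrow> x - y \<in> U"
    using *(2)[of x "-y"] **[of y] by simp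
qed

lemma linsub_sum: "linsub U \<Longrightarrow> (\<And>i. i \<in> S \<Longrightarrow> f i \<in> U) \<Longrightarrow> sum f S \<in> U"
  by (induction S rule: infinite_finite_induct) (auto intro: linsub_closed)

lemma linsub_zero [simp]: "linsub {0}" by (simp add: linsub_def)

lemma linsub_Int: "linsub U \<Longrightarrow> linsub Y \<Longrightarrow> linsub (U \<inter> Y)"
  by (auto simp: linsub_def)

text \<open>Quotient spaces are never formed: bases are finite families in the ambient ring whose
  properties hold modulo the subspace \<open>I\<close>. Families rather than sets make concatenation
  and reindexing easy.\<close>

definition indep_mod :: "'r set \<Rightarrow> nat \<Rightarrow> (nat \<Rightarrow> 'r) \<Rightarrow> bool" where
  "indep_mod I r b \<longleftrightarrow> (\<forall>a. (\<Sum>i<r. \<iota> (a i) * b i) \<in> I \<longrightarrow> (\<forall>i<r. a i = 0))"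

definition spans_mod :: "'r set \<Rightarrow> 'r set \<Rightarrow> nat \<Rightarrow> (nat \<Rightarrow> 'r) \<Rightarrow> bool" where
  "spans_mod U I r b \<longleftrightarrow> (\<forall>x\<in>U. \<exists>a. x - (\<Sum>i<r. \<iota> (a i) * b i) \<in> I)"

definition basis_mod :: "'r set \<Rightarrow> 'r set \<Rightarrow> nat \<Rightarrow> (nat \<Rightarrow> 'r) \<Rightarrow> bool" where
  "basis_mod U I r b \<longleftrightarrow> (\<forall>i<r. b i \<in> U) \<and> indep_mod I r b \<and> spans_mod U I r b"

text \<open>Expressing \<open>r\<close> vectors by \<open>s < r\<close> others gives a homogeneous
  system with more unknowns than equations, and a solution is a relation modulo
  \<open>I\<close>.\<close>

lemma indep_le_spans:
  assumes I: "linsub I" and b: "indep_mod I r b" "\<forall>i<r. b i \<in> U" and e: "spans_mod U I s e"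
  shows "r \<le> s"
proof (rule ccontr)
  assume "\<not> r \<le> s"
  then have lt: "s < r" by simp
  have "\<forall>i<r. \<exists>a. b i - (\<Sum>j<s. \<iota> (a j) * e j) \<in> I"
    using b(2) e by (auto simp: spans_mod_def)
  then obtain M where M: "\<And>i. i < r \<Longrightarrow> b i - (\<Sum>j<s. \<iota> (M i j) * e j) \<in> I"
    by metis
  have "\<exists>a. (\<forall>i\<in>{..<r}. a i \<in> UNIV) \<and> (\<exists>i\<in>{..<r}. a i \<noteq> 0) \<and> (\<forall>j\<in>{..<s}. (\<Sum>i\<in>{..<r}. a i * M i j) = 0)"
    by (rule homogeneous_system) (use lt in auto)
  then obtain a where a: "\<exists>i<r. a i \<noteq> 0" "\<And>j. j < s \<Longrightarrow> (\<Sum>i<r. a i * M i j) = 0" by auto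
  have "(\<Sum>i<r. \<iota> (a i) * (b i - (\<Sum>j<s. \<iota> (M i j) * e j))) \<in> I"
    using M by (intro linsub_sum[OF I] linsub_closed(3)[OF I]) auto
  also have "(\<Sum>i<r. \<iota> (a i) * (b i - (\<Sum>j<s. \<iota> (M i j) * e j)))
      = (\<Sum>i<r. \<iota> (a i) * b i) - (\<Sum>j<s. \<iota> (\<Sum>i<r. a i * M i j) * e j)"
  proof -
    have "(\<Sum>i<r. \<iota> (a i) * (\<Sum>j<s. \<iota> (M i j) * e j)) = (\<Sum>i<r. \<Sum>j<s. \<iota> (a i * M i j) * e j)"
      by (simp add: sum_distrib_left hom_mult mult.assoc)
    also have "\<dots> = (\<Sum>j<s. \<iota> (\<Sum>i<r. a i * M i j) * e j)"
      by (subst sum.swap) (simp add: hom_sum sum_distrib_right)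
    finally show ?thesis by (simp add: right_diff_distrib sum_subtractf)
  qed
  also have "(\<Sum>j<s. \<iota> (\<Sum>i<r. a i * M i j) * e j) = 0"
    using a(2) by simp
  finally have "(\<Sum>i<r. \<iota> (a i) * b i) \<in> I" by simp
  then show False using b(1) a(1) by (auto simp: indep_mod_def)
qed

lemma basis_mod_unique:
  "linsub I \<Longrightarrow> basis_mod U I r b \<Longrightarrow> basis_mod U I s e \<Longrightarrow> r = s"
  by (meson basis_mod_def indep_le_spans order_antisym)

text \<open>A shortest spanning family drawn from \<open>e\<close> is independent, since a relation
  would let one of its members be dropped.\<close>

lemma basis_mod_from_spanning:
  assumes I: "linsub I" and U: "linsub U" and e: "\<And>i. i < s \<Longrightarrow> e i \<in> U" "spans_mod U I s e"
  shows "\<exists>r b. basis_mod U I r b \<and> (\<forall>i<r. b i \<in> e ` {..<s})"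
proof -
  define P where "P n \<longleftrightarrow> (\<exists>b. (\<forall>i<n. b i \<in> e ` {..<s}) \<and> spans_mod U I n b)" for n
  have "P s" unfolding P_def using e by auto
  define r where "r = (LEAST n. P n)"
  have "P r" unfolding r_def by (rule LeastI) (rule \<open>P s\<close>)
  then obtain b where b: "\<And>i. i < r \<Longrightarrow> b i \<in> e ` {..<s}" "spans_mod U I r b"
    by (auto simp: P_def)
  have "indep_mod I r b"
    unfolding indep_mod_def
  proof (intro allI impI, rule ccontr)
    fix a p assume a: "(\<Sum>i<r. \<iota> (a i) * b i) \<in> I" and p: "p < r" "a p \<noteq> 0"
    define t where "t = r - 1"
    \<comment> \<open>The last vector moves to the vacant place \<open>p\<close>, so that the
      shortened family is again indexed by an initial segment.\<close>
    define b' where "b' = b(p := b t)"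
    have r: "r = Suc t" using p t_def by simp
    have "spans_mod U I t b'"
      unfolding spans_mod_def
    proof
      fix x assume "x \<in> U"
      then obtain c where c: "x - (\<Sum>i<r. \<iota> (c i) * b i) \<in> I"
        using b(2) by (auto simp: spans_mod_def)
      \<comment> \<open>Subtracting this multiple of the relation makes the coefficient of
        \<open>b p\<close> zero.\<close>
      define q where "q = c p / a p"
      define d where "d i = c i - q * a i" for i
      have dp: "d p = 0" using p by (simp add: d_def q_def)
      have "\<iota> q * (\<Sum>i<r. \<iota> (a i) * b i) \<in> I"
        using a linsub_closed(3)[OF I] by blast
      then have "x - (\<Sum>i<r. \<iota> (c i) * b i) + \<iota> q * (\<Sum>i<r. \<iota> (a i) * b i) \<in> I"
        using linsub_closed(2)[OF I] c by blast
      also have "x - (\<Sum>i<r. \<iota> (c i) * b i) + \<iota> q * (\<Sum>i<r. \<iota> (a i) * b i)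
         = x - (\<Sum>i<r. \<iota> (d i) * b i)"
        unfolding d_def
        by (simp add: hom_diff left_diff_distrib sum_subtractf sum_distrib_left hom_mult mult.assoc)
      also have "(\<Sum>i<r. \<iota> (d i) * b i) = (\<Sum>i<t. \<iota> ((d(p := d t)) i) * b' i)"
      proof (cases "p = t")
        case True
        then show ?thesis using True dp by (simp add: r b'_def)
      next
        case False
        then have pt: "p \<in> {..<t}" using p r by auto
        have "(\<Sum>i<t. \<iota> ((d(p := d t)) i) * b' i) = \<iota> (d t) * b t + (\<Sum>i\<in>{..<t}-{p}. \<iota> (d i) * b i)"
        proof -
          have "(\<Sum>i\<in>{..<t}-{p}. \<iota> ((d(p := d t)) i) * b' i) = (\<Sum>i\<in>{..<t}-{p}. \<iota> (d i) * b i)"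
            by (rule sum.cong) (auto simp: b'_def)
          then show ?thesis
            using sum.remove[OF finite_lessThan pt, of "\<lambda>i. \<iota> ((d(p := d t)) i) * b' i"]
            by (simp only: fun_upd_same b'_def)
        qed
        also have "(\<Sum>i\<in>{..<t}-{p}. \<iota> (d i) * b i) = (\<Sum>i<t. \<iota> (d i) * b i)"
          using sum.remove[OF _ pt, of "\<lambda>i. \<iota> (d i) * b i"] dp by simp
        finally show ?thesis by (simp add: r)
      qed
      finally show "\<exists>a. x - (\<Sum>i<t. \<iota> (a i) * b' i) \<in> I" by blast
    qed
    moreover have "\<forall>i<t. b' i \<in> e ` {..<s}" using b(1) r by (auto simp: b'_def)
    ultimately have "P t" by (auto simp: P_def)
    then show False using Least_le[of P t] r by (simp add: r_def)
  qed
  moreover have "\<forall>i<r. b i \<in> U" using b(1) e(1) by (metis imageE lessThan_iff)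
  ultimately show ?thesis using b by (intro exI[of _ r] exI[of _ b]) (auto simp: basis_mod_def)
qed

definition fin_span :: "'r set \<Rightarrow> bool" where
  "fin_span U \<longleftrightarrow> linsub U \<and> (\<exists>s e. (\<forall>i<s. e i \<in> U) \<and> spans_mod U {0} s e)"

lemma spans_mod_mono: "spans_mod U I s e \<Longrightarrow> I \<subseteq> J \<Longrightarrow> Y \<subseteq> U \<Longrightarrow> spans_mod Y J s e"
  unfolding spans_mod_def by blast

lemma fin_span_sum_set:
  assumes "linsub U" "finite E" "E \<subseteq> U"
    and "\<And>x. x \<in> U \<Longrightarrow> \<exists>a. x = (\<Sum>t\<in>E. \<iota> (a t) * t)"
  shows "fin_span U"
proof -
  obtain e where e: "bij_betw e {..<card E} E"
    using ex_bij_betw_nat_finite[OF assms(2)] by (auto simp: atLeast0LessThan)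
  have "spans_mod U {0} (card E) e"
    unfolding spans_mod_def
  proof
    fix x assume "x \<in> U"
    then obtain a where "x = (\<Sum>t\<in>E. \<iota> (a t) * t)" using assms(4) by blast
    also have "\<dots> = (\<Sum>i<card E. \<iota> (a (e i)) * e i)"
      by (rule sum.reindex_bij_betw[OF e, symmetric])
    finally show "\<exists>a. x - (\<Sum>i<card E. \<iota> (a i) * e i) \<in> {0}"
      by (intro exI[of _ "\<lambda>i. a (e i)"]) simp
  qed
  moreover have "\<forall>i<card E. e i \<in> U"
    using e assms(3) by (auto simp: bij_betw_def)
  ultimately show ?thesis using assms(1) by (auto simp: fin_span_def)
qed

text \<open>The dimension of \<open>U\<close> modulo its intersection with \<open>I\<close>; the
  choice is harmless because all bases have the same length.\<close>

definition hdim :: "'r set \<Rightarrow> 'r set \<Rightarrow> nat" where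
  "hdim U I = (SOME r. \<exists>b. basis_mod U I r b)"

lemma hdim_eqI: "linsub I \<Longrightarrow> basis_mod U I r b \<Longrightarrow> hdim U I = r"
  unfolding hdim_def by (rule some_equality) (auto dest: basis_mod_unique)

lemma basis_mod_exists:
  assumes "linsub I" "fin_span U"
  obtains b where "basis_mod U I (hdim U I) b"
proof -
  obtain s e where e: "linsub U" "\<And>i. i < s \<Longrightarrow> e i \<in> U" "spans_mod U {0} s e"
    using assms(2) by (auto simp: fin_span_def)
  have "spans_mod U I s e"
    using spans_mod_mono[OF e(3)] linsub_closed(1)[OF assms(1)] by simp
  from basis_mod_from_spanning[OF assms(1) e(1) e(2) this]
  obtain r b where "basis_mod U I r b" by blast
  then show ?thesis using that hdim_eqI[OF assms(1)] by metis
qed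

lemma hdim_le_spans:
  assumes "linsub I" "fin_span U" "spans_mod U I s e"
  shows "hdim U I \<le> s"
proof -
  obtain b where "basis_mod U I (hdim U I) b" using basis_mod_exists assms by blast
  then show ?thesis using indep_le_spans[OF assms(1)] assms(3) by (auto simp: basis_mod_def)
qed

lemma hdim_ge_indep:
  assumes "linsub I" "fin_span U" "indep_mod I r b" "\<forall>i<r. b i \<in> U"
  shows "r \<le> hdim U I"
proof -
  obtain e where "basis_mod U I (hdim U I) e" using basis_mod_exists assms by blast
  then show ?thesis using indep_le_spans[OF assms(1,3,4)] by (auto simp: basis_mod_def)
qed

lemma hdim_antimono:
  assumes "linsub I" "linsub J" "fin_span U" "I \<subseteq> J"
  shows "hdim U J \<le> hdim U I"
proof -
  obtain b where "basis_mod U I (hdim U I) b" using basis_mod_exists assms by blast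
  then have "spans_mod U J (hdim U I) b"
    using spans_mod_mono assms(4) by (auto simp: basis_mod_def)
  then show ?thesis using hdim_le_spans assms by blast
qed

lemma hdim_mono:
  assumes "linsub I" "fin_span U" "fin_span Y" "U \<subseteq> Y"
  shows "hdim U I \<le> hdim Y I"
proof -
  obtain b where "basis_mod U I (hdim U I) b" using basis_mod_exists assms by blast
  then show ?thesis using hdim_ge_indep[OF assms(1,3)] assms(4) by (auto simp: basis_mod_def)
qed

lemma hdim_zero:
  assumes "linsub I" "U \<subseteq> I"
  shows "hdim U I = 0"
  by (rule hdim_eqI[OF assms(1), of _ _ "\<lambda>_. 0"])
    (use assms in \<open>auto simp: basis_mod_def indep_mod_def spans_mod_def\<close>)

lemma sum_lessThan_append:
  fixes f g :: "nat \<Rightarrow> 'z::comm_monoid_add"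
  shows "(\<Sum>i<r+s. if i < r then f i else g (i - r)) = (\<Sum>i<r. f i) + (\<Sum>i<s. g i)"
proof -
  have "{..<r+s} = {..<r} \<union> {r..<r+s}" by auto
  then have "(\<Sum>i<r+s. if i < r then f i else g (i - r))
      = (\<Sum>i<r. if i < r then f i else g (i - r)) + (\<Sum>i\<in>{r..<r+s}. if i < r then f i else g (i - r))"
    by (simp add: sum.union_disjoint ivl_disj_int)
  also have "(\<Sum>i\<in>{r..<r+s}. if i < r then f i else g (i - r)) = (\<Sum>i<s. g i)"
    by (rule sum.reindex_bij_witness[of _ "\<lambda>i. i + r" "\<lambda>i. i - r"]) auto
  finally show ?thesis by simp
qed

lemma lcomb_append:
  fixes r s :: nat
  shows "(\<Sum>i<r+s. \<iota> (a i) * (if i < r then b i else e (i - r)))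
    = (\<Sum>i<r. \<iota> (a i) * b i) + (\<Sum>i<s. \<iota> (a (i + r)) * e i)"
proof -
  have "(\<Sum>i<r+s. \<iota> (a i) * (if i < r then b i else e (i - r)))
    = (\<Sum>i<r+s. if i < r then \<iota> (a i) * b i else \<iota> (a (i - r + r)) * e (i - r))"
    by (rule sum.cong) (auto simp: not_less)
  also have "\<dots> = (\<Sum>i<r. \<iota> (a i) * b i) + (\<Sum>i<s. \<iota> (a (i + r)) * e i)"
    by (rule sum_lessThan_append[where f = "\<lambda>i. \<iota> (a i) * b i" and g = "\<lambda>i. \<iota> (a (i + r)) * e i"])
  finally show ?thesis .
qed

lemma lcomb_append':
  fixes r s :: nat
  shows "(\<Sum>i<r+s. \<iota> (if i < r then a i else c (i - r)) * (if i < r then b i else e (i - r)))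
    = (\<Sum>i<r. \<iota> (a i) * b i) + (\<Sum>i<s. \<iota> (c i) * e i)"
proof -
  have "(\<Sum>i<r+s. \<iota> (if i < r then a i else c (i - r)) * (if i < r then b i else e (i - r)))
    = (\<Sum>i<r+s. if i < r then \<iota> (a i) * b i else \<iota> (c (i - r)) * e (i - r))"
    by (rule sum.cong) auto
  also have "\<dots> = (\<Sum>i<r. \<iota> (a i) * b i) + (\<Sum>i<s. \<iota> (c i) * e i)"
    by (rule sum_lessThan_append[where f = "\<lambda>i. \<iota> (a i) * b i" and g = "\<lambda>i. \<iota> (c i) * e i"])
  finally show ?thesis .
qed

text \<open>The two inequalities combine to the exactness of the sequence
  Y/P --g--> U/I --> U/J.\<close>

lemma hdim_split_ge:
  assumes I: "linsub I" and J: "linsub J" and P: "linsub P" and U: "fin_span U" and Y: "fin_span Y"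
    and gY: "\<And>f. f \<in> Y \<Longrightarrow> g * f \<in> U \<inter> J" and gP: "\<And>f. f \<in> Y \<Longrightarrow> g * f \<in> I \<Longrightarrow> f \<in> P"
    and IJ: "I \<subseteq> J"
  shows "hdim U J + hdim Y P \<le> hdim U I"
proof -
  obtain b where b: "basis_mod U J (hdim U J) b" using basis_mod_exists U J by blast
  obtain e where e: "basis_mod Y P (hdim Y P) e" using basis_mod_exists Y P by blast
  let ?r = "hdim U J" and ?s = "hdim Y P"
  let ?B = "\<lambda>i. if i < ?r then b i else g * e (i - ?r)"
  have Ysub: "linsub Y" using Y by (simp add: fin_span_def)
  have in_Y: "(\<Sum>i<?s. \<iota> (a i) * e i) \<in> Y" for a
    using e by (intro linsub_sum[OF Ysub] linsub_closed(3)[OF Ysub]) (auto simp: basis_mod_def)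
  have pull: "(\<Sum>i<?s. \<iota> (a i) * (g * e i)) = g * (\<Sum>i<?s. \<iota> (a i) * e i)" for a
    by (simp add: sum_distrib_left mult.left_commute)
  have "indep_mod I (?r + ?s) ?B"
    unfolding indep_mod_def lcomb_append[where r = ?r and s = ?s and b = b and e = "\<lambda>i. g * e i"] pull
  proof (intro allI impI)
    fix a i assume a: "(\<Sum>i<?r. \<iota> (a i) * b i) + g * (\<Sum>i<?s. \<iota> (a (i + ?r)) * e i) \<in> I" and i: "i < ?r + ?s"
    have "g * (\<Sum>i<?s. \<iota> (a (i + ?r)) * e i) \<in> J" using gY[OF in_Y[of "\<lambda>i. a (i + ?r)"]] by simp
    moreover have "(\<Sum>i<?r. \<iota> (a i) * b i) + g * (\<Sum>i<?s. \<iota> (a (i + ?r)) * e i) \<in> J" using a IJ by blast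
    ultimately have "(\<Sum>i<?r. \<iota> (a i) * b i) + g * (\<Sum>i<?s. \<iota> (a (i + ?r)) * e i)
        - g * (\<Sum>i<?s. \<iota> (a (i + ?r)) * e i) \<in> J"
      by (intro linsub_closed(5)[OF J])
    then have "(\<Sum>i<?r. \<iota> (a i) * b i) \<in> J" by (simp only: add_diff_cancel_right')
    then have z: "\<forall>i<?r. a i = 0" using b by (auto simp: basis_mod_def indep_mod_def)
    then have "g * (\<Sum>i<?s. \<iota> (a (i + ?r)) * e i) \<in> I" using a by simp
    then have "(\<Sum>i<?s. \<iota> (a (i + ?r)) * e i) \<in> P" by (rule gP[OF in_Y])
    then have z2: "\<forall>i<?s. a (i + ?r) = 0"
      using e[unfolded basis_mod_def indep_mod_def, THEN conjunct2, THEN conjunct1,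
          THEN spec[of _ "\<lambda>i. a (i + ?r)"]] by blast
    show "a i = 0"
    proof (cases "i < ?r")
      case False
      then show ?thesis using z2[THEN spec, of "i - ?r"] i by auto
    qed (use z in auto)
  qed
  moreover have "\<forall>i<?r+?s. ?B i \<in> U"
    using b e gY by (auto simp: basis_mod_def)
  ultimately show ?thesis using hdim_ge_indep I U by blast
qed

lemma hdim_split_le:
  assumes I: "linsub I" and J: "linsub J" and P: "linsub P" and U: "fin_span U" and Y: "fin_span Y"
    and gP: "\<And>f. f \<in> Y \<Longrightarrow> f \<in> P \<Longrightarrow> g * f \<in> I"
    and IJ: "\<And>f. f \<in> U \<Longrightarrow> f \<in> J \<Longrightarrow> \<exists>h\<in>Y. f - g * h \<in> I"
  shows "hdim U I \<le> hdim U J + hdim Y P"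
proof -
  obtain b where b: "basis_mod U J (hdim U J) b" using basis_mod_exists U J by blast
  obtain e where e: "basis_mod Y P (hdim Y P) e" using basis_mod_exists Y P by blast
  let ?r = "hdim U J" and ?s = "hdim Y P"
  let ?B = "\<lambda>i. if i < ?r then b i else g * e (i - ?r)"
  have Xsub: "linsub U" and Ysub: "linsub Y" using U Y by (simp_all add: fin_span_def)
  have in_X: "(\<Sum>i<?r. \<iota> (a i) * b i) \<in> U" for a
    using b by (intro linsub_sum[OF Xsub] linsub_closed(3)[OF Xsub]) (auto simp: basis_mod_def)
  have "spans_mod U I (?r + ?s) ?B"
    unfolding spans_mod_def
  proof
    fix x assume x: "x \<in> U"
    then obtain a where a: "x - (\<Sum>i<?r. \<iota> (a i) * b i) \<in> J"
      using b by (auto simp: basis_mod_def spans_mod_def)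
    then obtain h where h: "h \<in> Y" "x - (\<Sum>i<?r. \<iota> (a i) * b i) - g * h \<in> I"
      using IJ[of "x - (\<Sum>i<?r. \<iota> (a i) * b i)"] linsub_closed(5)[OF Xsub x in_X] by blast
    then obtain c where c: "h - (\<Sum>i<?s. \<iota> (c i) * e i) \<in> P"
      using e unfolding basis_mod_def spans_mod_def by meson
    have "(\<Sum>i<?s. \<iota> (c i) * e i) \<in> Y"
      using e by (intro linsub_sum[OF Ysub] linsub_closed(3)[OF Ysub]) (auto simp: basis_mod_def)
    then have hY: "h - (\<Sum>i<?s. \<iota> (c i) * e i) \<in> Y" using linsub_closed(5)[OF Ysub h(1)] by blast
    have "x - (\<Sum>i<?r. \<iota> (a i) * b i) - g * h + g * (h - (\<Sum>i<?s. \<iota> (c i) * e i)) \<in> I"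
      using linsub_closed(2)[OF I h(2) gP[OF hY c]] .
    also have "x - (\<Sum>i<?r. \<iota> (a i) * b i) - g * h + g * (h - (\<Sum>i<?s. \<iota> (c i) * e i))
      = x - ((\<Sum>i<?r. \<iota> (a i) * b i) + (\<Sum>i<?s. \<iota> (c i) * (g * e i)))"
      by (simp add: algebra_simps sum_distrib_left)
    also have "(\<Sum>i<?r. \<iota> (a i) * b i) + (\<Sum>i<?s. \<iota> (c i) * (g * e i))
        = (\<Sum>i<?r+?s. \<iota> (if i < ?r then a i else c (i - ?r)) * ?B i)"
      by (rule lcomb_append'[symmetric])
    finally show "\<exists>a. x - (\<Sum>i<?r+?s. \<iota> (a i) * ?B i) \<in> I"
      by (intro exI[of _ "\<lambda>i. if i < ?r then a i else c (i - ?r)"])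
  qed
  then show ?thesis using hdim_le_spans I U by blast
qed

lemma hdim_sum_le:
  assumes I: "linsub I" and U: "fin_span U" and Y: "fin_span Y" and Z: "fin_span Z"
    and ZXY: "\<And>z. z \<in> Z \<Longrightarrow> \<exists>x\<in>U. \<exists>y\<in>Y. z = x + y"
  shows "hdim Z I \<le> hdim U I + hdim Y I"
proof -
  obtain b where b: "basis_mod U I (hdim U I) b" using basis_mod_exists U I by blast
  obtain e where e: "basis_mod Y I (hdim Y I) e" using basis_mod_exists Y I by blast
  let ?r = "hdim U I" and ?s = "hdim Y I"
  let ?B = "\<lambda>i. if i < ?r then b i else e (i - ?r)"
  have "spans_mod Z I (?r + ?s) ?B"
    unfolding spans_mod_def
  proof
    fix z assume "z \<in> Z"
    then obtain x y where xy: "x \<in> U" "y \<in> Y" "z = x + y" using ZXY by blast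
    obtain a c where "x - (\<Sum>i<?r. \<iota> (a i) * b i) \<in> I" "y - (\<Sum>i<?s. \<iota> (c i) * e i) \<in> I"
      using b e xy unfolding basis_mod_def spans_mod_def by meson
    then have "x - (\<Sum>i<?r. \<iota> (a i) * b i) + (y - (\<Sum>i<?s. \<iota> (c i) * e i)) \<in> I"
      using linsub_closed(2)[OF I] by blast
    then have "z - (\<Sum>i<?r+?s. \<iota> (if i < ?r then a i else c (i - ?r)) * ?B i) \<in> I"
      unfolding lcomb_append' xy by (simp add: algebra_simps)
    then show "\<exists>a. z - (\<Sum>i<?r+?s. \<iota> (a i) * ?B i) \<in> I"
      by (intro exI[of _ "\<lambda>i. if i < ?r then a i else c (i - ?r)"])
  qed
  then show ?thesis using hdim_le_spans I Z by blast
qed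

end

section \<open>Polynomial rings\<close>

abbreviation lookup :: "('a \<Rightarrow>\<^sub>0 'b::zero) \<Rightarrow> 'a \<Rightarrow> 'b" where "lookup \<equiv> Poly_Mapping.lookup"
abbreviation keys :: "('a \<Rightarrow>\<^sub>0 'b::zero) \<Rightarrow> 'a set" where "keys \<equiv> Poly_Mapping.keys"
abbreviation single :: "'a \<Rightarrow> 'b \<Rightarrow> 'a \<Rightarrow>\<^sub>0 'b::zero" where "single \<equiv> Poly_Mapping.single"

lemma mpoly_eq_sum_single: "f = (\<Sum>t\<in>keys f. single t (lookup f t))"
  by (rule poly_mapping_eqI)
    (simp add: Poly_Mapping.lookup_sum lookup_single when_def in_keys_iff sum.delta)

lemma mpoly_induct [case_names single plus]:
  fixes P :: "('a \<Rightarrow>\<^sub>0 'b::comm_monoid_add) \<Rightarrow> bool"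
  assumes "\<And>t c. P (single t c)" "\<And>f g. P f \<Longrightarrow> P g \<Longrightarrow> P (f + g)"
  shows "P f"
proof -
  have "P (\<Sum>t\<in>A. single t (lookup f t))" if "finite A" for A
    using that
  proof (induction A rule: finite_induct)
    case empty
    then show ?case using assms(1)[of undefined 0] by simp
  qed (use assms in auto)
  then show ?thesis using mpoly_eq_sum_single[of f] finite_keys by metis
qed

lemma mdeg_add: "mdeg (s + t) = mdeg s + mdeg t"
  by (simp add: mdeg_def lookup_add sum.distrib)

lemma mdeg_zero [simp]: "mdeg 0 = 0"
  by (simp add: mdeg_def)

lemma mdeg_eq_0: "mdeg t = 0 \<longleftrightarrow> t = 0"
  by (auto simp: mdeg_def intro!: poly_mapping_eqI)

lemma mdeg_single [simp]: "mdeg (single v n) = n"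
  by (simp add: mdeg_def lookup_single when_def sum.delta)

lemma lookup_le_mdeg: "lookup t v \<le> mdeg t"
  unfolding mdeg_def by (rule member_le_sum) auto

lemma finite_mdeg_le: "finite {t :: 'v::finite \<Rightarrow>\<^sub>0 nat. mdeg t \<le> m}"
proof -
  have "lookup ` {t :: 'v \<Rightarrow>\<^sub>0 nat. mdeg t \<le> m} \<subseteq> PiE UNIV (\<lambda>_. {..m})"
    by (auto intro: order_trans[OF lookup_le_mdeg])
  moreover have "finite (PiE (UNIV :: 'v set) (\<lambda>_. {..m}))"
    by (rule finite_PiE) auto
  ultimately have "finite (lookup ` {t :: 'v \<Rightarrow>\<^sub>0 nat. mdeg t \<le> m})" by (rule finite_subset)
  moreover have "inj_on lookup {t :: 'v \<Rightarrow>\<^sub>0 nat. mdeg t \<le> m}"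
    by (rule inj_onI) (rule poly_mapping_eqI, simp)
  ultimately show ?thesis by (rule finite_imageD)
qed

lemma finite_mdeg_eq: "finite {t :: 'v::finite \<Rightarrow>\<^sub>0 nat. mdeg t = m}"
  by (rule finite_subset[OF _ finite_mdeg_le[of m]]) auto

lemma lookup_times:
  fixes f g :: "'a::comm_monoid_add \<Rightarrow>\<^sub>0 'b::comm_ring_1"
  shows "lookup (f * g) u = (\<Sum>s\<in>keys f. \<Sum>t\<in>keys g. if s + t = u then lookup f s * lookup g t else 0)"
proof -
  have "f * g = (\<Sum>s\<in>keys f. \<Sum>t\<in>keys g. single (s + t) (lookup f s * lookup g t))"
    by (subst mpoly_eq_sum_single[of f], subst mpoly_eq_sum_single[of g])
      (simp add: sum_product mult_single)
  then show ?thesis by (simp add: Poly_Mapping.lookup_sum lookup_single when_def)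
qed

lemma lookup_single_mult:
  fixes g :: "'a::cancel_comm_monoid_add \<Rightarrow>\<^sub>0 'b::comm_ring_1"
  shows "lookup (single s c * g) (s + t) = c * lookup g t"
proof (cases "c = 0")
  case False
  have "lookup (single s c * g) (s + t) = (\<Sum>r\<in>keys g. if r = t then c * lookup g r else 0)"
    using False by (simp add: lookup_times)
  also have "\<dots> = c * lookup g t"
    by (auto simp: in_keys_iff sum.delta)
  finally show ?thesis .
qed simp

lemma lookup_const_mult: "lookup (const c * (f::('v,'k::field) mpoly)) t = c * lookup f t"
  using lookup_single_mult[of 0 c f t] by (simp add: const_def)

lemma scalar_hom_const: "scalar_hom (const :: 'k::field \<Rightarrow> ('v, 'k) mpoly)"
  by unfold_locales (simp_all add: const_def single_add mult_single)

interpretation R: scalar_hom "const :: 'k::field \<Rightarrow> ('v, 'k) mpoly"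
  by (rule scalar_hom_const)

text \<open>Graded pieces and the spaces of bounded degree are both of this form, so their finite
  dimensionality is shown once.\<close>

definition monomial_span :: "('v \<Rightarrow>\<^sub>0 nat) set \<Rightarrow> ('v, 'k::field) mpoly set" where
  "monomial_span T = {f. keys f \<subseteq> T}"

lemma linsub_monomial_span: "R.linsub (monomial_span T :: ('v, 'k::field) mpoly set)"
proof -
  have "keys (const c * f) \<subseteq> keys f" for c and f :: "('v, 'k) mpoly"
    by (auto simp: in_keys_iff lookup_const_mult)
  then show ?thesis
    unfolding R.linsub_def monomial_span_def
    by (auto dest!: subsetD[OF Poly_Mapping.keys_add] dest: subsetD)
qed

lemma const_times_single: "const c * single t d = single t (c * d)"
  by (simp add: const_def mult_single)

lemma fin_span_monomial_span:
  assumes "finite T"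
  shows "R.fin_span (monomial_span T :: ('v, 'k::field) mpoly set)"
proof (rule R.fin_span_sum_set[OF linsub_monomial_span, of "(\<lambda>t. single t 1) ` T"])
  fix f :: "('v, 'k) mpoly" assume "f \<in> monomial_span T"
  then have sub: "keys f \<subseteq> T" by (simp add: monomial_span_def)
  have inj: "inj_on (\<lambda>t. single t (1::'k)) T"
    by (auto intro!: inj_onI)
      (metis lookup_single_eq lookup_single_not_eq zero_neq_one)
  define a where "a s = lookup f (THE t. s = single t (1::'k))" for s
  have a: "a (single t 1) = lookup f t" for t
  proof -
    have "(THE s. single t (1::'k) = single s 1) = t"
      by (rule the_equality) (auto, metis lookup_single_eq lookup_single_not_eq zero_neq_one)
    then show ?thesis by (simp add: a_def)
  qed
  have "f = (\<Sum>t\<in>T. single t (lookup f t))"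
    by (subst mpoly_eq_sum_single, rule sum.mono_neutral_left)
      (use assms sub in \<open>auto simp: in_keys_iff\<close>)
  also have "\<dots> = (\<Sum>s\<in>(\<lambda>t. single t 1) ` T. const (a s) * s)"
    by (subst sum.reindex[OF inj]) (simp add: a const_times_single)
  finally show "\<exists>a. f = (\<Sum>s\<in>(\<lambda>t. single t 1) ` T. const (a s) * s)" by blast
qed (use assms in \<open>auto simp: monomial_span_def\<close>)

lemma graded_piece_eq: "graded_piece m = monomial_span {t. mdeg t = m}"
  by (auto simp: graded_piece_def monomial_span_def)

definition deg_le :: "nat \<Rightarrow> ('v::finite, 'k::field) mpoly set" where
  "deg_le m = monomial_span {t. mdeg t \<le> m}"

lemma deg_leI: "(\<And>t. t \<in> keys f \<Longrightarrow> mdeg t \<le> m) \<Longrightarrow> f \<in> deg_le m"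
  by (auto simp: deg_le_def monomial_span_def)

lemma deg_leD: "f \<in> deg_le m \<Longrightarrow> t \<in> keys f \<Longrightarrow> mdeg t \<le> m"
  by (auto simp: deg_le_def monomial_span_def)

lemma fin_span_graded [simp]: "R.fin_span (graded_piece m)"
  unfolding graded_piece_eq by (rule fin_span_monomial_span) (rule finite_mdeg_eq)

lemma fin_span_deg_le [simp]: "R.fin_span (deg_le m)"
  unfolding deg_le_def by (rule fin_span_monomial_span) (rule finite_mdeg_le)

lemma linsub_graded: "R.linsub (graded_piece m)"
  unfolding graded_piece_eq by (rule linsub_monomial_span)

lemma linsub_deg_le: "R.linsub (deg_le m)"
  unfolding deg_le_def by (rule linsub_monomial_span)

lemma deg_le_mono: "m \<le> n \<Longrightarrow> deg_le m \<subseteq> deg_le n"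
  by (auto simp: deg_le_def monomial_span_def)

lemma keys_times: "keys (f * g) \<subseteq> {s + t |s t. s \<in> keys f \<and> t \<in> keys (g::('v,'k::field) mpoly)}"
  using keys_mult[of f g] by auto

lemma graded_times: "f \<in> graded_piece m \<Longrightarrow> g \<in> graded_piece n \<Longrightarrow> f * g \<in> graded_piece (m + n)"
  using keys_times[of f g] by (fastforce simp: graded_piece_def mdeg_add)

lemma deg_le_times: "f \<in> deg_le m \<Longrightarrow> g \<in> deg_le n \<Longrightarrow> f * g \<in> deg_le (m + n)"
  using keys_times[of f g] by (intro deg_leI) (fastforce dest: deg_leD simp: mdeg_add intro: add_mono)

lemma deg_le_exists: obtains m where "f \<in> deg_le m"
proof -
  have "f \<in> deg_le (Max (mdeg ` keys f))"
    by (rule deg_leI) simp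
  then show ?thesis using that by blast
qed

lemma one_deg_le [simp]: "1 \<in> deg_le m"
  by (rule deg_leI) simp

lemma zero_deg_le [simp]: "0 \<in> deg_le m"
  by (rule deg_leI) simp

section \<open>Ideals and the Hilbert function as a relative dimension\<close>

lemma ideal_closed:
  assumes "is_ideal I"
  shows "0 \<in> I" "a \<in> I \<Longrightarrow> b \<in> I \<Longrightarrow> a + b \<in> I" "a \<in> I \<Longrightarrow> r * a \<in> I" "a \<in> I \<Longrightarrow> a * r \<in> I"
    "a \<in> I \<Longrightarrow> - a \<in> I" "a \<in> I \<Longrightarrow> b \<in> I \<Longrightarrow> a - b \<in> I"
proof -
  show *: "0 \<in> I" "a \<in> I \<Longrightarrow> b \<in> I \<Longrightarrow> a + b \<in> I" "a \<in> I \<Longrightarrow> r * a \<in> I" for a b r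
    using assms by (auto simp: is_ideal_def)
  show "a \<in> I \<Longrightarrow> a * r \<in> I" using *(3) by (simp add: mult.commute)
  show **: "a \<in> I \<Longrightarrow> - a \<in> I" for a using *(3)[of a "-1"] by simp
  show "a \<in> I \<Longrightarrow> b \<in> I \<Longrightarrow> a - b \<in> I" using *(2)[of a "-b"] **[of b] by simp
qed

lemma ideal_sum: "is_ideal I \<Longrightarrow> (\<And>i. i \<in> S \<Longrightarrow> f i \<in> I) \<Longrightarrow> sum f S \<in> I"
  by (induction S rule: infinite_finite_induct) (auto intro: ideal_closed)

lemma ideal_eq_UNIV: "is_ideal I \<Longrightarrow> 1 \<in> I \<Longrightarrow> I = UNIV"
  using ideal_closed(3)[of I 1] by auto

lemma ideal_linsub: "is_ideal I \<Longrightarrow> R.linsub I"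
  by (auto simp: R.linsub_def intro: ideal_closed)

lemma is_ideal_Int: "is_ideal I \<Longrightarrow> is_ideal J \<Longrightarrow> is_ideal (I \<inter> J)"
  by (auto simp: is_ideal_def)

abbreviation hf :: "('v::finite, 'k::field) mpoly set \<Rightarrow> nat \<Rightarrow> nat" where
  "hf I m \<equiv> R.hdim (graded_piece m) I"

text \<open>A least spanning set has as many elements as a basis; the basis family is injective, so
  passing to its image loses nothing.\<close>

lemma hilbert_fun_eq_hdim:
  fixes I :: "('v::finite, 'k::field) mpoly set"
  assumes "is_ideal I"
  shows "hilbert_fun I m = hf I m"
  unfolding hilbert_fun_def
proof (rule Least_equality)
  have I: "R.linsub I" using assms by (rule ideal_linsub)
  obtain b where b: "R.basis_mod (graded_piece m) I (hf I m) b"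
    using R.basis_mod_exists[OF I fin_span_graded] by blast
  let ?r = "hf I m"
  have inj: "inj_on b {..<?r}"
  proof (rule inj_onI, rule ccontr)
    fix i j assume ij: "i \<in> {..<?r}" "j \<in> {..<?r}" "b i = b j" "i \<noteq> j"
    \<comment> \<open>If a vector occurred twice, 1 and -1 at its two places would give a nontrivial
      relation.\<close>
    define a :: "nat \<Rightarrow> 'k" where "a l = (if l = i then 1 else if l = j then - 1 else 0)" for l
    have "(\<Sum>l<?r. const (a l) * b l) = (\<Sum>l\<in>{i,j}. const (a l) * b l)"
      by (rule sum.mono_neutral_right) (use ij in \<open>auto simp: a_def\<close>)
    also have "\<dots> = 0" using ij by (simp add: a_def R.hom_uminus)
    finally have "(\<Sum>l<?r. const (a l) * b l) \<in> I" using ideal_closed(1)[OF assms] by simp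
    then have "a i = 0" using b ij(1) unfolding R.basis_mod_def R.indep_mod_def by blast
    then show False by (simp add: a_def)
  qed
  have "\<exists>a. f - (\<Sum>s\<in>b ` {..<?r}. const (a s) * s) \<in> I" if f: "f \<in> graded_piece m" for f
  proof -
    obtain a where a: "f - (\<Sum>i<?r. const (a i) * b i) \<in> I"
      using b[unfolded R.basis_mod_def R.spans_mod_def, THEN conjunct2, THEN conjunct2, THEN bspec, OF f]
      by blast
    have "(\<Sum>s\<in>b ` {..<?r}. const (a (the_inv_into {..<?r} b s)) * s) = (\<Sum>i<?r. const (a i) * b i)"
      by (subst sum.reindex[OF inj]) (auto simp: the_inv_into_f_f[OF inj])
    then show ?thesis using a by (intro exI[of _ "\<lambda>s. a (the_inv_into {..<?r} b s)"]) simp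
  qed
  then show "\<exists>S. finite S \<and> card S = ?r \<and> S \<subseteq> graded_piece m \<and>
      (\<forall>f\<in>graded_piece m. \<exists>a. f - (\<Sum>s\<in>S. const (a s) * s) \<in> I)"
    using b inj by (intro exI[of _ "b ` {..<?r}"]) (auto simp: R.basis_mod_def card_image)
next
  fix c assume "\<exists>S. finite S \<and> card S = c \<and> S \<subseteq> graded_piece m \<and>
      (\<forall>f\<in>graded_piece m. \<exists>a. f - (\<Sum>s\<in>S. const (a s) * s) \<in> I)"
  then obtain S where S: "finite S" "card S = c" "S \<subseteq> graded_piece m"
    "\<forall>f\<in>graded_piece m. \<exists>a. f - (\<Sum>s\<in>S. const (a s) * s) \<in> I" by blast
  obtain e where e: "bij_betw e {..<c} S"
    using ex_bij_betw_nat_finite[OF S(1)] S(2) by (auto simp: atLeast0LessThan)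
  have "R.spans_mod (graded_piece m) I c e"
    unfolding R.spans_mod_def
  proof
    fix f :: "('v, 'k) mpoly" assume "f \<in> graded_piece m"
    then obtain a where "f - (\<Sum>s\<in>S. const (a s) * s) \<in> I" using S(4) by blast
    then show "\<exists>a. f - (\<Sum>i<c. const (a i) * e i) \<in> I"
      by (intro exI[of _ "\<lambda>i. a (e i)"]) (simp add: sum.reindex_bij_betw[OF e, of "\<lambda>s. const (a s) * s"])
  qed
  then show "hf I m \<le> c"
    using R.hdim_le_spans[OF ideal_linsub[OF assms] fin_span_graded] by blast
qed

lemma lookup_homog_part: "lookup (homog_part m f) t = (if mdeg t = m then lookup f t else 0)"
  by (auto simp: homog_part_def lookup_mapp when_def in_keys_iff)

lemma homog_part_graded: "homog_part m f \<in> graded_piece m"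
  by (auto simp: graded_piece_def in_keys_iff lookup_homog_part split: if_splits)

lemma homog_part_same: "f \<in> graded_piece m \<Longrightarrow> homog_part m f = f"
  by (rule poly_mapping_eqI) (auto simp: graded_piece_def in_keys_iff lookup_homog_part)

lemma homog_part_other: "f \<in> graded_piece m \<Longrightarrow> n \<noteq> m \<Longrightarrow> homog_part n f = 0"
  by (rule poly_mapping_eqI) (auto simp: graded_piece_def in_keys_iff lookup_homog_part)

lemma homog_part_add: "homog_part m (f + g) = homog_part m f + homog_part m g"
  by (rule poly_mapping_eqI) (auto simp: lookup_homog_part lookup_add)

lemma homog_part_zero [simp]: "homog_part m 0 = 0"
  by (rule poly_mapping_eqI) (auto simp: lookup_homog_part)

lemma homog_part_sum: "homog_part m (sum f A) = (\<Sum>i\<in>A. homog_part m (f i))"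
  by (induction A rule: infinite_finite_induct) (auto simp: homog_part_add)

lemma homog_part_times:
  assumes "a \<in> graded_piece s"
  shows "homog_part m (a * f) = (if s \<le> m then a * homog_part (m - s) f else 0)"
proof (induction f rule: mpoly_induct)
  case (single t c)
  have sg: "single t c \<in> graded_piece (mdeg t)" by (auto simp: graded_piece_def)
  then have *: "a * single t c \<in> graded_piece (s + mdeg t)" by (rule graded_times[OF assms])
  show ?case
    by (cases "m = s + mdeg t")
       (auto simp: homog_part_same[OF *] homog_part_other[OF *] homog_part_same[OF sg] homog_part_other[OF sg])
qed (simp add: homog_part_add algebra_simps)

lemma sum_homog_part: "f \<in> deg_le n \<Longrightarrow> f = (\<Sum>m\<le>n. homog_part m f)"
  by (rule poly_mapping_eqI)
    (auto simp: Poly_Mapping.lookup_sum lookup_homog_part sum.delta in_keys_iff dest!: deg_leD)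

section \<open>Leading monomials\<close>

text \<open>A monomial order borrowed from the ordered group of integer polynomials, which are
  compared by the leading coefficient of their difference: exponents become coefficients, and the
  total degree sits above them as the top coefficient. The result is a graded lexicographic order,
  additive by construction.\<close>

definition wt :: "('v::finite \<Rightarrow>\<^sub>0 nat) \<Rightarrow> int poly" where
  "wt t = (\<Sum>v\<in>UNIV. Polynomial.monom (int (lookup t v)) (to_nat v))
    + Polynomial.monom (int (mdeg t)) (Suc (Max (range (to_nat :: 'v \<Rightarrow> nat))))"

lemma coeff_wt_var: "Polynomial.coeff (wt t) (to_nat v) = int (lookup t (v::'v::finite))"
proof -
  have "to_nat v \<le> Max (range (to_nat :: 'v \<Rightarrow> nat))" by simp
  then have "to_nat v \<noteq> Suc (Max (range (to_nat :: 'v \<Rightarrow> nat)))" by linarith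
  then show ?thesis
    by (simp add: wt_def Polynomial.coeff_sum sum.delta eq_commute[of _ v])
qed

lemma wt_inj: "wt s = wt t \<Longrightarrow> s = t"
  by (rule poly_mapping_eqI) (metis coeff_wt_var of_nat_eq_iff)

lemma wt_add: "wt (s + t) = wt s + wt t"
  by (simp add: wt_def lookup_add mdeg_add add_monom[symmetric] sum.distrib)

lemma wt_less_if_mdeg_less:
  fixes s t :: "'v::finite \<Rightarrow>\<^sub>0 nat"
  assumes "mdeg s < mdeg t" shows "wt s < wt t"
proof -
  let ?N = "Suc (Max (range (to_nat :: 'v \<Rightarrow> nat)))"
  have le: "to_nat v < ?N" for v :: 'v by (simp add: less_Suc_eq_le)
  have N: "Polynomial.coeff (wt u) ?N = int (mdeg u)" for u :: "'v \<Rightarrow>\<^sub>0 nat"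
  proof -
    have "to_nat v \<noteq> ?N" for v :: 'v using le[of v] by linarith
    then show ?thesis by (simp add: wt_def Polynomial.coeff_sum)
  qed
  have hi: "Polynomial.coeff (wt u) n = 0" if "n > ?N" for u :: "'v \<Rightarrow>\<^sub>0 nat" and n
  proof -
    have "to_nat v \<noteq> n" for v :: 'v using le[of v] that by linarith
    then show ?thesis using that by (simp add: wt_def Polynomial.coeff_sum)
  qed
  have "Polynomial.degree (wt t - wt s) = ?N"
  proof (rule antisym)
    show "Polynomial.degree (wt t - wt s) \<le> ?N" by (rule degree_le) (auto simp: hi)
    show "?N \<le> Polynomial.degree (wt t - wt s)" by (rule le_degree) (use assms in \<open>simp add: N\<close>)
  qed
  then have "pos_poly (wt t - wt s)"
    using assms by (simp add: pos_poly_def N)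
  then show ?thesis by (simp add: less_poly_def)
qed

definition is_lm :: "('v::finite, 'k::field) mpoly \<Rightarrow> ('v \<Rightarrow>\<^sub>0 nat) \<Rightarrow> bool" where
  "is_lm f t \<longleftrightarrow> t \<in> keys f \<and> (\<forall>s\<in>keys f. wt s \<le> wt t)"

lemma is_lm_exists:
  assumes "f \<noteq> 0" obtains t where "is_lm f t"
proof -
  have "keys f \<noteq> {}" using assms by simp
  then have "Max (wt ` keys f) \<in> wt ` keys f" by (intro Max_in) auto
  then obtain t where t: "t \<in> keys f" "wt t = Max (wt ` keys f)" by auto
  then have "is_lm f t" by (auto simp: is_lm_def)
  then show ?thesis using that by blast
qed

lemma is_lm_unique: "is_lm f s \<Longrightarrow> is_lm f t \<Longrightarrow> s = t"
  unfolding is_lm_def by (meson order_antisym wt_inj)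

lemma is_lm_deg: "is_lm f t \<Longrightarrow> s \<in> keys f \<Longrightarrow> mdeg s \<le> mdeg t"
  unfolding is_lm_def by (meson leD leI wt_less_if_mdeg_less)

text \<open>Weights add, so two keys can only multiply to \<open>s + t\<close> if both are maximal;
  a single term contributes to that coefficient.\<close>

lemma is_lm_times:
  assumes "is_lm f s" "is_lm g t"
  shows "is_lm (f * g) (s + t)" "lookup (f * g) (s + t) = lookup f s * lookup g t"
proof -
  have eq: "s' + t' = s + t \<longleftrightarrow> s' = s \<and> t' = t" if "s' \<in> keys f" "t' \<in> keys g" for s' t'
  proof
    assume "s' + t' = s + t"
    then have "wt s' + wt t' = wt s + wt t" by (simp flip: wt_add)
    moreover have "wt s' \<le> wt s" "wt t' \<le> wt t" using that assms by (auto simp: is_lm_def)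
    ultimately have "wt s' = wt s" "wt t' = wt t" by linarith+
    then show "s' = s \<and> t' = t" using wt_inj by blast
  qed auto
  have "lookup (f * g) (s + t)
     = (\<Sum>s'\<in>keys f. \<Sum>t'\<in>keys g. if s' = s \<and> t' = t then lookup f s' * lookup g t' else 0)"
    unfolding lookup_times by (intro sum.cong refl) (simp add: eq)
  also have "\<dots> = (\<Sum>s'\<in>keys f. if s' = s then lookup f s * lookup g t else 0)"
    using assms(2) by (intro sum.cong refl) (auto simp: is_lm_def sum.delta)
  also have "\<dots> = lookup f s * lookup g t"
    using assms(1) by (auto simp: is_lm_def sum.delta)
  finally show l: "lookup (f * g) (s + t) = lookup f s * lookup g t" .
  have "wt u \<le> wt (s + t)" if u: "u \<in> keys (f * g)" for u
  proof -
    obtain s' t' where "u = s' + t'" "s' \<in> keys f" "t' \<in> keys g" using subsetD[OF keys_times u] by blast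
    then show ?thesis using assms by (auto simp: is_lm_def wt_add intro: add_mono)
  qed
  moreover have "s + t \<in> keys (f * g)"
    using assms by (auto simp: is_lm_def in_keys_iff l)
  ultimately show "is_lm (f * g) (s + t)" by (simp add: is_lm_def)
qed

lemma mpoly_times_eq_0: "f * g = 0 \<longleftrightarrow> f = 0 \<or> g = (0 :: ('v::finite, 'k::field) mpoly)"
proof -
  have "f * g \<noteq> 0" if "f \<noteq> 0" "g \<noteq> 0"
    using that is_lm_times(1) is_lm_exists by (metis emptyE is_lm_def keys_zero)
  then show ?thesis by auto
qed

lemma mpoly_power_eq_0: "f ^ n = 0 \<Longrightarrow> f = (0 :: ('v::finite, 'k::field) mpoly)"
  by (induction n) (auto simp: mpoly_times_eq_0)

lemma is_lm_one: "is_lm (1 :: ('v::finite, 'k::field) mpoly) 0"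
  by (simp add: is_lm_def)

lemma is_lm_power:
  assumes "is_lm f t"
  shows "\<exists>s. is_lm (f ^ n) s \<and> (\<forall>v. lookup s v = n * lookup t v)"
proof (induction n)
  case 0
  then show ?case using is_lm_one by (intro exI[of _ 0]) simp
next
  case (Suc n)
  then obtain s where "is_lm (f ^ n) s" "\<forall>v. lookup s v = n * lookup t v" by blast
  then show ?case
    using is_lm_times(1)[OF assms] by (intro exI[of _ "t + s"]) (simp add: lookup_add)
qed

lemma finite_wt_less:
  fixes t :: "'v::finite \<Rightarrow>\<^sub>0 nat"
  shows "finite {s :: 'v \<Rightarrow>\<^sub>0 nat. wt s < wt t}"
proof -
  have "{s :: 'v \<Rightarrow>\<^sub>0 nat. wt s < wt t} \<subseteq> {s :: 'v \<Rightarrow>\<^sub>0 nat. mdeg s \<le> mdeg t}"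
  proof (rule subsetI)
    fix s :: "'v \<Rightarrow>\<^sub>0 nat" assume "s \<in> {s. wt s < wt t}"
    then have "\<not> wt t < wt s" by auto
    then have "mdeg s \<le> mdeg t" using wt_less_if_mdeg_less[of t s] by linarith
    then show "s \<in> {s. mdeg s \<le> mdeg t}" by simp
  qed
  then show ?thesis by (rule finite_subset) (rule finite_mdeg_le)
qed

text \<open>The degree bounds all smaller monomials, so each monomial has only finitely many below
  it, and their number is a measure.\<close>

lemma wf_wt: "wf {(s, t :: 'v::finite \<Rightarrow>\<^sub>0 nat). wt s < wt t}"
proof (rule wf_subset[OF wf_measure[of "\<lambda>t :: 'v \<Rightarrow>\<^sub>0 nat. card {s :: 'v \<Rightarrow>\<^sub>0 nat. wt s < wt t}"]], rule subrelI)
  fix s t :: "'v \<Rightarrow>\<^sub>0 nat" assume "(s, t) \<in> {(s, t). wt s < wt t}"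
  then have less: "wt s < wt t" by simp
  then have "{u :: 'v \<Rightarrow>\<^sub>0 nat. wt u < wt s} \<subseteq> {u :: 'v \<Rightarrow>\<^sub>0 nat. wt u < wt t}" by auto
  moreover have "s \<in> {u :: 'v \<Rightarrow>\<^sub>0 nat. wt u < wt t}" "s \<notin> {u :: 'v \<Rightarrow>\<^sub>0 nat. wt u < wt s}" using less by auto
  ultimately have "{u :: 'v \<Rightarrow>\<^sub>0 nat. wt u < wt s} \<subset> {u :: 'v \<Rightarrow>\<^sub>0 nat. wt u < wt t}" by blast
  from psubset_card_mono[OF finite_wt_less this]
  show "(s, t) \<in> Wellfounded.measure (\<lambda>t :: 'v \<Rightarrow>\<^sub>0 nat. card {s :: 'v \<Rightarrow>\<^sub>0 nat. wt s < wt t})"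
    unfolding in_measure .
qed

lemma cancel_lm:
  fixes f h :: "('v::finite, 'k::field) mpoly"
  assumes "is_lm f t" "is_lm h t" "lookup f t = lookup h t" "is_lm (f - h) s"
  shows "wt s < wt t"
proof -
  have "s \<in> keys f \<union> keys h" "s \<noteq> t"
    using assms(3,4) by (auto simp: is_lm_def in_keys_iff lookup_minus)
  then have "wt s \<le> wt t" using assms by (auto simp: is_lm_def)
  then show ?thesis using \<open>s \<noteq> t\<close> wt_inj by (metis order_le_less)
qed

definition LM :: "('v::finite, 'k::field) mpoly set \<Rightarrow> ('v \<Rightarrow>\<^sub>0 nat) set" where
  "LM I = {t. \<exists>f\<in>I. is_lm f t}"

lemma is_lm_const_mult: "c \<noteq> 0 \<Longrightarrow> is_lm f t \<Longrightarrow> is_lm (const c * f) t"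
  by (auto simp: is_lm_def in_keys_iff lookup_const_mult)

text \<open>Among the elements of \<open>J - I\<close> take one with least leading monomial. Were
  this the leading monomial of some element of \<open>I\<close>, subtracting a scalar multiple of
  that element would leave an element of \<open>J - I\<close> with a smaller one.\<close>

lemma LM_psubset:
  fixes I J :: "('v::finite, 'k::field) mpoly set"
  assumes "is_ideal I" "is_ideal J" "I \<subset> J"
  shows "\<exists>t. t \<in> LM J - LM I"
proof -
  obtain f0 where f0: "f0 \<in> J - I" using assms by blast
  then have "f0 \<noteq> 0" using ideal_closed(1)[OF assms(1)] by auto
  then obtain t0 where "is_lm f0 t0" using is_lm_exists by blast
  then have "t0 \<in> {t. \<exists>f\<in>J - I. is_lm f t}" using f0 by blast
  from wfE_min[OF wf_wt this] obtain t where t: "t \<in> {t. \<exists>f\<in>J - I. is_lm f t}"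
    and min: "\<And>s. (s, t) \<in> {(s, t). wt s < wt t} \<Longrightarrow> s \<notin> {t. \<exists>f\<in>J - I. is_lm f t}"
    by blast
  obtain f where f: "f \<in> J" "f \<notin> I" "is_lm f t" using t by blast
  have "t \<notin> LM I"
  proof
    assume "t \<in> LM I"
    then obtain g where g: "g \<in> I" "is_lm g t" by (auto simp: LM_def)
    define h where "h = const (lookup f t / lookup g t) * g"
    have nz: "lookup g t \<noteq> 0" "lookup f t \<noteq> 0" using g f by (auto simp: is_lm_def in_keys_iff)
    have h: "h \<in> I" unfolding h_def using g ideal_closed(3)[OF assms(1)] by blast
    have "lookup h t = lookup f t" using nz by (simp add: h_def lookup_const_mult)
    moreover have "is_lm h t" unfolding h_def by (rule is_lm_const_mult) (use nz g in auto)
    ultimately have less: "wt s < wt t" if "is_lm (f - h) s" for s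
      using cancel_lm[OF f(3)] that by metis
    have "f - h \<notin> I"
    proof
      assume "f - h \<in> I"
      then have "f - h + h \<in> I" using h ideal_closed(2)[OF assms(1)] by blast
      then show False using f by simp
    qed
    moreover have "f - h \<in> J" using f h assms(3) ideal_closed(6)[OF assms(2)] by blast
    moreover have "f - h \<noteq> 0" using calculation(1) ideal_closed(1)[OF assms(1)] by auto
    ultimately show False using less min is_lm_exists by (metis (mono_tags, lifting) DiffI case_prodI mem_Collect_eq)
  qed
  then show ?thesis using f by (auto simp: LM_def)
qed

lemma LM_add:
  fixes I :: "('v::finite, 'k::field) mpoly set"
  assumes "is_ideal I" "t \<in> LM I" shows "s + t \<in> LM I"
proof -
  obtain f where f: "f \<in> I" "is_lm f t" using assms by (auto simp: LM_def)
  have "is_lm (single s (1::'k)) s" by (simp add: is_lm_def)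
  then have "is_lm (single s 1 * f) (s + t)" using f is_lm_times(1) by blast
  then show ?thesis using ideal_closed(3)[OF assms(1) f(1)] by (auto simp: LM_def)
qed

lemma LM_mono: "I \<subseteq> J \<Longrightarrow> LM I \<subseteq> LM J"
  by (auto simp: LM_def)

section \<open>Dickson's lemma and the ascending chain condition\<close>

lemma nat_seq_mono_subseq:
  fixes f :: "nat \<Rightarrow> nat"
  obtains \<sigma> :: "nat \<Rightarrow> nat" where "strict_mono \<sigma>" "mono (\<lambda>n. f (\<sigma> n))"
proof -
  obtain g :: "nat \<Rightarrow> nat" where g: "strict_mono g" "monoseq (\<lambda>n. f (g n))"
    using seq_monosub[of f] by auto
  show ?thesis
  proof (cases "\<forall>m. \<forall>n\<ge>m. f (g m) \<le> f (g n)")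
    case True
    then show ?thesis using g that by (auto simp: mono_def)
  next
    case False
    then have dec: "\<And>m n. m \<le> n \<Longrightarrow> f (g n) \<le> f (g m)" using g(2) by (auto simp: monoseq_def)
    \<comment> \<open>The least value attained; from an occurrence of it on, the nonincreasing
      subsequence is constant.\<close>
    define k where "k = (LEAST k. k \<in> range (\<lambda>n. f (g n)))"
    have "k \<in> range (\<lambda>n. f (g n))" unfolding k_def by (rule LeastI[of _ "f (g 0)"]) auto
    then obtain n0 where n0: "f (g n0) = k" by auto
    have "f (g (n + n0)) = k" for n
    proof (rule antisym)
      show "f (g (n + n0)) \<le> k" using dec[of n0 "n + n0"] n0 by simp
      show "k \<le> f (g (n + n0))" unfolding k_def by (rule Least_le) auto
    qed
    then show ?thesis
      using g(1) by (intro that[of "\<lambda>n. g (n + n0)"]) (auto simp: strict_mono_def mono_def)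
  qed
qed

text \<open>Refining to nondecreasing exponents one variable at a time leaves a subsequence in which
  each monomial divides all later ones; its first two terms suffice.\<close>

lemma dickson:
  fixes t :: "nat \<Rightarrow> ('v::finite \<Rightarrow>\<^sub>0 nat)"
  obtains i j s where "i < j" "t j = s + t i"
proof -
  have "\<exists>\<sigma>::nat \<Rightarrow> nat. strict_mono \<sigma> \<and> (\<forall>v\<in>A. mono (\<lambda>n. lookup (t (\<sigma> n)) v))" if "finite A" for A
    using that
  proof (induction A rule: finite_induct)
    case empty
    show ?case by (intro exI[of _ id]) (auto simp: strict_mono_def)
  next
    case (insert v A)
    then obtain \<sigma> :: "nat \<Rightarrow> nat" where \<sigma>: "strict_mono \<sigma>" "\<forall>v\<in>A. mono (\<lambda>n. lookup (t (\<sigma> n)) v)" by blast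
    obtain \<rho> :: "nat \<Rightarrow> nat" where \<rho>: "strict_mono \<rho>" "mono (\<lambda>n. lookup (t (\<sigma> (\<rho> n))) v)"
      using nat_seq_mono_subseq[of "\<lambda>n. lookup (t (\<sigma> n)) v"] by blast
    have "mono (\<lambda>n. lookup (t (\<sigma> (\<rho> n))) w)" if "w \<in> A" for w
      using \<sigma>(2) that \<rho>(1) by (simp add: mono_def strict_mono_leD)
    then show ?case
      using \<sigma>(1) \<rho> by (intro exI[of _ "\<lambda>n. \<sigma> (\<rho> n)"]) (auto simp: strict_mono_def)
  qed
  from this[OF finite_class.finite_UNIV] obtain \<sigma> :: "nat \<Rightarrow> nat" where
    \<sigma>: "strict_mono \<sigma>" "\<And>v. mono (\<lambda>n. lookup (t (\<sigma> n)) v)" by blast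
  have "t (\<sigma> 1) = (t (\<sigma> 1) - t (\<sigma> 0)) + t (\<sigma> 0)"
    using \<sigma>(2) by (intro poly_mapping_eqI) (simp add: lookup_add lookup_minus mono_def)
  moreover have "\<sigma> 0 < \<sigma> 1" using \<sigma>(1) by (simp add: strict_mono_def)
  ultimately show ?thesis using that by blast
qed

text \<open>In a strictly ascending chain each step contributes a leading monomial
  \<open>t i\<close> that was not there before; by Dickson's lemma one of them divides a later one,
  which then was not new.\<close>

lemma noetherian_wf:
  "wf {(J, I :: ('v::finite, 'k::field) mpoly set). is_ideal I \<and> is_ideal J \<and> I \<subset> J}"
proof (subst wf_iff_no_infinite_down_chain, rule notI)
  assume "\<exists>F. \<forall>i. (F (Suc i), F i) \<in> {(J, I :: ('v, 'k) mpoly set). is_ideal I \<and> is_ideal J \<and> I \<subset> J}"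
  then obtain F :: "nat \<Rightarrow> ('v, 'k) mpoly set"
    where "\<forall>i. (F (Suc i), F i) \<in> {(J, I :: ('v, 'k) mpoly set). is_ideal I \<and> is_ideal J \<and> I \<subset> J}" by blast
  then have F: "\<And>i. is_ideal (F i)" "\<And>i. F i \<subset> F (Suc i)" by auto
  have "\<forall>i. \<exists>t. t \<in> LM (F (Suc i)) - LM (F i)"
    using LM_psubset[OF F(1) F(1) F(2)] by blast
  then obtain t where t: "\<And>i. t i \<in> LM (F (Suc i))" "\<And>i. t i \<notin> LM (F i)" by (metis DiffE)
  obtain i j s where ij: "i < j" "t j = s + t i" using dickson .
  have "F (Suc i) \<subseteq> F j" using lift_Suc_mono_le[of F "Suc i" j] F(2) ij by (simp add: less_imp_le)
  then have "t i \<in> LM (F j)" using t(1) LM_mono by blast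
  then have "t j \<in> LM (F j)" unfolding ij by (rule LM_add[OF F(1)])
  then show False using t(2) by blast
qed

lemma noetherian_induct [consumes 1, case_names step]:
  fixes I :: "('v::finite, 'k::field) mpoly set"
  assumes "is_ideal I"
    and "\<And>I. is_ideal I \<Longrightarrow> (\<And>J. is_ideal J \<Longrightarrow> I \<subset> J \<Longrightarrow> P J) \<Longrightarrow> P I"
  shows "P I"
  using assms(1)
proof (induction I rule: wf_induct_rule[OF noetherian_wf])
  case (1 I)
  then show ?case using assms(2)[of I] by blast
qed

text \<open>Polynomial rings are completely integrally closed, with control of degrees: comparing leading
  monomials for all N shows that the leading monomial of b divides that of a,
  and subtracting a multiple of b from a preserves the hypothesis.\<close>

lemma completely_integrally_closed:
  fixes a b c :: "('v::finite, 'k::field) mpoly"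
  assumes b: "b \<noteq> 0" and c: "c \<noteq> 0" and q: "\<And>N. c * a ^ N = q N * b ^ N"
  shows "b dvd a"
proof -
  have "b dvd a" if "a \<noteq> 0" "is_lm a t" "\<And>N. \<exists>q. c * a ^ N = q * b ^ N" for t a
    using that
  proof (induction t arbitrary: a rule: wf_induct_rule[OF wf_wt])
    case (1 t)
    obtain tb tc where tb: "is_lm b tb" and tc: "is_lm c tc" using b c is_lm_exists by metis
    have le: "lookup tb v \<le> lookup t v" for v
    proof -
      have *: "N * lookup tb v \<le> lookup tc v + N * lookup t v" for N
      proof -
        obtain q where q: "c * a ^ N = q * b ^ N" using 1 by blast
        have "c * a ^ N \<noteq> 0" using c \<open>a \<noteq> 0\<close> mpoly_power_eq_0 by (auto simp: mpoly_times_eq_0)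
        then have "q \<noteq> 0" using q by auto
        then obtain tq where tq: "is_lm q tq" using is_lm_exists by blast
        obtain s where s: "is_lm (a ^ N) s" "\<forall>v. lookup s v = N * lookup t v"
          using is_lm_power 1 by blast
        obtain r where r: "is_lm (b ^ N) r" "\<forall>v. lookup r v = N * lookup tb v"
          using is_lm_power tb by blast
        have "tc + s = tq + r"
          using is_lm_times(1)[OF tc s(1)] is_lm_times(1)[OF tq r(1)] q is_lm_unique by metis
        then have "lookup tc v + lookup s v = lookup tq v + lookup r v" by (metis lookup_add)
        then show ?thesis using s r by auto
      qed
      show ?thesis
      proof (rule ccontr)
        assume "\<not> ?thesis"
        then have "lookup tb v \<ge> Suc (lookup t v)" by simp
        then have "Suc (lookup tc v) * Suc (lookup t v) \<le> Suc (lookup tc v) * lookup tb v"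
          by (rule mult_le_mono2)
        then show False using *[of "Suc (lookup tc v)"] by simp
      qed
    qed
    define u where "u = t - tb"
    have t: "t = u + tb"
      unfolding u_def by (rule poly_mapping_eqI) (use le in \<open>simp add: lookup_add lookup_minus\<close>)
    define p where "p = single u (lookup a t / lookup b tb)"
    have nz: "lookup a t \<noteq> 0" "lookup b tb \<noteq> 0" using 1 tb by (auto simp: is_lm_def in_keys_iff)
    have p: "is_lm p u" using nz by (simp add: p_def is_lm_def)
    have pb: "is_lm (p * b) t" "lookup (p * b) t = lookup a t"
      using is_lm_times[OF p tb] nz by (auto simp: t p_def)
    show ?case
    proof (cases "a - p * b = 0")
      case True
      then have "a = b * p" by (simp add: mult.commute)
      then show ?thesis by (rule dvdI)
    next
      case False
      then obtain s where s: "is_lm (a - p * b) s" using is_lm_exists by blast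
      have "wt s < wt t" using cancel_lm[OF 1(3) pb(1) _ s] pb(2) by simp
      \<comment> \<open>By the binomial theorem: each term contains \<open>c * a ^ k\<close>, which
        is divisible by \<open>b ^ k\<close>, together with the factor
        \<open>b ^ (N - k)\<close>.\<close>
      moreover have "\<exists>q. c * (a - p * b) ^ N = q * b ^ N" for N
      proof -
        obtain q where q: "\<And>N. c * a ^ N = q N * b ^ N" using 1 by metis
        have "c * (a - p * b) ^ N = c * (a + (- p) * b) ^ N" by simp
        also have "\<dots> = (\<Sum>k\<le>N. of_nat (N choose k) * (c * a ^ k) * ((- p) * b) ^ (N - k))"
          unfolding binomial_ring by (simp add: sum_distrib_left mult_ac)
        also have "\<dots> = (\<Sum>k\<le>N. of_nat (N choose k) * q k * (- p) ^ (N - k) * b ^ N)"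
        proof (rule sum.cong[OF refl])
          fix k assume k: "k \<in> {..N}"
          have "b ^ N = b ^ k * b ^ (N - k)" using k by (simp flip: power_add)
          then show "of_nat (N choose k) * (c * a ^ k) * ((- p) * b) ^ (N - k)
            = of_nat (N choose k) * q k * (- p) ^ (N - k) * b ^ N"
            unfolding q power_mult_distrib by (simp add: mult_ac)
        qed
        finally show ?thesis unfolding sum_distrib_right[symmetric] by blast
      qed
      ultimately have "b dvd (a - p * b)" using 1(1)[of s "a - p * b"] False s by blast
      then show ?thesis by (metis diff_add_cancel dvd_add dvd_triv_right)
    qed
  qed
  then show ?thesis using is_lm_exists q by (metis dvd_0_right)
qed

text \<open>After division \<open>c * h ^ N = q N\<close>. As \<open>N\<close> grows, the degree of
  the left side has the degree of \<open>h\<close> as slope, that of the right side a slope of at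
  most \<open>m\<close>.\<close>

lemma completely_integrally_closed_deg:
  fixes a b c :: "('v::finite, 'k::field) mpoly"
  assumes b: "b \<noteq> 0" and c: "c \<noteq> 0" and q: "\<And>N. c * a ^ N = q N * b ^ N"
    and deg: "\<And>N. q N \<in> deg_le (m * N + g)"
  obtains h where "a = h * b" "h \<in> deg_le m"
proof -
  obtain h where h: "a = h * b"
    using completely_integrally_closed[OF b c q] by (metis dvdE mult.commute)
  have "h \<in> deg_le m"
  proof (cases "h = 0")
    case False
    then obtain t where t: "is_lm h t" using is_lm_exists by blast
    obtain tc where tc: "is_lm c tc" using c is_lm_exists by blast
    have *: "N * mdeg t \<le> m * N + g" for N
    proof -
      have "(c * h ^ N - q N) * b ^ N = 0"
        using q[of N] by (simp add: h power_mult_distrib algebra_simps)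
      then have "c * h ^ N = q N" using b mpoly_power_eq_0[of b N] by (auto simp: mpoly_times_eq_0)
      moreover obtain s where s: "is_lm (h ^ N) s" "\<forall>v. lookup s v = N * lookup t v"
        using is_lm_power t by blast
      ultimately have "tc + s \<in> keys (q N)" using is_lm_times(1)[OF tc s(1)] by (simp add: is_lm_def)
      then have "mdeg tc + mdeg s \<le> m * N + g" using deg deg_leD by (metis mdeg_add)
      moreover have "mdeg s = N * mdeg t" using s(2) by (simp add: mdeg_def sum_distrib_left)
      ultimately show ?thesis by simp
    qed
    have "mdeg t \<le> m"
    proof (rule ccontr)
      assume "\<not> ?thesis"
      then have "Suc g * Suc m \<le> Suc g * mdeg t" by (intro mult_le_mono2) simp
      then show False using *[of "Suc g"] by (simp add: mult.commute)
    qed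
    then show ?thesis using is_lm_deg[OF t] by (intro deg_leI) fastforce
  qed simp
  then show ?thesis using h that by blast
qed

section \<open>Sums, colons and primality of homogeneous ideals\<close>

lemma homogeneous_ideal_is_ideal: "homogeneous_ideal J \<Longrightarrow> is_ideal J"
  by (simp add: homogeneous_ideal_def)

lemma homogeneous_ideal_homog_part: "homogeneous_ideal J \<Longrightarrow> f \<in> J \<Longrightarrow> homog_part m f \<in> J"
  by (simp add: homogeneous_ideal_def)

definition ideal_plus :: "'a::comm_ring_1 set \<Rightarrow> 'a \<Rightarrow> 'a set" where
  "ideal_plus J a = {f + a * r |f r. f \<in> J}"

definition ideal_colon :: "'a::comm_ring_1 set \<Rightarrow> 'a \<Rightarrow> 'a set" where
  "ideal_colon J a = {f. a * f \<in> J}"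

lemma is_ideal_plus:
  assumes "is_ideal J" shows "is_ideal (ideal_plus J a)"
  unfolding is_ideal_def
proof (intro conjI ballI allI)
  have "0 = 0 + a * 0" by simp
  then show "0 \<in> ideal_plus J a" using ideal_closed(1)[OF assms] unfolding ideal_plus_def by blast
next
  fix x y assume "x \<in> ideal_plus J a" "y \<in> ideal_plus J a"
  then obtain f r g s where *: "x = f + a * r" "y = g + a * s" "f \<in> J" "g \<in> J"
    unfolding ideal_plus_def by blast
  then have "x + y = (f + g) + a * (r + s)" by (simp add: algebra_simps)
  then show "x + y \<in> ideal_plus J a"
    using ideal_closed(2)[OF assms *(3,4)] unfolding ideal_plus_def by blast
next
  fix x s assume "x \<in> ideal_plus J a"
  then obtain f r where *: "x = f + a * r" "f \<in> J" unfolding ideal_plus_def by blast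
  then have "s * x = s * f + a * (s * r)" by (simp add: algebra_simps)
  then show "s * x \<in> ideal_plus J a"
    using ideal_closed(3)[OF assms *(2)] unfolding ideal_plus_def by blast
qed

lemma ideal_plus_superset: "J \<subseteq> ideal_plus J a"
proof
  fix f assume "f \<in> J"
  moreover have "f = f + a * 0" by simp
  ultimately show "f \<in> ideal_plus J a" unfolding ideal_plus_def by blast
qed

lemma ideal_plus_self: "is_ideal J \<Longrightarrow> a * r \<in> ideal_plus J a"
proof -
  assume "is_ideal J"
  moreover have "a * r = 0 + a * r" by simp
  ultimately show ?thesis using ideal_closed(1) unfolding ideal_plus_def by blast
qed

lemma is_ideal_colon: "is_ideal J \<Longrightarrow> is_ideal (ideal_colon J a)"
  unfolding is_ideal_def ideal_colon_def by (auto simp: distrib_left mult.left_commute)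

lemma ideal_colon_superset: "is_ideal J \<Longrightarrow> J \<subseteq> ideal_colon J a"
  by (auto simp: ideal_colon_def intro: ideal_closed)

lemma homogeneous_ideal_plus:
  assumes "homogeneous_ideal J" "a \<in> graded_piece s"
  shows "homogeneous_ideal (ideal_plus J a)"
  unfolding homogeneous_ideal_def
proof (intro conjI ballI allI)
  show "is_ideal (ideal_plus J a)" using is_ideal_plus assms homogeneous_ideal_is_ideal by blast
  fix x m assume "x \<in> ideal_plus J a"
  then obtain f r where x: "x = f + a * r" "f \<in> J" unfolding ideal_plus_def by blast
  have "homog_part m x = homog_part m f + a * (if s \<le> m then homog_part (m - s) r else 0)"
    by (simp add: x homog_part_add homog_part_times[OF assms(2)])
  then show "homog_part m x \<in> ideal_plus J a"
    using homogeneous_ideal_homog_part[OF assms(1) x(2)] unfolding ideal_plus_def by blast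
qed

lemma homogeneous_ideal_colon:
  assumes "homogeneous_ideal J" "a \<in> graded_piece s"
  shows "homogeneous_ideal (ideal_colon J a)"
  unfolding homogeneous_ideal_def
proof (intro conjI ballI allI)
  show "is_ideal (ideal_colon J a)" using is_ideal_colon assms homogeneous_ideal_is_ideal by blast
  fix x m assume "x \<in> ideal_colon J a"
  then have "homog_part (s + m) (a * x) \<in> J"
    using homogeneous_ideal_homog_part[OF assms(1)] by (simp add: ideal_colon_def)
  then show "homog_part m x \<in> ideal_colon J a"
    by (simp add: homog_part_times[OF assms(2)] ideal_colon_def)
qed

lemma homog_part_beyond: "f \<in> deg_le n \<Longrightarrow> n < m \<Longrightarrow> homog_part m f = 0"
  by (rule poly_mapping_eqI) (auto simp: lookup_homog_part in_keys_iff dest: deg_leD)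

text \<open>Choosing the highest component outside \<open>J\<close>, rather than any, is what
  isolates a single product in the test for primality.\<close>

lemma top_part_outside:
  assumes "is_ideal J" "a \<notin> J"
  obtains m where "homog_part m a \<notin> J" "\<And>i. m < i \<Longrightarrow> homog_part i a \<in> J"
proof -
  obtain n where n: "a \<in> deg_le n" using deg_le_exists .
  let ?M = "{m. homog_part m a \<notin> J}"
  have "?M \<subseteq> {..n}"
    using homog_part_beyond[OF n] ideal_closed(1)[OF assms(1)] by (metis (mono_tags, lifting) atMost_iff linorder_not_le mem_Collect_eq subsetI)
  then have fin: "finite ?M" by (rule finite_subset) simp
  have ne: "?M \<noteq> {}"
  proof
    assume "?M = {}"
    then have "(\<Sum>m\<le>n. homog_part m a) \<in> J" by (intro ideal_sum[OF assms(1)]) auto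
    then show False using sum_homog_part[OF n] assms(2) by simp
  qed
  show ?thesis
  proof (rule that)
    show "homog_part (Max ?M) a \<notin> J" using Max_in[OF fin ne] by simp
    show "homog_part i a \<in> J" if "Max ?M < i" for i
      using Max_ge[OF fin, of i] that by (force simp: not_le[symmetric])
  qed
qed

text \<open>Given \<open>a * b\<close> in \<open>J\<close>, take the highest components of
  \<open>a\<close> and \<open>b\<close> outside \<open>J\<close>, in degrees \<open>m\<close> and
  \<open>n\<close>. In degree \<open>m + n\<close> every other product has a factor above these
  degrees, hence in \<open>J\<close>, so the product of the two components lies in \<open>J\<close>
  as well.\<close>

lemma homogeneous_not_prime:
  assumes J: "homogeneous_ideal J" and "J \<noteq> UNIV" "\<not> prime_ideal J"
  obtains s t a b where "a \<in> graded_piece s" "b \<in> graded_piece t" "a \<notin> J" "b \<notin> J" "a * b \<in> J"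
proof -
  have id: "is_ideal J" using J by (rule homogeneous_ideal_is_ideal)
  obtain a b where ab: "a * b \<in> J" "a \<notin> J" "b \<notin> J"
    using assms id by (auto simp: prime_ideal_def)
  obtain m where m: "homog_part m a \<notin> J" "\<And>i. m < i \<Longrightarrow> homog_part i a \<in> J"
    using top_part_outside[OF id ab(2)] by metis
  obtain n where n: "homog_part n b \<notin> J" "\<And>i. n < i \<Longrightarrow> homog_part i b \<in> J"
    using top_part_outside[OF id ab(3)] by metis
  obtain M0 where "a \<in> deg_le M0" using deg_le_exists .
  then have M: "a \<in> deg_le (max M0 m)" using deg_le_mono[of M0 "max M0 m"] by auto
  define M' where "M' = max M0 m"
  define h where "h i = (if i \<le> m + n then homog_part i a * homog_part (m + n - i) b else 0)" for i
  have "homog_part (m + n) (a * b) = homog_part (m + n) (\<Sum>i\<le>M'. homog_part i a * b)"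
    using sum_homog_part[OF M] by (simp add: M'_def flip: sum_distrib_right)
  also have "\<dots> = (\<Sum>i\<le>M'. h i)"
    unfolding homog_part_sum h_def
    by (intro sum.cong refl) (rule homog_part_times[OF homog_part_graded])
  also have "\<dots> = h m + (\<Sum>i\<in>{..M'}-{m}. h i)"
    by (rule sum.remove) (auto simp: M'_def)
  finally have eq: "h m = homog_part (m + n) (a * b) - (\<Sum>i\<in>{..M'}-{m}. h i)" by simp
  have "h i \<in> J" if "i \<noteq> m" for i
  proof (cases "i < m")
    case True
    then have "homog_part (m + n - i) b \<in> J" by (intro n(2)) simp
    then show ?thesis using ideal_closed(1,3)[OF id] by (simp add: h_def)
  next
    case False
    then have "homog_part i a \<in> J" using that by (intro m(2)) simp
    then show ?thesis using ideal_closed(1,4)[OF id] by (simp add: h_def)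
  qed
  then have "(\<Sum>i\<in>{..M'}-{m}. h i) \<in> J" by (intro ideal_sum[OF id]) auto
  then have "h m \<in> J"
    unfolding eq using homogeneous_ideal_homog_part[OF J ab(1)] ideal_closed(6)[OF id] by blast
  then have "homog_part m a * homog_part n b \<in> J" by (simp add: h_def)
  then show ?thesis using that[OF homog_part_graded homog_part_graded m(1) n(1)] by blast
qed

lemma fin_span_zero: "R.fin_span ({0} :: ('v::finite, 'k::field) mpoly set)"
proof -
  have "monomial_span {} = ({0} :: ('v, 'k) mpoly set)" by (auto simp: monomial_span_def)
  moreover have "R.fin_span (monomial_span {} :: ('v, 'k) mpoly set)" by (rule fin_span_monomial_span) simp
  ultimately show ?thesis by simp
qed

text \<open>The exact sequence formed by R/(J:a) shifted by \<open>s\<close>, R/J and R/(J+(a)),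
  with multiplication by \<open>a\<close> as first map; below degree \<open>s\<close> the shifted
  module vanishes.\<close>

lemma hf_exact:
  fixes J :: "('v::finite, 'k::field) mpoly set"
  assumes J: "homogeneous_ideal J" and a: "a \<in> graded_piece s"
  shows "hf J m = hf (ideal_plus J a) m + (if s \<le> m then hf (ideal_colon J a) (m - s) else 0)"
proof -
  have id: "is_ideal J" using J by (rule homogeneous_ideal_is_ideal)
  have l: "R.linsub J" "R.linsub (ideal_plus J a)" "R.linsub (ideal_colon J a)"
    using id is_ideal_plus[OF id] is_ideal_colon[OF id] ideal_linsub by blast+
  have part: "f = homog_part m g + a * (if s \<le> m then homog_part (m - s) r else 0)"
    if "f \<in> graded_piece m" "f = g + a * r" for f g r
  proof -
    have "homog_part m f = homog_part m g + homog_part m (a * r)" unfolding that(2) by (rule homog_part_add)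
    then show ?thesis using homog_part_same[OF that(1)] homog_part_times[OF a, of m r] by (cases "s \<le> m") auto
  qed
  show ?thesis
  proof (cases "s \<le> m")
    case True
    have "hf (ideal_plus J a) m + hf (ideal_colon J a) (m - s) \<le> hf J m"
    proof (rule R.hdim_split_ge[OF l(1,2,3), of _ _ a])
      fix f :: "('v, 'k) mpoly" assume "f \<in> graded_piece (m - s)"
      then show "a * f \<in> graded_piece m \<inter> ideal_plus J a"
        using graded_times[OF a, of f "m - s"] True ideal_plus_self[OF id] by simp
    qed (simp_all add: ideal_colon_def ideal_plus_superset)
    moreover have "hf J m \<le> hf (ideal_plus J a) m + hf (ideal_colon J a) (m - s)"
    proof (rule R.hdim_split_le[OF l(1,2,3), of _ _ a])
      fix f assume f: "f \<in> graded_piece m" "f \<in> ideal_plus J a"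
      then obtain g r where g: "f = g + a * r" "g \<in> J" unfolding ideal_plus_def by blast
      have "f - a * homog_part (m - s) r = homog_part m g" using part[OF f(1) g(1)] True by simp
      then have "f - a * homog_part (m - s) r \<in> J" using homogeneous_ideal_homog_part[OF J g(2)] by simp
      then show "\<exists>h\<in>graded_piece (m - s). f - a * h \<in> J" using homog_part_graded by blast
    qed (simp_all add: ideal_colon_def)
    ultimately show ?thesis using True by simp
  next
    case False
    have "hf (ideal_plus J a) m \<le> hf J m"
      by (rule R.hdim_antimono[OF l(1,2)]) (simp_all add: ideal_plus_superset)
    \<comment> \<open>In degrees below \<open>s\<close> no multiple of \<open>a\<close> occurs; a
      zero space in place of the colon term makes the same inequality applicable.\<close>
    moreover have "hf J m \<le> hf (ideal_plus J a) m + R.hdim {0} (UNIV :: ('v, 'k) mpoly set)"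
    proof (rule R.hdim_split_le[OF l(1,2), where g = 0 and Y = "{0}" and P = UNIV])
      fix f assume f: "f \<in> graded_piece m" "f \<in> ideal_plus J a"
      then obtain g r where g: "f = g + a * r" "g \<in> J" unfolding ideal_plus_def by blast
      have "f = homog_part m g" using part[OF f(1) g(1)] False by simp
      then show "\<exists>h\<in>{0}. f - 0 * h \<in> J" using homogeneous_ideal_homog_part[OF J g(2)] by simp
    qed (simp_all add: R.linsub_def ideal_closed(1)[OF id] fin_span_zero)
    moreover have "R.hdim {0} (UNIV :: ('v, 'k) mpoly set) = 0"
      by (rule R.hdim_zero) (simp_all add: R.linsub_def)
    ultimately show ?thesis using False by simp
  qed
qed

section \<open>Hilbert polynomials\<close>

definition evpoly :: "(nat \<Rightarrow> nat) \<Rightarrow> bool" where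
  "evpoly f \<longleftrightarrow> (\<exists>p::real poly. \<exists>m0. \<forall>m\<ge>m0. real (f m) = poly p (real m))"

lemma evpoly_zero: "(\<And>m. m \<ge> m0 \<Longrightarrow> f m = 0) \<Longrightarrow> evpoly f"
  unfolding evpoly_def by (intro exI[of _ 0] exI[of _ m0]) simp

lemma evpoly_add:
  assumes "evpoly f" "evpoly g" shows "evpoly (\<lambda>m. f m + g m)"
proof -
  obtain p m0 q m1 where "\<forall>m\<ge>m0. real (f m) = poly p (real m)" "\<forall>m\<ge>m1. real (g m) = poly q (real m)"
    using assms unfolding evpoly_def by blast
  then show ?thesis unfolding evpoly_def
    by (intro exI[of _ "p + q"] exI[of _ "max m0 m1"]) simp
qed

lemma evpoly_shift:
  assumes "evpoly f" shows "evpoly (\<lambda>m. if s \<le> m then f (m - s) else 0)"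
proof -
  obtain p m0 where p: "\<forall>m\<ge>m0. real (f m) = poly p (real m)"
    using assms unfolding evpoly_def by blast
  have "real (if s \<le> m then f (m - s) else 0) = poly (pcompose p [:- real s, 1:]) (real m)" if "m \<ge> m0 + s" for m
    using p that by (simp add: poly_pcompose of_nat_diff)
  then show ?thesis unfolding evpoly_def by blast
qed

text \<open>The difference \<open>x ^ Suc n - (x - 1) ^ Suc n\<close> is \<open>Suc n\<close> times
  \<open>x ^ n\<close> plus lower terms \<open>c k * x ^ k\<close>. Antidifferences of the latter
  are subtracted from \<open>x ^ Suc n\<close>, and the result is divided by
  \<open>Suc n\<close>.\<close>

lemma poly_antidifference_power: "\<exists>Q::real poly. \<forall>x. poly Q x - poly Q (x - 1) = x ^ n"
proof (induction n rule: less_induct)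
  case (less n)
  then obtain Q :: "nat \<Rightarrow> real poly" where Q: "\<And>k x. k < n \<Longrightarrow> poly (Q k) x - poly (Q k) (x - 1) = x ^ k"
    by metis
  define c :: "nat \<Rightarrow> real" where "c k = - (real (Suc n choose k) * (-1) ^ (Suc n - k))" for k
  have cn: "c n = real (Suc n)" by (simp add: c_def)
  define P where "P = Polynomial.smult (1 / real (Suc n)) (Polynomial.monom 1 (Suc n) - (\<Sum>k<n. Polynomial.smult (c k) (Q k)))"
  have "poly P x - poly P (x - 1) = x ^ n" for x
  proof -
    have "(x + (- 1)) ^ Suc n = (\<Sum>k\<le>Suc n. real (Suc n choose k) * x ^ k * (- 1) ^ (Suc n - k))"
      by (rule binomial_ring)
    also have "\<dots> = x ^ Suc n - (\<Sum>k\<le>n. c k * x ^ k)"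
      by (simp add: c_def sum_negf mult_ac)
    also have "(\<Sum>k\<le>n. c k * x ^ k) = (\<Sum>k<n. c k * x ^ k) + real (Suc n) * x ^ n"
      by (simp add: cn flip: lessThan_Suc_atMost)
    finally have 1: "x ^ Suc n - (x - 1) ^ Suc n = (\<Sum>k<n. c k * x ^ k) + real (Suc n) * x ^ n" by simp
    have 2: "(\<Sum>k<n. c k * poly (Q k) x) - (\<Sum>k<n. c k * poly (Q k) (x - 1)) = (\<Sum>k<n. c k * x ^ k)"
      unfolding sum_subtractf[symmetric]
      by (intro sum.cong refl) (simp add: Q flip: right_diff_distrib)
    have "poly P x - poly P (x - 1) = 1 / real (Suc n) * ((x ^ Suc n - (x - 1) ^ Suc n)
       - ((\<Sum>k<n. c k * poly (Q k) x) - (\<Sum>k<n. c k * poly (Q k) (x - 1))))"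
      unfolding P_def poly_smult poly_diff poly_monom poly_sum by (simp only: right_diff_distrib mult_1)
    also have "\<dots> = x ^ n" unfolding 1 2 by simp
    finally show ?thesis .
  qed
  then show ?case by blast
qed

lemma poly_antidifference: "\<exists>Q::real poly. \<forall>x. poly Q x - poly Q (x - 1) = poly q x"
proof -
  obtain Q :: "nat \<Rightarrow> real poly" where Q: "\<And>k x. poly (Q k) x - poly (Q k) (x - 1) = x ^ k"
    using poly_antidifference_power by metis
  have "poly (\<Sum>k\<le>Polynomial.degree q. Polynomial.smult (Polynomial.coeff q k) (Q k)) x
      - poly (\<Sum>k\<le>Polynomial.degree q. Polynomial.smult (Polynomial.coeff q k) (Q k)) (x - 1) = poly q x" for x
    unfolding poly_sum sum_subtractf[symmetric] poly_smult right_diff_distrib[symmetric] Q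
    by (simp add: poly_altdef)
  then show ?thesis by blast
qed

lemma evpoly_antidifference:
  assumes "evpoly g" "\<And>m. m \<ge> 1 \<Longrightarrow> f m = g m + f (m - 1)"
  shows "evpoly f"
proof -
  obtain q m0 where q: "\<And>m. m \<ge> m0 \<Longrightarrow> real (g m) = poly q (real m)"
    using assms unfolding evpoly_def by blast
  obtain Q :: "real poly" where Q: "\<And>x. poly Q x - poly Q (x - 1) = poly q x"
    using poly_antidifference by blast
  define K where "K = real (f m0) - poly Q (real m0)"
  have "real (f m) = poly (Q + [:K:]) (real m)" if "m \<ge> m0" for m
    using that
  proof (induction m rule: dec_induct)
    case base
    then show ?case by (simp add: K_def)
  next
    case (step m)
    have "real (f (Suc m)) = real (g (Suc m)) + real (f m)" using assms(2)[of "Suc m"] by simp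
    also have "real (g (Suc m)) = poly Q (real (Suc m)) - poly Q (real (Suc m) - 1)"
      using q[of "Suc m"] step Q[of "real (Suc m)"] by simp
    finally show ?case using step by simp
  qed
  then show ?thesis unfolding evpoly_def by blast
qed

text \<open>The count on the affine cone: for a homogeneous prime its growth exponent turns out to
  be the Krull dimension of the quotient, which for the ideal of all variables is 0 although
  \<open>hf\<close> vanishes eventually.\<close>

definition cum :: "('v::finite, 'k::field) mpoly set \<Rightarrow> nat \<Rightarrow> nat" where
  "cum J m = (\<Sum>i\<le>m. hf J i)"

lemma hf_UNIV: "hf UNIV m = 0"
  by (rule R.hdim_zero) (simp_all add: R.linsub_def)

definition pvar :: "'v \<Rightarrow> ('v::finite, 'k::field) mpoly" where
  "pvar v = single (single v 1) 1"

lemma pvar_graded: "pvar v \<in> graded_piece 1"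
  by (simp add: pvar_def graded_piece_def)

lemma single_in_ideal:
  assumes "is_ideal J" "\<And>v. pvar v \<in> J" "mdeg t \<ge> 1"
  shows "single t c \<in> (J :: ('v::finite, 'k::field) mpoly set)"
proof -
  have "t \<noteq> 0" using assms(3) by auto
  then obtain v where v: "lookup t v \<noteq> 0" by (metis lookup_zero poly_mapping_eqI)
  have "t = (t - single v 1) + single v 1"
    by (rule poly_mapping_eqI) (use v in \<open>auto simp: lookup_add lookup_minus lookup_single when_def\<close>)
  then have "single t c = single (t - single v 1) c * pvar v"
    by (metis mult.right_neutral mult_single pvar_def)
  then show ?thesis using ideal_closed(3)[OF assms(1,2)] by metis
qed

lemma hf_all_vars:
  assumes "is_ideal J" "\<And>v. pvar v \<in> (J :: ('v::finite, 'k::field) mpoly set)" "m \<ge> 1"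
  shows "hf J m = 0"
proof (rule R.hdim_zero[OF ideal_linsub[OF assms(1)]], rule subsetI)
  fix f :: "('v, 'k) mpoly" assume "f \<in> graded_piece m"
  then have "(\<Sum>t\<in>keys f. single t (lookup f t)) \<in> J"
    using assms by (intro ideal_sum[OF assms(1)] single_in_ideal) (auto simp: graded_piece_def)
  then show "f \<in> J" using mpoly_eq_sum_single[of f] by simp
qed

lemma prime_colon:
  assumes "prime_ideal P" "a \<notin> P" shows "ideal_colon P a = P"
  using assms ideal_closed(3)[of P] by (auto simp: ideal_colon_def prime_ideal_def)

lemma prime_ideal_is_ideal: "prime_ideal P \<Longrightarrow> is_ideal P"
  by (simp add: prime_ideal_def)

lemma hf_prime_step:
  assumes "homogeneous_ideal P" "prime_ideal P" "pvar v \<notin> P" "m \<ge> 1"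
  shows "hf P m = hf (ideal_plus P (pvar v)) m + hf P (m - 1)"
  using hf_exact[OF assms(1) pvar_graded[of v], of m] prime_colon[OF assms(2,3)] assms(4) by simp

lemma ideal_plus_psubset:
  assumes "is_ideal J" "a \<notin> J" shows "J \<subset> ideal_plus J a"
  using ideal_plus_superset[of J a] ideal_plus_self[OF assms(1), of a 1] assms(2) by auto

lemma ideal_colon_psubset:
  assumes "is_ideal J" "b \<notin> J" "a * b \<in> J" shows "J \<subset> ideal_colon J a"
  using ideal_colon_superset[OF assms(1), of a] assms(2,3) by (auto simp: ideal_colon_def)

text \<open>Noetherian induction takes the place of syzygies. If \<open>J\<close> is prime, a
  variable outside \<open>J\<close> is a nonzerodivisor and \<open>hf J\<close> is an antidifference
  of a known function; otherwise homogeneous zero divisors make both ends of the exact sequence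
  quotients by larger ideals.\<close>

theorem evpoly_hf:
  fixes J :: "('v::finite, 'k::field) mpoly set"
  assumes "homogeneous_ideal J" shows "evpoly (hf J)"
proof -
  have "is_ideal J" using assms by (rule homogeneous_ideal_is_ideal)
  then have "homogeneous_ideal J \<longrightarrow> evpoly (hf J)"
  proof (induction J rule: noetherian_induct)
    case (step J)
    show ?case
    proof
      assume hJ: "homogeneous_ideal J"
      consider "J = UNIV" | "prime_ideal J" "\<forall>v. pvar v \<in> J" | v where "prime_ideal J" "pvar v \<notin> J"
        | "J \<noteq> UNIV" "\<not> prime_ideal J" by blast
      then show "evpoly (hf J)"
      proof cases
        case 1
        then show ?thesis by (intro evpoly_zero) (simp add: hf_UNIV)
      next
        case 2
        then show ?thesis using hf_all_vars[OF step(1)] by (intro evpoly_zero[of 1]) simp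
      next
        case 3
        have "evpoly (hf (ideal_plus J (pvar v)))"
          using step(2)[OF is_ideal_plus[OF step(1)] ideal_plus_psubset[OF step(1) 3(2)]]
            homogeneous_ideal_plus[OF hJ pvar_graded] by blast
        then show ?thesis using hf_prime_step[OF hJ 3] by (rule evpoly_antidifference)
      next
        case 4
        obtain s t a b where ab: "a \<in> graded_piece s" "b \<in> graded_piece t" "a \<notin> J" "b \<notin> J" "a * b \<in> J"
          using homogeneous_not_prime[OF hJ 4] .
        have "evpoly (hf (ideal_plus J a))"
          using step(2)[OF is_ideal_plus[OF step(1)] ideal_plus_psubset[OF step(1) ab(3)]]
            homogeneous_ideal_plus[OF hJ ab(1)] by blast
        moreover have "evpoly (hf (ideal_colon J a))"
          using step(2)[OF is_ideal_colon[OF step(1)] ideal_colon_psubset[OF step(1) ab(4,5)]]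
            homogeneous_ideal_colon[OF hJ ab(1)] by blast
        ultimately have "evpoly (\<lambda>m. hf (ideal_plus J a) m + (if s \<le> m then hf (ideal_colon J a) (m - s) else 0))"
          by (intro evpoly_add evpoly_shift)
        then show ?thesis using hf_exact[OF hJ ab(1)] by (simp cong: if_cong)
      qed
    qed
  qed
  then show ?thesis using assms by blast
qed

lemma cum_shift_le: "(\<Sum>i\<le>m. if s \<le> i then hf J (i - s) else 0) \<le> cum J m"
proof -
  have "(\<Sum>i\<le>m. if s \<le> i then hf J (i - s) else 0) = (\<Sum>i\<in>{s..m}. hf J (i - s))"
    by (rule sum.mono_neutral_cong_right) auto
  also have "\<dots> = (\<Sum>i\<in>(\<lambda>i. i - s) ` {s..m}. hf J i)"
    by (subst sum.reindex) (auto intro!: inj_onI)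
  also have "\<dots> \<le> cum J m" unfolding cum_def by (rule sum_mono2) auto
  finally show ?thesis .
qed

text \<open>The cumulative Hilbert function makes the shifts of a prime filtration disappear.\<close>

lemma prime_filtration:
  fixes J :: "('v::finite, 'k::field) mpoly set"
  assumes "homogeneous_ideal J"
  shows "\<exists>Qs. (\<forall>Q\<in>set Qs. homogeneous_ideal Q \<and> prime_ideal Q \<and> J \<subseteq> Q) \<and>
     (\<forall>m. cum J m \<le> (\<Sum>Q\<leftarrow>Qs. cum Q m))" (is "?F J")
proof -
  have "is_ideal J" using assms by (rule homogeneous_ideal_is_ideal)
  then have "homogeneous_ideal J \<longrightarrow> ?F J"
  proof (induction J rule: noetherian_induct)
    case (step J)
    show ?case
    proof
      assume hJ: "homogeneous_ideal J"
      consider "J = UNIV" | "prime_ideal J" | "J \<noteq> UNIV" "\<not> prime_ideal J" by blast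
      then show "?F J"
      proof cases
        case 1
        then show ?thesis by (intro exI[of _ "[]"]) (simp add: cum_def hf_UNIV)
      next
        case 2
        then show ?thesis using hJ by (intro exI[of _ "[J]"]) simp
      next
        case 3
        obtain s t a b where ab: "a \<in> graded_piece s" "b \<in> graded_piece t" "a \<notin> J" "b \<notin> J" "a * b \<in> J"
          using homogeneous_not_prime[OF hJ 3] .
        have "?F (ideal_plus J a)"
          using step(2)[OF is_ideal_plus[OF step(1)] ideal_plus_psubset[OF step(1) ab(3)]]
            homogeneous_ideal_plus[OF hJ ab(1)] by blast
        then obtain Qs where Qs: "\<forall>Q\<in>set Qs. homogeneous_ideal Q \<and> prime_ideal Q \<and> ideal_plus J a \<subseteq> Q"
            "\<forall>m. cum (ideal_plus J a) m \<le> (\<Sum>Q\<leftarrow>Qs. cum Q m)" by blast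
        have "?F (ideal_colon J a)"
          using step(2)[OF is_ideal_colon[OF step(1)] ideal_colon_psubset[OF step(1) ab(4,5)]]
            homogeneous_ideal_colon[OF hJ ab(1)] by blast
        then obtain Qs' where Qs': "\<forall>Q\<in>set Qs'. homogeneous_ideal Q \<and> prime_ideal Q \<and> ideal_colon J a \<subseteq> Q"
            "\<forall>m. cum (ideal_colon J a) m \<le> (\<Sum>Q\<leftarrow>Qs'. cum Q m)" by blast
        have "cum J m \<le> (\<Sum>Q\<leftarrow>Qs @ Qs'. cum Q m)" for m
        proof -
          have "cum J m = cum (ideal_plus J a) m + (\<Sum>i\<le>m. if s \<le> i then hf (ideal_colon J a) (i - s) else 0)"
            unfolding cum_def hf_exact[OF hJ ab(1)] by (rule sum.distrib)
          also have "\<dots> \<le> cum (ideal_plus J a) m + cum (ideal_colon J a) m" using cum_shift_le by simp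
          also have "\<dots> \<le> (\<Sum>Q\<leftarrow>Qs. cum Q m) + (\<Sum>Q\<leftarrow>Qs'. cum Q m)"
            using Qs(2) Qs'(2) by (intro add_mono) auto
          finally show ?thesis by simp
        qed
        moreover have "\<forall>Q\<in>set (Qs @ Qs'). homogeneous_ideal Q \<and> prime_ideal Q \<and> J \<subseteq> Q"
          using Qs(1) Qs'(1) ideal_plus_superset[of J a] ideal_colon_superset[OF step(1), of a]
          by (metis Un_iff set_append subset_trans)
        ultimately show ?thesis by blast
      qed
    qed
  qed
  then show ?thesis using assms by blast
qed

section \<open>Growth exponents of cumulative Hilbert functions\<close>

lemma hf_0_pos:
  assumes "is_ideal J" "J \<noteq> UNIV" shows "hf J 0 \<ge> 1"
proof (rule R.hdim_ge_indep[OF ideal_linsub[OF assms(1)] fin_span_graded])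
  have "a = 0" if "const a \<in> J" for a
  proof (rule ccontr)
    assume "a \<noteq> 0"
    then have "const (inverse a) * const a = (1 :: ('a, 'b) mpoly)" by (simp flip: R.hom_mult)
    then have "1 \<in> J" using ideal_closed(3)[OF assms(1) that] by metis
    then show False using ideal_eq_UNIV assms by blast
  qed
  then show "R.indep_mod J 1 (\<lambda>_. 1)" by (auto simp: R.indep_mod_def)
  show "\<forall>i<1::nat. 1 \<in> graded_piece 0" by (simp add: graded_piece_def)
qed

text \<open>The leading term dominates; \<open>f m \<ge> 1\<close> excludes both the zero polynomial
  and a negative leading coefficient.\<close>

lemma poly_growth:
  fixes f :: "nat \<Rightarrow> nat" and p :: "real poly"
  assumes p: "\<And>m. m \<ge> m0 \<Longrightarrow> real (f m) = poly p (real m)" and f: "\<And>m. f m \<ge> 1"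
  obtains c C :: real and m1 where "c > 0" "\<And>m. m \<ge> m1 \<Longrightarrow> c * real m ^ Polynomial.degree p \<le> real (f m)"
    "\<And>m. m \<ge> m1 \<Longrightarrow> real (f m) \<le> C * real m ^ Polynomial.degree p"
proof -
  define n where "n = Polynomial.degree p"
  define l where "l = Polynomial.coeff p n"
  define K where "K = (\<Sum>i<n. \<bar>Polynomial.coeff p i\<bar>)"
  \<comment> \<open>The estimate of the lower terms is multiplied by \<open>x\<close>, which avoids
    the exponent \<open>n - 1\<close> when \<open>n = 0\<close>.\<close>
  have est: "x * \<bar>poly p x - l * x ^ n\<bar> \<le> K * x ^ n" if "x \<ge> 1" for x :: real
  proof -
    have "poly p x - l * x ^ n = (\<Sum>i<n. Polynomial.coeff p i * x ^ i)"
      unfolding poly_altdef l_def n_def by (simp flip: lessThan_Suc_atMost)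
    then have "x * \<bar>poly p x - l * x ^ n\<bar> \<le> x * (\<Sum>i<n. \<bar>Polynomial.coeff p i\<bar> * x ^ i)"
      using that by (simp, intro order_trans[OF sum_abs] sum_mono) (simp add: abs_mult)
    also have "\<dots> = (\<Sum>i<n. \<bar>Polynomial.coeff p i\<bar> * x ^ Suc i)"
      by (simp add: sum_distrib_left mult_ac)
    also have "\<dots> \<le> (\<Sum>i<n. \<bar>Polynomial.coeff p i\<bar> * x ^ n)"
      using that by (intro sum_mono mult_left_mono power_increasing) auto
    finally show ?thesis by (simp add: K_def sum_distrib_right)
  qed
  have K: "K \<ge> 0" by (simp add: K_def sum_nonneg)
  have l0: "l > 0"
  proof (rule ccontr)
    assume "\<not> l > 0"
    moreover have "l \<noteq> 0"
    proof
      assume "l = 0"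
      then have "p = 0" by (simp add: l_def n_def)
      then show False using p[of m0] f[of m0] by simp
    qed
    ultimately have l: "l < 0" by simp
    obtain k :: nat where k: "real k > K / (- l)" using reals_Archimedean2 by blast
    define x where "x = real (max (Suc k) m0)"
    have x: "x \<ge> 1" "x > K / (- l)" using k by (auto simp: x_def)
    have "poly p x \<ge> 1"
      using p[of "max (Suc k) m0"] f[of "max (Suc k) m0"] by (simp add: x_def)
    then have "x * 1 \<le> x * poly p x" using x by (intro mult_left_mono) auto
    also have "x * poly p x = x * l * x ^ n + x * (poly p x - l * x ^ n)" by (simp add: algebra_simps)
    also have "\<dots> \<le> x * l * x ^ n + x * \<bar>poly p x - l * x ^ n\<bar>" using x by simp
    also have "\<dots> \<le> x * l * x ^ n + K * x ^ n" using est[OF x(1)] by simp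
    also have "\<dots> = (x * l + K) * x ^ n" by (simp add: algebra_simps)
    also have "\<dots> \<le> 0"
    proof (rule mult_nonpos_nonneg)
      show "x * l + K \<le> 0" using x(2) l by (simp add: field_simps)
    qed (use x in simp)
    finally show False using x by simp
  qed
  obtain k :: nat where k: "real k > 2 * K / l" using reals_Archimedean2 by blast
  have both: "l / 2 * real m ^ n \<le> real (f m) \<and> real (f m) \<le> (l + K) * real m ^ n" if "m \<ge> max (Suc k) m0" for m
  proof -
    define x where "x = real m"
    have x: "x \<ge> 1" "x > 2 * K / l" using that k by (auto simp: x_def)
    have e: "\<bar>poly p x - l * x ^ n\<bar> \<le> K * x ^ n / x" using est[OF x(1)] x(1) by (simp add: field_simps)
    have "K * x ^ n / x \<le> K * x ^ n" using x K divide_left_mono[of 1 x "K * x ^ n"] by simp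
    then have u: "poly p x \<le> (l + K) * x ^ n" using e by (simp add: algebra_simps abs_le_iff)
    have "K / x \<le> l / 2" using x l0 by (simp add: field_simps)
    then have "K / x * x ^ n \<le> l / 2 * x ^ n" using x by (intro mult_right_mono) auto
    moreover have "K / x * x ^ n = K * x ^ n / x" by simp
    moreover have "l / 2 * x ^ n = l * x ^ n / 2" by simp
    ultimately have "l / 2 * x ^ n \<le> poly p x" using e by linarith
    then show ?thesis using u p[of m] that by (simp add: x_def)
  qed
  show ?thesis
    by (rule that[of "l / 2" "max (Suc k) m0" "l + K"]) (use l0 both in \<open>auto simp: n_def\<close>)
qed

definition growth :: "('v::finite, 'k::field) mpoly set \<Rightarrow> nat \<Rightarrow> bool" where
  "growth J T \<longleftrightarrow> (\<exists>c>0. \<exists>C m0. \<forall>m\<ge>m0. c * real m ^ T \<le> real (cum J m) \<and> real (cum J m) \<le> C * real m ^ T)"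

lemma cum_ge_1: "is_ideal J \<Longrightarrow> J \<noteq> UNIV \<Longrightarrow> cum J m \<ge> 1"
  unfolding cum_def
  by (rule order_trans[OF hf_0_pos]) (auto intro: member_le_sum)

lemma cum_step: "m \<ge> 1 \<Longrightarrow> cum J m = hf J m + cum J (m - 1)"
  by (cases m) (auto simp: cum_def)

lemma growth_exists:
  assumes "homogeneous_ideal J" "J \<noteq> UNIV" obtains T where "growth J T"
proof -
  have "evpoly (cum J)" using evpoly_hf[OF assms(1)] cum_step by (rule evpoly_antidifference)
  then obtain p m0 where p: "\<And>m. m \<ge> m0 \<Longrightarrow> real (cum J m) = poly p (real m)"
    unfolding evpoly_def by blast
  have ge: "cum J m \<ge> 1" for m using cum_ge_1 assms homogeneous_ideal_is_ideal by blast
  obtain c C :: real and m1 where "c > 0" "\<And>m. m \<ge> m1 \<Longrightarrow> c * real m ^ Polynomial.degree p \<le> real (cum J m)"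
    "\<And>m. m \<ge> m1 \<Longrightarrow> real (cum J m) \<le> C * real m ^ Polynomial.degree p"
    using poly_growth[OF p ge] by metis
  then have "growth J (Polynomial.degree p)" unfolding growth_def by blast
  then show ?thesis using that by blast
qed

lemma power_compare:
  fixes c C :: real
  assumes "c > 0" "\<And>m. m \<ge> m0 \<Longrightarrow> c * real m ^ a \<le> C * real m ^ b"
  shows "a \<le> b"
proof (rule ccontr)
  assume "\<not> a \<le> b"
  then have ab: "b + 1 \<le> a" by simp
  obtain k :: nat where k: "real k > C / c" using reals_Archimedean2 by blast
  define m where "m = max (Suc k) m0"
  have m: "real m \<ge> 1" "real m > C / c" using k by (auto simp: m_def)
  have "c * real m * real m ^ b \<le> c * real m ^ a"
    using power_increasing[OF ab m(1)] assms(1) by (simp add: mult.assoc)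
  also have "\<dots> \<le> C * real m ^ b" by (rule assms(2)) (simp add: m_def)
  finally have "c * real m \<le> C" using m(1) by (simp add: mult_le_cancel_right)
  then show False using m(2) assms(1) by (simp add: field_simps)
qed

section \<open>Krull dimension of homogeneous primes\<close>

lemma growth_le:
  assumes "growth J T" "\<And>m. m \<ge> m0 \<Longrightarrow> real (cum J m) \<le> C * real m ^ n"
  shows "T \<le> n"
proof -
  obtain c C' m1 where c: "c > 0" "\<forall>m\<ge>m1. c * real m ^ T \<le> real (cum J m)"
    using assms(1) unfolding growth_def by blast
  show ?thesis
    by (rule power_compare[OF c(1), of "max m0 m1" _ C]) (use c(2) assms(2) in \<open>force intro: order_trans\<close>)
qed

text \<open>Chains of primes may contain inhomogeneous ideals, whose graded pieces carry too little
  information; for them all polynomials of degree at most \<open>m\<close> are counted.\<close>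

abbreviation aff_hf :: "('v::finite, 'k::field) mpoly set \<Rightarrow> nat \<Rightarrow> nat" where
  "aff_hf J m \<equiv> R.hdim (deg_le m) J"

lemma aff_hf_le_cum:
  assumes "is_ideal (J :: ('v::finite, 'k::field) mpoly set)" shows "aff_hf J m \<le> cum J m"
proof (induction m)
  case 0
  have "deg_le 0 = (graded_piece 0 :: ('v, 'k) mpoly set)" by (simp add: deg_le_def graded_piece_eq)
  then show ?case by (simp add: cum_def)
next
  case (Suc m)
  have "aff_hf J (Suc m) \<le> aff_hf J m + hf J (Suc m)"
  proof (rule R.hdim_sum_le[OF ideal_linsub[OF assms] fin_span_deg_le fin_span_graded fin_span_deg_le])
    fix z :: "('v, 'k) mpoly" assume "z \<in> deg_le (Suc m)"
    then have "z = (\<Sum>i\<le>Suc m. homog_part i z)" by (rule sum_homog_part)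
    then have "z = (\<Sum>i\<le>m. homog_part i z) + homog_part (Suc m) z" by simp
    moreover have "homog_part i z \<in> deg_le m" if "i \<le> m" for i
      using homog_part_graded[of i z] that by (intro deg_leI) (auto simp: graded_piece_def)
    then have "(\<Sum>i\<le>m. homog_part i z) \<in> deg_le m" by (intro R.linsub_sum[OF linsub_deg_le]) auto
    ultimately show "\<exists>x\<in>deg_le m. \<exists>y\<in>graded_piece (Suc m). z = x + y" using homog_part_graded by blast
  qed
  then show ?case using Suc by (simp add: cum_def)
qed

lemma aff_hf_ge_1:
  assumes "is_ideal J" "J \<noteq> UNIV" shows "aff_hf J m \<ge> 1"
proof -
  have "graded_piece 0 \<subseteq> (deg_le m :: ('a, 'b) mpoly set)" by (auto simp: graded_piece_eq deg_le_def monomial_span_def)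
  then have "hf J 0 \<le> aff_hf J m" by (intro R.hdim_mono[OF ideal_linsub[OF assms(1)]]) simp_all
  then show ?thesis using hf_0_pos[OF assms] by simp
qed

text \<open>Multiplication by \<open>f\<close> is injective modulo the prime \<open>Q\<close> and
  maps into \<open>Q'\<close>, so a shifted copy of the count for \<open>Q\<close> fits beside the
  count for \<open>Q'\<close>.\<close>

lemma aff_hf_prime_step:
  fixes Q Q' :: "('v::finite, 'k::field) mpoly set"
  assumes "prime_ideal Q" "prime_ideal Q'" "Q \<subseteq> Q'" "f \<in> Q'" "f \<notin> Q" "f \<in> deg_le \<delta>" "\<delta> \<le> m"
  shows "aff_hf Q' m + aff_hf Q (m - \<delta>) \<le> aff_hf Q m"
proof (rule R.hdim_split_ge[where g = f])
  fix h :: "('v, 'k) mpoly" assume "h \<in> deg_le (m - \<delta>)"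
  then show "f * h \<in> deg_le m \<inter> Q'"
    using deg_le_times[OF assms(6), of h "m - \<delta>"] assms ideal_closed(4) by (auto simp: prime_ideal_def)
  show "f * h \<in> Q \<Longrightarrow> h \<in> Q" using assms(1,5) by (auto simp: prime_ideal_def)
qed (use assms ideal_linsub in \<open>auto simp: prime_ideal_def\<close>)

text \<open>Unrolling the recursion about \<open>m / (2 * \<delta>)\<close> times keeps all
  arguments of \<open>g\<close> above \<open>m / 2\<close>. So a number of summands proportional to
  \<open>m\<close>, each at least of order \<open>m ^ s\<close>, accumulates.\<close>

lemma recursive_growth:
  fixes f g :: "nat \<Rightarrow> nat" and c :: real
  assumes "c > 0" "\<And>m. m \<ge> m0 \<Longrightarrow> c * real m ^ s \<le> real (g m)" "\<delta> \<ge> 1"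
    and f: "\<And>m. m \<ge> \<delta> \<Longrightarrow> g m + f (m - \<delta>) \<le> f m"
  shows "\<exists>c'>0. \<exists>m1. \<forall>m\<ge>m1. c' * real m ^ Suc s \<le> real (f m)"
proof -
  have iter: "(\<Sum>j<k. g (m - j * \<delta>)) \<le> f m" if "k * \<delta> \<le> m" for k m
  proof -
    have "(\<Sum>j<k. g (m - j * \<delta>)) + f (m - k * \<delta>) \<le> f m"
      using that
    proof (induction k)
      case (Suc k)
      have "g (m - k * \<delta>) + f (m - k * \<delta> - \<delta>) \<le> f (m - k * \<delta>)"
        by (rule f) (use Suc.prems in simp)
      then show ?case using Suc by (simp add: algebra_simps)
    qed simp
    then show ?thesis by simp
  qed
  have main: "c / (4 * real \<delta> * 2 ^ s) * real m ^ Suc s \<le> real (f m)" if m: "m \<ge> max (2 * m0) (4 * \<delta>)" for m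
  proof -
    define k where "k = m div (2 * \<delta>)"
    have k1: "2 * (k * \<delta>) \<le> m"
      unfolding k_def by (metis div_times_less_eq_dividend mult.assoc mult.commute)
    have "m < 2 * \<delta> * (k + 1)" unfolding k_def
      using dividend_less_div_times[of "2 * \<delta>" m] assms(3) by (simp add: algebra_simps)
    then have "real m < real (2 * \<delta> * (k + 1))" by (simp only: of_nat_less_iff)
    then have "real m < 2 * real \<delta> * (real k + 1)" by (simp add: algebra_simps)
    moreover have "real m \<ge> 4 * real \<delta>" using m by (metis max.bounded_iff of_nat_le_iff of_nat_mult of_nat_numeral)
    ultimately have k2: "real m \<le> 4 * real \<delta> * real k" by (simp add: algebra_simps)
    have summand: "c * (real m / 2) ^ s \<le> real (g (m - j * \<delta>))" if "j < k" for j
    proof -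
      have "j * \<delta> \<le> k * \<delta>" using that by simp
      then have j: "2 * (j * \<delta>) \<le> m" using k1 by linarith
      then have "real m / 2 \<le> real (m - j * \<delta>)" by linarith
      then have "c * (real m / 2) ^ s \<le> c * real (m - j * \<delta>) ^ s"
        using assms(1) by (intro mult_left_mono power_mono) auto
      also have "\<dots> \<le> real (g (m - j * \<delta>))" by (rule assms(2)) (use j m in linarith)
      finally show ?thesis .
    qed
    have "c / (4 * real \<delta> * 2 ^ s) * real m ^ Suc s = real m / (4 * real \<delta>) * (c * (real m / 2) ^ s)"
      by (simp add: power_divide)
    also have "\<dots> \<le> real k * (c * (real m / 2) ^ s)"
      using k2 assms(1,3) by (intro mult_right_mono) (auto simp: divide_le_eq mult_ac)
    also have "\<dots> \<le> (\<Sum>j<k. real (g (m - j * \<delta>)))"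
      using sum_mono[of "{..<k}" "\<lambda>_. c * (real m / 2) ^ s"] summand by simp
    also have "\<dots> \<le> real (f m)" using iter[of k m] k1 by (simp flip: of_nat_sum)
    finally show ?thesis .
  qed
  then show ?thesis
    using assms(1,3) by (intro exI[of _ "c / (4 * real \<delta> * 2 ^ s)"] conjI exI[of _ "max (2 * m0) (4 * \<delta>)"]) auto
qed

definition prime_chain :: "'a::comm_ring_1 set \<Rightarrow> nat \<Rightarrow> (nat \<Rightarrow> 'a set) \<Rightarrow> bool" where
  "prime_chain J r P \<longleftrightarrow> (\<forall>i\<le>r. prime_ideal (P i) \<and> J \<subseteq> P i) \<and> (\<forall>i<r. P i \<subset> P (Suc i))"

lemma krull_dim_quot_chain: "krull_dim_quot J = Sup {r. \<exists>P. prime_chain J r P}"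
  by (simp add: krull_dim_quot_def prime_chain_def)

text \<open>Going down the chain from its top, each strict inclusion raises the exponent of the
  lower bound by one; at the bottom it meets the upper bound for \<open>J\<close>.\<close>

lemma prime_chain_le_growth:
  fixes J :: "('v::finite, 'k::field) mpoly set"
  assumes J: "is_ideal J" and gr: "growth J T" and ch: "prime_chain J r P"
  shows "r \<le> T"
proof -
  have pr: "prime_ideal (P i)" "J \<subseteq> P i" if "i \<le> r" for i using ch that by (auto simp: prime_chain_def)
  have "\<exists>c>0. \<exists>m0. \<forall>m\<ge>m0. c * real m ^ s \<le> real (aff_hf (P (r - s)) m)" if "s \<le> r" for s
    using that
  proof (induction s)
    case 0
    have "is_ideal (P r)" "P r \<noteq> UNIV" using pr[of r] by (auto simp: prime_ideal_def)
    then have "1 \<le> aff_hf (P r) m" for m by (rule aff_hf_ge_1)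
    then show ?case by (intro exI[of _ 1]) auto
  next
    case (Suc s)
    let ?Q = "P (r - Suc s)" and ?Q' = "P (r - s)"
    have "?Q \<subset> P (Suc (r - Suc s))" using ch Suc.prems by (auto simp: prime_chain_def)
    also have "Suc (r - Suc s) = r - s" using Suc.prems by simp
    finally obtain f where f: "f \<in> ?Q'" "f \<notin> ?Q" and sub: "?Q \<subseteq> ?Q'" by blast
    obtain \<delta>0 where "f \<in> deg_le \<delta>0" using deg_le_exists .
    then have \<delta>: "f \<in> deg_le (Suc \<delta>0)" using deg_le_mono[of \<delta>0 "Suc \<delta>0"] by auto
    obtain c m0 where c: "c > 0" "\<And>m. m \<ge> m0 \<Longrightarrow> c * real m ^ s \<le> real (aff_hf ?Q' m)"
      using Suc.IH Suc.prems by (meson Suc_leD)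
    show ?case
      by (rule recursive_growth[OF c, of _ "Suc \<delta>0"])
        (use aff_hf_prime_step[OF pr(1) pr(1) sub f \<delta>] in auto)
  qed
  from this[of r] obtain c m0 where c: "c > 0" "\<And>m. m \<ge> m0 \<Longrightarrow> c * real m ^ r \<le> real (aff_hf (P 0) m)"
    by auto
  obtain C m1 where C: "\<And>m. m \<ge> m1 \<Longrightarrow> real (cum J m) \<le> C * real m ^ T"
    using gr unfolding growth_def by blast
  have le: "real (aff_hf (P 0) m) \<le> real (cum J m)" for m
  proof -
    have "aff_hf (P 0) m \<le> aff_hf J m"
      by (rule R.hdim_antimono[OF ideal_linsub[OF J] ideal_linsub]) (use pr[of 0] in \<open>auto simp: prime_ideal_def\<close>)
    then show ?thesis using aff_hf_le_cum[OF J, of m] by simp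
  qed
  have "c * real m ^ r \<le> C * real m ^ T" if "m \<ge> max m0 m1" for m
    using c(2)[of m] C[of m] that le[of m] by simp
  then show ?thesis by (rule power_compare[OF c(1)])
qed

lemma sum_list_bound:
  assumes "\<And>Q. Q \<in> set Qs \<Longrightarrow> \<exists>C m0. \<forall>m\<ge>m0. real (f Q m) \<le> C * real m ^ n"
  shows "\<exists>C m0. \<forall>m\<ge>m0. real (\<Sum>Q\<leftarrow>Qs. f Q m) \<le> C * real m ^ n"
  using assms
proof (induction Qs)
  case Nil
  then show ?case by (intro exI[of _ 0]) simp
next
  case (Cons Q Qs)
  obtain C m0 where 1: "\<forall>m\<ge>m0. real (f Q m) \<le> C * real m ^ n" using Cons.prems by force
  obtain C' m0' where 2: "\<forall>m\<ge>m0'. real (\<Sum>Q\<leftarrow>Qs. f Q m) \<le> C' * real m ^ n" using Cons by force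
  have "\<forall>m\<ge>max m0 m0'. real (\<Sum>Q\<leftarrow>Q # Qs. f Q m) \<le> (C + C') * real m ^ n"
    using 1 2 by (auto simp: distrib_right intro: add_mono)
  then show ?case by blast
qed

text \<open>A nonzerodivisor of degree 1 turns the exact sequence into a difference equation, whose
  sum telescopes.\<close>

lemma cum_ideal_plus_var:
  assumes "homogeneous_ideal P" "prime_ideal P" "pvar v \<notin> P"
  shows "cum (ideal_plus P (pvar v)) m = hf P m"
proof (induction m)
  case 0
  then show ?case
    using hf_exact[OF assms(1) pvar_graded[of v], of 0] by (simp add: cum_def)
next
  case (Suc m)
  then show ?case using hf_prime_step[OF assms, of "Suc m"] by (simp add: cum_def)
qed

lemma cum_bound_from_hf:
  assumes "\<forall>m\<ge>m0. real (hf J m) \<le> C * real m ^ n"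
  shows "\<exists>C' m1. \<forall>m\<ge>m1. real (cum J m) \<le> C' * real m ^ Suc n"
proof -
  define A where "A = (\<Sum>i\<le>m0. real (hf J i))"
  have A: "A \<ge> 0" by (simp add: A_def sum_nonneg)
  have "real (cum J m) \<le> A + \<bar>C\<bar> * real m ^ Suc n" if "m \<ge> m0" for m
    using that
  proof (induction m rule: dec_induct)
    case base
    then show ?case by (simp add: cum_def A_def)
  next
    case (step m)
    have "real (hf J (Suc m)) \<le> \<bar>C\<bar> * real (Suc m) ^ n"
      using assms step by (meson abs_ge_self le_SucI mult_right_mono order_trans of_nat_0_le_iff zero_le_power)
    moreover have "real (Suc m) ^ n + real m ^ Suc n \<le> real (Suc m) ^ Suc n"
    proof -
      have "real m * real m ^ n \<le> real m * real (Suc m) ^ n" by (intro mult_left_mono power_mono) auto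
      then show ?thesis by (simp add: algebra_simps)
    qed
    then have "\<bar>C\<bar> * (real (Suc m) ^ n + real m ^ Suc n) \<le> \<bar>C\<bar> * real (Suc m) ^ Suc n"
      by (intro mult_left_mono) auto
    ultimately show ?case using step(3) by (simp add: cum_def distrib_left)
  qed
  moreover have "A + \<bar>C\<bar> * real m ^ Suc n \<le> (A + \<bar>C\<bar>) * real m ^ Suc n" if "m \<ge> 1" for m :: nat
    using A mult_left_mono[of 1 "real m ^ Suc n" A] that by (simp add: distrib_right one_le_power del: power_Suc)
  ultimately have "\<forall>m\<ge>max m0 1. real (cum J m) \<le> (A + \<bar>C\<bar>) * real m ^ Suc n"
    by (meson max.bounded_iff order_trans)
  then show ?thesis by blast
qed

text \<open>The cumulative count of \<open>ideal_plus P (pvar v)\<close> is \<open>hf P\<close>. If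
  all primes in a filtration of that ideal had exponents below \<open>T - 1\<close>, summation would
  bound \<open>cum P\<close> by a power below \<open>T\<close>. So one of them has exponent at least
  \<open>T - 1\<close>, and the chain continues from it by induction.\<close>

lemma prime_chain_exists:
  fixes P :: "('v::finite, 'k::field) mpoly set"
  assumes "homogeneous_ideal P" "prime_ideal P" "growth P T"
  shows "\<exists>r\<ge>T. \<exists>C. prime_chain P r C"
proof -
  have "is_ideal P" using assms by (simp add: prime_ideal_def)
  then have "\<forall>T. homogeneous_ideal P \<and> prime_ideal P \<and> growth P T \<longrightarrow> (\<exists>r\<ge>T. \<exists>C. prime_chain P r C)"
  proof (induction P rule: noetherian_induct)
    case (step P)
    show ?case
    proof (intro allI impI, elim conjE)
      fix T assume P: "homogeneous_ideal P" "prime_ideal P" "growth P T"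
      show "\<exists>r\<ge>T. \<exists>C. prime_chain P r C"
      proof (cases "T = 0")
        case True
        have "prime_chain P 0 (\<lambda>_. P)" using P by (simp add: prime_chain_def)
        then show ?thesis using True by blast
      next
        case False
        have "\<exists>v. pvar v \<notin> P"
        proof (rule ccontr)
          assume "\<not> ?thesis"
          then have z: "hf P m = 0" if "m \<ge> 1" for m using hf_all_vars[OF step(1)] that by blast
          have "cum P m = hf P 0" for m
            by (induction m) (auto simp: cum_def z)
          then have "T \<le> 0" by (intro growth_le[OF P(3), of 0 "real (hf P 0)"]) simp
          then show False using False by simp
        qed
        then obtain v where v: "pvar v \<notin> P" by blast
        let ?J = "ideal_plus P (pvar v)"
        obtain Qs where Qs: "\<And>Q. Q \<in> set Qs \<Longrightarrow> homogeneous_ideal Q \<and> prime_ideal Q \<and> ?J \<subseteq> Q"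
          "\<And>m. cum ?J m \<le> (\<Sum>Q\<leftarrow>Qs. cum Q m)"
          using prime_filtration[OF homogeneous_ideal_plus[OF P(1) pvar_graded[of v]]] by blast
        have cJ: "cum ?J m = hf P m" for m by (rule cum_ideal_plus_var[OF P(1,2) v])
        have "\<exists>Q\<in>set Qs. \<exists>T'. growth Q T' \<and> T \<le> Suc T'"
        proof (rule ccontr)
          assume neg: "\<not> ?thesis"
          \<comment> \<open>\<open>T \<ge> 2\<close> is recorded along with the bound, since
            \<open>T - 2\<close> is truncated subtraction.\<close>
          have bd: "\<exists>C m0. \<forall>m\<ge>m0. real (cum Q m) \<le> C * real m ^ (T - 2) \<and> T \<ge> 2" if Q: "Q \<in> set Qs" for Q
          proof -
            have "homogeneous_ideal Q" "Q \<noteq> UNIV" using Qs(1)[OF Q] by (auto simp: prime_ideal_def)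
            then obtain T' where T': "growth Q T'" using growth_exists by blast
            then have lt: "T' + 2 \<le> T" using neg Q by force
            obtain C m0 where C: "\<forall>m\<ge>m0. real (cum Q m) \<le> C * real m ^ T'" using T' unfolding growth_def by blast
            have "real (cum Q m) \<le> \<bar>C\<bar> * real m ^ (T - 2)" if "m \<ge> max m0 1" for m
            proof -
              have "real (cum Q m) \<le> C * real m ^ T'" using C that by simp
              also have "\<dots> \<le> \<bar>C\<bar> * real m ^ T'" by (intro mult_right_mono) auto
              also have "\<dots> \<le> \<bar>C\<bar> * real m ^ (T - 2)"
                using that lt by (intro mult_left_mono power_increasing) auto
              finally show ?thesis .
            qed
            then show ?thesis using lt by (intro exI[of _ "\<bar>C\<bar>"] exI[of _ "max m0 1"]) auto
          qed
          have ne: "Qs \<noteq> []"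
          proof
            assume "Qs = []"
            then have "hf P 0 = 0" using Qs(2)[of 0] cJ by simp
            then show False using hf_0_pos[OF step(1)] P(2) by (auto simp: prime_ideal_def)
          qed
          then have T2: "T \<ge> 2" using bd[of "hd Qs"] by (auto dest: list.set_sel)
          have "\<exists>C m0. \<forall>m\<ge>m0. real (\<Sum>Q\<leftarrow>Qs. cum Q m) \<le> C * real m ^ (T - 2)"
            by (rule sum_list_bound) (use bd in blast)
          then obtain C m0 where C: "\<forall>m\<ge>m0. real (\<Sum>Q\<leftarrow>Qs. cum Q m) \<le> C * real m ^ (T - 2)" by blast
          have "\<forall>m\<ge>m0. real (hf P m) \<le> C * real m ^ (T - 2)"
            using C Qs(2) by (metis cJ of_nat_le_iff order_trans)
          then obtain C' m1 where "\<forall>m\<ge>m1. real (cum P m) \<le> C' * real m ^ Suc (T - 2)"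
            using cum_bound_from_hf by blast
          then have "T \<le> Suc (T - 2)" by (intro growth_le[OF P(3)]) blast
          then show False using T2 by simp
        qed
        then obtain Q T' where Q: "Q \<in> set Qs" "growth Q T'" "T \<le> Suc T'" by blast
        have hQ: "homogeneous_ideal Q" "prime_ideal Q" "?J \<subseteq> Q" using Qs(1)[OF Q(1)] by auto
        have PQ: "P \<subset> Q" using ideal_plus_psubset[OF step(1) v] hQ(3) by blast
        obtain r C where r: "r \<ge> T'" "prime_chain Q r C"
          using step(2)[OF _ PQ] hQ Q(2) by (meson prime_ideal_is_ideal)
        define C' where "C' i = (case i of 0 \<Rightarrow> P | Suc j \<Rightarrow> C j)" for i
        have "prime_chain P (Suc r) C'"
          unfolding prime_chain_def
        proof (intro conjI allI impI)
          fix i assume "i \<le> Suc r"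
          then show "prime_ideal (C' i)" "P \<subseteq> C' i"
            using r(2) P PQ by (auto simp: C'_def prime_chain_def split: nat.split)
        next
          fix i assume i: "i < Suc r"
          show "C' i \<subset> C' (Suc i)"
          proof (cases i)
            case 0
            have "Q \<subseteq> C 0" using r(2) by (simp add: prime_chain_def)
            then show ?thesis using PQ by (auto simp: C'_def 0)
          next
            case (Suc j)
            then show ?thesis using r(2) i by (simp add: C'_def prime_chain_def)
          qed
        qed
        then show ?thesis using r(1) Q(3) by (intro exI[of _ "Suc r"]) auto
      qed
    qed
  qed
  then show ?thesis using assms by blast
qed

theorem krull_dim_quot_homogeneous_prime:
  assumes "homogeneous_ideal P" "prime_ideal P" "growth P T"
  shows "krull_dim_quot P = T"
proof -
  have le: "r \<le> T" if "prime_chain P r C" for r C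
    using prime_chain_le_growth[OF _ assms(3) that] assms(2) by (simp add: prime_ideal_def)
  obtain r C where "r \<ge> T" "prime_chain P r C" using prime_chain_exists[OF assms] by blast
  then have "T \<in> {r. \<exists>C. prime_chain P r C}" using le by (metis (mono_tags, lifting) antisym mem_Collect_eq)
  then show ?thesis unfolding krull_dim_quot_chain by (intro cSup_eq_maximum) (use le in auto)
qed

section \<open>Prime components of radical ideals\<close>

text \<open>A longest independent family in \<open>Y\<close> exists because a spanning family of
  \<open>U\<close> bounds the length; it spans, since one more vector produces a relation in which
  that vector has a nonzero coefficient.\<close>

lemma (in scalar_hom) fin_span_subspace:
  assumes U: "fin_span U" and Y: "linsub Y" "Y \<subseteq> U"
  shows "fin_span Y"
proof -
  obtain s e where e: "spans_mod U {0} s e" using U by (auto simp: fin_span_def)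
  define N where "N = {r. \<exists>b. (\<forall>i<r. b i \<in> Y) \<and> indep_mod {0} r b}"
  have "N \<subseteq> {..s}"
  proof
    fix r assume "r \<in> N"
    then obtain b where "\<forall>i<r. b i \<in> U" "indep_mod {0} r b" using Y(2) by (auto simp: N_def)
    then show "r \<in> {..s}" using indep_le_spans[OF linsub_zero _ _ e] by auto
  qed
  then have fin: "finite N" by (rule finite_subset) simp
  have "0 \<in> N" by (simp add: N_def indep_mod_def)
  define r where "r = Max N"
  have "r \<in> N" unfolding r_def using \<open>0 \<in> N\<close> by (intro Max_in fin) auto
  then obtain b where b: "\<forall>i<r. b i \<in> Y" "indep_mod {0} r b" by (auto simp: N_def)
  have "spans_mod Y {0} r b"
    unfolding spans_mod_def
  proof
    fix y assume y: "y \<in> Y"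
    have "Suc r \<notin> N" using Max_ge[OF fin, of "Suc r"] by (auto simp: r_def)
    moreover have "\<forall>i<Suc r. (b(r := y)) i \<in> Y" using b(1) y by (simp add: less_Suc_eq)
    ultimately have "\<not> indep_mod {0} (Suc r) (b(r := y))" unfolding N_def by blast
    then obtain a i where a: "(\<Sum>i<Suc r. \<iota> (a i) * (b(r := y)) i) = 0" "i < Suc r" "a i \<noteq> 0"
      unfolding indep_mod_def by auto
    have eq: "(\<Sum>i<r. \<iota> (a i) * b i) + \<iota> (a r) * y = 0" using a(1) by simp
    have ar: "a r \<noteq> 0"
    proof
      assume "a r = 0"
      then have "\<forall>i<r. a i = 0" using eq b(2) by (simp add: indep_mod_def)
      then show False using a(2,3) \<open>a r = 0\<close> by (auto simp: less_Suc_eq)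
    qed
    have inv: "\<iota> (inverse (a r)) * \<iota> (a r) = 1" using ar by (simp flip: hom_mult)
    have "\<iota> (inverse (a r)) * ((\<Sum>i<r. \<iota> (a i) * b i) + \<iota> (a r) * y) = 0" unfolding eq by simp
    then have "(\<Sum>i<r. \<iota> (inverse (a r) * a i) * b i) + y = 0"
      by (simp add: distrib_left sum_distrib_left hom_mult inv flip: mult.assoc)
    then have "y - (\<Sum>i<r. \<iota> (- (inverse (a r) * a i)) * b i) = 0"
      by (simp add: hom_uminus sum_negf add.commute)
    then show "\<exists>a. y - (\<Sum>i<r. \<iota> (a i) * b i) \<in> {0}" by (intro exI[of _ "\<lambda>i. - (inverse (a r) * a i)"]) simp
  qed
  then show ?thesis using b(1) Y(1) unfolding fin_span_def by blast
qed

lemma is_ideal_Inter: "(\<And>P. P \<in> \<P> \<Longrightarrow> is_ideal P) \<Longrightarrow> is_ideal (\<Inter>\<P>)"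
  unfolding is_ideal_def by blast

lemma homogeneous_ideal_Inter: "(\<And>P. P \<in> \<P> \<Longrightarrow> homogeneous_ideal P) \<Longrightarrow> homogeneous_ideal (\<Inter>\<P>)"
  unfolding homogeneous_ideal_def using is_ideal_Inter by blast

definition colon_set :: "'a::comm_ring_1 set \<Rightarrow> 'a set \<Rightarrow> 'a set" where
  "colon_set I J = {f. \<forall>j\<in>J. j * f \<in> I}"

lemma radical_colon_set:
  assumes "radical_ideal I" shows "radical_ideal (colon_set I J)"
  unfolding radical_ideal_def
proof (intro conjI allI impI)
  have I: "is_ideal I" using assms by (simp add: radical_ideal_def)
  then show "is_ideal (colon_set I J)"
    by (auto simp: colon_set_def is_ideal_def distrib_left mult.left_commute)
  fix f n assume f: "f ^ n \<in> colon_set I J"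
  show "f \<in> colon_set I J"
    unfolding colon_set_def
  proof (rule CollectI, rule ballI)
    fix j assume "j \<in> J"
    then have j: "j * f ^ n \<in> I" using f by (auto simp: colon_set_def)
    have "(j * f) ^ Suc n = (j ^ n * f) * (j * f ^ n)" by (simp add: power_mult_distrib algebra_simps)
    then have "(j * f) ^ Suc n \<in> I" using ideal_closed(3)[OF I j] by metis
    then show "j * f \<in> I" using assms unfolding radical_ideal_def by blast
  qed
qed

lemma homogeneous_colon_set:
  assumes I: "homogeneous_ideal I" and J: "homogeneous_ideal J"
  shows "homogeneous_ideal (colon_set I J)"
  unfolding homogeneous_ideal_def
proof (intro conjI ballI allI)
  have id: "is_ideal I" using I by (rule homogeneous_ideal_is_ideal)
  then show "is_ideal (colon_set I J)"
    by (auto simp: colon_set_def is_ideal_def distrib_left mult.left_commute)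
  fix f m assume f: "f \<in> colon_set I J"
  show "homog_part m f \<in> colon_set I J"
    unfolding colon_set_def
  proof (rule CollectI, rule ballI)
    fix j assume j: "j \<in> J"
    obtain n where n: "j \<in> deg_le n" using deg_le_exists .
    have "homog_part i j * homog_part m f \<in> I" for i
    proof -
      have "homog_part i j * f \<in> I"
        using f homogeneous_ideal_homog_part[OF J j] by (auto simp: colon_set_def)
      then have "homog_part (i + m) (homog_part i j * f) \<in> I" by (rule homogeneous_ideal_homog_part[OF I])
      then show ?thesis by (simp add: homog_part_times[OF homog_part_graded])
    qed
    then have "(\<Sum>i\<le>n. homog_part i j * homog_part m f) \<in> I" by (intro ideal_sum[OF id])
    then show "j * homog_part m f \<in> I"
      using sum_homog_part[OF n] by (simp flip: sum_distrib_right)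
  qed
qed

text \<open>For homogeneous \<open>a\<close>, \<open>b\<close> outside \<open>I\<close> with product
  in \<open>I\<close>, the ideals I:a and I:(I:a) are again radical and strictly larger, and they
  meet in \<open>I\<close>, since an \<open>f\<close> in both has \<open>f ^ 2\<close> in
  \<open>I\<close>. Colon ideals are taken because the sum of \<open>I\<close> and the ideal of
  \<open>a\<close> may fail to be radical.\<close>

lemma radical_prime_decomposition:
  fixes I :: "('v::finite, 'k::field) mpoly set"
  assumes "homogeneous_ideal I" "radical_ideal I"
  shows "\<exists>\<P>. finite \<P> \<and> (\<forall>P\<in>\<P>. homogeneous_ideal P \<and> prime_ideal P) \<and> I = \<Inter>\<P>" (is "?D I")
proof -
  have "is_ideal I" using assms by (simp add: radical_ideal_def)
  then have "homogeneous_ideal I \<and> radical_ideal I \<longrightarrow> ?D I"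
  proof (induction I rule: noetherian_induct)
    case (step I)
    show ?case
    proof (intro impI, elim conjE)
      assume hI: "homogeneous_ideal I" and rI: "radical_ideal I"
      consider "I = UNIV" | "prime_ideal I" | "I \<noteq> UNIV" "\<not> prime_ideal I" by blast
      then show "?D I"
      proof cases
        case 1
        then show ?thesis by (intro exI[of _ "{}"]) simp
      next
        case 2
        then show ?thesis using hI by (intro exI[of _ "{I}"]) simp
      next
        case 3
        obtain s t a b where ab: "a \<in> graded_piece s" "b \<in> graded_piece t" "a \<notin> I" "b \<notin> I" "a * b \<in> I"
          using homogeneous_not_prime[OF hI 3] .
        define J where "J = ideal_colon I a"
        define J' where "J' = colon_set I J"
        have J: "homogeneous_ideal J" unfolding J_def by (rule homogeneous_ideal_colon[OF hI ab(1)])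
        have rJ: "radical_ideal J"
          using radical_colon_set[OF rI, of "{a}"] by (simp add: J_def ideal_colon_def colon_set_def)
        have J': "homogeneous_ideal J'" "radical_ideal J'"
          unfolding J'_def by (rule homogeneous_colon_set[OF hI J], rule radical_colon_set[OF rI])
        have sub: "I \<subset> J" unfolding J_def by (rule ideal_colon_psubset[OF step(1) ab(4,5)])
        have "a \<in> J'" by (auto simp: J'_def J_def colon_set_def ideal_colon_def mult.commute)
        moreover have "I \<subseteq> J'" using ideal_closed(3)[OF step(1)] by (auto simp: J'_def colon_set_def)
        ultimately have sub': "I \<subset> J'" using ab(3) by blast
        obtain \<P> where P: "finite \<P>" "\<forall>P\<in>\<P>. homogeneous_ideal P \<and> prime_ideal P" "J = \<Inter>\<P>"
          using step(2)[OF homogeneous_ideal_is_ideal[OF J] sub] J rJ by blast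
        obtain \<P>' where P': "finite \<P>'" "\<forall>P\<in>\<P>'. homogeneous_ideal P \<and> prime_ideal P" "J' = \<Inter>\<P>'"
          using step(2)[OF homogeneous_ideal_is_ideal[OF J'(1)] sub'] J' by blast
        have "J \<inter> J' \<subseteq> I"
        proof
          fix f assume "f \<in> J \<inter> J'"
          then have "f * f \<in> I" by (auto simp: J'_def colon_set_def)
          then have "f ^ 2 \<in> I" by (simp add: power2_eq_square)
          then show "f \<in> I" using rI unfolding radical_ideal_def by blast
        qed
        then have "I = \<Inter>(\<P> \<union> \<P>')" using sub sub' P(3) P'(3) by auto
        then show ?thesis using P P' by (intro exI[of _ "\<P> \<union> \<P>'"]) auto
      qed
    qed
  qed
  then show ?thesis using assms by blast
qed

text \<open>If each member had an element outside \<open>P\<close>, the product of these would lie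
  in the intersection but not in \<open>P\<close>.\<close>

lemma prime_contains_Inter:
  assumes "finite \<P>" "\<And>Q. Q \<in> \<P> \<Longrightarrow> is_ideal Q" "prime_ideal P" "\<Inter>\<P> \<subseteq> P"
  shows "\<exists>Q\<in>\<P>. Q \<subseteq> P"
  using assms(1,2,4)
proof (induction \<P> rule: finite_induct)
  case empty
  then show ?case using assms(3) by (auto simp: prime_ideal_def)
next
  case (insert Q \<P>)
  show ?case
  proof (rule ccontr)
    assume neg: "\<not> ?thesis"
    then obtain q where q: "q \<in> Q" "q \<notin> P" by blast
    have "\<not> \<Inter>\<P> \<subseteq> P" using insert.IH insert.prems(1) neg by blast
    then obtain r where r: "r \<in> \<Inter>\<P>" "r \<notin> P" by blast
    have "q * r \<in> Q" using q(1) insert.prems(1) ideal_closed(4) by blast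
    moreover have "q * r \<in> \<Inter>\<P>" using r(1) insert.prems(1) ideal_closed(3) by blast
    ultimately have "q * r \<in> P" using insert.prems(2) by auto
    then show False using q r assms(3) by (auto simp: prime_ideal_def)
  qed
qed

section \<open>Irredundant intersections and associated primes\<close>

definition antichain :: "'a set set \<Rightarrow> bool" where
  "antichain \<P> \<longleftrightarrow> (\<forall>P\<in>\<P>. \<forall>Q\<in>\<P>. P \<subseteq> Q \<longrightarrow> P = Q)"

lemma antichain_Inter:
  assumes "finite \<P>" obtains \<Q> where "\<Q> \<subseteq> \<P>" "antichain \<Q>" "\<Inter>\<Q> = \<Inter>\<P>"
proof -
  define \<Q> where "\<Q> = {P\<in>\<P>. \<forall>Q\<in>\<P>. Q \<subseteq> P \<longrightarrow> P = Q}"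
  have "\<exists>Q\<in>\<Q>. Q \<subseteq> P" if "P \<in> \<P>" for P
    using finite_has_minimal2[OF assms that] by (auto simp: \<Q>_def)
  then have "\<Inter>\<Q> = \<Inter>\<P>" unfolding \<Q>_def by blast
  then show ?thesis using that[of \<Q>] by (auto simp: \<Q>_def antichain_def)
qed

lemma antichain_prime_avoid:
  assumes "finite \<P>" "antichain \<P>" "\<And>Q. Q \<in> \<P> \<Longrightarrow> prime_ideal Q" "P \<in> \<P>"
  shows "\<not> \<Inter>(\<P> - {P}) \<subseteq> P"
proof
  assume "\<Inter>(\<P> - {P}) \<subseteq> P"
  then obtain Q where "Q \<in> \<P> - {P}" "Q \<subseteq> P"
    using prime_contains_Inter[of "\<P> - {P}" P] assms by (auto simp: prime_ideal_def)
  then show False using assms by (auto simp: antichain_def)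
qed

text \<open>An element \<open>g\<close> of all other components but not of \<open>P\<close> exhibits
  \<open>P\<close> as the annihilator of \<open>g\<close> modulo the intersection.\<close>

lemma antichain_associated:
  assumes "finite \<P>" "antichain \<P>" "\<And>Q. Q \<in> \<P> \<Longrightarrow> prime_ideal Q" "P \<in> \<P>"
  shows "P \<in> associated_primes (\<Inter>\<P>)"
proof -
  obtain g where g: "g \<in> \<Inter>(\<P> - {P})" "g \<notin> P" using antichain_prime_avoid[OF assms] by blast
  have id: "is_ideal Q" if "Q \<in> \<P>" for Q using assms(3)[OF that] by (simp add: prime_ideal_def)
  have "P = {h. h * g \<in> \<Inter>\<P>}"
  proof (intro Set.set_eqI iffI)
    fix h assume h: "h \<in> P"
    have "h * g \<in> Q" if "Q \<in> \<P>" for Q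
      using ideal_closed(3,4)[OF id[OF that]] g(1) h that by (cases "Q = P") auto
    then show "h \<in> {h. h * g \<in> \<Inter>\<P>}" by blast
  next
    fix h assume "h \<in> {h. h * g \<in> \<Inter>\<P>}"
    then have "h * g \<in> P" using assms(4) by blast
    then show "h \<in> P" using assms(3)[OF assms(4)] g(2) by (auto simp: prime_ideal_def)
  qed
  then show ?thesis using assms(3)[OF assms(4)] unfolding associated_primes_def by blast
qed

lemma prime_chain_mono: "prime_chain J r C \<Longrightarrow> i \<le> r \<Longrightarrow> C 0 \<subseteq> C i"
proof (induction i)
  case (Suc i)
  then have "C i \<subset> C (Suc i)" by (simp add: prime_chain_def)
  then show ?case using Suc by auto
qed simp

text \<open>The components of an irredundant intersection are associated primes, so unmixedness
  gives them one common dimension. A chain of primes over \<open>I\<close> lies over one of the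
  components, so this is also the dimension of \<open>I\<close>; \<open>Suc d\<close> appears
  because the projective dimension is the Krull dimension minus one.\<close>

theorem unmixed_radical_decomposition:
  fixes I :: "('v::finite, 'k::field) mpoly set"
  assumes hom: "homogeneous_ideal I" and unm: "unmixed I" and rad: "radical_ideal I"
    and dim: "proj_dim I = int d"
  obtains \<P> where "finite \<P>" "\<P> \<noteq> {}" "antichain \<P>" "I = \<Inter>\<P>"
    "\<And>P. P \<in> \<P> \<Longrightarrow> homogeneous_ideal P \<and> prime_ideal P \<and> growth P (Suc d)"
proof -
  obtain \<P>' where P': "finite \<P>'" "\<forall>P\<in>\<P>'. homogeneous_ideal P \<and> prime_ideal P" "I = \<Inter>\<P>'"
    using radical_prime_decomposition[OF hom rad] by blast
  obtain \<P> where sub: "\<P> \<subseteq> \<P>'" and anti: "antichain \<P>" and eq: "\<Inter>\<P> = \<Inter>\<P>'"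
    using antichain_Inter[OF P'(1)] .
  have fin: "finite \<P>" using sub P'(1) by (rule finite_subset)
  have pr: "homogeneous_ideal P" "prime_ideal P" "is_ideal P" "P \<noteq> UNIV" if "P \<in> \<P>" for P
    using P'(2) sub that by (auto simp: prime_ideal_def)
  have krI: "krull_dim_quot I = Suc d" using dim by (simp add: proj_dim_def)
  \<comment> \<open>The empty intersection is the unit ideal, over which there are no prime chains;
    the supremum of the empty set is 0, not \<open>Suc d\<close>.\<close>
  have ne: "\<P> \<noteq> {}"
  proof
    assume "\<P> = {}"
    then have "I = UNIV" using eq P'(3) by auto
    then have "{r. \<exists>C. prime_chain I r C} = {}" by (auto simp: prime_chain_def prime_ideal_def)
    then have "krull_dim_quot I = 0" unfolding krull_dim_quot_chain by (simp only: Sup_nat_empty)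
    then show False using krI by simp
  qed
  have "\<forall>P\<in>\<P>. \<exists>T. growth P T" using growth_exists pr by metis
  then obtain T where T: "\<And>P. P \<in> \<P> \<Longrightarrow> growth P (T P)" by metis
  have kr: "krull_dim_quot P = T P" if "P \<in> \<P>" for P
    using krull_dim_quot_homogeneous_prime pr T that by blast
  have "P \<in> associated_primes I" if "P \<in> \<P>" for P
    using antichain_associated[OF fin anti pr(2) that] eq P'(3) by simp
  then have same: "T P = T Q" if "P \<in> \<P>" "Q \<in> \<P>" for P Q
    using unm that kr unfolding unmixed_def by metis
  have "T P = Suc d" if P: "P \<in> \<P>" for P
  proof -
    have le: "r \<le> T P" if ch: "prime_chain I r C" for r C
    proof -
      have "\<Inter>\<P> \<subseteq> C 0" "prime_ideal (C 0)" using ch eq P'(3) by (auto simp: prime_chain_def)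
      then obtain Q where Q: "Q \<in> \<P>" "Q \<subseteq> C 0" using prime_contains_Inter[OF fin pr(3)] by blast
      have "prime_chain Q r C"
        using ch prime_chain_mono[OF ch] Q(2) unfolding prime_chain_def by blast
      then have "r \<le> T Q" by (rule prime_chain_le_growth[OF pr(3)[OF Q(1)] T[OF Q(1)]])
      then show ?thesis using same[OF P Q(1)] by simp
    qed
    obtain r C where r: "r \<ge> T P" "prime_chain P r C" using prime_chain_exists pr T P by blast
    have "I \<subseteq> P" using P eq P'(3) by blast
    then have "prime_chain I r C" using r(2) unfolding prime_chain_def by blast
    then have "T P \<in> {r. \<exists>C. prime_chain I r C}" using le r(1) by (metis (mono_tags, lifting) antisym mem_Collect_eq)
    then have "krull_dim_quot I = T P"
      unfolding krull_dim_quot_chain by (intro cSup_eq_maximum) (use le in auto)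
    then show ?thesis using krI by simp
  qed
  then show ?thesis using that[OF fin ne anti] pr T eq P'(3) by metis
qed

section \<open>Hilbert functions of intersections\<close>

lemma hf_Int_le:
  fixes I J :: "('v::finite, 'k::field) mpoly set"
  assumes "is_ideal I" "is_ideal J"
  shows "hf (I \<inter> J) m \<le> hf I m + hf J m"
proof -
  note l = ideal_linsub[OF assms(1)] ideal_linsub[OF assms(2)] ideal_linsub[OF is_ideal_Int[OF assms]]
  have Y: "R.fin_span (graded_piece m \<inter> I)"
    by (rule R.fin_span_subspace[OF fin_span_graded]) (use R.linsub_Int[OF linsub_graded l(1)] in auto)
  \<comment> \<open>With \<open>g = 1\<close>: the kernel of the map from the quotient by
    \<open>I \<inter> J\<close> to the quotient by \<open>I\<close> is \<open>I\<close> modulo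
    \<open>I \<inter> J\<close>, and this embeds into the quotient by \<open>J\<close>.\<close>
  have "hf (I \<inter> J) m \<le> hf I m + R.hdim (graded_piece m \<inter> I) J"
  proof (rule R.hdim_split_le[OF l(3,1,2) fin_span_graded Y, where g = 1])
    fix f assume "f \<in> graded_piece m" "f \<in> I"
    then show "\<exists>h\<in>graded_piece m \<inter> I. f - 1 * h \<in> I \<inter> J"
      using ideal_closed(1)[OF assms(1)] ideal_closed(1)[OF assms(2)] by (intro bexI[of _ f]) auto
  qed auto
  also have "R.hdim (graded_piece m \<inter> I) J \<le> hf J m"
    by (rule R.hdim_mono[OF l(2) Y fin_span_graded]) auto
  finally show ?thesis by simp
qed

lemma hf_Inter_le:
  assumes "finite \<P>" "\<And>P. P \<in> \<P> \<Longrightarrow> is_ideal P"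
  shows "hf (\<Inter>\<P>) m \<le> (\<Sum>P\<in>\<P>. hf P m)"
  using assms
proof (induction \<P> rule: finite_induct)
  case empty
  then show ?case by (simp add: hf_UNIV)
next
  case (insert P \<P>)
  have "hf (\<Inter>(insert P \<P>)) m \<le> hf P m + hf (\<Inter>\<P>) m"
    using hf_Int_le[of P "\<Inter>\<P>"] insert.prems is_ideal_Inter[of \<P>] by simp
  then show ?case using insert by simp
qed

text \<open>A homogeneous \<open>g\<close> that lies in the other components but not in
  \<open>P\<close> embeds the quotient by \<open>P\<close>, shifted by the degree of
  \<open>g\<close>, into \<open>J\<close> modulo \<open>J \<inter> P\<close>. The shifts
  \<open>\<gamma>\<close> will not affect leading coefficients.\<close>

lemma hf_Inter_ge:
  fixes \<P> :: "('v::finite, 'k::field) mpoly set set"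
  assumes "finite \<P>" "antichain \<P>" "\<And>P. P \<in> \<P> \<Longrightarrow> homogeneous_ideal P \<and> prime_ideal P"
  shows "\<exists>\<gamma>. \<forall>m. (\<forall>P\<in>\<P>. \<gamma> P \<le> m) \<longrightarrow> (\<Sum>P\<in>\<P>. hf P (m - \<gamma> P)) \<le> hf (\<Inter>\<P>) m"
  using assms
proof (induction \<P> rule: finite_induct)
  case (insert P \<P>)
  have "antichain \<P>" using insert.prems(1) by (auto simp: antichain_def)
  then obtain \<gamma> where \<gamma>: "\<And>m. \<forall>P\<in>\<P>. \<gamma> P \<le> m \<Longrightarrow> (\<Sum>P\<in>\<P>. hf P (m - \<gamma> P)) \<le> hf (\<Inter>\<P>) m"
    using insert.IH insert.prems(2) by blast
  define J where "J = \<Inter>\<P>"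
  have J: "homogeneous_ideal J" unfolding J_def by (rule homogeneous_ideal_Inter) (use insert.prems in auto)
  have P: "homogeneous_ideal P" "prime_ideal P" "is_ideal P" using insert.prems(2)[of P] by (auto simp: prime_ideal_def)
  have "insert P \<P> - {P} = \<P>" using insert.hyps by blast
  then have "\<not> J \<subseteq> P"
    using antichain_prime_avoid[of "insert P \<P>" P] insert.hyps insert.prems unfolding J_def by auto
  then obtain a where a: "a \<in> J" "a \<notin> P" by blast
  obtain s where s: "homog_part s a \<notin> P" using top_part_outside[OF P(3) a(2)] by metis
  define g where "g = homog_part s a"
  have g: "g \<in> J" "g \<notin> P" "g \<in> graded_piece s"
    using homogeneous_ideal_homog_part[OF J a(1)] s homog_part_graded by (auto simp: g_def)
  have Jid: "is_ideal J" using J by (rule homogeneous_ideal_is_ideal)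
  have ge: "hf J m + hf P (m - s) \<le> hf (J \<inter> P) m" if "s \<le> m" for m
  proof (rule R.hdim_split_ge[where g = g])
    fix f :: "('v, 'k) mpoly" assume "f \<in> graded_piece (m - s)"
    then show "g * f \<in> graded_piece m \<inter> J"
      using graded_times[OF g(3), of f "m - s"] that ideal_closed(4)[OF Jid g(1)] by simp
    show "g * f \<in> J \<inter> P \<Longrightarrow> f \<in> P" using P(2) g(2) by (auto simp: prime_ideal_def)
  qed (use ideal_linsub[OF Jid] ideal_linsub[OF P(3)] ideal_linsub[OF is_ideal_Int[OF Jid P(3)]] in auto)
  have "(\<Sum>Q\<in>insert P \<P>. hf Q (m - (\<gamma>(P := s)) Q)) \<le> hf (\<Inter>(insert P \<P>)) m"
    if m: "\<forall>Q\<in>insert P \<P>. (\<gamma>(P := s)) Q \<le> m" for m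
  proof -
    have sm: "s \<le> m" using m by simp
    have "(\<Sum>Q\<in>\<P>. hf Q (m - (\<gamma>(P := s)) Q)) = (\<Sum>Q\<in>\<P>. hf Q (m - \<gamma> Q))"
      using insert.hyps by (intro sum.cong) auto
    also have "\<dots> \<le> hf J m"
      unfolding J_def by (rule \<gamma>) (use m insert.hyps in \<open>auto split: if_splits\<close>)
    finally have "(\<Sum>Q\<in>insert P \<P>. hf Q (m - (\<gamma>(P := s)) Q)) \<le> hf P (m - s) + hf J m"
      using insert.hyps by simp
    also have "\<dots> \<le> hf (J \<inter> P) m" using ge[OF sm] by simp
    also have "J \<inter> P = \<Inter>(insert P \<P>)" by (auto simp: J_def)
    finally show ?thesis .
  qed
  then show ?case by blast
qed (simp add: hf_UNIV)

section \<open>Filtrations by degree\<close>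

context scalar_hom
begin

definition mon :: "('v::finite \<Rightarrow> 'r) \<Rightarrow> ('v \<Rightarrow>\<^sub>0 nat) \<Rightarrow> 'r" where
  "mon x t = (\<Prod>v\<in>UNIV. x v ^ lookup t v)"

definition ev :: "('v::finite \<Rightarrow> 'r) \<Rightarrow> ('v, 'f) mpoly \<Rightarrow> 'r" where
  "ev x f = (\<Sum>t\<in>keys f. \<iota> (lookup f t) * mon x t)"

lemma mon_add: "mon x (s + t) = mon x s * mon x t"
  by (simp add: mon_def lookup_add power_add prod.distrib)

lemma mon_zero [simp]: "mon x 0 = 1"
  by (simp add: mon_def)

lemma mon_single: "mon x (single v n) = x v ^ n"
proof -
  have "mon x (single v n) = (\<Prod>w\<in>UNIV. if w = v then x v ^ n else 1)"
    unfolding mon_def by (rule prod.cong) (auto simp: lookup_single when_def)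
  then show ?thesis by (simp add: prod.delta)
qed

lemma ev_superset: "finite T \<Longrightarrow> keys f \<subseteq> T \<Longrightarrow> ev x f = (\<Sum>t\<in>T. \<iota> (lookup f t) * mon x t)"
  unfolding ev_def by (rule sum.mono_neutral_left) (auto simp: in_keys_iff)

lemma ev_add: "ev x (f + g) = ev x f + ev x g"
proof -
  have fin: "finite (keys f \<union> keys g)" by simp
  show ?thesis
    unfolding ev_superset[OF fin keys_add] ev_superset[OF fin Un_upper1] ev_superset[OF fin Un_upper2]
    by (simp add: lookup_add hom_add distrib_right sum.distrib)
qed

lemma ev_single: "ev x (single t c) = \<iota> c * mon x t"
  by (simp add: ev_def)

lemma ev_zero [simp]: "ev x 0 = 0"
  by (simp add: ev_def)

lemma ev_one [simp]: "ev x 1 = 1"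
  by (simp add: ev_def lookup_one)

lemma ev_mult: "ev x (f * g) = ev x f * ev x g"
proof (induction f rule: mpoly_induct)
  case (single s c)
  show ?case
    by (induction g rule: mpoly_induct)
      (simp_all add: mult_single ev_single hom_mult mon_add distrib_left distrib_right ev_add mult_ac)
qed (simp add: distrib_right ev_add)

lemma ev_const: "ev x (const c) = \<iota> c"
  by (simp add: const_def ev_single)

lemma ev_uminus: "ev x (- f) = - ev x f"
  using ev_add[of x f "-f"] by (simp add: add_eq_0_iff2)

lemma ev_diff: "ev x (f - g) = ev x f - ev x g"
  using ev_add[of x f "-g"] by (simp add: ev_uminus)

lemma ev_sum: "ev x (sum f A) = (\<Sum>i\<in>A. ev x (f i))"
  by (induction A rule: infinite_finite_induct) (auto simp: ev_add)

lemma ev_power: "ev x (f ^ n) = ev x f ^ n"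
  by (induction n) (auto simp: ev_mult)

lemma ev_pvar: "ev x (single (single v 1) 1) = x v"
  by (simp add: ev_single mon_single)

lemma ev_lcomb: "ev x (\<Sum>i<r. const (a i) * b i) = (\<Sum>i<r. \<iota> (a i) * ev x (b i))"
  by (simp add: ev_sum ev_mult ev_const)

lemma linsub_ev_image: "R.linsub U \<Longrightarrow> linsub (ev x ` U)"
  unfolding linsub_def R.linsub_def
  by (auto simp: ev_zero[symmetric, of x] ev_add[symmetric] simp del: ev_zero)
    (metis ev_const ev_mult imageI)

lemma fin_span_ev_image:
  assumes "R.fin_span U" shows "fin_span (ev x ` U)"
proof -
  obtain s e where e: "R.linsub U" "\<forall>i<s. e i \<in> U" "R.spans_mod U {0} s e"
    using assms by (auto simp: R.fin_span_def)
  have "spans_mod (ev x ` U) {0} s (\<lambda>i. ev x (e i))"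
    unfolding spans_mod_def
  proof
    fix y assume "y \<in> ev x ` U"
    then obtain f where f: "f \<in> U" "y = ev x f" by blast
    then obtain a where a: "f = (\<Sum>i<s. const (a i) * e i)"
      using e(3) unfolding R.spans_mod_def by auto
    have "y = (\<Sum>i<s. \<iota> (a i) * ev x (e i))" unfolding f(2) a by (rule ev_lcomb)
    then show "\<exists>a. y - (\<Sum>i<s. \<iota> (a i) * ev x (e i)) \<in> {0}" by (intro exI[of _ a]) simp
  qed
  then show ?thesis
    unfolding fin_span_def using linsub_ev_image[OF e(1)] e(2) by (intro conjI exI) auto
qed

text \<open>The first isomorphism theorem for evaluation, looking at the kernel only within
  \<open>U\<close>; this matters because a dehomogenized point has kernel \<open>P\<close> only on
  each single graded piece.\<close>

lemma hdim_ev_image: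
  assumes U: "R.fin_span U" and I: "R.linsub I" and ker: "\<And>f. f \<in> U \<Longrightarrow> ev x f = 0 \<longleftrightarrow> f \<in> I"
  shows "hdim (ev x ` U) {0} = R.hdim U I"
proof -
  obtain b where b: "R.basis_mod U I (R.hdim U I) b" using R.basis_mod_exists[OF I U] .
  let ?r = "R.hdim U I"
  have Xs: "R.linsub U" using U by (simp add: R.fin_span_def)
  have in_X: "(\<Sum>i<?r. const (a i) * b i) \<in> U" for a
    using b by (intro R.linsub_sum[OF Xs] R.linsub_closed(3)[OF Xs]) (auto simp: R.basis_mod_def)
  have "basis_mod (ev x ` U) {0} ?r (\<lambda>i. ev x (b i))"
    unfolding basis_mod_def
  proof (intro conjI)
    show "\<forall>i<?r. ev x (b i) \<in> ev x ` U" using b by (auto simp: R.basis_mod_def)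
    show "indep_mod {0} ?r (\<lambda>i. ev x (b i))"
      unfolding indep_mod_def
    proof (intro allI impI)
      fix a i assume "(\<Sum>i<?r. \<iota> (a i) * ev x (b i)) \<in> {0}" and i: "i < ?r"
      then have "ev x (\<Sum>i<?r. const (a i) * b i) = 0" by (simp add: ev_lcomb)
      then have "(\<Sum>i<?r. const (a i) * b i) \<in> I" using ker[OF in_X, of a] by blast
      then show "a i = 0" using b i unfolding R.basis_mod_def R.indep_mod_def by auto
    qed
    show "spans_mod (ev x ` U) {0} ?r (\<lambda>i. ev x (b i))"
      unfolding spans_mod_def
    proof
      fix y assume "y \<in> ev x ` U"
      then obtain f where f: "f \<in> U" "y = ev x f" by blast
      obtain a where a: "f - (\<Sum>i<?r. const (a i) * b i) \<in> I"
        using b[unfolded R.basis_mod_def R.spans_mod_def, THEN conjunct2, THEN conjunct2, THEN bspec, OF f(1)]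
        by blast
      have "ev x (f - (\<Sum>i<?r. const (a i) * b i)) = 0"
        using ker[OF R.linsub_closed(5)[OF Xs f(1) in_X]] a by simp
      then show "\<exists>a. y - (\<Sum>i<?r. \<iota> (a i) * ev x (b i)) \<in> {0}"
        using f(2) by (intro exI[of _ a]) (simp add: ev_diff ev_lcomb)
    qed
  qed
  then show ?thesis by (rule hdim_eqI[OF linsub_zero])
qed

definition V :: "('v::finite \<Rightarrow> 'r) \<Rightarrow> nat \<Rightarrow> 'r set" where
  "V x m = ev x ` deg_le m"

lemma linsub_V: "linsub (V x m)"
  unfolding V_def by (rule linsub_ev_image) (rule linsub_deg_le)

lemma fin_span_V: "fin_span (V x m)"
  unfolding V_def by (rule fin_span_ev_image) simp

lemma V_mono: "m \<le> n \<Longrightarrow> V x m \<subseteq> V x n"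
  unfolding V_def by (intro image_mono deg_le_mono)

lemma V_mult: "a \<in> V x m \<Longrightarrow> b \<in> V x n \<Longrightarrow> a * b \<in> V x (m + n)"
  unfolding V_def by (auto simp: ev_mult[symmetric] intro!: imageI deg_le_times)

lemma one_in_V [simp]: "1 \<in> V x m"
  unfolding V_def using imageI[OF one_deg_le, of "ev x" m] by simp

lemma zero_in_V [simp]: "0 \<in> V x m"
  using linsub_closed(1)[OF linsub_V] .

lemma V_power: "a \<in> V x m \<Longrightarrow> a ^ n \<in> V x (m * n)"
  by (induction n) (auto dest: V_mult simp: algebra_simps)

lemma V_scalar: "\<iota> c \<in> V x m"
  using linsub_closed(3)[OF linsub_V one_in_V, of c] by simp

lemma V_var: "x v \<in> V x 1"
proof -
  have "single (single v 1) 1 \<in> deg_le 1" by (rule deg_leI) simp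
  then show ?thesis unfolding V_def using ev_pvar[of x v] by (metis imageI)
qed

lemma V_sum: "(\<And>i. i \<in> A \<Longrightarrow> f i \<in> V x m) \<Longrightarrow> sum f A \<in> V x m"
  by (rule linsub_sum[OF linsub_V])

lemma V_substitute:
  assumes "\<And>v. x v \<in> V y 1" shows "V x m \<subseteq> V y m"
proof
  fix b assume "b \<in> V x m"
  then obtain f where f: "f \<in> deg_le m" "b = ev x f" by (auto simp: V_def)
  have "mon x t \<in> V y (mdeg t)" for t
  proof -
    have "(\<Prod>v\<in>A. x v ^ lookup t v) \<in> V y (\<Sum>v\<in>A. lookup t v)" if "finite A" for A
      using that
    proof (induction A rule: finite_induct)
      case (insert v A)
      have "x v ^ lookup t v \<in> V y (1 * lookup t v)" by (rule V_power[OF assms])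
      then show ?case using V_mult insert by fastforce
    qed simp
    then show ?thesis by (simp add: mon_def mdeg_def)
  qed
  then have "mon x t \<in> V y m" if "t \<in> keys f" for t
    using V_mono[OF deg_leD[OF f(1) that], of y] by blast
  then show "b \<in> V y m"
    unfolding f(2) ev_def by (intro V_sum linsub_closed(3)[OF linsub_V])
qed

end

text \<open>Eliminating a variable does not change the polynomial ring: points keep the index type
  \<open>'v\<close>, eliminated coordinates become zero, and relations are restricted to the
  surviving variables \<open>S\<close>.\<close>

definition vars_in :: "'v set \<Rightarrow> ('v, 'k::zero) mpoly set" where
  "vars_in S = {f. \<forall>t\<in>keys f. keys t \<subseteq> S}"

lemma (in scalar_hom) ev_cong_vars_in:
  assumes "f \<in> vars_in S" "\<And>v. v \<in> S \<Longrightarrow> x v = y v"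
  shows "ev x f = ev y f"
proof -
  have "mon x t = mon y t" if "t \<in> keys f" for t
    unfolding mon_def
  proof (rule prod.cong[OF refl])
    fix v show "x v ^ lookup t v = y v ^ lookup t v"
    proof (cases "v \<in> S")
      case False
      then have "v \<notin> keys t" using assms(1) that by (auto simp: vars_in_def)
      then have "lookup t v = 0" by (simp add: in_keys_iff)
      then show ?thesis by simp
    qed (use assms in simp)
  qed
  then show ?thesis unfolding ev_def by simp
qed

text \<open>Kronecker substitution with weights \<open>B ^ to_nat v\<close>. Two distinct monomials
  collide only if \<open>B\<close> is a root of a nonzero integer polynomial, and finitely many
  pairs exclude finitely many \<open>B\<close>.\<close>

lemma monomial_projection_separating:
  fixes A :: "('v::finite \<Rightarrow>\<^sub>0 nat) set"
  assumes "finite A"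
  obtains k :: "'v \<Rightarrow> nat" where "inj_on (\<lambda>t. \<Sum>v\<in>UNIV. lookup t v * k v) A"
proof -
  define D :: "('v \<Rightarrow>\<^sub>0 nat) \<Rightarrow> ('v \<Rightarrow>\<^sub>0 nat) \<Rightarrow> int poly" where
    "D s t = (\<Sum>v\<in>UNIV. Polynomial.monom (int (lookup s v) - int (lookup t v)) (to_nat v))" for s t
  have nz: "D s t \<noteq> 0" if st: "s \<noteq> t" for s t
  proof -
    obtain v where "lookup s v \<noteq> lookup t v" using st by (metis poly_mapping_eqI)
    moreover have "Polynomial.coeff (D s t) (to_nat v) = int (lookup s v) - int (lookup t v)"
      by (simp add: D_def Polynomial.coeff_sum sum.delta eq_commute[of _ v])
    ultimately show ?thesis by auto
  qed
  define bad where "bad = (\<Union>s\<in>A. \<Union>t\<in>A - {s}. {B::nat. poly (D s t) (int B) = 0})"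
  have "finite {B::nat. poly (D s t) (int B) = 0}" if "s \<noteq> t" for s t
    using finite_vimageI[OF poly_roots_finite[OF nz[OF that]], of int] by (simp add: vimage_def)
  then have "finite bad" unfolding bad_def by (intro finite_UN_I finite_Diff assms) auto
  then obtain B where B: "B \<notin> bad" using ex_new_if_finite[OF infinite_UNIV_nat] by blast
  have "inj_on (\<lambda>t. \<Sum>v\<in>UNIV. lookup t v * B ^ to_nat v) A"
  proof (rule inj_onI, rule ccontr)
    fix s t assume st: "s \<in> A" "t \<in> A" "s \<noteq> t"
      and eq: "(\<Sum>v\<in>UNIV. lookup s v * B ^ to_nat v) = (\<Sum>v\<in>UNIV. lookup t v * B ^ to_nat v)"
    have "poly (D s t) (int B) = int (\<Sum>v\<in>UNIV. lookup s v * B ^ to_nat v) - int (\<Sum>v\<in>UNIV. lookup t v * B ^ to_nat v)"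
      by (simp add: D_def poly_sum poly_monom left_diff_distrib sum_subtractf)
    then have "poly (D s t) (int B) = 0" using eq by simp
    then show False using B st by (auto simp: bad_def)
  qed
  then show ?thesis by (rule that)
qed

lemma scalar_hom_id: "scalar_hom (id :: 'f::field \<Rightarrow> 'f)"
  by unfold_locales auto

interpretation Id: scalar_hom "id :: 'f::field \<Rightarrow> 'f"
  by (rule scalar_hom_id)

lemma deg_le_0_keys: "f \<in> deg_le 0 \<Longrightarrow> keys f \<subseteq> {0}"
proof
  fix t assume "f \<in> deg_le 0" "t \<in> keys f"
  then have "mdeg t = 0" using deg_leD by fastforce
  then show "t \<in> {0}" by (simp add: mdeg_eq_0)
qed

lemma pderiv_sum: "pderiv (sum f A) = (\<Sum>i\<in>A. pderiv (f i))"
  by (induction A rule: infinite_finite_induct) (auto simp: pderiv_add)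

definition pconst :: "'a::comm_ring_1 \<Rightarrow> 'a poly" where "pconst c = [:c:]"

lemma poly_pconst [simp]: "poly (pconst c) s = c"
  by (simp add: pconst_def)

lemma coeff_pconst: "Polynomial.coeff (pconst c) i = (if i = 0 then c else 0)"
  by (cases i) (simp_all add: pconst_def)

lemma coeff_pconst_mult [simp]: "Polynomial.coeff (pconst c * p) i = c * Polynomial.coeff p i"
  by (simp add: pconst_def)

lemma pderiv_pconst [simp]: "pderiv (pconst (c::'a::field)) = 0"
  by (simp add: pconst_def pderiv_pCons)

lemma pconst_hom: "pconst (a + b) = pconst a + pconst b" "pconst (a * b) = pconst a * pconst b"
  by (simp_all add: pconst_def)

lemma pconst_one: "pconst 1 = 1"
  unfolding pconst_def by (rule one_pCons[symmetric])

lemma scalar_hom_pconst: "scalar_hom (pconst :: 'f::field \<Rightarrow> 'f poly)"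
  by unfold_locales (simp_all add: pconst_hom pconst_one)

text \<open>Substituting powers of one variable with separating weights keeps the monomials of
  \<open>f\<close> distinct; the result is a nonzero univariate polynomial, which has a nonroot in
  an infinite field.\<close>

lemma mpoly_nonzero_point:
  fixes f :: "('v::finite, 'f::field) mpoly"
  assumes "infinite (UNIV :: 'f set)" "f \<noteq> 0"
  obtains a where "Id.ev a f \<noteq> 0"
proof -
  interpret P: scalar_hom "pconst :: 'f \<Rightarrow> 'f poly" by (rule scalar_hom_pconst)
  obtain k :: "'v \<Rightarrow> nat" where k: "inj_on (\<lambda>t. \<Sum>v\<in>UNIV. lookup t v * k v) (keys f)"
    using monomial_projection_separating[OF finite_keys] .
  define U where "U v = Polynomial.monom (1::'f) (k v)" for v
  have mon: "P.mon U t = Polynomial.monom 1 (\<Sum>v\<in>UNIV. lookup t v * k v)" for t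
  proof -
    have "(\<Prod>v\<in>A. U v ^ lookup t v) = Polynomial.monom 1 (\<Sum>v\<in>A. lookup t v * k v)" if "finite A" for A
      using that
    proof (induction A rule: finite_induct)
      case (insert v A)
      have "U v ^ lookup t v = Polynomial.monom 1 (lookup t v * k v)"
        unfolding U_def monom_power by (simp only: power_one mult.commute[of "k v"])
      then show ?case using insert.IH
        by (simp only: prod.insert[OF insert.hyps] sum.insert[OF insert.hyps] mult_monom mult_1)
    qed (simp only: prod.empty sum.empty monom_eq_1)
    then show ?thesis by (simp add: P.mon_def)
  qed
  obtain t where t: "t \<in> keys f" using assms(2) by (metis ex_in_conv keys_eq_empty)
  have "Polynomial.coeff (P.ev U f) (\<Sum>v\<in>UNIV. lookup t v * k v) = (\<Sum>s\<in>keys f. if s = t then lookup f s else 0)"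
    unfolding P.ev_def mon Polynomial.coeff_sum
    by (intro sum.cong refl) (use k t in \<open>auto dest: inj_onD\<close>)
  also have "\<dots> = lookup f t" using t by (simp add: sum.delta)
  finally have "P.ev U f \<noteq> 0" using t by (auto simp: in_keys_iff)
  then have "finite {s. poly (P.ev U f) s = 0}" by (rule poly_roots_finite)
  then obtain s where "poly (P.ev U f) s \<noteq> 0" using ex_new_if_finite[OF assms(1)] by blast
  moreover have "poly (P.ev U f) s = Id.ev (\<lambda>v. poly (U v) s) f"
    by (simp add: P.ev_def Id.ev_def P.mon_def Id.mon_def poly_sum poly_prod)
  ultimately show ?thesis using that by metis
qed

text \<open>The formal partial derivative. Where \<open>v\<close> does not occur the subtraction of
  exponents is truncated, but the coefficient is then 0.\<close>

definition pd :: "'v \<Rightarrow> ('v::finite, 'k::field) mpoly \<Rightarrow> ('v, 'k) mpoly" where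
  "pd v f = (\<Sum>t\<in>keys f. single (t - single v 1) (of_nat (lookup t v) * lookup f t))"

lemma minus_plus_var: "lookup t v \<noteq> 0 \<Longrightarrow> t - single v 1 + single v (1::nat) = t"
  by (rule poly_mapping_eqI) (auto simp: lookup_add lookup_minus lookup_single when_def)

lemma lookup_pd: "lookup (pd v f) u = of_nat (Suc (lookup u v)) * lookup f (u + single v 1)"
proof -
  have "lookup (pd v f) u = (\<Sum>t\<in>keys f. if t - single v 1 = u then of_nat (lookup t v) * lookup f t else 0)"
    by (simp add: pd_def Poly_Mapping.lookup_sum lookup_single when_def)
  also have "\<dots> = (\<Sum>t\<in>keys f. if t = u + single v 1 then of_nat (lookup t v) * lookup f t else 0)"
  proof (rule sum.cong[OF refl])
    fix t assume "t \<in> keys f"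
    show "(if t - single v 1 = u then of_nat (lookup t v) * lookup f t else 0) =
      (if t = u + single v 1 then of_nat (lookup t v) * lookup f t else 0)"
    proof (cases "lookup t v = 0")
      case False
      have "t - single v 1 = u \<longleftrightarrow> t = u + single v 1"
        using minus_plus_var[OF False] by (metis add_diff_cancel_right')
      then show ?thesis by simp
    qed simp
  qed
  also have "\<dots> = of_nat (Suc (lookup u v)) * lookup f (u + single v 1)"
    by (auto simp: sum.delta in_keys_iff lookup_add)
  finally show ?thesis .
qed

lemma keys_pd: "u \<in> keys (pd v f) \<Longrightarrow> u + single v 1 \<in> keys f"
  unfolding in_keys_iff lookup_pd by (metis mult_zero_right)

lemma pd_deg_le: "f \<in> deg_le (Suc e) \<Longrightarrow> pd v f \<in> deg_le e"
  using deg_leD keys_pd by (intro deg_leI) (fastforce simp: mdeg_add)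

lemma pd_vars_in: "f \<in> vars_in S \<Longrightarrow> pd v f \<in> vars_in S"
  unfolding vars_in_def
proof (rule CollectI, rule ballI, rule subsetI)
  fix u w assume "f \<in> {f. \<forall>t\<in>keys f. keys t \<subseteq> S}" "u \<in> keys (pd v f)" "w \<in> keys u"
  then have "u + single v 1 \<in> keys f" by (intro keys_pd)
  then have "keys (u + single v 1) \<subseteq> S" using \<open>f \<in> _\<close> by blast
  moreover have "w \<in> keys (u + single v 1)" using \<open>w \<in> keys u\<close> by (simp add: in_keys_iff lookup_add)
  ultimately show "w \<in> S" by blast
qed

lemma pd_eq_0:
  fixes f :: "('v::finite, 'k::field) mpoly"
  assumes "pd v f = 0" "t \<in> keys f" shows "(of_nat (lookup t v) :: 'k) = 0"
proof (cases "lookup t v = 0")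
  case False
  from assms have "of_nat (Suc (lookup (t - single v 1) v)) * lookup f (t - single v 1 + single v 1) = 0"
    by (metis lookup_pd lookup_zero)
  moreover have "Suc (lookup (t - single v 1) v) = lookup t v" using False by (simp add: lookup_minus)
  ultimately have "(of_nat (lookup t v) :: 'k) * lookup f t = 0" by (simp only: minus_plus_var[OF False])
  then show ?thesis using assms(2) by (simp add: in_keys_iff)
qed simp

lemma pd_outside:
  assumes "f \<in> vars_in S" "v \<notin> S" shows "pd v f = 0"
proof (rule poly_mapping_eqI)
  fix u show "lookup (pd v f) u = lookup 0 u"
  proof (cases "u \<in> keys (pd v f)")
    case True
    then have "v \<in> keys (u + single v 1)" "u + single v 1 \<in> keys f" using keys_pd by (auto simp: in_keys_iff lookup_add)
    then show ?thesis using assms by (auto simp: vars_in_def)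
  qed (simp add: in_keys_iff)
qed

section \<open>Separable projections\<close>

locale field_embedding = scalar_hom \<iota> for \<iota> :: "'f::field \<Rightarrow> 'o::field"
begin

lemma scalar_hom_lift: "scalar_hom (\<lambda>c. pconst (\<iota> c))"
  by unfold_locales (simp_all add: hom_add hom_mult pconst_hom pconst_one)

sublocale P: scalar_hom "\<lambda>c. pconst (\<iota> c)"
  by (rule scalar_hom_lift)

text \<open>The restriction of \<open>f\<close> to the line through \<open>x\<close> in direction
  \<open>a\<close>, as a polynomial in the parameter.\<close>

definition line :: "('v::finite \<Rightarrow> 'o) \<Rightarrow> ('v \<Rightarrow> 'f) \<Rightarrow> ('v, 'f) mpoly \<Rightarrow> 'o poly" where
  "line x a f = P.ev (\<lambda>v. [:x v, \<iota> (a v):]) f"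

lemma poly_line: "poly (line x a f) z = ev (\<lambda>v. x v + z * \<iota> (a v)) f"
  by (simp add: line_def P.ev_def ev_def P.mon_def mon_def poly_sum poly_prod)

text \<open>The chain rule: simplicity of a root on the line becomes a statement about the
  gradient.\<close>

lemma pderiv_line:
  "poly (pderiv (line x a f)) z = (\<Sum>v\<in>UNIV. \<iota> (a v) * ev (\<lambda>v. x v + z * \<iota> (a v)) (pd v f))"
proof -
  let ?y = "\<lambda>v. x v + z * \<iota> (a v)"
  have m: "mon ?y (t - single v 1) = ?y v ^ (lookup t v - 1) * (\<Prod>w\<in>UNIV-{v}. ?y w ^ lookup t w)" for t v
  proof -
    have "mon ?y (t - single v 1) = ?y v ^ lookup (t - single v 1) v * (\<Prod>w\<in>UNIV-{v}. ?y w ^ lookup (t - single v 1) w)"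
      unfolding mon_def by (rule prod.remove) auto
    also have "(\<Prod>w\<in>UNIV-{v}. ?y w ^ lookup (t - single v 1) w) = (\<Prod>w\<in>UNIV-{v}. ?y w ^ lookup t w)"
      by (rule prod.cong) (auto simp: lookup_minus lookup_single when_def)
    finally show ?thesis by (simp add: lookup_minus)
  qed
  have 1: "poly (pderiv (P.mon (\<lambda>v. [:x v, \<iota> (a v):]) t)) z
      = (\<Sum>v\<in>UNIV. \<iota> (a v) * (of_nat (lookup t v) * mon ?y (t - single v 1)))" for t
    unfolding P.mon_def pderiv_prod poly_sum
  proof (rule sum.cong[OF refl])
    fix v
    have "poly (pderiv ([:x v, \<iota> (a v):] ^ lookup t v)) z = of_nat (lookup t v) * ?y v ^ (lookup t v - 1) * \<iota> (a v)"
      by (cases "lookup t v") (simp_all add: pderiv_power_Suc pderiv_pCons del: power_Suc of_nat_Suc)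
    then show "poly ((\<Prod>v\<in>UNIV - {v}. [:x v, \<iota> (a v):] ^ lookup t v) * pderiv ([:x v, \<iota> (a v):] ^ lookup t v)) z =
      \<iota> (a v) * (of_nat (lookup t v) * mon ?y (t - single v 1))"
      unfolding m by (simp add: poly_prod mult_ac)
  qed
  have "poly (pderiv (line x a f)) z = (\<Sum>t\<in>keys f. \<iota> (lookup f t) * poly (pderiv (P.mon (\<lambda>v. [:x v, \<iota> (a v):]) t)) z)"
    unfolding line_def P.ev_def pderiv_sum poly_sum by (simp add: pderiv_mult pderiv_pCons)
  also have "\<dots> = (\<Sum>v\<in>UNIV. \<Sum>t\<in>keys f. \<iota> (a v) * (\<iota> (of_nat (lookup t v) * lookup f t) * mon ?y (t - single v 1)))"
    unfolding 1 sum_distrib_left by (subst sum.swap) (simp add: hom_mult hom_of_nat mult_ac)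
  also have "\<dots> = (\<Sum>v\<in>UNIV. \<iota> (a v) * ev ?y (pd v f))"
    by (simp add: pd_def ev_sum ev_single sum_distrib_left)
  finally show ?thesis .
qed

text \<open>Joint degree at most \<open>m\<close>, where the polynomial variable has degree 1 and
  coefficients are measured by the filtration \<open>V x\<close>. The zero clause takes over where
  \<open>m - i\<close> would be truncated.\<close>

definition graded_poly :: "('v::finite \<Rightarrow> 'o) \<Rightarrow> nat \<Rightarrow> 'o poly \<Rightarrow> bool" where
  "graded_poly x m p \<longleftrightarrow> (\<forall>i. if i \<le> m then Polynomial.coeff p i \<in> V x (m - i) else Polynomial.coeff p i = 0)"

lemma graded_polyI:
  assumes "\<And>i. i \<le> m \<Longrightarrow> Polynomial.coeff p i \<in> V x (m - i)" "\<And>i. i > m \<Longrightarrow> Polynomial.coeff p i = 0"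
  shows "graded_poly x m p"
  using assms by (simp add: graded_poly_def)

lemma graded_polyD:
  assumes "graded_poly x m p"
  shows "i \<le> m \<Longrightarrow> Polynomial.coeff p i \<in> V x (m - i)" "i > m \<Longrightarrow> Polynomial.coeff p i = 0"
  using spec[OF assms[unfolded graded_poly_def], of i] by simp_all

lemma graded_poly_add: "graded_poly x m p \<Longrightarrow> graded_poly x m q \<Longrightarrow> graded_poly x m (p + q)"
  by (rule graded_polyI) (simp_all add: graded_polyD linsub_closed(2)[OF linsub_V])

lemma graded_poly_zero: "graded_poly x m 0"
  by (rule graded_polyI) simp_all

lemma graded_poly_mono:
  assumes "graded_poly x m p" "m \<le> n" shows "graded_poly x n p"
proof (rule graded_polyI)
  fix i assume "i \<le> n"
  show "Polynomial.coeff p i \<in> V x (n - i)"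
  proof (cases "i \<le> m")
    case True
    have "V x (m - i) \<subseteq> V x (n - i)" using assms(2) by (intro V_mono) simp
    then show ?thesis using graded_polyD(1)[OF assms(1) True] by blast
  next
    case False
    then have "Polynomial.coeff p i = 0" by (intro graded_polyD(2)[OF assms(1)]) simp
    then show ?thesis by simp
  qed
qed (rule graded_polyD(2)[OF assms(1)], use assms(2) in simp)

lemma graded_poly_mult:
  assumes "graded_poly x m p" "graded_poly x n q" shows "graded_poly x (m + n) (p * q)"
proof -
  have z: "Polynomial.coeff p j * Polynomial.coeff q (i - j) = 0" if "\<not> (j \<le> m \<and> i - j \<le> n)" for i j
    using that graded_polyD(2)[OF assms(1), of j] graded_polyD(2)[OF assms(2), of "i - j"] by (auto simp: not_le)
  show ?thesis
  proof (rule graded_polyI)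
    fix i assume "i \<le> m + n"
    show "Polynomial.coeff (p * q) i \<in> V x (m + n - i)"
      unfolding Polynomial.coeff_mult
    proof (rule V_sum)
      fix j assume j: "j \<in> {..i}"
      show "Polynomial.coeff p j * Polynomial.coeff q (i - j) \<in> V x (m + n - i)"
      proof (cases "j \<le> m \<and> i - j \<le> n")
        case True
        then have "Polynomial.coeff p j * Polynomial.coeff q (i - j) \<in> V x ((m - j) + (n - (i - j)))"
          by (intro V_mult graded_polyD(1)[OF assms(1)] graded_polyD(1)[OF assms(2)]) auto
        moreover have "(m - j) + (n - (i - j)) = m + n - i" using True j by auto
        ultimately show ?thesis by simp
      next
        case False
        then have "Polynomial.coeff p j * Polynomial.coeff q (i - j) = 0" by (rule z)
        then show ?thesis by (simp only: zero_in_V)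
      qed
    qed
  next
    fix i assume i: "i > m + n"
    show "Polynomial.coeff (p * q) i = 0"
      unfolding Polynomial.coeff_mult by (rule sum.neutral) (use i in \<open>auto intro!: z simp del: mult_eq_0_iff\<close>)
  qed
qed

lemma graded_poly_one [simp]: "graded_poly x 0 1"
  by (rule graded_polyI) auto

lemma graded_poly_line:
  assumes "f \<in> deg_le m" shows "graded_poly x m (line x a f)"
proof -
  have lin: "graded_poly x 1 [:x v, \<iota> (a v):]" for v
    using V_var[of x v] V_scalar[of "a v" x 0]
    by (auto simp: graded_poly_def coeff_pCons split: nat.split)
  have pow: "graded_poly x n ([:x v, \<iota> (a v):] ^ n)" for v n
  proof (induction n)
    case (Suc n)
    then show ?case using graded_poly_mult[OF lin] by fastforce
  qed simp
  have mon: "graded_poly x (mdeg t) (P.mon (\<lambda>v. [:x v, \<iota> (a v):]) t)" for t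
  proof -
    have "graded_poly x (\<Sum>v\<in>A. lookup t v) (\<Prod>v\<in>A. [:x v, \<iota> (a v):] ^ lookup t v)" if "finite A" for A
      using that by (induction A rule: finite_induct) (auto intro: graded_poly_mult pow)
    then show ?thesis by (simp add: P.mon_def mdeg_def)
  qed
  have sc: "graded_poly x 0 (pconst (\<iota> c))" for c
    using V_scalar by (auto simp: graded_poly_def coeff_pconst)
  have monomials: "graded_poly x m (pconst (\<iota> c) * P.mon (\<lambda>v. [:x v, \<iota> (a v):]) t)" if "t \<in> keys f" for t c
    using graded_poly_mono[OF graded_poly_mult[OF sc mon]] deg_leD[OF assms that] by simp
  have sums: "graded_poly x m (\<Sum>t\<in>A. g t)" if "\<And>t. t \<in> A \<Longrightarrow> graded_poly x m (g t)"
    for A :: "('a \<Rightarrow>\<^sub>0 nat) set" and g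
    using that by (induction A rule: infinite_finite_induct) (auto intro: graded_poly_add graded_poly_zero)
  show ?thesis unfolding line_def P.ev_def by (rule sums) (rule monomials)
qed

text \<open>A formal leading coefficient: \<open>c\<close> may be 0, so products need no case
  distinction on actual degrees.\<close>

definition top_coeff :: "nat \<Rightarrow> 'o poly \<Rightarrow> 'o \<Rightarrow> bool" where
  "top_coeff m p c \<longleftrightarrow> (\<forall>i>m. Polynomial.coeff p i = 0) \<and> Polynomial.coeff p m = c"

lemma top_coeff_mult:
  assumes "top_coeff m p c" "top_coeff n q d" shows "top_coeff (m + n) (p * q) (c * d)"
proof -
  have z: "Polynomial.coeff p j * Polynomial.coeff q (i - j) = 0" if "i \<ge> m + n" "j \<le> i" "j \<noteq> m \<or> i \<noteq> m + n" for i j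
  proof (cases "j > m")
    case False
    then have "i - j > n" using that by linarith
    then show ?thesis using assms by (simp add: top_coeff_def)
  qed (use assms in \<open>simp add: top_coeff_def\<close>)
  have "Polynomial.coeff (p * q) (m + n) = (\<Sum>j\<le>m+n. if j = m then c * d else 0)"
    unfolding Polynomial.coeff_mult
    by (intro sum.cong refl) (use z[of "m + n"] assms in \<open>auto simp: top_coeff_def\<close>)
  moreover have "Polynomial.coeff (p * q) i = 0" if "i > m + n" for i
    unfolding Polynomial.coeff_mult by (rule sum.neutral) (use z[of i] that in auto)
  ultimately show ?thesis by (simp add: top_coeff_def sum.delta)
qed

text \<open>Only monomials of degree \<open>e\<close> reach the power \<open>e\<close> of the
  parameter, and each contributes its value at the direction \<open>a\<close>. If the top form does
  not vanish at \<open>a\<close>, the equation is monic up to a scalar.\<close>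

lemma coeff_line_top:
  assumes "f \<in> deg_le e"
  shows "Polynomial.coeff (line x a f) e = ev (\<lambda>v. \<iota> (a v)) (homog_part e f)"
proof -
  have lin: "top_coeff 1 [:x v, \<iota> (a v):] (\<iota> (a v))" for v
    by (auto simp: top_coeff_def coeff_pCons split: nat.split)
  have pow: "top_coeff n ([:x v, \<iota> (a v):] ^ n) (\<iota> (a v) ^ n)" for v n
  proof (induction n)
    case (Suc n)
    then show ?case using top_coeff_mult[OF lin] by fastforce
  qed (simp add: top_coeff_def)
  have mon: "top_coeff (mdeg t) (P.mon (\<lambda>v. [:x v, \<iota> (a v):]) t) (mon (\<lambda>v. \<iota> (a v)) t)" for t
  proof -
    have "top_coeff (\<Sum>v\<in>A. lookup t v) (\<Prod>v\<in>A. [:x v, \<iota> (a v):] ^ lookup t v) (\<Prod>v\<in>A. \<iota> (a v) ^ lookup t v)" if "finite A" for A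
      using that
    proof (induction A rule: finite_induct)
      case empty
      then show ?case by (simp add: top_coeff_def)
    next
      case (insert v A)
      then show ?case using top_coeff_mult[OF pow insert.IH] by simp
    qed
    then show ?thesis by (simp add: P.mon_def mon_def mdeg_def)
  qed
  have "Polynomial.coeff (line x a f) e = (\<Sum>t\<in>keys f. \<iota> (lookup f t) * Polynomial.coeff (P.mon (\<lambda>v. [:x v, \<iota> (a v):]) t) e)"
    by (simp add: line_def P.ev_def Polynomial.coeff_sum)
  also have "\<dots> = (\<Sum>t\<in>keys f. \<iota> (lookup (homog_part e f) t) * mon (\<lambda>v. \<iota> (a v)) t)"
  proof (rule sum.cong[OF refl])
    fix t assume "t \<in> keys f"
    then have "mdeg t \<le> e" using deg_leD assms by blast
    then show "\<iota> (lookup f t) * Polynomial.coeff (P.mon (\<lambda>v. [:x v, \<iota> (a v):]) t) e =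
      \<iota> (lookup (homog_part e f) t) * mon (\<lambda>v. \<iota> (a v)) t"
      using mon[of t] by (cases "mdeg t = e") (auto simp: top_coeff_def lookup_homog_part)
  qed
  also have "\<dots> = ev (\<lambda>v. \<iota> (a v)) (homog_part e f)"
    by (rule ev_superset[symmetric]) (auto simp: in_keys_iff lookup_homog_part split: if_splits)
  finally show ?thesis .
qed

lemma ev_hom: "ev (\<lambda>v. \<iota> (a v)) f = \<iota> (Id.ev a f)"
proof -
  have "\<iota> (\<Prod>v\<in>A. a v ^ lookup t v) = (\<Prod>v\<in>A. \<iota> (a v) ^ lookup t v)" for t and A :: "'a set"
    by (induction A rule: infinite_finite_induct) (auto simp: hom_mult hom_power)
  then show ?thesis by (simp add: ev_def Id.ev_def mon_def Id.mon_def hom_sum hom_mult)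
qed

text \<open>The condition that makes the extension separable, in Mac Lane's form:
  linear independence is preserved by the Frobenius map.\<close>

definition maclane_separable :: bool where
  "maclane_separable \<longleftrightarrow> CHAR('f) = 0 \<or>
    (\<forall>(r::nat) c b. (\<Sum>i<r. \<iota> (c i) * b i ^ CHAR('f)) = 0 \<and> (\<exists>i<r. c i \<noteq> 0) \<longrightarrow>
       (\<exists>d. (\<Sum>i<r. \<iota> (d i) * b i) = 0 \<and> (\<exists>i<r. d i \<noteq> 0)))"

lemma maclane_separableD:
  fixes r :: nat
  assumes maclane_separable "CHAR('f) \<noteq> 0" "(\<Sum>i<r. \<iota> (c i) * b i ^ CHAR('f)) = 0" "\<exists>i<r. c i \<noteq> 0"
  shows "\<exists>d. (\<Sum>i<r. \<iota> (d i) * b i) = 0 \<and> (\<exists>i<r. d i \<noteq> 0)"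
proof -
  have "\<forall>(r::nat) c b. (\<Sum>i<r. \<iota> (c i) * b i ^ CHAR('f)) = 0 \<and> (\<exists>i<r. c i \<noteq> 0) \<longrightarrow>
       (\<exists>d. (\<Sum>i<r. \<iota> (d i) * b i) = 0 \<and> (\<exists>i<r. d i \<noteq> 0))"
    using assms(1,2) by (simp only: maclane_separable_def simp_thms)
  then have "(\<Sum>i<r. \<iota> (c i) * b i ^ CHAR('f)) = 0 \<and> (\<exists>i<r. c i \<noteq> 0) \<longrightarrow>
       (\<exists>d. (\<Sum>i<r. \<iota> (d i) * b i) = 0 \<and> (\<exists>i<r. d i \<noteq> 0))"
    by (elim allE)
  then show ?thesis using assms(3,4) by (rule mp[OF _ conjI])
qed

text \<open>The partial derivatives of a relation of least degree have smaller degree, so if all of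
  them vanished at \<open>x\<close> they would be zero polynomials. In characteristic 0 this makes
  \<open>F\<close> constant. In characteristic p all exponents are multiples of p, and Mac Lane's
  condition turns the relation between p-th powers of monomials into one between the monomials
  themselves, of smaller degree.\<close>

lemma gradient_nonzero:
  fixes x :: "'v::finite \<Rightarrow> 'o"
  assumes sep: maclane_separable and F: "F \<in> vars_in S" "F \<noteq> 0" "ev x F = 0" "F \<in> deg_le e"
    and min: "\<And>g e'. g \<in> vars_in S \<Longrightarrow> g \<noteq> 0 \<Longrightarrow> ev x g = 0 \<Longrightarrow> g \<in> deg_le e' \<Longrightarrow> e \<le> e'"
  shows "\<exists>v. ev x (pd v F) \<noteq> 0"
proof (rule ccontr)
  assume neg: "\<not> ?thesis"
  have e1: "e \<ge> 1"
  proof (rule ccontr)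
    assume "\<not> e \<ge> 1"
    then have "keys F \<subseteq> {0}" using deg_le_0_keys[of F] F(4) by (simp add: not_le)
    then have "ev x F = (\<Sum>t\<in>{0}. \<iota> (lookup F t) * mon x t)" by (intro ev_superset) auto
    then have "lookup F 0 = 0" using F(3) by (simp add: hom_eq_0)
    then have "0 \<notin> keys F" by (simp add: in_keys_iff)
    then have "keys F = {}" using \<open>keys F \<subseteq> {0}\<close> by blast
    then show False using F(2) by simp
  qed
  have "pd v F = 0" for v
  proof (rule ccontr)
    assume nz: "pd v F \<noteq> 0"
    have "pd v F \<in> deg_le (e - 1)" by (rule pd_deg_le) (use F(4) e1 in simp)
    then have "e \<le> e - 1" using min[OF pd_vars_in[OF F(1)] nz] neg by auto
    then show False using e1 by simp
  qed
  then have of0: "(of_nat (lookup t v) :: 'f) = 0" if "t \<in> keys F" for t v using pd_eq_0 that by blast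
  show False
  proof (cases "CHAR('f) = 0")
    case True
    have "t = 0" if "t \<in> keys F" for t
      by (rule poly_mapping_eqI) (use of0[OF that] True in \<open>simp add: of_nat_eq_0_iff_char_dvd\<close>)
    then have "mdeg t \<le> 0" if "t \<in> keys F" for t using that by (metis mdeg_zero order_refl)
    then have "F \<in> deg_le 0" by (rule deg_leI)
    then show False using min[OF F(1,2,3)] e1 by fastforce
  next
    case False
    define p where "p = CHAR('f)"
    have p2: "p \<ge> 2"
    proof -
      have "p \<noteq> 1" unfolding p_def by simp
      moreover have "p \<noteq> 0" using False by (simp only: p_def not_False_eq_True)
      ultimately show ?thesis by linarith
    qed
    \<comment> \<open>The p-th root of a monomial all of whose exponents are multiples of p.\<close>
    define root where "root t = (\<Sum>v\<in>UNIV. single v (lookup t v div p))" for t :: "'v \<Rightarrow>\<^sub>0 nat"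
    have root: "lookup t v = p * lookup (root t) v" if "t \<in> keys F" for t v
    proof -
      have "lookup (root t) v = lookup t v div p"
        by (simp add: root_def Poly_Mapping.lookup_sum lookup_single when_def sum.delta)
      moreover have "p dvd lookup t v" using of0[OF that] by (simp add: of_nat_eq_0_iff_char_dvd p_def)
      ultimately show ?thesis by simp
    qed
    obtain h where h: "bij_betw h {..<card (keys F)} (keys F)"
      using ex_bij_betw_nat_finite[OF finite_keys[of F]] by (auto simp: atLeast0LessThan)
    let ?r = "card (keys F)"
    have hk: "h i \<in> keys F" if "i < ?r" for i using h that by (auto simp: bij_betw_def)
    have "mon x t = mon x (root t) ^ p" if "t \<in> keys F" for t
      unfolding mon_def prod_power_distrib
      by (intro prod.cong refl) (simp add: root[OF that] mult.commute flip: power_mult)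
    then have "ev x F = (\<Sum>t\<in>keys F. \<iota> (lookup F t) * mon x (root t) ^ p)" by (simp add: ev_def)
    also have "\<dots> = (\<Sum>i<?r. \<iota> (lookup F (h i)) * mon x (root (h i)) ^ p)"
      by (rule sum.reindex_bij_betw[OF h, symmetric])
    finally have "(\<Sum>i<?r. \<iota> (lookup F (h i)) * mon x (root (h i)) ^ CHAR('f)) = 0"
      using F(3) by (simp add: p_def)
    moreover have "\<exists>i<?r. lookup F (h i) \<noteq> 0"
    proof -
      have "?r > 0" using F(2) by (simp add: card_gt_0_iff)
      then show ?thesis using hk in_keys_iff by blast
    qed
    ultimately have "\<exists>d. (\<Sum>i<?r. \<iota> (d i) * mon x (root (h i))) = 0 \<and> (\<exists>i<?r. d i \<noteq> 0)"
      by (rule maclane_separableD[OF sep False])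
    then obtain d i0 where d: "(\<Sum>i<?r. \<iota> (d i) * mon x (root (h i))) = 0" "i0 < ?r" "d i0 \<noteq> 0" by blast
    define g where "g = (\<Sum>i<?r. single (root (h i)) (d i))"
    have gk: "\<exists>i<?r. t = root (h i)" if "t \<in> keys g" for t
    proof (rule ccontr)
      assume "\<not> ?thesis"
      then have "lookup g t = 0" by (auto simp: g_def Poly_Mapping.lookup_sum lookup_single when_def intro!: sum.neutral)
      then show False using that by (simp add: in_keys_iff)
    qed
    \<comment> \<open>Roots of distinct monomials are distinct, so no coefficients of
      \<open>g\<close> cancel.\<close>
    have inj: "root (h i) = root (h j) \<longleftrightarrow> i = j" if "i < ?r" "j < ?r" for i j
    proof
      assume "root (h i) = root (h j)"
      then have "h i = h j" using root[OF hk[OF that(1)]] root[OF hk[OF that(2)]] by (intro poly_mapping_eqI) simp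
      then show "i = j" using h that by (auto simp: bij_betw_def dest: inj_onD)
    qed simp
    have "lookup g (root (h i0)) = (\<Sum>i<?r. if i = i0 then d i else 0)"
      unfolding g_def Poly_Mapping.lookup_sum
      by (intro sum.cong refl) (simp add: lookup_single when_def inj d(2))
    then have "lookup g (root (h i0)) \<noteq> 0" using d by (simp add: sum.delta)
    then have g0: "g \<noteq> 0" by auto
    have evg: "ev x g = 0" using d(1) by (simp add: g_def ev_sum ev_single)
    have gS: "g \<in> vars_in S"
      unfolding vars_in_def
    proof (rule CollectI, rule ballI, rule subsetI)
      fix t v assume "t \<in> keys g" "v \<in> keys t"
      then obtain i where i: "i < ?r" "t = root (h i)" using gk by blast
      then have "v \<in> keys (h i)" using \<open>v \<in> keys t\<close> root[OF hk[OF i(1)], of v] p2 by (simp add: in_keys_iff)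
      then show "v \<in> S" using F(1) hk[OF i(1)] by (auto simp: vars_in_def)
    qed
    have "g \<in> deg_le (e div p)"
    proof (rule deg_leI)
      fix t assume "t \<in> keys g"
      then obtain i where i: "i < ?r" "t = root (h i)" using gk by blast
      have "mdeg (h i) = p * mdeg t"
        unfolding i(2) mdeg_def by (simp add: root[OF hk[OF i(1)]] sum_distrib_left)
      then have "p * mdeg t \<le> e" using deg_leD[OF F(4) hk[OF i(1)]] by simp
      then show "mdeg t \<le> e div p" using p2 by (simp add: less_eq_div_iff_mult_less_eq mult.commute)
    qed
    then have "e \<le> e div p" by (rule min[OF gS g0 evg])
    moreover have "e div p < e" using e1 p2 by (intro div_less_dividend) auto
    ultimately show False by simp
  qed
qed

text \<open>From a point \<open>a1\<close> at which \<open>f\<close> is nonzero, move in the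
  direction of the coordinate \<open>v0\<close>. The value of \<open>f\<close> is a nonzero
  polynomial in the parameter \<open>s\<close>, and the linear form is affine in \<open>s\<close>
  with slope \<open>D v0\<close>; so each condition excludes finitely many \<open>s\<close>.\<close>

lemma good_direction:
  fixes x :: "'v::finite \<Rightarrow> 'o"
  assumes inf: "infinite (UNIV :: 'f set)" and f: "f \<in> vars_in S" "f \<noteq> 0"
    and D: "D v0 \<noteq> (0::'o)" "v0 \<in> S"
  obtains a where "\<And>v. v \<notin> S \<Longrightarrow> a v = 0" "Id.ev a f \<noteq> 0" "(\<Sum>v\<in>UNIV. \<iota> (a v) * D v) \<noteq> 0"
proof -
  interpret Q: scalar_hom "pconst :: 'f \<Rightarrow> 'f poly" by (rule scalar_hom_pconst)
  obtain a0 where a0: "Id.ev a0 f \<noteq> 0" using mpoly_nonzero_point[OF inf f(2)] .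
  define a1 where "a1 v = (if v \<in> S then a0 v else 0)" for v
  have a1: "Id.ev a1 f \<noteq> 0"
    using a0 Id.ev_cong_vars_in[OF f(1), of a1 a0] by (simp add: a1_def)
  define u where "u v = (if v = v0 then (1::'f) else 0)" for v
  define q where "q = Q.ev (\<lambda>v. [:a1 v, u v:]) f"
  have q: "poly q s = Id.ev (\<lambda>v. a1 v + s * u v) f" for s
    by (simp add: q_def Q.ev_def Id.ev_def Q.mon_def Id.mon_def poly_sum poly_prod)
  have "q \<noteq> 0" using q[of 0] a1 by auto
  then have fin1: "finite {s. poly q s = 0}" by (rule poly_roots_finite)
  have lin: "(\<Sum>v\<in>UNIV. \<iota> (a1 v + s * u v) * D v) = (\<Sum>v\<in>UNIV. \<iota> (a1 v) * D v) + \<iota> s * D v0" for s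
  proof -
    have "(\<Sum>v\<in>UNIV. \<iota> (s * u v) * D v) = (\<Sum>v\<in>UNIV. if v = v0 then \<iota> s * D v0 else 0)"
      by (rule sum.cong) (auto simp: u_def)
    then show ?thesis by (simp add: hom_add distrib_right sum.distrib sum.delta)
  qed
  have fin2: "finite {s. (\<Sum>v\<in>UNIV. \<iota> (a1 v + s * u v) * D v) = 0}"
  proof (cases "\<exists>s0. (\<Sum>v\<in>UNIV. \<iota> (a1 v + s0 * u v) * D v) = 0")
    case True
    then obtain s0 where s0: "(\<Sum>v\<in>UNIV. \<iota> (a1 v + s0 * u v) * D v) = 0" by blast
    have "s = s0" if "(\<Sum>v\<in>UNIV. \<iota> (a1 v + s * u v) * D v) = 0" for s
    proof -
      have "\<iota> s * D v0 = \<iota> s0 * D v0" using s0 that unfolding lin by (metis add_left_cancel)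
      then show ?thesis using D(1) hom_inj by simp
    qed
    then have "{s. (\<Sum>v\<in>UNIV. \<iota> (a1 v + s * u v) * D v) = 0} \<subseteq> {s0}" by blast
    then show ?thesis by (rule finite_subset) simp
  qed simp
  obtain s where "s \<notin> {s. poly q s = 0} \<union> {s. (\<Sum>v\<in>UNIV. \<iota> (a1 v + s * u v) * D v) = 0}"
    using ex_new_if_finite[OF inf] fin1 fin2 by (meson finite_UnI)
  then show ?thesis
    using D(2) by (intro that[of "\<lambda>v. a1 v + s * u v"]) (auto simp: q a1_def u_def)
qed

text \<open>Projection of \<open>x\<close> along a direction \<open>a\<close>. A relation
  \<open>F\<close> of least degree, read on the line through \<open>x'\<close>, is an equation for
  \<open>z\<close> over \<open>x'\<close>: monic after scaling because the top form of
  \<open>F\<close> does not vanish at \<open>a\<close>, graded because \<open>F\<close> has degree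
  \<open>e\<close>, and with \<open>z\<close> as a simple root because the derivative of
  \<open>F\<close> along \<open>a\<close> is not zero at \<open>x\<close>.\<close>

lemma normalization_step:
  fixes x :: "'v::finite \<Rightarrow> 'o"
  assumes inf: "infinite (UNIV :: 'f set)" and sep: maclane_separable
    and rel: "F0 \<in> vars_in S" "F0 \<noteq> 0" "ev x F0 = 0" and x0: "\<And>v. v \<notin> S \<Longrightarrow> x v = 0"
  obtains l a z x' G e where "l \<in> S" "x' = (\<lambda>v. x v - z * \<iota> (a v))" "\<And>v. v \<notin> S - {l} \<Longrightarrow> x' v = 0"
    "z \<in> V x 1" "1 \<le> e" "poly G z = 0" "graded_poly x' e G" "Polynomial.coeff G e = 1" "poly (pderiv G) z \<noteq> 0"
proof -
  define Q where "Q e \<longleftrightarrow> (\<exists>F. F \<in> vars_in S \<and> F \<noteq> 0 \<and> ev x F = 0 \<and> F \<in> deg_le e)" for e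
  obtain m where "F0 \<in> deg_le m" using deg_le_exists .
  then have "Q m" unfolding Q_def using rel by blast
  define e where "e = (LEAST e. Q e)"
  have "Q e" unfolding e_def by (rule LeastI) (rule \<open>Q m\<close>)
  then obtain F where F: "F \<in> vars_in S" "F \<noteq> 0" "ev x F = 0" "F \<in> deg_le e" unfolding Q_def by blast
  have min: "e \<le> e'" if "g \<in> vars_in S" "g \<noteq> 0" "ev x g = 0" "g \<in> deg_le e'" for g e'
    unfolding e_def by (rule Least_le) (use that in \<open>auto simp: Q_def\<close>)
  have "\<exists>v. ev x (pd v F) \<noteq> 0" by (rule gradient_nonzero[OF sep F]) (rule min)
  then obtain v0 where v0: "ev x (pd v0 F) \<noteq> 0" by blast
  have v0S: "v0 \<in> S" using pd_outside[OF F(1)] v0 by force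
  have e1: "e \<ge> 1"
  proof (rule ccontr)
    assume "\<not> e \<ge> 1"
    then have "keys F \<subseteq> {0}" using deg_le_0_keys[of F] F(4) by (simp add: not_le)
    then have "F \<in> vars_in {}" by (auto simp: vars_in_def)
    then have "pd v0 F = 0" by (rule pd_outside) simp
    then show False using v0 by simp
  qed
  have "homog_part e F \<noteq> 0"
  proof
    assume z: "homog_part e F = 0"
    have "F \<in> deg_le (e - 1)"
    proof (rule deg_leI)
      fix t assume t: "t \<in> keys F"
      have "mdeg t \<noteq> e"
      proof
        assume "mdeg t = e"
        then have "lookup (homog_part e F) t = lookup F t" by (simp add: lookup_homog_part)
        then show False using t z by (simp add: in_keys_iff)
      qed
      then show "mdeg t \<le> e - 1" using deg_leD[OF F(4) t] by simp
    qed
    then show False using min[OF F(1,2,3)] e1 by fastforce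
  qed
  moreover have "homog_part e F \<in> vars_in S"
    using F(1) by (auto simp: vars_in_def in_keys_iff lookup_homog_part split: if_splits)
  ultimately obtain a where a: "\<And>v. v \<notin> S \<Longrightarrow> a v = 0" "Id.ev a (homog_part e F) \<noteq> 0"
     "(\<Sum>v\<in>UNIV. \<iota> (a v) * ev x (pd v F)) \<noteq> 0"
    using good_direction[OF inf, of "homog_part e F" S "\<lambda>v. ev x (pd v F)" v0] v0 v0S by metis
  have "\<exists>l. a l \<noteq> 0"
  proof (rule ccontr)
    assume "\<not> ?thesis"
    then have "(\<Sum>v\<in>UNIV. \<iota> (a v) * ev x (pd v F)) = 0" by simp
    then show False using a(3) by simp
  qed
  then obtain l where l: "a l \<noteq> 0" by blast
  \<comment> \<open>Scaled so that subtracting \<open>z\<close> times the direction makes coordinate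
    \<open>l\<close> of \<open>x'\<close> zero; this is how a variable disappears.\<close>
  define z where "z = \<iota> (inverse (a l)) * x l"
  define x' where "x' = (\<lambda>v. x v - z * \<iota> (a v))"
  define c where "c = Id.ev a (homog_part e F)"
  define G where "G = Polynomial.smult (\<iota> (inverse c)) (line x' a F)"
  have xx: "(\<lambda>v. x' v + z * \<iota> (a v)) = x" by (simp add: x'_def)
  show ?thesis
  proof (rule that[of l x' z a e G])
    show "l \<in> S" using a(1) l by blast
    show "x' = (\<lambda>v. x v - z * \<iota> (a v))" by (rule x'_def)
    have "\<iota> (inverse (a l)) * \<iota> (a l) = 1" using l by (simp flip: hom_mult)
    then have "x' l = 0" by (simp add: x'_def z_def mult.assoc mult.commute[of "x l"] flip: mult.assoc)
    then show "x' v = 0" if "v \<notin> S - {l}" for v using that x0 a(1) by (cases "v = l") (auto simp: x'_def)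
    show "z \<in> V x 1" unfolding z_def by (rule linsub_closed(3)[OF linsub_V V_var])
    show "1 \<le> e" by (rule e1)
    show "poly G z = 0" by (simp add: G_def poly_line xx F(3))
    have "graded_poly x' e (line x' a F)" by (rule graded_poly_line[OF F(4)])
    then show "graded_poly x' e G" by (auto simp: graded_poly_def G_def intro: linsub_closed(3)[OF linsub_V])
    show "Polynomial.coeff G e = 1"
      using a(2) unfolding G_def c_def by (simp add: coeff_line_top[OF F(4)] ev_hom flip: hom_mult)
    have "poly (pderiv G) z = \<iota> (inverse c) * (\<Sum>v\<in>UNIV. \<iota> (a v) * ev x (pd v F))"
      by (simp add: G_def pderiv_smult pderiv_line xx)
    then show "poly (pderiv G) z \<noteq> 0" using a(2,3) by (simp add: c_def hom_eq_0)
  qed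
qed

end

section \<open>Finite extensions and traces\<close>

text \<open>Writing \<open>j = i * g + l\<close> identifies a single index with the pairs that index
  the basis of a tower.\<close>

lemma sum_div_mod:
  fixes F :: "nat \<Rightarrow> nat \<Rightarrow> 'a::comm_monoid_add"
  shows "(\<Sum>j<n*g. F (j div g) (j mod g)) = (\<Sum>i<n. \<Sum>l<g. F i l)"
proof -
  have "(\<Sum>i<n. \<Sum>l<g. F i l) = (\<Sum>(i,l)\<in>{..<n}\<times>{..<g}. F i l)"
    by (rule sum.cartesian_product)
  also have "\<dots> = (\<Sum>j<n*g. F (j div g) (j mod g))"
  proof (rule sum.reindex_bij_witness[of _ "\<lambda>j. (j div g, j mod g)" "\<lambda>(i,l). i * g + l"])
    fix a assume "a \<in> {..<n}\<times>{..<g}"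
    then obtain i l where a: "a = (i, l)" "i < n" "l < g" by auto
    have "i * g + l < Suc i * g" using a by simp
    also have "\<dots> \<le> n * g" using a by (intro mult_le_mono1) simp
    finally show "(case a of (i, l) \<Rightarrow> i * g + l) \<in> {..<n*g}" using a by simp
  next
    fix j assume j: "j \<in> {..<n*g}"
    then have "g > 0" by (cases g) auto
    then show "(j div g, j mod g) \<in> {..<n}\<times>{..<g}" using j by (auto simp: less_mult_imp_div_less)
  qed auto
  finally show ?thesis by simp
qed

definition rep :: "'a::field set \<Rightarrow> nat \<Rightarrow> (nat \<Rightarrow> 'a) \<Rightarrow> 'a \<Rightarrow> (nat \<Rightarrow> 'a) \<Rightarrow> bool" where
  "rep K n b x \<kappa> \<longleftrightarrow> (\<forall>i<n. \<kappa> i \<in> K) \<and> x = (\<Sum>i<n. \<kappa> i * b i)"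

text \<open>Both fields are subsets of one field type. The first clause says that \<open>L\<close>
  is exactly the span of \<open>b\<close> over \<open>K\<close>, so closure of \<open>L\<close>
  under sums and scaling comes for free.\<close>

definition basis :: "'a::field set \<Rightarrow> nat \<Rightarrow> (nat \<Rightarrow> 'a) \<Rightarrow> 'a set \<Rightarrow> bool" where
  "basis K n b L \<longleftrightarrow> (\<forall>x. x \<in> L \<longleftrightarrow> (\<exists>\<kappa>. rep K n b x \<kappa>)) \<and> (\<forall>\<kappa>. rep K n b 0 \<kappa> \<longrightarrow> (\<forall>i<n. \<kappa> i = 0))"

definition crd :: "'a::field set \<Rightarrow> nat \<Rightarrow> (nat \<Rightarrow> 'a) \<Rightarrow> 'a \<Rightarrow> nat \<Rightarrow> 'a" where
  "crd K n b x = (SOME \<kappa>. rep K n b x \<kappa>)"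

text \<open>The trace of the matrix of multiplication by \<open>x\<close> in the basis
  \<open>b\<close>.\<close>

definition trace :: "'a::field set \<Rightarrow> nat \<Rightarrow> (nat \<Rightarrow> 'a) \<Rightarrow> 'a \<Rightarrow> 'a" where
  "trace K n b x = (\<Sum>i<n. crd K n b (x * b i) i)"

locale basis_ext =
  fixes K :: "'a::field set" and n b L
  assumes K: "subfld K" and bas: "basis K n b L"
begin

lemma rep_crd:
  assumes "x \<in> L" shows "rep K n b x (crd K n b x)"
proof -
  obtain \<kappa> where "rep K n b x \<kappa>" using assms bas unfolding basis_def by blast
  then show ?thesis unfolding crd_def by (rule someI[of "rep K n b x"])
qed

lemma crd_mem: "x \<in> L \<Longrightarrow> i < n \<Longrightarrow> crd K n b x i \<in> K"
  using rep_crd by (auto simp: rep_def)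

lemma crd_sum: "x \<in> L \<Longrightarrow> x = (\<Sum>i<n. crd K n b x i * b i)"
  using rep_crd[of x] by (simp add: rep_def)

lemma rep_in: "rep K n b x \<kappa> \<Longrightarrow> x \<in> L"
  using bas by (auto simp: basis_def)

lemma rep_unique:
  assumes "rep K n b x \<kappa>" "rep K n b x \<mu>" "i < n" shows "\<kappa> i = \<mu> i"
proof -
  have "rep K n b 0 (\<lambda>i. \<kappa> i - \<mu> i)"
    using assms by (auto simp: rep_def left_diff_distrib sum_subtractf intro: subfld_closed[OF K])
  then have "\<forall>i<n. \<kappa> i - \<mu> i = 0" using bas unfolding basis_def by blast
  then show ?thesis using assms(3) by simp
qed

lemma crd_eqI: "rep K n b x \<kappa> \<Longrightarrow> i < n \<Longrightarrow> crd K n b x i = \<kappa> i"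
  using rep_unique rep_crd rep_in by blast

lemma rep_add: "rep K n b x \<kappa> \<Longrightarrow> rep K n b y \<mu> \<Longrightarrow> rep K n b (x + y) (\<lambda>i. \<kappa> i + \<mu> i)"
  by (auto simp: rep_def distrib_right sum.distrib intro: subfld_closed[OF K])

lemma rep_scale: "c \<in> K \<Longrightarrow> rep K n b x \<kappa> \<Longrightarrow> rep K n b (c * x) (\<lambda>i. c * \<kappa> i)"
  by (auto simp: rep_def sum_distrib_left mult.assoc intro: subfld_closed[OF K])

lemma rep_zero: "rep K n b 0 (\<lambda>_. 0)"
  by (auto simp: rep_def intro: subfld_closed[OF K])

lemma L_add: "x \<in> L \<Longrightarrow> y \<in> L \<Longrightarrow> x + y \<in> L"
  using rep_add rep_crd rep_in by blast

lemma L_scale: "c \<in> K \<Longrightarrow> x \<in> L \<Longrightarrow> c * x \<in> L"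
  using rep_scale rep_crd rep_in by blast

lemma L_zero: "0 \<in> L" using rep_zero rep_in by blast

lemma L_sum: "(\<And>i. i \<in> A \<Longrightarrow> f i \<in> L) \<Longrightarrow> sum f A \<in> L"
  by (induction A rule: infinite_finite_induct) (auto intro: L_add L_zero)

lemma crd_add: "x \<in> L \<Longrightarrow> y \<in> L \<Longrightarrow> i < n \<Longrightarrow> crd K n b (x + y) i = crd K n b x i + crd K n b y i"
  by (rule crd_eqI[OF rep_add]) (auto intro: rep_crd)

lemma crd_scale: "c \<in> K \<Longrightarrow> x \<in> L \<Longrightarrow> i < n \<Longrightarrow> crd K n b (c * x) i = c * crd K n b x i"
  by (rule crd_eqI[OF rep_scale]) (auto intro: rep_crd)

lemma crd_zero: "i < n \<Longrightarrow> crd K n b 0 i = 0"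
  by (rule crd_eqI[OF rep_zero])

lemma crd_of_sum: "(\<And>j. j \<in> A \<Longrightarrow> f j \<in> L) \<Longrightarrow> i < n \<Longrightarrow> crd K n b (sum f A) i = (\<Sum>j\<in>A. crd K n b (f j) i)"
  by (induction A rule: infinite_finite_induct) (auto simp: crd_zero crd_add L_sum)

lemma rep_basis: "j < n \<Longrightarrow> rep K n b (b j) (\<lambda>i. if i = j then 1 else 0)"
  by (auto simp: rep_def sum.delta if_distrib[of "\<lambda>x. x * _"] cong: if_cong intro: subfld_closed[OF K])

lemma b_in: "j < n \<Longrightarrow> b j \<in> L"
  using rep_basis rep_in by blast

lemma crd_basis: "j < n \<Longrightarrow> i < n \<Longrightarrow> crd K n b (b j) i = (if i = j then 1 else 0)"
  using crd_eqI[OF rep_basis] by simp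

text \<open>A finite-dimensional domain over a field is a field: 1 and the multiples w * b i
  are too many vectors to be independent.\<close>

lemma subfld_of_ring:
  assumes one: "1 \<in> L" and mult: "\<And>x y. x \<in> L \<Longrightarrow> y \<in> L \<Longrightarrow> x * y \<in> L"
  shows "subfld L"
  unfolding subfld_def
proof (intro conjI ballI)
  have neg: "-1 \<in> K" using subfld_closed[OF K] by blast
  show uminus: "- x \<in> L" if "x \<in> L" for x using L_scale[OF neg that] by simp
  fix w assume w: "w \<in> L"
  show "inverse w \<in> L"
  proof (cases "w = 0")
    case False
    define y where "y i = (case i of None \<Rightarrow> 1 | Some i \<Rightarrow> w * b i)" for i :: "nat option"
    define I where "I = insert None (Some ` {..<n})"
    have yL: "y i \<in> L" if "i \<in> I" for i using that one mult[OF w b_in] by (auto simp: y_def I_def)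
    have fin: "finite I" and card: "card I = Suc n" by (auto simp: I_def card_image)
    have "\<exists>a. (\<forall>i\<in>I. a i \<in> K) \<and> (\<exists>i\<in>I. a i \<noteq> 0) \<and> (\<forall>j\<in>{..<n}. (\<Sum>i\<in>I. a i * crd K n b (y i) j) = 0)"
      by (rule homogeneous_system[OF K _ fin]) (use card yL crd_mem in auto)
    then obtain a where a: "\<forall>i\<in>I. a i \<in> K" "\<exists>i\<in>I. a i \<noteq> 0" "\<forall>j<n. (\<Sum>i\<in>I. a i * crd K n b (y i) j) = 0" by auto
    have "(\<Sum>i\<in>I. a i * y i) = (\<Sum>j<n. crd K n b (\<Sum>i\<in>I. a i * y i) j * b j)"
      by (rule crd_sum, rule L_sum) (use a(1) yL L_scale in blast)
    also have "\<dots> = 0"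
    proof (rule sum.neutral, rule ballI)
      fix j assume "j \<in> {..<n}"
      then have "crd K n b (\<Sum>i\<in>I. a i * y i) j = (\<Sum>i\<in>I. a i * crd K n b (y i) j)"
        using a(1) yL by (subst crd_of_sum) (auto intro!: sum.cong L_scale simp: crd_scale)
      then show "crd K n b (\<Sum>i\<in>I. a i * y i) j * b j = 0" using a(3) \<open>j \<in> {..<n}\<close> by simp
    qed
    finally have "a None + (\<Sum>i<n. a (Some i) * (w * b i)) = 0"
      by (simp add: I_def y_def sum.reindex)
    then have eq: "a None + w * (\<Sum>i<n. a (Some i) * b i) = 0"
      by (simp add: sum_distrib_left mult.left_commute)
    define s where "s = (\<Sum>i<n. a (Some i) * b i)"
    have rs: "rep K n b s (\<lambda>i. a (Some i))" using a(1) by (auto simp: rep_def s_def I_def)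
    \<comment> \<open>If the coefficient of 1 vanished, cancelling \<open>w\<close> would leave a
      relation among the basis vectors.\<close>
    have n0: "a None \<noteq> 0"
    proof
      assume z: "a None = 0"
      then have "s = 0" using eq False by (simp add: s_def)
      then have "\<forall>i<n. a (Some i) = 0" using rs bas unfolding basis_def by blast
      then show False using a(2) z by (auto simp: I_def)
    qed
    have "w * s = - a None" using eq by (simp add: s_def add_eq_0_iff)
    then have "inverse w = (- inverse (a None)) * s" using False n0 by (simp add: field_simps)
    moreover have "- inverse (a None) \<in> K" using a(1) subfld_closed[OF K] by (auto simp: I_def)
    ultimately show ?thesis using L_scale rep_in[OF rs] by metis
  qed (use L_zero in simp)
qed (use L_zero one L_add mult in auto)

end

section \<open>Minimal polynomials and simple separable extensions\<close>

definition polys_over :: "'a::field set \<Rightarrow> 'a poly set" where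
  "polys_over E = {p. \<forall>i. Polynomial.coeff p i \<in> E}"

lemma polys_over_closed:
  assumes "subfld E"
  shows "p \<in> polys_over E \<Longrightarrow> q \<in> polys_over E \<Longrightarrow> p + q \<in> polys_over E"
    "p \<in> polys_over E \<Longrightarrow> q \<in> polys_over E \<Longrightarrow> p - q \<in> polys_over E"
    "p \<in> polys_over E \<Longrightarrow> - p \<in> polys_over E"
    "p \<in> polys_over E \<Longrightarrow> q \<in> polys_over E \<Longrightarrow> p * q \<in> polys_over E"
    "c \<in> E \<Longrightarrow> p \<in> polys_over E \<Longrightarrow> Polynomial.smult c p \<in> polys_over E"
    "c \<in> E \<Longrightarrow> Polynomial.monom c k \<in> polys_over E" "0 \<in> polys_over E" "1 \<in> polys_over E"
  using subfld_closed[OF assms]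
  by (auto simp: polys_over_def Polynomial.coeff_mult intro!: subfld_sum[OF assms])

lemma polys_over_sum:
  assumes "subfld E" shows "(\<And>i. i \<in> A \<Longrightarrow> f i \<in> polys_over E) \<Longrightarrow> sum f A \<in> polys_over E"
  by (induction A rule: infinite_finite_induct) (auto intro: polys_over_closed[OF assms])

lemma polys_over_division:
  fixes G :: "'a::field poly"
  assumes E: "subfld E" and G: "G \<in> polys_over E" "Polynomial.lead_coeff G = 1" and p: "p \<in> polys_over E"
  shows "\<exists>q r. p = q * G + r \<and> q \<in> polys_over E \<and> r \<in> polys_over E \<and> (r = 0 \<or> Polynomial.degree r < Polynomial.degree G)"
  using p
proof (induction "Polynomial.degree p" arbitrary: p rule: less_induct)
  case less
  show ?case
  proof (cases "p = 0 \<or> Polynomial.degree p < Polynomial.degree G")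
    case True
    then show ?thesis using less.prems polys_over_closed(7)[OF E]
      by (intro exI[of _ 0] exI[of _ p]) auto
  next
    case False
    define k where "k = Polynomial.degree p - Polynomial.degree G"
    define m where "m = Polynomial.monom (Polynomial.lead_coeff p) k"
    have m: "m \<in> polys_over E" unfolding m_def using less.prems by (intro polys_over_closed(6)[OF E]) (simp add: polys_over_def)
    have nz: "m \<noteq> 0" "G \<noteq> 0" using False G(2) by (auto simp: m_def)
    have deg1: "Polynomial.degree (m * G) = Polynomial.degree p"
      using nz False by (auto simp: degree_mult_eq m_def degree_monom_eq k_def)
    have "Polynomial.lead_coeff (m * G) = Polynomial.lead_coeff m * Polynomial.lead_coeff G" by (rule lead_coeff_mult)
    also have "\<dots> = Polynomial.lead_coeff p" using G(2) by (simp only: m_def lead_coeff_monom mult_1_right)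
    finally have deg: "Polynomial.degree (m * G) = Polynomial.degree p" "Polynomial.lead_coeff (m * G) = Polynomial.lead_coeff p"
      using deg1 by auto
    define p' where "p' = p - m * G"
    have p': "p' \<in> polys_over E" unfolding p'_def by (intro polys_over_closed[OF E] less.prems m G)
    have "\<exists>q r. p' = q * G + r \<and> q \<in> polys_over E \<and> r \<in> polys_over E \<and> (r = 0 \<or> Polynomial.degree r < Polynomial.degree G)"
    proof (cases "p' = 0")
      case True
      then show ?thesis using polys_over_closed(7)[OF E] by (intro exI[of _ 0]) auto
    next
      case nz': False
      have "Polynomial.degree p' \<le> Polynomial.degree p" unfolding p'_def by (rule degree_diff_le) (use deg in auto)
      moreover have "Polynomial.coeff p' (Polynomial.degree p) = 0" using deg by (simp add: p'_def)
      ultimately have "Polynomial.degree p' < Polynomial.degree p"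
        using nz' by (metis leading_coeff_0_iff order_le_less)
      then show ?thesis using less.hyps p' by blast
    qed
    then obtain q r where "p' = q * G + r" "q \<in> polys_over E" "r \<in> polys_over E" "r = 0 \<or> Polynomial.degree r < Polynomial.degree G" by blast
    then show ?thesis using m
      by (intro exI[of _ "q + m"] exI[of _ r]) (auto simp: p'_def algebra_simps intro: polys_over_closed[OF E])
  qed
qed

text \<open>The minimal polynomial \<open>G\<close> divides \<open>F\<close>, and at the common root
  the derivative of \<open>F = q * G\<close> is the value of \<open>q\<close> times the derivative
  of \<open>G\<close>; so the root is simple for \<open>G\<close> too.\<close>

lemma separable_minimal_polynomial:
  fixes F :: "'a::field poly"
  assumes E: "subfld E" and F: "F \<in> polys_over E" "poly F z = 0" "poly (pderiv F) z \<noteq> 0"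
  obtains G where "G \<in> polys_over E" "Polynomial.lead_coeff G = 1" "poly G z = 0" "poly (pderiv G) z \<noteq> 0" "Polynomial.degree G \<ge> 1"
    "\<And>p. p \<in> polys_over E \<Longrightarrow> poly p z = 0 \<Longrightarrow> Polynomial.degree p < Polynomial.degree G \<Longrightarrow> p = 0"
proof -
  define Q where "Q d \<longleftrightarrow> (\<exists>p. p \<in> polys_over E \<and> p \<noteq> 0 \<and> poly p z = 0 \<and> Polynomial.degree p = d)" for d
  have "F \<noteq> 0" using F(3) by auto
  then have "Q (Polynomial.degree F)" unfolding Q_def using F by blast
  define d where "d = (LEAST d. Q d)"
  have "Q d" unfolding d_def by (rule LeastI) fact
  then obtain G0 where G0: "G0 \<in> polys_over E" "G0 \<noteq> 0" "poly G0 z = 0" "Polynomial.degree G0 = d" unfolding Q_def by blast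
  have min: "p = 0" if "p \<in> polys_over E" "poly p z = 0" "Polynomial.degree p < d" for p
  proof (rule ccontr)
    assume "p \<noteq> 0"
    then have "d \<le> Polynomial.degree p" unfolding d_def by (intro Least_le) (use that in \<open>auto simp: Q_def\<close>)
    then show False using that by simp
  qed
  define G where "G = Polynomial.smult (inverse (Polynomial.lead_coeff G0)) G0"
  have lc: "Polynomial.lead_coeff G0 \<in> E" using G0 by (simp add: polys_over_def)
  have G: "G \<in> polys_over E" unfolding G_def by (intro polys_over_closed(5)[OF E] subfld_closed(6)[OF E] lc G0)
  have lc0: "Polynomial.lead_coeff G0 \<noteq> 0" using G0(2) by (metis leading_coeff_0_iff)
  then have dG: "Polynomial.degree G = d" using G0(4) unfolding G_def by (metis degree_smult_eq inverse_nonzero_iff_nonzero)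
  have lG: "Polynomial.lead_coeff G = 1" unfolding G_def lead_coeff_smult using lc0 by (rule left_inverse)
  have Gz: "poly G z = 0" using G0 by (simp add: G_def)
  have d1: "d \<ge> 1"
  proof (rule ccontr)
    assume "\<not> d \<ge> 1"
    then have "G = 1" using dG lG by (metis degree_eq_zeroE lead_coeff_pCons(2) less_one not_le one_pCons pCons_0_0 coeff_pCons_0)
    then show False using Gz by simp
  qed
  obtain q r where qr: "F = q * G + r" "q \<in> polys_over E" "r \<in> polys_over E" "r = 0 \<or> Polynomial.degree r < Polynomial.degree G"
    using polys_over_division[OF E G lG F(1)] by blast
  have "poly r z = 0" using F(2) Gz by (simp add: qr(1))
  then have "r = 0" using min[OF qr(3)] qr(4) dG by auto
  then have "poly (pderiv F) z = poly q z * poly (pderiv G) z"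
    using Gz by (simp add: qr(1) pderiv_mult)
  then have "poly (pderiv G) z \<noteq> 0" using F(3) by auto
  then show ?thesis using that[OF G lG Gz] d1 dG min by metis
qed

text \<open>\<open>Gmin\<close> makes \<open>G\<close> the minimal polynomial of \<open>z\<close>;
  it gives the independence of the powers of \<open>z\<close> below \<open>g\<close>, so that
  \<open>adj\<close> is a field of degree \<open>g\<close> over \<open>E\<close>.\<close>

locale simple_ext =
  fixes E :: "'a::field set" and z :: 'a and G :: "'a poly" and g :: nat
  assumes E: "subfld E" and G: "G \<in> polys_over E" "Polynomial.lead_coeff G = 1" "poly G z = 0" and Gd: "Polynomial.degree G = g" "g \<ge> 1"
    and Gsep: "poly (pderiv G) z \<noteq> 0"
    and Gmin: "\<And>p. p \<in> polys_over E \<Longrightarrow> poly p z = 0 \<Longrightarrow> Polynomial.degree p < g \<Longrightarrow> p = 0"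
begin

definition adj :: "'a set" where "adj = {poly p z |p. p \<in> polys_over E}"

lemma E_adj: "c \<in> E \<Longrightarrow> c \<in> adj"
proof -
  assume "c \<in> E"
  then have "Polynomial.monom c 0 \<in> polys_over E" by (rule polys_over_closed(6)[OF E])
  moreover have "c = poly (Polynomial.monom c 0) z" by (simp add: poly_monom)
  ultimately show ?thesis unfolding adj_def by blast
qed

lemma adj_mult: "x \<in> adj \<Longrightarrow> y \<in> adj \<Longrightarrow> x * y \<in> adj"
  unfolding adj_def using polys_over_closed(4)[OF E] by (auto simp flip: poly_mult)

lemma z_adj: "z \<in> adj"
proof -
  have "Polynomial.monom 1 1 \<in> polys_over E" by (rule polys_over_closed(6)[OF E subfld_closed(2)[OF E]])
  moreover have "z = poly (Polynomial.monom 1 1) z" by (simp add: poly_monom)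
  ultimately show ?thesis unfolding adj_def by blast
qed

lemma poly_low: "(\<And>i. i \<ge> g \<Longrightarrow> Polynomial.coeff p i = 0) \<Longrightarrow> poly p z = (\<Sum>i<g. Polynomial.coeff p i * z ^ i)"
proof -
  assume *: "\<And>i. i \<ge> g \<Longrightarrow> Polynomial.coeff p i = 0"
  have "poly p z = (\<Sum>i\<le>Polynomial.degree p. Polynomial.coeff p i * z ^ i)" by (rule poly_altdef)
  also have "\<dots> = (\<Sum>i\<in>{..<g}. Polynomial.coeff p i * z ^ i)"
  proof (cases "p = 0")
    case False
    then have "Polynomial.degree p < g" using * by (metis leI leading_coeff_0_iff)
    then show ?thesis by (intro sum.mono_neutral_left) (auto simp: coeff_eq_0)
  qed simp
  finally show ?thesis by simp
qed

lemma basis_adj: "basis E g (\<lambda>i. z ^ i) adj"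
  unfolding basis_def
proof (intro conjI allI impI)
  fix x
  show "x \<in> adj \<longleftrightarrow> (\<exists>\<kappa>. rep E g (\<lambda>i. z ^ i) x \<kappa>)"
  proof
    assume "x \<in> adj"
    then obtain p where p: "p \<in> polys_over E" "x = poly p z" by (auto simp: adj_def)
    obtain q r where qr: "p = q * G + r" "r \<in> polys_over E" "r = 0 \<or> Polynomial.degree r < g"
      using polys_over_division[OF E G(1,2) p(1)] Gd by metis
    have "x = poly r z" using p(2) G(3) by (simp add: qr(1))
    also have "\<dots> = (\<Sum>i<g. Polynomial.coeff r i * z ^ i)"
      by (rule poly_low) (use qr(3) in \<open>auto simp: coeff_eq_0\<close>)
    finally have "rep E g (\<lambda>i. z ^ i) x (Polynomial.coeff r)" using qr(2) by (simp add: rep_def polys_over_def)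
    then show "\<exists>\<kappa>. rep E g (\<lambda>i. z ^ i) x \<kappa>" by blast
  next
    assume "\<exists>\<kappa>. rep E g (\<lambda>i. z ^ i) x \<kappa>"
    then obtain \<kappa> where \<kappa>: "\<forall>i<g. \<kappa> i \<in> E" "x = (\<Sum>i<g. \<kappa> i * z ^ i)" by (auto simp: rep_def)
    have "(\<Sum>i<g. Polynomial.monom (\<kappa> i) i) \<in> polys_over E"
      by (intro polys_over_sum[OF E] polys_over_closed(6)[OF E]) (use \<kappa> in auto)
    moreover have "x = poly (\<Sum>i<g. Polynomial.monom (\<kappa> i) i) z" using \<kappa>(2) by (simp add: poly_sum poly_monom)
    ultimately show "x \<in> adj" unfolding adj_def by blast
  qed
next
  fix \<kappa> i assume r: "rep E g (\<lambda>i. z ^ i) 0 \<kappa>" and i: "i < g"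
  define p where "p = (\<Sum>i<g. Polynomial.monom (\<kappa> i) i)"
  have co: "Polynomial.coeff p j = (if j < g then \<kappa> j else 0)" for j
    by (simp add: p_def Polynomial.coeff_sum sum.delta)
  have "p \<in> polys_over E" using r subfld_closed(1)[OF E] by (auto simp: polys_over_def co rep_def)
  moreover have "poly p z = 0" using r by (simp add: p_def poly_sum poly_monom rep_def)
  moreover have "Polynomial.degree p < g" using Gd(2) by (intro degree_lessI) (auto simp: co)
  ultimately have "p = 0" by (rule Gmin)
  then show "\<kappa> i = 0" using co[of i] i by simp
qed

sublocale Z: basis_ext E g "\<lambda>i. z ^ i" adj
  by unfold_locales (rule E, rule basis_adj)

lemma subfld_adj: "subfld adj"
  by (rule Z.subfld_of_ring) (auto intro: E_adj adj_mult subfld_closed(2)[OF E])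

text \<open>Euler's dual basis: the quotient of \<open>G\<close> by the linear factor with root \<open>z\<close> has the coefficients \<open>dual l\<close>.\<close>

definition dual :: "nat \<Rightarrow> 'a" where
  "dual l = (\<Sum>k\<in>{Suc l..g}. Polynomial.coeff G k * z ^ (k - 1 - l))"

text \<open>By Euler's formula this coefficient is the trace over \<open>E\<close> of
  \<open>y\<close> divided by the derivative of \<open>G\<close> at \<open>z\<close>; using it
  directly makes duality a matter of reading off coefficients.\<close>

definition top :: "'a \<Rightarrow> 'a" where "top y = crd E g (\<lambda>i. z ^ i) y (g - 1)"

lemma power_adj: "z ^ i \<in> adj"
  by (rule subfld_closed(9)[OF subfld_adj z_adj])

lemma dual_adj: "dual l \<in> adj"
  unfolding dual_def
  by (intro Z.L_sum Z.L_scale power_adj) (use G(1) in \<open>simp add: polys_over_def\<close>)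

lemma top_power_low: "i < g \<Longrightarrow> top (z ^ i) = (if i = g - 1 then 1 else 0)"
  unfolding top_def using Z.crd_basis[of i "g - 1"] Gd(2) by auto

lemma top_scaled_power: "c \<in> E \<Longrightarrow> i < g \<Longrightarrow> top (c * z ^ i) = (if i = g - 1 then c else 0)"
  using Z.crd_scale[OF _ power_adj, of c "g - 1" i] top_power_low[of i] Gd(2) by (auto simp: top_def)

lemma top_sum: "(\<And>j. j \<in> A \<Longrightarrow> f j \<in> adj) \<Longrightarrow> top (sum f A) = (\<Sum>j\<in>A. top (f j))"
  unfolding top_def by (rule Z.crd_of_sum) (use Gd(2) in auto)

lemma top_scale: "c \<in> E \<Longrightarrow> x \<in> adj \<Longrightarrow> top (c * x) = c * top x"
  unfolding top_def by (rule Z.crd_scale) (use Gd(2) in auto)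

lemma G_E: "Polynomial.coeff G k \<in> E" using G(1) by (simp add: polys_over_def)

text \<open>For \<open>i \<le> l\<close> all powers stay below \<open>g\<close>, and only the
  leading term of \<open>G\<close>, with \<open>i = l\<close>, reaches \<open>g - 1\<close>. For
  \<open>i > l\<close> the equation of \<open>z\<close> first trades the upper part of
  \<open>G\<close> for its lower part, and then all powers stay below \<open>g - 1\<close>.\<close>

lemma top_dual:
  assumes "i < g" "l < g" shows "top (z ^ i * dual l) = (if i = l then 1 else 0)"
proof (cases "i \<le> l")
  case True
  have "z ^ i * dual l = (\<Sum>k\<in>{Suc l..g}. Polynomial.coeff G k * z ^ (k - 1 - l + i))"
    unfolding dual_def sum_distrib_left power_add by (intro sum.cong refl) (simp only: mult_ac)
  also have "top \<dots> = (\<Sum>k\<in>{Suc l..g}. top (Polynomial.coeff G k * z ^ (k - 1 - l + i)))"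
    by (intro top_sum Z.L_scale power_adj G_E)
  also have "\<dots> = (\<Sum>k\<in>{Suc l..g}. if k = g then (if i = l then 1 else 0) else 0)"
  proof (rule sum.cong[OF refl])
    fix k assume k: "k \<in> {Suc l..g}"
    have lt: "k - 1 - l + i < g" using k True by auto
    have iff: "k - 1 - l + i = g - 1 \<longleftrightarrow> k = g \<and> i = l" using k True Gd(2) by auto
    show "top (Polynomial.coeff G k * z ^ (k - 1 - l + i)) = (if k = g then if i = l then 1 else 0 else 0)"
      unfolding top_scaled_power[OF G_E lt] iff using G(2) Gd(1) by auto
  qed
  also have "\<dots> = (if i = l then 1 else 0)" using assms(2) by (simp add: sum.delta)
  finally show ?thesis .
next
  case False
  have "0 = (\<Sum>k\<le>g. Polynomial.coeff G k * z ^ k)" using G(3) Gd(1) by (simp add: poly_altdef)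
  also have "{..g} = {..l} \<union> {Suc l..g}" using assms(2) by auto
  also have "(\<Sum>k\<in>{..l} \<union> {Suc l..g}. Polynomial.coeff G k * z ^ k) =
      (\<Sum>k\<le>l. Polynomial.coeff G k * z ^ k) + (\<Sum>k\<in>{Suc l..g}. Polynomial.coeff G k * z ^ k)"
    by (rule sum.union_disjoint) auto
  also have "(\<Sum>k\<in>{Suc l..g}. Polynomial.coeff G k * z ^ k) = z ^ Suc l * dual l"
    unfolding dual_def sum_distrib_left
  proof (rule sum.cong[OF refl])
    fix k assume "k \<in> {Suc l..g}"
    then have "k = Suc l + (k - 1 - l)" by auto
    then have "z ^ k = z ^ Suc l * z ^ (k - 1 - l)" by (metis power_add)
    then show "Polynomial.coeff G k * z ^ k = z ^ Suc l * (Polynomial.coeff G k * z ^ (k - 1 - l))"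
      by (simp only: mult.left_commute)
  qed
  finally have "z ^ Suc l * dual l = (\<Sum>k\<le>l. (- Polynomial.coeff G k) * z ^ k)"
    by (simp add: sum_negf eq_neg_iff_add_eq_0 add.commute del: power_Suc)
  moreover have "i = (i - Suc l) + Suc l" using False by simp
  then have "z ^ i = z ^ (i - Suc l) * z ^ Suc l" by (metis power_add)
  ultimately have "z ^ i * dual l = z ^ (i - Suc l) * (\<Sum>k\<le>l. (- Polynomial.coeff G k) * z ^ k)"
    by (simp only: mult.assoc)
  also have "\<dots> = (\<Sum>k\<le>l. (- Polynomial.coeff G k) * z ^ (k + (i - Suc l)))"
    unfolding sum_distrib_left power_add by (intro sum.cong refl) (simp only: mult_ac)
  also have "top \<dots> = (\<Sum>k\<le>l. top ((- Polynomial.coeff G k) * z ^ (k + (i - Suc l))))"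
    by (intro top_sum Z.L_scale power_adj subfld_closed(5)[OF E G_E])
  also have "\<dots> = 0"
  proof (rule sum.neutral, rule ballI)
    fix k assume "k \<in> {..l}"
    then have "k + (i - Suc l) < g" "k + (i - Suc l) \<noteq> g - 1" using False assms by auto
    then show "top ((- Polynomial.coeff G k) * z ^ (k + (i - Suc l))) = 0"
      using top_scaled_power[OF subfld_closed(5)[OF E G_E]] by simp
  qed
  finally show ?thesis using False by simp
qed

lemma crd_eq_top_dual:
  assumes "y \<in> adj" "l < g" shows "crd E g (\<lambda>i. z ^ i) y l = top (y * dual l)"
proof -
  let ?c = "crd E g (\<lambda>i. z ^ i) y"
  have "y * dual l = (\<Sum>i<g. ?c i * (z ^ i * dual l))"
    by (subst Z.crd_sum[OF assms(1)]) (simp add: sum_distrib_right mult.assoc)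
  also have "top \<dots> = (\<Sum>i<g. top (?c i * (z ^ i * dual l)))"
    by (intro top_sum Z.L_scale adj_mult power_adj dual_adj Z.crd_mem assms) auto
  also have "\<dots> = (\<Sum>i<g. if i = l then ?c i else 0)"
  proof (rule sum.cong[OF refl])
    fix i assume "i \<in> {..<g}"
    then have i: "i < g" by simp
    have "top (?c i * (z ^ i * dual l)) = ?c i * top (z ^ i * dual l)"
      by (intro top_scale Z.crd_mem[OF assms(1) i] adj_mult power_adj dual_adj)
    then show "top (?c i * (z ^ i * dual l)) = (if i = l then ?c i else 0)"
      by (simp add: top_dual[OF i assms(2)])
  qed
  also have "\<dots> = ?c l" using assms(2) by (simp add: sum.delta)
  finally show ?thesis by simp
qed

text \<open>The value at \<open>z\<close> of the quotient of \<open>G\<close> by its linear factor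
  is the derivative there.\<close>

lemma sum_dual: "(\<Sum>l<g. z ^ l * dual l) = poly (pderiv G) z"
proof -
  have "(\<Sum>l<g. z ^ l * dual l) = (\<Sum>l<g. \<Sum>k\<in>{Suc l..g}. Polynomial.coeff G k * z ^ (k - 1))"
  proof (rule sum.cong[OF refl])
    fix l assume "l \<in> {..<g}"
    show "z ^ l * dual l = (\<Sum>k\<in>{Suc l..g}. Polynomial.coeff G k * z ^ (k - 1))"
      unfolding dual_def sum_distrib_left
    proof (rule sum.cong[OF refl])
      fix k assume "k \<in> {Suc l..g}"
      then have "k - 1 = l + (k - 1 - l)" by auto
      then have "z ^ (k - 1) = z ^ l * z ^ (k - 1 - l)" by (metis power_add)
      then show "z ^ l * (Polynomial.coeff G k * z ^ (k - 1 - l)) = Polynomial.coeff G k * z ^ (k - 1)"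
        by (simp only: mult.left_commute)
    qed
  qed
  also have "\<dots> = (\<Sum>k\<in>{1..g}. \<Sum>l<k. Polynomial.coeff G k * z ^ (k - 1))"
    unfolding sum.Sigma[OF finite_lessThan ballI[OF finite_atLeastAtMost]]
      sum.Sigma[OF finite_atLeastAtMost ballI[OF finite_lessThan]]
    by (rule sum.reindex_bij_witness[of _ "\<lambda>(k,l). (l,k)" "\<lambda>(l,k). (k,l)"]) auto
  also have "\<dots> = (\<Sum>k\<in>{1..g}. of_nat k * Polynomial.coeff G k * z ^ (k - 1))"
    by (simp add: mult.assoc)
  also have "\<dots> = (\<Sum>k<g. of_nat (Suc k) * Polynomial.coeff G (Suc k) * z ^ k)"
    by (rule sum.reindex_bij_witness[of _ Suc "\<lambda>k. k - 1"]) auto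
  also have "\<dots> = poly (pderiv G) z"
    by (subst poly_low) (auto simp: coeff_pderiv coeff_eq_0 Gd(1))
  finally show ?thesis .
qed

end

section \<open>Towers and the transitivity of the trace\<close>

locale tower = basis_ext K n b E + simple_ext E z G g for K n b E z G g
begin

definition tb :: "nat \<Rightarrow> 'a" where "tb j = b (j div g) * z ^ (j mod g)"

lemma K_E: "1 \<in> E \<Longrightarrow> c \<in> K \<Longrightarrow> c \<in> E"
  using L_scale[of c 1] by simp

lemma rep_tower:
  assumes "x \<in> adj"
  shows "rep K (n * g) tb x (\<lambda>j. crd K n b (crd E g (\<lambda>i. z ^ i) x (j mod g)) (j div g))"
  unfolding rep_def
proof (intro conjI allI impI)
  fix j assume "j < n * g"
  then have "j div g < n" "j mod g < g" using Gd(2) by (auto simp: less_mult_imp_div_less)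
  then show "crd K n b (crd E g (\<lambda>i. z ^ i) x (j mod g)) (j div g) \<in> K"
    by (intro crd_mem Z.crd_mem assms)
next
  let ?e = "crd E g (\<lambda>i. z ^ i) x"
  have "(\<Sum>j<n*g. crd K n b (?e (j mod g)) (j div g) * tb j) = (\<Sum>i<n. \<Sum>l<g. crd K n b (?e l) i * (b i * z ^ l))"
    unfolding tb_def by (rule sum_div_mod)
  also have "\<dots> = (\<Sum>l<g. (\<Sum>i<n. crd K n b (?e l) i * b i) * z ^ l)"
    by (subst sum.swap) (simp add: sum_distrib_right mult.assoc)
  also have "\<dots> = (\<Sum>l<g. ?e l * z ^ l)"
    by (intro sum.cong refl) (simp flip: crd_sum[OF Z.crd_mem[OF assms]])
  also have "\<dots> = x" by (rule Z.crd_sum[OF assms, symmetric])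
  finally show "x = (\<Sum>j<n*g. crd K n b (?e (j mod g)) (j div g) * tb j)" by simp
qed

lemma basis_tower: "basis K (n * g) tb adj"
  unfolding basis_def
proof (intro conjI allI impI)
  fix x show "x \<in> adj \<longleftrightarrow> (\<exists>\<kappa>. rep K (n * g) tb x \<kappa>)"
  proof
    assume "\<exists>\<kappa>. rep K (n * g) tb x \<kappa>"
    then obtain \<kappa> where \<kappa>: "\<forall>j<n*g. \<kappa> j \<in> K" "x = (\<Sum>j<n*g. \<kappa> j * tb j)" by (auto simp: rep_def)
    have "tb j \<in> adj" if "j < n * g" for j
      unfolding tb_def using that by (intro adj_mult E_adj b_in power_adj) (auto simp: less_mult_imp_div_less)
    moreover have "\<kappa> j \<in> adj" if "j < n * g" for j
      using \<kappa>(1) that E_adj K_E[OF subfld_closed(2)[OF E]] by blast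
    ultimately show "x \<in> adj" unfolding \<kappa>(2) by (intro Z.L_sum adj_mult) auto
  qed (use rep_tower in blast)
next
  fix \<kappa> j assume r: "rep K (n * g) tb 0 \<kappa>" and j: "j < n * g"
  define e where "e l = (\<Sum>i<n. \<kappa> (i * g + l) * b i)" for l
  have idx: "i * g + l < n * g" if "i < n" "l < g" for i l
  proof -
    have "i * g + l < Suc i * g" using that by simp
    also have "\<dots> \<le> n * g" using that by (intro mult_le_mono1) simp
    finally show ?thesis .
  qed
  have re: "rep K n b (e l) (\<lambda>i. \<kappa> (i * g + l))" if "l < g" for l
    using r idx that by (auto simp: rep_def e_def)
  have "(\<Sum>j<n*g. \<kappa> j * tb j) = (\<Sum>j<n*g. \<kappa> (j div g * g + j mod g) * (b (j div g) * z ^ (j mod g)))"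
    by (simp add: tb_def)
  also have "\<dots> = (\<Sum>i<n. \<Sum>l<g. \<kappa> (i * g + l) * (b i * z ^ l))"
    by (rule sum_div_mod[where F = "\<lambda>i l. \<kappa> (i * g + l) * (b i * z ^ l)"])
  also have "\<dots> = (\<Sum>l<g. e l * z ^ l)"
    unfolding e_def by (subst sum.swap) (simp add: sum_distrib_right mult.assoc)
  finally have "rep E g (\<lambda>i. z ^ i) 0 e" using r re rep_in by (auto simp: rep_def)
  then have "e l = 0" if "l < g" for l using basis_adj that unfolding basis_def by blast
  then have "rep K n b 0 (\<lambda>i. \<kappa> (i * g + l))" if "l < g" for l using re[OF that] that by simp
  then have z: "\<kappa> (i * g + l) = 0" if "l < g" "i < n" for i l using bas that unfolding basis_def by blast
  have "j div g < n" "j mod g < g" using j Gd(2) by (auto simp: less_mult_imp_div_less)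
  then have "\<kappa> (j div g * g + j mod g) = 0" by (intro z)
  then show "\<kappa> j = 0" by simp
qed

text \<open>Transitivity of the trace with Euler's formula built in: the diagonal coordinates over
  \<open>E\<close> are \<open>top\<close> of products with the dual basis, and the products of
  powers of \<open>z\<close> with the dual basis add up to the derivative of
  \<open>G\<close>.\<close>

lemma trace_tower:
  assumes "x \<in> adj"
  shows "trace K (n * g) tb x = trace K n b (top (x * poly (pderiv G) z))"
proof -
  interpret T: basis_ext K "n * g" tb adj by unfold_locales (rule K, rule basis_tower)
  have bE: "b i \<in> adj" if "i < n" for i using that by (intro E_adj b_in)
  have topE: "top y \<in> E" if "y \<in> adj" for y unfolding top_def by (rule Z.crd_mem[OF that]) (use Gd(2) in simp)
  have "trace K (n * g) tb x = (\<Sum>j<n*g. crd K n b (crd E g (\<lambda>i. z ^ i) (x * (b (j div g) * z ^ (j mod g))) (j mod g)) (j div g))"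
    unfolding trace_def
  proof (rule sum.cong[OF refl])
    fix j assume j: "j \<in> {..<n*g}"
    have "x * tb j \<in> adj"
      unfolding tb_def using j by (intro adj_mult assms bE power_adj) (auto simp: less_mult_imp_div_less)
    then show "crd K (n * g) tb (x * tb j) j = crd K n b (crd E g (\<lambda>i. z ^ i) (x * (b (j div g) * z ^ (j mod g))) (j mod g)) (j div g)"
      using T.crd_eqI[OF rep_tower, of "x * tb j" j] j by (simp add: tb_def)
  qed
  also have "\<dots> = (\<Sum>i<n. \<Sum>l<g. crd K n b (crd E g (\<lambda>i. z ^ i) (x * (b i * z ^ l)) l) i)"
    by (rule sum_div_mod[where F = "\<lambda>i l. crd K n b (crd E g (\<lambda>i. z ^ i) (x * (b i * z ^ l)) l) i"])
  also have "\<dots> = (\<Sum>i<n. crd K n b (top (x * poly (pderiv G) z) * b i) i)"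
  proof (rule sum.cong[OF refl])
    fix i assume "i \<in> {..<n}"
    then have i: "i < n" by simp
    have "(\<Sum>l<g. crd K n b (crd E g (\<lambda>i. z ^ i) (x * (b i * z ^ l)) l) i)
        = (\<Sum>l<g. crd K n b (top (x * (b i * z ^ l) * dual l)) i)"
      by (intro sum.cong refl) (simp add: crd_eq_top_dual adj_mult assms bE i power_adj)
    also have "\<dots> = crd K n b (\<Sum>l<g. top (x * (b i * z ^ l) * dual l)) i"
      by (rule crd_of_sum[OF _ i, symmetric]) (intro topE adj_mult assms bE i power_adj dual_adj)
    also have "(\<Sum>l<g. top (x * (b i * z ^ l) * dual l)) = top (\<Sum>l<g. x * (b i * z ^ l) * dual l)"
      by (rule top_sum[symmetric]) (intro adj_mult assms bE i power_adj dual_adj)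
    also have "(\<Sum>l<g. x * (b i * z ^ l) * dual l) = b i * (x * poly (pderiv G) z)"
      unfolding sum_dual[symmetric] sum_distrib_left by (intro sum.cong refl) (simp add: mult_ac)
    also have "top \<dots> = b i * top (x * poly (pderiv G) z)"
    proof (rule top_scale[OF b_in[OF i]])
      have "poly (pderiv G) z \<in> adj"
        unfolding sum_dual[symmetric] by (intro Z.L_sum adj_mult power_adj dual_adj)
      then show "x * poly (pderiv G) z \<in> adj" by (intro adj_mult assms)
    qed
    finally show "(\<Sum>l<g. crd K n b (crd E g (\<lambda>i. z ^ i) (x * (b i * z ^ l)) l) i)
      = crd K n b (top (x * poly (pderiv G) z) * b i) i" by (simp add: mult.commute)
  qed
  finally show ?thesis by (simp add: trace_def)
qed

text \<open>Separability enters here: dividing by the nonzero derivative of \<open>G\<close> at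
  \<open>z\<close> produces an element to which the trace formula assigns the given
  \<open>w\<close>.\<close>

lemma trace_tower_nonzero:
  assumes "w \<in> E" "trace K n b w \<noteq> 0"
  obtains x where "x \<in> adj" "trace K (n * g) tb x \<noteq> 0"
proof -
  have d: "poly (pderiv G) z \<in> adj"
    unfolding sum_dual[symmetric] by (intro Z.L_sum adj_mult power_adj dual_adj)
  define x where "x = w * z ^ (g - 1) / poly (pderiv G) z"
  have "x \<in> adj" unfolding x_def
    by (intro subfld_closed(8)[OF subfld_adj] adj_mult E_adj assms power_adj d)
  moreover have "top (x * poly (pderiv G) z) = w"
    using top_scaled_power[OF assms(1), of "g - 1"] Gd(2) Gsep by (simp add: x_def)
  ultimately show ?thesis using that trace_tower assms(2) by metis
qed

end

section \<open>Noether normalization\<close>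

context field_embedding
begin

text \<open>A coarse form of finiteness: one set \<open>W\<close> of generators serves all degrees,
  with coefficients of degree at most \<open>m\<close> in \<open>y\<close>. It is what bounds
  denominators later.\<close>

definition lin_span :: "('v::finite \<Rightarrow> 'o) \<Rightarrow> 'o set \<Rightarrow> nat \<Rightarrow> 'o set" where
  "lin_span y W m = {\<Sum>w\<in>W. \<kappa> w * w |\<kappa>. \<forall>w\<in>W. \<kappa> w \<in> V y m}"

lemma lin_span_add:
  assumes "a \<in> lin_span y W m" "b \<in> lin_span y W m" shows "a + b \<in> lin_span y W m"
proof -
  obtain \<kappa> \<mu> where *: "a = (\<Sum>w\<in>W. \<kappa> w * w)" "b = (\<Sum>w\<in>W. \<mu> w * w)" "\<forall>w\<in>W. \<kappa> w \<in> V y m" "\<forall>w\<in>W. \<mu> w \<in> V y m"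
    using assms unfolding lin_span_def by blast
  have "a + b = (\<Sum>w\<in>W. (\<kappa> w + \<mu> w) * w)" by (simp add: * distrib_right sum.distrib)
  moreover have "\<forall>w\<in>W. \<kappa> w + \<mu> w \<in> V y m" using * linsub_closed(2)[OF linsub_V] by blast
  ultimately show ?thesis unfolding lin_span_def by (intro CollectI exI[of _ "\<lambda>w. \<kappa> w + \<mu> w"]) simp
qed

lemma lin_span_zero: "0 \<in> lin_span y W m"
  unfolding lin_span_def by (intro CollectI exI[of _ "\<lambda>_. 0"]) simp

lemma lin_span_sum: "(\<And>i. i \<in> A \<Longrightarrow> f i \<in> lin_span y W m) \<Longrightarrow> sum f A \<in> lin_span y W m"
  by (induction A rule: infinite_finite_induct) (auto intro: lin_span_add lin_span_zero)

lemma lin_span_single: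
  assumes "finite W" "w \<in> W" "c \<in> V y m" shows "c * w \<in> lin_span y W m"
proof -
  have "c * w = (\<Sum>u\<in>W. (if u = w then c else 0) * u)"
    using assms by (simp add: sum.delta if_distrib[of "\<lambda>x. x * _"] cong: if_cong)
  then show ?thesis unfolding lin_span_def using assms(3)
    by (intro CollectI exI[of _ "\<lambda>u. if u = w then c else 0"]) auto
qed

text \<open>A denominator evaluating to 0 gives the element 0, so no side condition on
  \<open>g\<close> is imposed.\<close>

definition quot_field :: "('v::finite \<Rightarrow> 'o) \<Rightarrow> 'o set" where
  "quot_field y = {ev y f / ev y g |f g. True}"

lemma subfld_quot_field: "subfld (quot_field y)"
  unfolding subfld_def
proof (intro conjI ballI)
  have one: "ev y 1 = 1" by simp
  have "0 = ev y 0 / ev y 1" "1 = ev y 1 / ev y 1" by auto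
  then show "0 \<in> quot_field y" "1 \<in> quot_field y" unfolding quot_field_def by blast+
next
  fix a b assume ab: "a \<in> quot_field y" "b \<in> quot_field y"
  then obtain f g h k where *: "a = ev y f / ev y g" "b = ev y h / ev y k" unfolding quot_field_def by blast
  show "a * b \<in> quot_field y"
    using * unfolding quot_field_def by (auto simp flip: ev_mult)
  show "a + b \<in> quot_field y"
  proof (cases "ev y g = 0 \<or> ev y k = 0")
    case True
    then have "a = 0 \<or> b = 0" using * by auto
    then show ?thesis using ab by auto
  next
    case False
    then have "a + b = ev y (f * k + h * g) / ev y (g * k)"
      by (simp add: * ev_add ev_mult add_frac_eq)
    then show ?thesis unfolding quot_field_def by blast
  qed
next
  fix a assume "a \<in> quot_field y"
  then obtain f g where *: "a = ev y f / ev y g" unfolding quot_field_def by blast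
  have "- a = ev y (- f) / ev y g" by (simp add: * ev_uminus)
  then show "- a \<in> quot_field y" unfolding quot_field_def by blast
  have "inverse a = ev y g / ev y f" by (simp add: *)
  then show "inverse a \<in> quot_field y" unfolding quot_field_def by blast
qed

lemma V_quot_field: "V y m \<subseteq> quot_field y"
proof
  fix a assume "a \<in> V y m"
  then obtain f where "a = ev y f" by (auto simp: V_def)
  then have "a = ev y f / ev y 1" by simp
  then show "a \<in> quot_field y" unfolding quot_field_def by blast
qed

lemma V_in_subfld:
  assumes E: "subfld E" and c: "\<And>c. \<iota> c \<in> E" and x: "\<And>v. x v \<in> E"
  shows "V x m \<subseteq> E"
proof
  fix a assume "a \<in> V x m"
  then obtain f where a: "a = ev x f" by (auto simp: V_def)
  have "(\<Prod>v\<in>A. x v ^ lookup t v) \<in> E" for t A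
    by (induction A rule: infinite_finite_induct) (auto intro: subfld_closed[OF E] x)
  then show "a \<in> E" unfolding a ev_def mon_def by (intro subfld_sum[OF E] subfld_closed(4)[OF E] c)
qed

text \<open>The finer form for one step: powers of \<open>z\<close> below \<open>e\<close> with
  coefficients of complementary degree. The zero clause again guards the truncated
  \<open>m - i\<close>.\<close>

definition wspan :: "('v::finite \<Rightarrow> 'o) \<Rightarrow> nat \<Rightarrow> 'o \<Rightarrow> nat \<Rightarrow> 'o set" where
  "wspan y e z m = {\<Sum>i<e. c i * z ^ i |c. \<forall>i<e. if i \<le> m then c i \<in> V y (m - i) else c i = 0}"

lemma wspan_add:
  assumes "a \<in> wspan y e z m" "b \<in> wspan y e z m" shows "a + b \<in> wspan y e z m"
proof -
  obtain c d where *: "a = (\<Sum>i<e. c i * z ^ i)" "b = (\<Sum>i<e. d i * z ^ i)"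
    "\<forall>i<e. if i \<le> m then c i \<in> V y (m - i) else c i = 0" "\<forall>i<e. if i \<le> m then d i \<in> V y (m - i) else d i = 0"
    using assms unfolding wspan_def by blast
  have "a + b = (\<Sum>i<e. (c i + d i) * z ^ i)" by (simp add: * distrib_right sum.distrib)
  moreover have "\<forall>i<e. if i \<le> m then c i + d i \<in> V y (m - i) else c i + d i = 0"
  proof (intro allI impI)
    fix i assume "i < e"
    then have "if i \<le> m then c i \<in> V y (m - i) else c i = 0" "if i \<le> m then d i \<in> V y (m - i) else d i = 0"
      using *(3,4) by simp_all
    then show "if i \<le> m then c i + d i \<in> V y (m - i) else c i + d i = 0"
      using linsub_closed(2)[OF linsub_V, of "c i" y "m - i" "d i"] by (cases "i \<le> m") simp_all
  qed
  ultimately show ?thesis unfolding wspan_def by (intro CollectI exI[of _ "\<lambda>i. c i + d i"]) simp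
qed

lemma wspan_scale:
  assumes "a \<in> wspan y e z m" "b \<in> V y j" shows "b * a \<in> wspan y e z (m + j)"
proof -
  obtain c where *: "a = (\<Sum>i<e. c i * z ^ i)" "\<forall>i<e. if i \<le> m then c i \<in> V y (m - i) else c i = 0"
    using assms unfolding wspan_def by blast
  have "b * a = (\<Sum>i<e. (b * c i) * z ^ i)" by (simp add: * sum_distrib_left mult.assoc)
  moreover have "if i \<le> m + j then b * c i \<in> V y (m + j - i) else b * c i = 0" if "i < e" for i
  proof (cases "i \<le> m")
    case True
    then have "b * c i \<in> V y (j + (m - i))" using * that assms(2) by (intro V_mult) auto
    moreover have "j + (m - i) = m + j - i" using True by simp
    ultimately show ?thesis using True by simp
  next
    case False
    then have "c i = 0" using * that by auto
    then show ?thesis by simp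
  qed
  ultimately show ?thesis unfolding wspan_def by (intro CollectI exI[of _ "\<lambda>i. b * c i"]) simp
qed

lemma wspan_zero: "0 \<in> wspan y e z m"
  unfolding wspan_def by (intro CollectI exI[of _ "\<lambda>_. 0"]) simp

lemma wspan_sum: "(\<And>i. i \<in> A \<Longrightarrow> f i \<in> wspan y e z m) \<Longrightarrow> sum f A \<in> wspan y e z m"
  by (induction A rule: infinite_finite_induct) (auto intro: wspan_add wspan_zero)

lemma wspan_power_low: "i < e \<Longrightarrow> z ^ i \<in> wspan y e z i"
proof -
  assume i: "i < e"
  have "z ^ i = (\<Sum>j<e. (if j = i then 1 else 0) * z ^ j)"
    using i by (simp add: sum.delta if_distrib[of "\<lambda>x. x * _"] cong: if_cong)
  then show ?thesis unfolding wspan_def by (intro CollectI exI[of _ "\<lambda>j. if j = i then 1 else 0"]) auto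
qed

context
  fixes x' :: "'v::finite \<Rightarrow> 'o" and e :: nat and G :: "'o poly" and z :: 'o
  assumes e1: "1 \<le> e" and Gz: "poly G z = 0" and Gg: "graded_poly x' e G" and Gm: "Polynomial.coeff G e = 1"
begin

text \<open>Higher powers are reduced by the monic equation; since it is graded, replacing
  \<open>z ^ e\<close> does not raise the joint degree.\<close>

lemma wspan_power: "z ^ n \<in> wspan x' e z n"
proof (induction n rule: less_induct)
  case (less n)
  show ?case
  proof (cases "n < e")
    case False
    have hi: "Polynomial.coeff G i = 0" if "i > e" for i
    proof -
      have "if i \<le> e then Polynomial.coeff G i \<in> V x' (e - i) else Polynomial.coeff G i = 0"
        using Gg unfolding graded_poly_def by blast
      then show ?thesis using that by simp
    qed
    have lo: "Polynomial.coeff G i \<in> V x' (e - i)" if "i \<le> e" for i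
    proof -
      have "if i \<le> e then Polynomial.coeff G i \<in> V x' (e - i) else Polynomial.coeff G i = 0"
        using Gg unfolding graded_poly_def by blast
      then show ?thesis using that by simp
    qed
    have "Polynomial.degree G \<le> e" by (rule degree_le) (use hi in auto)
    then have "poly G z = (\<Sum>i\<le>e. Polynomial.coeff G i * z ^ i)"
      unfolding poly_altdef by (intro sum.mono_neutral_left) (auto simp: coeff_eq_0)
    then have "(\<Sum>i<e. Polynomial.coeff G i * z ^ i) + z ^ e = 0"
      using Gz Gm by (simp flip: lessThan_Suc_atMost)
    then have "z ^ e = - (\<Sum>i<e. Polynomial.coeff G i * z ^ i)" by (simp add: add_eq_0_iff)
    moreover have "n = (n - e) + e" using False by simp
    then have "z ^ n = z ^ (n - e) * z ^ e" by (metis power_add)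
    ultimately have "z ^ n = z ^ (n - e) * (- (\<Sum>i<e. Polynomial.coeff G i * z ^ i))" by simp
    also have "\<dots> = (\<Sum>i<e. (- Polynomial.coeff G i) * z ^ (n - e + i))"
      unfolding sum_negf[symmetric] sum_distrib_left power_add by (intro sum.cong refl) (simp add: mult_ac)
    also have "\<dots> \<in> wspan x' e z n"
    proof (rule wspan_sum)
      fix i assume "i \<in> {..<e}"
      then have i: "i < e" by simp
      have "n - e + i < n" using i False by simp
      then have "z ^ (n - e + i) \<in> wspan x' e z (n - e + i)" by (rule less)
      moreover have "- Polynomial.coeff G i \<in> V x' (e - i)"
        by (rule linsub_closed(4)[OF linsub_V lo]) (use i in simp)
      ultimately have "(- Polynomial.coeff G i) * z ^ (n - e + i) \<in> wspan x' e z (n - e + i + (e - i))"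
        by (rule wspan_scale)
      moreover have "n - e + i + (e - i) = n" using i False by simp
      ultimately show "(- Polynomial.coeff G i) * z ^ (n - e + i) \<in> wspan x' e z n" by simp
    qed
    finally show ?thesis .
  qed (rule wspan_power_low)
qed

lemma V_sub_wspan:
  assumes "x = (\<lambda>v. x' v + z * \<iota> (a v))" shows "V x m \<subseteq> wspan x' e z m"
proof
  fix b assume "b \<in> V x m"
  then obtain f where f: "f \<in> deg_le m" "b = ev x f" by (auto simp: V_def)
  have gr: "graded_poly x' m (line x' a f)" by (rule graded_poly_line[OF f(1)])
  have lo: "if i \<le> m then Polynomial.coeff (line x' a f) i \<in> V x' (m - i) else Polynomial.coeff (line x' a f) i = 0" for i
    using gr unfolding graded_poly_def by blast
  have "Polynomial.degree (line x' a f) \<le> m" by (rule degree_le) (use lo in \<open>auto split: if_splits\<close>)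
  then have "poly (line x' a f) z = (\<Sum>i\<le>m. Polynomial.coeff (line x' a f) i * z ^ i)"
    unfolding poly_altdef by (intro sum.mono_neutral_left) (auto simp: coeff_eq_0)
  moreover have "b = poly (line x' a f) z" unfolding f(2) poly_line assms ..
  moreover have "(\<Sum>i\<le>m. Polynomial.coeff (line x' a f) i * z ^ i) \<in> wspan x' e z m"
  proof (rule wspan_sum)
    fix i assume "i \<in> {..m}"
    then have i: "i \<le> m" by simp
    have "Polynomial.coeff (line x' a f) i * z ^ i \<in> wspan x' e z (i + (m - i))"
      by (rule wspan_scale[OF wspan_power]) (use lo[of i] i in simp)
    then show "Polynomial.coeff (line x' a f) i * z ^ i \<in> wspan x' e z m" using i by simp
  qed
  ultimately show "b \<in> wspan x' e z m" by simp
qed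

end

lemma wspan_sub_lin_span:
  assumes W: "finite W" "\<And>m. V x' m \<subseteq> lin_span y W m"
  shows "wspan x' e z m \<subseteq> lin_span y ((\<lambda>(w, i). w * z ^ i) ` (W \<times> {..<e})) m"
proof
  let ?W = "(\<lambda>(w, i). w * z ^ i) ` (W \<times> {..<e})"
  have fin: "finite ?W" using W(1) by simp
  fix a assume "a \<in> wspan x' e z m"
  then obtain c where c: "a = (\<Sum>i<e. c i * z ^ i)" "\<forall>i<e. if i \<le> m then c i \<in> V x' (m - i) else c i = 0"
    unfolding wspan_def by blast
  have "c i * z ^ i \<in> lin_span y ?W m" if i: "i < e" for i
  proof -
    have "c i \<in> V x' m"
      using c(2) i V_mono[of "m - i" m x'] by (cases "i \<le> m") auto
    then obtain \<kappa> where \<kappa>: "c i = (\<Sum>w\<in>W. \<kappa> w * w)" "\<forall>w\<in>W. \<kappa> w \<in> V y m"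
      using W(2)[of m] unfolding lin_span_def by blast
    have "c i * z ^ i = (\<Sum>w\<in>W. \<kappa> w * (w * z ^ i))" by (simp add: \<kappa>(1) sum_distrib_right mult.assoc)
    also have "\<dots> \<in> lin_span y ?W m"
      by (intro lin_span_sum lin_span_single fin) (use \<kappa>(2) i in auto)
    finally show ?thesis .
  qed
  then show "a \<in> lin_span y ?W m" unfolding c(1) by (intro lin_span_sum) auto
qed

text \<open>The invariant of Noether normalization. The inequality for monotone
  \<open>\<phi>\<close> stands for the statement that \<open>\<delta> j\<close> is at most
  \<open>j\<close> after reordering, in a form that needs no permutation and passes through towers.
  The existence of a nonzero trace amounts to nondegeneracy of the trace form.\<close>

definition normalized :: "('v::finite \<Rightarrow> 'o) \<Rightarrow> 'v set \<Rightarrow> ('v \<Rightarrow> 'o) \<Rightarrow> 'o set \<Rightarrow> nat \<Rightarrow> (nat \<Rightarrow> 'o) \<Rightarrow> (nat \<Rightarrow> nat) \<Rightarrow> 'o set \<Rightarrow> bool" where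
  "normalized x S y W n b \<delta> L \<longleftrightarrow>
    (\<forall>f\<in>vars_in S. ev y f = 0 \<longrightarrow> f = 0) \<and> (\<forall>v. v \<notin> S \<longrightarrow> y v = 0) \<and> (\<forall>v. y v \<in> V x 1) \<and>
    finite W \<and> W \<subseteq> L \<and> (\<forall>m. V x m \<subseteq> lin_span y W m) \<and>
    subfld L \<and> basis (quot_field y) n b L \<and> (\<forall>v. x v \<in> L) \<and> (\<forall>j<n. b j \<in> V x (\<delta> j)) \<and>
    (\<forall>\<phi>::nat \<Rightarrow> nat. mono \<phi> \<longrightarrow> (\<Sum>j<n. \<phi> (\<delta> j)) \<le> (\<Sum>j<n. \<phi> j)) \<and>
    (\<exists>w\<in>L. trace (quot_field y) n b w \<noteq> 0)"

lemma normalized_trivial: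
  assumes ind: "\<And>f. f \<in> vars_in S \<Longrightarrow> ev x f = 0 \<Longrightarrow> f = 0" and x0: "\<And>v. v \<notin> S \<Longrightarrow> x v = 0"
  shows "normalized x S x {1} 1 (\<lambda>_. 1) (\<lambda>_. 0) (quot_field x)"
proof -
  let ?K = "quot_field x"
  have K: "subfld ?K" by (rule subfld_quot_field)
  have rep: "rep ?K 1 (\<lambda>_. 1) c \<kappa> \<longleftrightarrow> \<kappa> 0 = c \<and> c \<in> ?K" for c \<kappa> by (auto simp: rep_def)
  have bas: "basis ?K 1 (\<lambda>_. 1) ?K"
    unfolding basis_def rep
  proof (intro conjI allI impI)
    fix c show "c \<in> ?K \<longleftrightarrow> (\<exists>\<kappa>. \<kappa> 0 = c \<and> c \<in> ?K)" for c :: 'o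
      by (auto intro: exI[of _ "\<lambda>_. c"])
  qed auto
  interpret basis_ext ?K 1 "\<lambda>_. 1" ?K by unfold_locales (rule K, rule bas)
  have "crd ?K 1 (\<lambda>_. 1) 1 0 = 1"
    by (rule crd_eqI[of 1 "\<lambda>_. 1"]) (simp_all add: rep_def subfld_closed(2)[OF K])
  then have "trace ?K 1 (\<lambda>_. 1) 1 \<noteq> 0" by (simp add: trace_def)
  moreover have "V x m \<subseteq> lin_span x {1} m" for m
    using lin_span_single[of "{1}" 1 _ x m] by auto
  moreover have "x v \<in> ?K" for v using V_var[of x v] V_quot_field by blast
  ultimately show ?thesis
    unfolding normalized_def using ind x0 V_var K bas subfld_closed(2)[OF K]
    by (intro conjI) auto
qed

text \<open>Each relation removes one variable: the induction hypothesis normalizes the projected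
  point \<open>x'\<close>, and \<open>x\<close> is recovered by adjoining \<open>z\<close>. The
  number of variables drops until the point is independent.\<close>

lemma normal_form_exists:
  fixes x :: "'v::finite \<Rightarrow> 'o"
  assumes inf: "infinite (UNIV :: 'f set)" and sep: maclane_separable and x0: "\<And>v. v \<notin> S \<Longrightarrow> x v = 0"
  shows "\<exists>S y W n b \<delta> L. normalized x S y W n b \<delta> L"
  using x0
proof (induction "card S" arbitrary: S x rule: less_induct)
  case less
  show ?case
  proof (cases "\<exists>F\<in>vars_in S. ev x F = 0 \<and> F \<noteq> 0")
    case False
    then have "normalized x S x {1} 1 (\<lambda>_. 1) (\<lambda>_. 0) (quot_field x)"
      by (intro normalized_trivial) (use less.prems in auto)
    then show ?thesis by blast
  next
    case True
    then obtain F0 where F0: "F0 \<in> vars_in S" "F0 \<noteq> 0" "ev x F0 = 0" by blast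
    obtain l x' z a e G where st: "l \<in> S" "x' = (\<lambda>v. x v - z * \<iota> (a v))" "\<And>v. v \<notin> S - {l} \<Longrightarrow> x' v = 0"
      "z \<in> V x 1" "1 \<le> e" "poly G z = 0" "graded_poly x' e G" "Polynomial.coeff G e = 1" "poly (pderiv G) z \<noteq> 0"
      by (rule normalization_step[OF inf sep F0]) (rule less.prems, assumption, rule that)
    have "card (S - {l}) < card S" by (rule card_Diff1_less) (use st(1) in simp_all)
    from less.hyps[OF this, of x'] st(3)
    obtain S0 y W n b \<delta> E where N: "normalized x' S0 y W n b \<delta> E" by blast
    let ?K = "quot_field y"
    have x: "x = (\<lambda>v. x' v + z * \<iota> (a v))" by (simp add: st(2))
    have E: "subfld E" and bE: "basis ?K n b E" and x'E: "\<And>v. x' v \<in> E"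
      and W: "finite W" "W \<subseteq> E" "\<And>m. V x' m \<subseteq> lin_span y W m"
      and b\<delta>: "\<And>j. j < n \<Longrightarrow> b j \<in> V x' (\<delta> j)"
      and phi: "\<And>\<phi>::nat \<Rightarrow> nat. mono \<phi> \<Longrightarrow> (\<Sum>j<n. \<phi> (\<delta> j)) \<le> (\<Sum>j<n. \<phi> j)"
      using N unfolding normalized_def by blast+
    obtain w where w: "w \<in> E" "trace ?K n b w \<noteq> 0" using N unfolding normalized_def by blast
    interpret B: basis_ext ?K n b E by unfold_locales (rule subfld_quot_field, rule bE)
    have KE: "c \<in> E" if "c \<in> ?K" for c using B.L_scale[OF that subfld_closed(2)[OF E]] by simp
    have iE: "\<iota> c \<in> E" for c using KE V_quot_field V_scalar by blast
    have VE: "V x' m \<subseteq> E" for m by (rule V_in_subfld[OF E iE x'E])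
    have "G \<in> polys_over E"
      unfolding polys_over_def
    proof (rule CollectI, rule allI)
      fix i
      have "if i \<le> e then Polynomial.coeff G i \<in> V x' (e - i) else Polynomial.coeff G i = 0"
        using st(7) unfolding graded_poly_def by blast
      then show "Polynomial.coeff G i \<in> E" using VE subfld_closed(1)[OF E] by (auto split: if_splits)
    qed
    \<comment> \<open>The minimal polynomial \<open>H\<close> over \<open>E\<close> may have smaller
      degree than \<open>G\<close>, and nothing bounds the degrees of its coefficients. So the basis
      uses powers of \<open>z\<close> below the degree of \<open>H\<close>, while the generators
      with controlled degrees use powers below \<open>e\<close>.\<close>
    then obtain H where H: "H \<in> polys_over E" "Polynomial.lead_coeff H = 1" "poly H z = 0" "poly (pderiv H) z \<noteq> 0" "Polynomial.degree H \<ge> 1"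
      "\<And>p. p \<in> polys_over E \<Longrightarrow> poly p z = 0 \<Longrightarrow> Polynomial.degree p < Polynomial.degree H \<Longrightarrow> p = 0"
      using separable_minimal_polynomial[OF E _ st(6,9)] by metis
    define g where "g = Polynomial.degree H"
    interpret T: tower ?K n b E z H g
      by unfold_locales (use E H in \<open>auto simp: g_def\<close>)
    let ?W = "(\<lambda>(w, i). w * z ^ i) ` (W \<times> {..<e})"
    define \<delta>' where "\<delta>' j = \<delta> (j div g) + j mod g" for j
    have x'V: "V x' m \<subseteq> V x m" for m
    proof (rule V_substitute)
      fix v
      have "x v - \<iota> (a v) * z \<in> V x 1" by (intro linsub_closed(5,3)[OF linsub_V] V_var st(4))
      then show "x' v \<in> V x 1" by (simp add: st(2) mult.commute)
    qed
    have "normalized x S0 y ?W (n * g) T.tb \<delta>' T.adj"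
      unfolding normalized_def
    proof (intro conjI ballI allI impI)
      show "f = 0" if "f \<in> vars_in S0" "ev y f = 0" for f using N that unfolding normalized_def by blast
      show "y v = 0" if "v \<notin> S0" for v using N that unfolding normalized_def by blast
      show "y v \<in> V x 1" for v using N x'V[of 1] unfolding normalized_def by blast
      show "finite ?W" using W(1) by simp
      show "?W \<subseteq> T.adj" using W(2) by (auto intro!: T.adj_mult[OF T.E_adj T.power_adj])
      show "V x m \<subseteq> lin_span y ?W m" for m
        using V_sub_wspan[OF st(5-8) x, of m] wspan_sub_lin_span[OF W(1,3), of e z m] by blast
      show "subfld T.adj" by (rule T.subfld_adj)
      show "basis ?K (n * g) T.tb T.adj" by (rule T.basis_tower)
      have "x' v + z * \<iota> (a v) \<in> T.adj" for v
        by (intro subfld_closed(3)[OF T.subfld_adj] T.adj_mult T.E_adj T.z_adj x'E iE)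
      then show "x v \<in> T.adj" for v using x by metis
      show "T.tb j \<in> V x (\<delta>' j)" if "j < n * g" for j
      proof -
        have "j div g < n" using that by (simp add: less_mult_imp_div_less)
        then have "b (j div g) \<in> V x (\<delta> (j div g))" using b\<delta> x'V by blast
        moreover have "z ^ (j mod g) \<in> V x (1 * (j mod g))" by (rule V_power[OF st(4)])
        ultimately show ?thesis unfolding T.tb_def \<delta>'_def by (intro V_mult) auto
      qed
      show "(\<Sum>j<n*g. \<phi> (\<delta>' j)) \<le> (\<Sum>j<n*g. \<phi> j)" if mono: "mono \<phi>" for \<phi> :: "nat \<Rightarrow> nat"
      proof -
        have "(\<Sum>j<n*g. \<phi> (\<delta>' j)) = (\<Sum>i<n. \<Sum>l<g. \<phi> (\<delta> i + l))"
          unfolding \<delta>'_def by (rule sum_div_mod[where F = "\<lambda>i l. \<phi> (\<delta> i + l)"])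
        also have "\<dots> = (\<Sum>l<g. \<Sum>i<n. \<phi> (\<delta> i + l))" by (rule sum.swap)
        also have "\<dots> \<le> (\<Sum>l<g. \<Sum>i<n. \<phi> (i + l))"
        proof (rule sum_mono)
          fix l have "mono (\<lambda>i. \<phi> (i + l))" using mono by (simp add: mono_def)
          then show "(\<Sum>i<n. \<phi> (\<delta> i + l)) \<le> (\<Sum>i<n. \<phi> (i + l))" by (rule phi)
        qed
        \<comment> \<open>\<open>i + l \<le> l * n + i\<close> because \<open>n > 0\<close> as soon
          as there is an \<open>i\<close>; the indices on the right run exactly once through all
          numbers below \<open>g * n\<close>.\<close>
        also have "\<dots> \<le> (\<Sum>l<g. \<Sum>i<n. \<phi> (l * n + i))"
        proof (intro sum_mono)
          fix l i assume "i \<in> {..<n}"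
          then have "i + l \<le> l * n + i" by (cases n) auto
          then show "\<phi> (i + l) \<le> \<phi> (l * n + i)" using mono by (simp add: mono_def)
        qed
        also have "\<dots> = (\<Sum>j<g*n. \<phi> (j div n * n + j mod n))"
          by (rule sum_div_mod[where F = "\<lambda>l i. \<phi> (l * n + i)", symmetric])
        finally show ?thesis by (simp add: mult.commute)
      qed
      show "\<exists>w\<in>T.adj. trace ?K (n * g) T.tb w \<noteq> 0" using T.trace_tower_nonzero[OF w] by blast
    qed
    then show ?thesis by blast
  qed
qed

end

section \<open>Bounds on filtrations\<close>

text \<open>A form of Jacobi's formula valid for singular \<open>A\<close> as well: expansion along
  the replaced columns turns the sum into the trace of \<open>M * A * adj_mat A\<close>, which is
  \<open>det A\<close> times the trace of \<open>M\<close>.\<close>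

lemma sum_det_replace_col:
  fixes A M :: "'a::field mat"
  assumes A: "A \<in> carrier_mat n n" and M: "M \<in> carrier_mat n n"
  shows "(\<Sum>j<n. det (replace_col A (col (M * A) j) j)) = (\<Sum>i<n. M $$ (i, i)) * det A"
proof -
  have "det (replace_col A (col (M * A) j) j) = (\<Sum>i<n. (M * A) $$ (i, j) * cofactor A i j)" if j: "j < n" for j
  proof -
    let ?B = "replace_col A (col (M * A) j) j"
    have B: "?B \<in> carrier_mat n n" using A by (auto simp: replace_col_def)
    have "det ?B = (\<Sum>i<n. ?B $$ (i, j) * cofactor ?B i j)" by (rule laplace_expansion_column[OF B j])
    also have "\<dots> = (\<Sum>i<n. (M * A) $$ (i, j) * cofactor A i j)"
    proof (rule sum.cong[OF refl])
      fix i assume "i \<in> {..<n}"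
      then have i: "i < n" by simp
      have "mat_delete ?B i j = mat_delete A i j"
        by (rule eq_matI) (use A j i in \<open>auto simp: mat_delete_def replace_col_def\<close>)
      then have "cofactor ?B i j = cofactor A i j" by (simp add: cofactor_def)
      moreover have "?B $$ (i, j) = (M * A) $$ (i, j)" using A M i j by (simp add: replace_col_def)
      ultimately show "?B $$ (i, j) * cofactor ?B i j = (M * A) $$ (i, j) * cofactor A i j" by simp
    qed
    finally show ?thesis .
  qed
  then have "(\<Sum>j<n. det (replace_col A (col (M * A) j) j)) = (\<Sum>j<n. \<Sum>i<n. (M * A) $$ (i, j) * cofactor A i j)"
    by simp
  also have "\<dots> = (\<Sum>i<n. \<Sum>j<n. (M * A) $$ (i, j) * adj_mat A $$ (j, i))"
    using A by (subst sum.swap) (simp add: adj_mat_def)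
  also have "\<dots> = (\<Sum>i<n. ((M * A) * adj_mat A) $$ (i, i))"
  proof (rule sum.cong[OF refl])
    fix i assume "i \<in> {..<n}"
    then have "((M * A) * adj_mat A) $$ (i, i) = row (M * A) i \<bullet> col (adj_mat A) i"
      using A M adj_mat(1)[OF A] by (intro index_mult_mat(1)) auto
    also have "\<dots> = (\<Sum>j<n. (M * A) $$ (i, j) * adj_mat A $$ (j, i))"
      using A M adj_mat(1)[OF A] \<open>i \<in> {..<n}\<close> unfolding scalar_prod_def
      by (auto simp: atLeast0LessThan intro!: sum.cong)
    finally show "(\<Sum>j<n. (M * A) $$ (i, j) * adj_mat A $$ (j, i)) = ((M * A) * adj_mat A) $$ (i, i)" by simp
  qed
  also have "(M * A) * adj_mat A = M * (A * adj_mat A)" by (rule assoc_mult_mat[OF M A adj_mat(1)[OF A]])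
  also have "A * adj_mat A = det A \<cdot>\<^sub>m 1\<^sub>m n" by (rule adj_mat(2)[OF A])
  also have "M * (det A \<cdot>\<^sub>m 1\<^sub>m n) = det A \<cdot>\<^sub>m M"
    using M by (metis mult_smult_distrib one_carrier_mat right_mult_one_mat)
  also have "(\<Sum>i<n. (det A \<cdot>\<^sub>m M) $$ (i, i)) = (\<Sum>i<n. M $$ (i, i)) * det A"
    using M by (simp add: sum_distrib_left mult.commute)
  finally show ?thesis .
qed

definition Mon :: "'v::finite set \<Rightarrow> nat \<Rightarrow> ('v \<Rightarrow>\<^sub>0 nat) set" where
  "Mon S m = {t. keys t \<subseteq> S \<and> mdeg t \<le> m}"

lemma finite_Mon: "finite (Mon S m)"
  by (rule finite_subset[OF _ finite_mdeg_le[of m]]) (auto simp: Mon_def)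

text \<open>Pascal's rule, splitting by whether the monomial is divisible by the new variable
  \<open>v\<close>.\<close>

lemma card_Mon:
  fixes S :: "'v::finite set"
  shows "card (Mon S m) = (m + card S) choose card S"
proof -
  have "finite S" by simp
  then show ?thesis
  proof (induction S arbitrary: m rule: finite_induct)
    case empty
    have "Mon ({} :: 'v set) m = {0}" by (auto simp: Mon_def)
    then show ?case by simp
  next
    case (insert v S)
    show ?case
    proof (induction m)
      case 0
      have "Mon (insert v S) 0 = {0}" by (auto simp: Mon_def mdeg_eq_0)
      then show ?case by simp
    next
      case (Suc m)
      let ?f = "\<lambda>t. t + single v (1::nat)"
      have eq: "Mon (insert v S) (Suc m) = Mon S (Suc m) \<union> ?f ` Mon (insert v S) m"
      proof (intro Set.set_eqI iffI)
        fix t assume t: "t \<in> Mon (insert v S) (Suc m)"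
        show "t \<in> Mon S (Suc m) \<union> ?f ` Mon (insert v S) m"
        proof (cases "v \<in> keys t")
          case True
          then have nz: "lookup t v \<noteq> 0" by (simp add: in_keys_iff)
          have e: "t = t - single v 1 + single v 1" using minus_plus_var[OF nz] by simp
          have "mdeg t = mdeg (t - single v 1) + 1" by (subst e) (simp add: mdeg_add)
          moreover have "keys (t - single v 1) \<subseteq> keys t"
            by (auto simp: in_keys_iff lookup_minus)
          ultimately have "t - single v 1 \<in> Mon (insert v S) m" using t by (auto simp: Mon_def)
          then show ?thesis using e by blast
        qed (use t in \<open>auto simp: Mon_def\<close>)
      next
        fix t assume "t \<in> Mon S (Suc m) \<union> ?f ` Mon (insert v S) m"
        then show "t \<in> Mon (insert v S) (Suc m)"
          by (auto simp: Mon_def mdeg_add dest!: subsetD[OF Poly_Mapping.keys_add] split: if_splits)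
      qed
      have "Mon S (Suc m) \<inter> ?f ` Mon (insert v S) m = {}"
      proof -
        have "v \<in> keys (?f t)" for t by (simp add: in_keys_iff lookup_add)
        then show ?thesis using insert.hyps(2) by (auto simp: Mon_def)
      qed
      then have "card (Mon (insert v S) (Suc m)) = card (Mon S (Suc m)) + card (?f ` Mon (insert v S) m)"
        unfolding eq by (intro card_Un_disjoint finite_Mon finite_imageI)
      also have "card (?f ` Mon (insert v S) m) = card (Mon (insert v S) m)"
        by (rule card_image) (auto intro: inj_onI)
      finally show ?case
        using Suc insert.IH[of "Suc m"] insert.hyps by simp
    qed
  qed
qed

context scalar_hom
begin

lemma spans_mod_of_finite_set:
  assumes "finite E" "\<And>x. x \<in> U \<Longrightarrow> \<exists>a. x = (\<Sum>t\<in>E. \<iota> (a t) * t)"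
  shows "\<exists>e. spans_mod U {0} (card E) e"
proof -
  obtain e where e: "bij_betw e {..<card E} E"
    using ex_bij_betw_nat_finite[OF assms(1)] by (auto simp: atLeast0LessThan)
  have "spans_mod U {0} (card E) e"
    unfolding spans_mod_def
  proof
    fix x assume "x \<in> U"
    then obtain a where "x = (\<Sum>t\<in>E. \<iota> (a t) * t)" using assms(2) by blast
    also have "\<dots> = (\<Sum>i<card E. \<iota> (a (e i)) * e i)"
      by (rule sum.reindex_bij_betw[OF e, symmetric])
    finally show "\<exists>a. x - (\<Sum>i<card E. \<iota> (a i) * e i) \<in> {0}"
      by (intro exI[of _ "\<lambda>i. a (e i)"]) simp
  qed
  then show ?thesis by blast
qed

lemma ev_restrict_vars:
  assumes "\<forall>v. v \<notin> S \<longrightarrow> y v = 0"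
  shows "\<exists>f'\<in>vars_in S. ev y f' = ev y f \<and> keys f' \<subseteq> keys f"
proof -
  define f' where "f' = Poly_Mapping.mapp (\<lambda>t c. if keys t \<subseteq> S then c else 0) f"
  have l: "lookup f' t = (if keys t \<subseteq> S then lookup f t else 0)" for t
    by (auto simp: f'_def lookup_mapp when_def in_keys_iff)
  have sub: "keys f' \<subseteq> keys f" by (auto simp: in_keys_iff l split: if_splits)
  have z: "mon y t = 0" if nsub: "\<not> keys t \<subseteq> S" for t
  proof -
    obtain v where v: "v \<in> keys t" "v \<notin> S" using nsub by blast
    have "mon y t = y v ^ lookup t v * (\<Prod>w\<in>UNIV-{v}. y w ^ lookup t w)"
      unfolding mon_def by (rule prod.remove) auto
    moreover have "y v ^ lookup t v = 0" using v assms by (simp add: in_keys_iff zero_power)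
    ultimately show ?thesis by simp
  qed
  have "ev y f' = (\<Sum>t\<in>keys f. \<iota> (lookup f' t) * mon y t)" by (rule ev_superset) (use sub in auto)
  also have "\<dots> = ev y f" unfolding ev_def by (intro sum.cong refl) (auto simp: l z)
  finally have "ev y f' = ev y f" .
  moreover have "f' \<in> vars_in S" unfolding vars_in_def using l by (force simp: in_keys_iff split: if_splits)
  ultimately show ?thesis using sub by blast
qed

end

lemma vars_in_times:
  fixes f g :: "('v::finite, 'k::field) mpoly"
  assumes "f \<in> vars_in S" "g \<in> vars_in S" shows "f * g \<in> vars_in S"
  unfolding vars_in_def
proof (rule CollectI, rule ballI)
  fix t assume "t \<in> keys (f * g)"
  then obtain s r where "t = s + r" "s \<in> keys f" "r \<in> keys g" using subsetD[OF keys_times] by blast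
  then have "keys s \<subseteq> S" "keys r \<subseteq> S" "keys t \<subseteq> keys s \<union> keys r"
    using assms Poly_Mapping.keys_add[of s r] by (auto simp: vars_in_def)
  then show "keys t \<subseteq> S" by blast
qed

lemma vars_in_one: "(1 :: ('v, 'k::field) mpoly) \<in> vars_in S"
  by (simp add: vars_in_def)

lemma vars_in_power:
  fixes f :: "('v::finite, 'k::field) mpoly"
  shows "f \<in> vars_in S \<Longrightarrow> f ^ n \<in> vars_in S"
  by (induction n) (auto intro: vars_in_times vars_in_one)

lemma vars_in_diff:
  fixes f g :: "('v, 'k::field) mpoly"
  assumes "f \<in> vars_in S" "g \<in> vars_in S" shows "f - g \<in> vars_in S"
  unfolding vars_in_def
proof (rule CollectI, rule ballI)
  fix t assume "t \<in> keys (f - g)"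
  then have "t \<in> keys f \<or> t \<in> keys g" by (auto simp: in_keys_iff lookup_minus)
  then show "keys t \<subseteq> S" using assms by (auto simp: vars_in_def)
qed

section \<open>Traces and dimension bounds in a normalized extension\<close>

locale normalized_ext = field_embedding \<iota> for \<iota> :: "'f::field \<Rightarrow> 'o::field" +
  fixes x :: "'v::finite \<Rightarrow> 'o" and S y W n b \<delta> L
  assumes N: "normalized x S y W n b \<delta> L"
begin

abbreviation "K \<equiv> quot_field y"

lemma N_simps:
  shows ind: "\<And>f. f \<in> vars_in S \<Longrightarrow> ev y f = 0 \<Longrightarrow> f = 0" and y0: "\<And>v. v \<notin> S \<Longrightarrow> y v = 0"
    and yV: "\<And>v. y v \<in> V x 1" and finW: "finite W" and WL: "W \<subseteq> L" and VW: "\<And>m. V x m \<subseteq> lin_span y W m"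
    and L: "subfld L" and bL: "basis K n b L" and xL: "\<And>v. x v \<in> L" and b\<delta>: "\<And>j. j < n \<Longrightarrow> b j \<in> V x (\<delta> j)"
    and sum_\<delta>: "\<And>\<phi>::nat \<Rightarrow> nat. mono \<phi> \<Longrightarrow> (\<Sum>j<n. \<phi> (\<delta> j)) \<le> (\<Sum>j<n. \<phi> j)"
    and tr_nz: "\<exists>w\<in>L. trace K n b w \<noteq> 0"
  using N unfolding normalized_def by blast+

sublocale B: basis_ext K n b L
  by unfold_locales (rule subfld_quot_field, rule bL)

lemma VL: "V x m \<subseteq> L"
proof (rule V_in_subfld[OF L _ xL])
  fix c
  have "\<iota> c \<in> K" using V_quot_field V_scalar by blast
  then show "\<iota> c \<in> L" using B.L_scale[OF _ subfld_closed(2)[OF L], of "\<iota> c"] by simp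
qed

lemma VK: "a \<in> V y m \<Longrightarrow> a \<in> K"
  using V_quot_field by blast

lemma common_denominator:
  assumes "finite Q" "Q \<subseteq> K"
  shows "\<exists>c \<gamma>. c \<noteq> 0 \<and> c \<in> V y \<gamma> \<and> (\<forall>q\<in>Q. c * q \<in> V y \<gamma>)"
  using assms
proof (induction Q rule: finite_induct)
  case empty
  then show ?case by (intro exI[of _ 1] exI[of _ 0]) simp
next
  case (insert q Q)
  then obtain c \<gamma> where c: "c \<noteq> 0" "c \<in> V y \<gamma>" "\<forall>q\<in>Q. c * q \<in> V y \<gamma>" by auto
  obtain f g where q: "q = ev y f / ev y g" using insert.prems unfolding quot_field_def by blast
  show ?case
  proof (cases "ev y g = 0")
    case True
    then show ?thesis using c q by (intro exI[of _ c] exI[of _ \<gamma>]) auto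
  next
    case False
    obtain m1 where "f \<in> deg_le m1" using deg_le_exists .
    obtain m2 where "g \<in> deg_le m2" using deg_le_exists .
    define e where "e = max m1 m2"
    have fe: "ev y f \<in> V y e" and ge: "ev y g \<in> V y e"
      using \<open>f \<in> _\<close> \<open>g \<in> _\<close> deg_le_mono[of m1 e] deg_le_mono[of m2 e] by (auto simp: V_def e_def)
    have q1: "c * ev y g * q = c * ev y f" using False by (simp add: q)
    have q2: "c * ev y g * q' = (c * q') * ev y g" for q' by simp
    have "\<forall>p\<in>insert q Q. c * ev y g * p \<in> V y (\<gamma> + e)"
    proof
      fix p assume "p \<in> insert q Q"
      then consider "p = q" | "p \<in> Q" by blast
      then show "c * ev y g * p \<in> V y (\<gamma> + e)"
      proof cases
        case 1
        show ?thesis unfolding 1 q1 by (rule V_mult[OF c(2) fe])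
      next
        case 2
        then show ?thesis unfolding q2 using V_mult[OF bspec[OF c(3)] ge] by blast
      qed
    qed
    moreover have "c * ev y g \<noteq> 0" using c False by simp
    ultimately show ?thesis using V_mult[OF c(2) ge] by blast
  qed
qed

text \<open>One denominator \<open>c\<close> serves the coordinates of all elements, whatever their
  degree: it suffices to clear the coordinates of the finitely many generators in
  \<open>W\<close>.\<close>

lemma lattice:
  obtains c \<gamma> where "c \<noteq> 0" "c \<in> V y \<gamma>" "\<And>m a i. a \<in> V x m \<Longrightarrow> i < n \<Longrightarrow> c * crd K n b a i \<in> V y (m + \<gamma>)"
proof -
  let ?Q = "(\<lambda>(w, i). crd K n b w i) ` (W \<times> {..<n})"
  have "finite ?Q" using finW by simp
  moreover have "?Q \<subseteq> K" using WL B.crd_mem by auto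
  ultimately have "\<exists>c \<gamma>. c \<noteq> 0 \<and> c \<in> V y \<gamma> \<and> (\<forall>q\<in>?Q. c * q \<in> V y \<gamma>)" by (rule common_denominator)
  then obtain c \<gamma> where c: "c \<noteq> 0" "c \<in> V y \<gamma>" "\<forall>q\<in>?Q. c * q \<in> V y \<gamma>" by (elim exE conjE) (rule that)
  have "c * crd K n b a i \<in> V y (m + \<gamma>)" if a: "a \<in> V x m" and i: "i < n" for a m i
  proof -
    obtain \<kappa> where \<kappa>: "a = (\<Sum>w\<in>W. \<kappa> w * w)" "\<forall>w\<in>W. \<kappa> w \<in> V y m"
      using subsetD[OF VW a] unfolding lin_span_def by blast
    have "crd K n b a i = (\<Sum>w\<in>W. crd K n b (\<kappa> w * w) i)"
      unfolding \<kappa>(1) by (rule B.crd_of_sum[OF B.L_scale i]) (use \<kappa>(2) VK WL in auto)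
    also have "\<dots> = (\<Sum>w\<in>W. \<kappa> w * crd K n b w i)"
      by (intro sum.cong refl B.crd_scale i) (use \<kappa>(2) VK WL in auto)
    finally have "c * crd K n b a i = (\<Sum>w\<in>W. \<kappa> w * (c * crd K n b w i))"
      by (simp add: sum_distrib_left mult.left_commute)
    also have "\<dots> \<in> V y (m + \<gamma>)"
      by (intro V_sum V_mult) (use \<kappa>(2) c(3) i in auto)
    finally show ?thesis .
  qed
  then show ?thesis using that c by blast
qed

text \<open>The coordinates of \<open>y\<close> in \<open>S\<close> are independent, so the
  hypothesis becomes an identity of polynomials, and complete integral closure with control of
  degrees applies to numerator and denominator of \<open>q\<close>.\<close>

lemma ring_of_K_integral:
  assumes q: "q \<in> K" and c: "c \<noteq> 0" "c \<in> V y k" and int: "\<And>N. c * q ^ N \<in> V y (m * N + g)"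
  shows "q \<in> V y m"
proof -
  obtain f0 g0 where fg0: "q = ev y f0 / ev y g0" using q unfolding quot_field_def by blast
  show ?thesis
  proof (cases "ev y g0 = 0")
    case False
    obtain f where f: "f \<in> vars_in S" "ev y f = ev y f0" using ev_restrict_vars[of S y f0] y0 by blast
    obtain h where h: "h \<in> vars_in S" "ev y h = ev y g0" using ev_restrict_vars[of S y g0] y0 by blast
    obtain c0 where c0: "ev y c0 = c" using c(2) by (auto simp: V_def)
    obtain c' where c': "c' \<in> vars_in S" "ev y c' = c" using ev_restrict_vars[of S y c0] y0 c0 by auto
    have "\<forall>N. \<exists>p. p \<in> vars_in S \<and> ev y p = c * q ^ N \<and> p \<in> deg_le (m * N + g)"
    proof
      fix N
      obtain p0 where p0: "p0 \<in> deg_le (m * N + g)" "c * q ^ N = ev y p0" using int[of N] by (auto simp: V_def)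
      obtain p where p: "p \<in> vars_in S" "ev y p = ev y p0" "keys p \<subseteq> keys p0" using ev_restrict_vars[of S y p0] y0 by blast
      then show "\<exists>p. p \<in> vars_in S \<and> ev y p = c * q ^ N \<and> p \<in> deg_le (m * N + g)"
        using p0 by (intro exI[of _ p]) (auto intro!: deg_leI dest: deg_leD)
    qed
    then obtain p where p: "\<And>N. p N \<in> vars_in S" "\<And>N. ev y (p N) = c * q ^ N" "\<And>N. p N \<in> deg_le (m * N + g)"
      by metis
    have "c' * f ^ N = p N * h ^ N" for N
    proof -
      have "c' * f ^ N - p N * h ^ N \<in> vars_in S"
        by (intro vars_in_diff vars_in_times vars_in_power c' f h p)
      moreover have "ev y (c' * f ^ N - p N * h ^ N) = 0"
        using False by (simp add: ev_diff ev_mult ev_power c' p f h fg0 power_divide)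
      ultimately show ?thesis using ind by fastforce
    qed
    moreover have "h \<noteq> 0" "c' \<noteq> 0" using h(2) False c' c(1) by auto
    ultimately obtain u where u: "f = u * h" "u \<in> deg_le m"
      using completely_integrally_closed_deg[of h c' f p m g] p(3) by metis
    have "q = ev y u" using False by (simp add: fg0 f(2)[symmetric] h(2)[symmetric] u(1) ev_mult)
    then show ?thesis using u(2) by (auto simp: V_def)
  qed (simp add: fg0)
qed

text \<open>With \<open>t\<close> the trace, \<open>t ^ N\<close> is a sum of determinants whose columns are the
  coordinates of \<open>a ^ k * b j\<close>, so its denominator is bounded independently of \<open>N\<close>.\<close>

lemma trace_integral:
  assumes a: "a \<in> V x m" shows "trace K n b a \<in> V y m"
proof -
  obtain c \<gamma> where c: "c \<noteq> 0" "c \<in> V y \<gamma>"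
    "\<And>m a i. a \<in> V x m \<Longrightarrow> i < n \<Longrightarrow> c * crd K n b a i \<in> V y (m + \<gamma>)" using lattice by metis
  define D where "D = (\<Sum>j<n. \<delta> j)"
  have bD: "b j \<in> V x D" if "j < n" for j
  proof -
    have "\<delta> j \<le> D" unfolding D_def by (rule member_le_sum) (use that in auto)
    then show ?thesis using b\<delta>[OF that] V_mono by blast
  qed
  define C where "C ns = mat n n (\<lambda>(i,j). crd K n b (a ^ ns j * b j) i)" for ns :: "nat \<Rightarrow> nat"
  define M where "M = mat n n (\<lambda>(i,j). crd K n b (a * b j) i)"
  define t where "t = trace K n b a"
  have tM: "t = (\<Sum>i<n. M $$ (i, i))" by (simp add: t_def trace_def M_def)
  have aV: "a ^ k * b j \<in> V x (m * k + D)" if "j < n" for k j by (intro V_mult V_power a bD that)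
  have aL: "a ^ k * b j \<in> L" if "j < n" for k j using aV[OF that] VL by blast
  \<comment> \<open>Jacobi's formula: \<open>M\<close> acts on coordinate columns as multiplication
    by \<open>a\<close>, so multiplying by its trace raises one exponent in each summand.\<close>
  have step: "t * det (C ns) = (\<Sum>j<n. det (C (ns(j := Suc (ns j)))))" for ns
  proof -
    have "C (ns(j := Suc (ns j))) = replace_col (C ns) (col (M * C ns) j) j" if j: "j < n" for j
    proof (rule eq_matI)
      fix i k assume "i < dim_row (replace_col (C ns) (col (M * C ns) j) j)" "k < dim_col (replace_col (C ns) (col (M * C ns) j) j)"
      then have ik: "i < n" "k < n" by (auto simp: C_def replace_col_def)
      show "C (ns(j := Suc (ns j))) $$ (i, k) = replace_col (C ns) (col (M * C ns) j) j $$ (i, k)"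
      proof (cases "k = j")
        case True
        let ?v = "a ^ ns j * b j"
        have "a * ?v = (\<Sum>l<n. crd K n b ?v l * (a * b l))"
          by (subst B.crd_sum[OF aL[OF j, of "ns j"]]) (simp add: sum_distrib_left mult.left_commute)
        then have "crd K n b (a * ?v) i = crd K n b (\<Sum>l<n. crd K n b ?v l * (a * b l)) i" by simp
        also have "\<dots> = (\<Sum>l<n. crd K n b (crd K n b ?v l * (a * b l)) i)"
          by (rule B.crd_of_sum[OF B.L_scale ik(1)]) (use B.crd_mem[OF aL[OF j]] aL[of _ 1] in auto)
        also have "\<dots> = (\<Sum>l<n. crd K n b ?v l * crd K n b (a * b l) i)"
          by (intro sum.cong refl B.crd_scale ik(1)) (use B.crd_mem[OF aL[OF j]] aL[of _ 1] in auto)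
        also have "\<dots> = (\<Sum>l<n. M $$ (i, l) * C ns $$ (l, j))"
          using ik j by (intro sum.cong refl) (simp add: M_def C_def mult.commute)
        also have "\<dots> = (M * C ns) $$ (i, j)"
        proof -
          have "(M * C ns) $$ (i, j) = row M i \<bullet> col (C ns) j"
            by (rule index_mult_mat(1)) (use ik j in \<open>auto simp: M_def C_def\<close>)
          also have "\<dots> = (\<Sum>l<n. M $$ (i, l) * C ns $$ (l, j))"
            unfolding scalar_prod_def using ik j by (auto simp: M_def C_def atLeast0LessThan intro!: sum.cong)
          finally show ?thesis by simp
        qed
        finally show ?thesis
          using ik True by (simp add: C_def M_def replace_col_def mult.assoc)
      next
        case False
        then show ?thesis using ik by (simp add: C_def replace_col_def)
      qed
    qed (auto simp: C_def replace_col_def)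
    then have "(\<Sum>j<n. det (C (ns(j := Suc (ns j))))) = (\<Sum>j<n. det (replace_col (C ns) (col (M * C ns) j) j))"
      by simp
    also have "\<dots> = t * det (C ns)"
      unfolding tM by (rule sum_det_replace_col) (auto simp: C_def M_def)
    finally show ?thesis by simp
  qed
  \<comment> \<open>Each term of the Leibniz formula has \<open>n\<close> factors, one from each
    column; \<open>c ^ n\<close> clears their denominators, and the degrees add up over the
    columns.\<close>
  have base: "c ^ n * det (C ns) \<in> V y (\<Sum>j<n. m * ns j + D + \<gamma>)" for ns
  proof -
    have "c ^ n * det (C ns) = (\<Sum>p | p permutes {0..<n}. signof p * (\<Prod>i = 0..<n. c * C ns $$ (i, p i)))"
      by (subst det_def'[of _ n]) (auto simp: C_def sum_distrib_left prod.distrib mult_ac)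
    also have "\<dots> \<in> V y (\<Sum>j<n. m * ns j + D + \<gamma>)"
    proof (rule V_sum)
      fix p assume "p \<in> {p. p permutes {0..<n}}"
      then have p: "p permutes {0..<n}" by simp
      have pi: "p i < n" if "i < n" for i using permutes_in_image[OF p, of i] that by simp
      have "(\<Prod>i\<in>A. c * C ns $$ (i, p i)) \<in> V y (\<Sum>i\<in>A. m * ns (p i) + D + \<gamma>)" if "finite A" "A \<subseteq> {0..<n}" for A
        using that
      proof (induction A rule: finite_induct)
        case (insert i A)
        then have i: "i < n" by auto
        have "c * C ns $$ (i, p i) \<in> V y (m * ns (p i) + D + \<gamma>)"
          using c(3)[OF aV[OF pi[OF i]] i, of "ns (p i)"] i pi[OF i] by (simp add: C_def)
        then show ?case using insert V_mult by simp
      qed simp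
      then have "(\<Prod>i = 0..<n. c * C ns $$ (i, p i)) \<in> V y (\<Sum>i = 0..<n. m * ns (p i) + D + \<gamma>)" by simp
      also have "(\<Sum>i = 0..<n. m * ns (p i) + D + \<gamma>) = (\<Sum>j<n. m * ns j + D + \<gamma>)"
        using sum.permute[OF p, of "\<lambda>j. m * ns j + D + \<gamma>"] by (simp add: o_def atLeast0LessThan)
      finally show "signof p * (\<Prod>i = 0..<n. c * C ns $$ (i, p i)) \<in> V y (\<Sum>j<n. m * ns j + D + \<gamma>)"
        using linsub_closed(4)[OF linsub_V] by (auto simp: sign_def)
    qed
    finally show ?thesis .
  qed
  have main: "c ^ n * t ^ k * det (C ns) \<in> V y (m * k + (\<Sum>j<n. m * ns j + D + \<gamma>))" for k ns
  proof (induction k arbitrary: ns)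
    case 0
    then show ?case using base by simp
  next
    case (Suc k)
    have "c ^ n * t ^ Suc k * det (C ns) = c ^ n * t ^ k * (t * det (C ns))" by simp
    also have "\<dots> = (\<Sum>j<n. c ^ n * t ^ k * det (C (ns(j := Suc (ns j)))))" unfolding step by (rule sum_distrib_left)
    also have "\<dots> \<in> V y (m * Suc k + (\<Sum>j<n. m * ns j + D + \<gamma>))"
    proof (rule V_sum)
      fix j assume j: "j \<in> {..<n}"
      have "(\<Sum>i<n. m * (ns(j := Suc (ns j))) i + D + \<gamma>) = (\<Sum>i<n. (m * ns i + D + \<gamma>) + (if i = j then m else 0))"
        by (rule sum.cong) auto
      also have "\<dots> = (\<Sum>i<n. m * ns i + D + \<gamma>) + m" using j by (subst sum.distrib) (simp add: sum.delta)
      finally have "m * k + (\<Sum>i<n. m * (ns(j := Suc (ns j))) i + D + \<gamma>) = m * Suc k + (\<Sum>j<n. m * ns j + D + \<gamma>)" by simp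
      with Suc[of "ns(j := Suc (ns j))"]
      show "c ^ n * t ^ k * det (C (ns(j := Suc (ns j)))) \<in> V y (m * Suc k + (\<Sum>j<n. m * ns j + D + \<gamma>))" by argo
    qed
    finally show ?case .
  qed
  \<comment> \<open>With all exponents 0 the columns are the coordinates of the basis itself and the
    determinant is 1; so \<open>c ^ n\<close> is a denominator for every power of
    \<open>t\<close>.\<close>
  have "C (\<lambda>_. 0) = 1\<^sub>m n"
    by (rule eq_matI) (auto simp: C_def B.crd_basis)
  then have "c ^ n * t ^ k \<in> V y (m * k + n * (D + \<gamma>))" for k
    using main[of k "\<lambda>_. 0"] by (simp add: algebra_simps)
  moreover have "t \<in> K" unfolding t_def trace_def
    by (intro subfld_sum[OF subfld_quot_field] B.crd_mem) (use aL[of _ 1] in auto)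
  moreover have "c ^ n \<noteq> 0" "c ^ n \<in> V y (\<gamma> * n)" using c V_power by auto
  ultimately show ?thesis unfolding t_def[symmetric] by (intro ring_of_K_integral[of t "c ^ n"]) auto
qed

lemma Lmult: "u \<in> L \<Longrightarrow> v \<in> L \<Longrightarrow> u * v \<in> L"
  by (rule subfld_closed(4)[OF L])

lemma trace_add: "u \<in> L \<Longrightarrow> v \<in> L \<Longrightarrow> trace K n b (u + v) = trace K n b u + trace K n b v"
  by (simp add: trace_def distrib_right B.crd_add Lmult B.b_in sum.distrib)

lemma trace_scale: "c \<in> K \<Longrightarrow> u \<in> L \<Longrightarrow> trace K n b (c * u) = c * trace K n b u"
  by (simp add: trace_def mult.assoc B.crd_scale Lmult B.b_in sum_distrib_left)

lemma trace_zero: "trace K n b 0 = 0"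
  by (simp add: trace_def B.crd_zero)

lemma trace_sum: "(\<And>i. i \<in> A \<Longrightarrow> f i \<in> L) \<Longrightarrow> trace K n b (sum f A) = (\<Sum>i\<in>A. trace K n b (f i))"
  by (induction A rule: infinite_finite_induct) (auto simp: trace_zero trace_add B.L_sum)

lemma trace_mem: "u \<in> L \<Longrightarrow> trace K n b u \<in> K"
  unfolding trace_def by (intro subfld_sum[OF subfld_quot_field] B.crd_mem Lmult B.b_in) auto

definition theta :: "'o \<Rightarrow> 'o" where "theta u = (\<Sum>j<n. trace K n b (u * b j) * b j)"

text \<open>\<open>L\<close> is a field, so an element \<open>w\<close> of nonzero trace is a
  multiple of any nonzero \<open>u\<close>. If \<open>theta u = 0\<close>, all traces
  \<open>trace K n b (u * b j)\<close> vanish, and with them the trace of \<open>w\<close>.\<close>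

lemma theta_inj: assumes "u \<in> L" "theta u = 0" shows "u = 0"
proof (rule ccontr)
  assume "u \<noteq> 0"
  have "rep K n b 0 (\<lambda>j. trace K n b (u * b j))"
    using assms by (auto simp: rep_def theta_def intro!: trace_mem Lmult B.b_in)
  then have z: "trace K n b (u * b j) = 0" if "j < n" for j using bL that unfolding basis_def by blast
  obtain w where w: "w \<in> L" "trace K n b w \<noteq> 0" using tr_nz by blast
  define q where "q = w / u"
  have q: "q \<in> L" unfolding q_def by (intro subfld_closed(8)[OF L] w assms)
  have "w = u * (\<Sum>j<n. crd K n b q j * b j)" using B.crd_sum[OF q] \<open>u \<noteq> 0\<close> by (simp add: q_def)
  then have "w = (\<Sum>j<n. crd K n b q j * (u * b j))" by (simp add: sum_distrib_left mult.left_commute)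
  then have "trace K n b w = (\<Sum>j<n. trace K n b (crd K n b q j * (u * b j)))"
    by (simp only:) (intro trace_sum B.L_scale B.crd_mem q Lmult assms B.b_in, auto)
  also have "\<dots> = (\<Sum>j<n. crd K n b q j * trace K n b (u * b j))"
    by (intro sum.cong refl trace_scale B.crd_mem q Lmult assms B.b_in) auto
  also have "\<dots> = 0" by (rule sum.neutral) (simp add: z)
  finally show False using w by simp
qed

lemma scalar_K: "\<iota> c \<in> K"
  using V_scalar VK by blast

lemma theta_lcomb:
  assumes "\<And>i. i < r \<Longrightarrow> u i \<in> L"
  shows "theta (\<Sum>i<r. \<iota> (a i) * u i) = (\<Sum>i<r. \<iota> (a i) * theta (u i))"
proof -
  have "trace K n b ((\<Sum>i<r. \<iota> (a i) * u i) * b j) = (\<Sum>i<r. \<iota> (a i) * trace K n b (u i * b j))" if j: "j < n" for j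
  proof -
    have "(\<Sum>i<r. \<iota> (a i) * u i) * b j = (\<Sum>i<r. \<iota> (a i) * (u i * b j))"
      by (simp add: sum_distrib_right mult.assoc)
    also have "trace K n b \<dots> = (\<Sum>i<r. trace K n b (\<iota> (a i) * (u i * b j)))"
      by (intro trace_sum B.L_scale scalar_K Lmult assms B.b_in j) simp
    also have "\<dots> = (\<Sum>i<r. \<iota> (a i) * trace K n b (u i * b j))"
      by (intro sum.cong refl trace_scale scalar_K Lmult assms B.b_in j) simp
    finally show ?thesis .
  qed
  then have "theta (\<Sum>i<r. \<iota> (a i) * u i) = (\<Sum>j<n. \<Sum>i<r. \<iota> (a i) * (trace K n b (u i * b j) * b j))"
    by (simp add: theta_def sum_distrib_right mult.assoc)
  also have "\<dots> = (\<Sum>i<r. \<iota> (a i) * theta (u i))"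
    unfolding theta_def by (subst sum.swap) (simp add: sum_distrib_left)
  finally show ?thesis .
qed

text \<open>\<open>theta\<close> is linear and injective, and its \<open>j\<close>-th coefficient on
  \<open>V x m\<close> is a polynomial of degree at most \<open>m + \<delta> j\<close> in
  \<open>y\<close>. Count monomials and apply the inequality for \<open>\<delta>\<close> to the
  increasing function \<open>\<lambda>j. (m + j + card S) choose card S\<close>.\<close>

lemma hdim_upper: "hdim (V x m) {0} \<le> (\<Sum>j<n. (m + j + card S) choose card S)"
proof -
  define E where "E = (\<Union>j<n. (\<lambda>t. mon y t * b j) ` Mon S (m + \<delta> j))"
  have finE: "finite E" unfolding E_def using finite_Mon by auto
  have "card E \<le> (\<Sum>j<n. card ((\<lambda>t. mon y t * b j) ` Mon S (m + \<delta> j)))"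
    unfolding E_def by (rule card_UN_le) simp
  also have "\<dots> \<le> (\<Sum>j<n. card (Mon S (m + \<delta> j)))" by (intro sum_mono card_image_le finite_Mon)
  also have "\<dots> = (\<Sum>j<n. (m + \<delta> j + card S) choose card S)" by (simp add: card_Mon)
  also have "\<dots> \<le> (\<Sum>j<n. (m + j + card S) choose card S)"
    by (rule sum_\<delta>) (auto simp: mono_def intro!: binomial_right_mono)
  finally have cE: "card E \<le> (\<Sum>j<n. (m + j + card S) choose card S)" .
  have "\<exists>a. z = (\<Sum>w\<in>E. \<iota> (a w) * w)" if "z \<in> theta ` V x m" for z
  proof -
    define Sp where "Sp = {z. \<exists>a. z = (\<Sum>w\<in>E. \<iota> (a w) * w)}"
    have Sp_add: "p + q \<in> Sp" if pq: "p \<in> Sp" "q \<in> Sp" for p q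
    proof -
      obtain a a' where "p = (\<Sum>w\<in>E. \<iota> (a w) * w)" "q = (\<Sum>w\<in>E. \<iota> (a' w) * w)" using pq unfolding Sp_def by blast
      then have "p + q = (\<Sum>w\<in>E. \<iota> (a w + a' w) * w)" by (simp add: hom_add distrib_right sum.distrib)
      then show ?thesis unfolding Sp_def by (intro CollectI exI[of _ "\<lambda>w. a w + a' w"])
    qed
    have Sp_zero: "0 \<in> Sp" unfolding Sp_def by (intro CollectI exI[of _ "\<lambda>_. 0"]) simp
    have Sp_sum: "sum f A \<in> Sp" if "\<And>i. i \<in> A \<Longrightarrow> f i \<in> Sp" for f :: "'i \<Rightarrow> 'o" and A
      using that by (induction A rule: infinite_finite_induct) (auto intro: Sp_add Sp_zero)
    have Sp_sum': "sum f A \<in> Sp" if "\<And>i. i \<in> A \<Longrightarrow> f i \<in> Sp" for f :: "('v \<Rightarrow>\<^sub>0 nat) \<Rightarrow> 'o" and A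
      using that by (induction A rule: infinite_finite_induct) (auto intro: Sp_add Sp_zero)
    have Sp_gen: "\<iota> c * w \<in> Sp" if "w \<in> E" for c w
    proof -
      have "\<iota> c * w = (\<Sum>u\<in>E. \<iota> (if u = w then c else 0) * u)"
      proof -
        have "(\<Sum>u\<in>E. \<iota> (if u = w then c else 0) * u) = (\<Sum>u\<in>E. if u = w then \<iota> c * w else 0)"
          by (rule sum.cong) auto
        then show ?thesis using that finE by (simp add: sum.delta)
      qed
      then show ?thesis unfolding Sp_def by (intro CollectI exI[of _ "\<lambda>u. if u = w then c else 0"])
    qed
    have Sp_V: "q * b j \<in> Sp" if j: "j < n" and q: "q \<in> V y (m + \<delta> j)" for q j
    proof -
      obtain f0 where f0: "f0 \<in> deg_le (m + \<delta> j)" "q = ev y f0" using q by (auto simp: V_def)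
      obtain f where f: "f \<in> vars_in S" "ev y f = ev y f0" "keys f \<subseteq> keys f0" using ev_restrict_vars[of S y f0] y0 by blast
      have "q * b j = ev y f * b j" by (simp add: f0(2) f(2))
      also have "\<dots> = (\<Sum>t\<in>keys f. \<iota> (lookup f t) * (mon y t * b j))"
        by (simp add: ev_def sum_distrib_right mult.assoc)
      also have "\<dots> \<in> Sp"
      proof (intro Sp_sum' Sp_gen)
        fix t assume t: "t \<in> keys f"
        then have "t \<in> Mon S (m + \<delta> j)" using f deg_leD[OF f0(1)] by (auto simp: Mon_def vars_in_def)
        then show "mon y t * b j \<in> E" unfolding E_def using j by blast
      qed
      finally show ?thesis .
    qed
    obtain u where u: "u \<in> V x m" "z = theta u" using \<open>z \<in> _\<close> by blast
    have "theta u = (\<Sum>j\<in>{..<n}. trace K n b (u * b j) * b j)" by (simp add: theta_def)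
    also have "\<dots> \<in> Sp"
    proof -
      have "trace K n b (u * b j) * b j \<in> Sp" if "j < n" for j
        by (rule Sp_V[OF that]) (rule trace_integral, rule V_mult[OF u(1) b\<delta>[OF that]])
      then have "(\<Sum>j\<in>A. trace K n b (u * b j) * b j) \<in> Sp" if "A \<subseteq> {..<n}" for A
        using that by (induction A rule: infinite_finite_induct) (auto intro: Sp_add Sp_zero)
      then show ?thesis by blast
    qed
    finally show ?thesis using u(2) by (simp add: Sp_def)
  qed
  then obtain e where e: "spans_mod (theta ` V x m) {0} (card E) e"
    using spans_mod_of_finite_set[OF finE] by blast
  obtain u where u: "basis_mod (V x m) {0} (hdim (V x m) {0}) u"
    using basis_mod_exists[OF linsub_zero fin_span_V] .
  let ?r = "hdim (V x m) {0}"
  have uV: "u i \<in> V x m" if "i < ?r" for i using u that by (simp add: basis_mod_def)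
  have uL: "u i \<in> L" if "i < ?r" for i using uV[OF that] VL by blast
  have "indep_mod {0} ?r (\<lambda>i. theta (u i))"
    unfolding indep_mod_def
  proof (intro allI impI)
    fix a i assume z: "(\<Sum>i<?r. \<iota> (a i) * theta (u i)) \<in> {0}" and i: "i < ?r"
    have "theta (\<Sum>i<?r. \<iota> (a i) * u i) = (\<Sum>i<?r. \<iota> (a i) * theta (u i))"
      by (rule theta_lcomb) (rule uL)
    also have "\<dots> = 0" using z by (rule singletonD)
    finally have t0: "theta (\<Sum>i<?r. \<iota> (a i) * u i) = 0" .
    have "(\<Sum>i<?r. \<iota> (a i) * u i) \<in> L" by (rule B.L_sum, rule B.L_scale, rule scalar_K, rule uL) simp
    then have "(\<Sum>i<?r. \<iota> (a i) * u i) = 0" by (rule theta_inj[OF _ t0])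
    then have "(\<Sum>i<?r. \<iota> (a i) * u i) \<in> {0}" by (simp only: singleton_iff)
    then show "a i = 0" using u i unfolding basis_mod_def indep_mod_def by blast
  qed
  then have "?r \<le> card E" by (rule indep_le_spans[OF linsub_zero _ _ e]) (use uV in auto)
  then show ?thesis using cE by simp
qed

text \<open>Products of monomials in \<open>y\<close> with basis elements are independent: the basis
  separates their coefficients, which are polynomials in independent coordinates. The degree exceeds
  \<open>m\<close> by a constant only, and the factor \<open>n\<close> is the number of summands in
  the upper bound.\<close>

lemma hdim_lower:
  "n * ((m + card S) choose card S) \<le> hdim (V x (m + (\<Sum>j<n. \<delta> j))) {0}"
proof -
  define M where "M = card (Mon S m)"
  obtain \<tau> where \<tau>: "bij_betw \<tau> {..<M} (Mon S m)"
    using ex_bij_betw_nat_finite[OF finite_Mon[of S m]] by (auto simp: atLeast0LessThan M_def)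
  have \<tau>M: "\<tau> l \<in> Mon S m" if "l < M" for l using \<tau> that by (auto simp: bij_betw_def)
  have \<tau>V: "mon y (\<tau> l) \<in> V y m" if "l < M" for l
  proof -
    have "single (\<tau> l) 1 \<in> deg_le m" using \<tau>M[OF that] by (intro deg_leI) (simp add: Mon_def)
    then show ?thesis unfolding V_def by (metis ev_single hom_one imageI mult_1)
  qed
  have Vyx: "V y k \<subseteq> V x k" for k by (rule V_substitute) (rule yV)
  let ?D = "\<Sum>j<n. \<delta> j"
  let ?e = "\<lambda>j. mon y (\<tau> (j mod M)) * b (j div M)"
  have div_mod: "j div M < n" "j mod M < M" if "j < n * M" for j
  proof -
    have "M > 0" using that by (cases M) auto
    then show "j div M < n" "j mod M < M" using that by (auto simp: less_mult_imp_div_less)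
  qed
  have "indep_mod {0} (n * M) ?e"
    unfolding indep_mod_def
  proof (intro allI impI)
    fix a j assume s: "(\<Sum>i<n*M. \<iota> (a i) * ?e i) \<in> {0}" and j: "j < n * M"
    define q where "q i = (\<Sum>l<M. \<iota> (a (i * M + l)) * mon y (\<tau> l))" for i
    have qV: "q i \<in> V y m" for i unfolding q_def by (intro V_sum linsub_closed(3)[OF linsub_V] \<tau>V) simp
    have "(\<Sum>i<n*M. \<iota> (a i) * ?e i) = (\<Sum>i<n*M. \<iota> (a (i div M * M + i mod M)) * (mon y (\<tau> (i mod M)) * b (i div M)))"
      by simp
    also have "\<dots> = (\<Sum>i<n. \<Sum>l<M. \<iota> (a (i * M + l)) * (mon y (\<tau> l) * b i))"
      by (rule sum_div_mod[where F = "\<lambda>i l. \<iota> (a (i * M + l)) * (mon y (\<tau> l) * b i)"])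
    also have "\<dots> = (\<Sum>i<n. q i * b i)" by (simp add: q_def sum_distrib_right mult.assoc)
    finally have "rep K n b 0 q" using s VK[OF qV] by (simp add: rep_def)
    then have q0: "q i = 0" if "i < n" for i using bL that unfolding basis_def by blast
    define i l where "i = j div M" and "l = j mod M"
    have il: "i < n" "l < M" using div_mod[OF j] by (auto simp: i_def l_def)
    \<comment> \<open>The scalars in one vanishing coefficient \<open>q i\<close>, collected into a
      polynomial relation between the coordinates of \<open>y\<close>.\<close>
    define f where "f = (\<Sum>l<M. single (\<tau> l) (a (i * M + l)))"
    have f: "lookup f (\<tau> k) = a (i * M + k)" if k: "k < M" for k
    proof -
      have "lookup f (\<tau> k) = (\<Sum>l<M. if l = k then a (i * M + l) else 0)"
        unfolding f_def Poly_Mapping.lookup_sum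
      proof (rule sum.cong[OF refl])
        fix l' assume "l' \<in> {..<M}"
        then have "\<tau> l' = \<tau> k \<longleftrightarrow> l' = k" using \<tau> k by (auto simp: bij_betw_def dest: inj_onD)
        then show "lookup (single (\<tau> l') (a (i * M + l'))) (\<tau> k) = (if l' = k then a (i * M + l') else 0)"
          by (simp add: lookup_single when_def)
      qed
      then show ?thesis using k by (simp add: sum.delta)
    qed
    have "f \<in> vars_in S"
      unfolding vars_in_def
    proof (rule CollectI, rule ballI)
      fix t assume "t \<in> keys f"
      then have "lookup f t \<noteq> 0" by (simp add: in_keys_iff)
      then have "\<exists>l<M. t = \<tau> l"
        unfolding f_def Poly_Mapping.lookup_sum by (metis (no_types, lifting) lessThan_iff lookup_single_not_eq sum.neutral)
      then show "keys t \<subseteq> S" using \<tau>M by (auto simp: Mon_def)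
    qed
    moreover have "ev y f = 0" using q0[OF il(1)] by (simp add: f_def q_def ev_sum ev_single)
    ultimately have "f = 0" by (rule ind)
    then have "a (i * M + l) = 0" using f[OF il(2)] by simp
    then show "a j = 0" by (simp add: i_def l_def)
  qed
  moreover have "?e j \<in> V x (m + ?D)" if j: "j < n * M" for j
  proof -
    have "\<delta> (j div M) \<le> ?D" by (rule member_le_sum) (use div_mod[OF j] in auto)
    then have "b (j div M) \<in> V x ?D" using b\<delta>[OF div_mod(1)[OF j]] V_mono by blast
    then show ?thesis using \<tau>V[OF div_mod(2)[OF j]] Vyx by (intro V_mult) auto
  qed
  ultimately have "n * M \<le> hdim (V x (m + ?D)) {0}"
    by (intro hdim_ge_indep[OF linsub_zero fin_span_V]) auto
  then show ?thesis by (simp add: M_def card_Mon)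
qed

lemma n_pos: "n \<ge> 1"
  using tr_nz by (cases n) (auto simp: trace_def)

end

theorem (in field_embedding) filtration_bounds:
  fixes x :: "'v::finite \<Rightarrow> 'o"
  assumes "infinite (UNIV :: 'f set)" maclane_separable
  obtains T D c :: nat where "D \<ge> 1" "\<And>m. hdim (V x m) {0} \<le> (\<Sum>j<D. (m + j + T) choose T)"
    "\<And>m. D * ((m + T) choose T) \<le> hdim (V x (m + c)) {0}"
proof -
  obtain S y W n b \<delta> L where N: "normalized x S y W n b \<delta> L"
    using normal_form_exists[OF assms, of UNIV x] by auto
  interpret normalized_ext \<iota> x S y W n b \<delta> L by unfold_locales (rule N)
  show ?thesis using that[of n "card S" "\<Sum>j<n. \<delta> j"] n_pos hdim_upper hdim_lower by blast
qed

section \<open>Generic points of prime ideals\<close>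

lemma map_poly_coeff: "f 0 = 0 \<Longrightarrow> Polynomial.coeff (map_poly f p) i = f (Polynomial.coeff p i)"
  by (rule coeff_map_poly)

text \<open>\<open>\<phi>\<close> embeds the domain A/(A \<inter> P) into an algebraically closed
  field. The ideal \<open>P\<close> belongs to the whole ring, since \<open>A\<close> will be
  enlarged by one variable at a time.\<close>

locale residue_hom =
  fixes A :: "'a::comm_ring_1 set" and P :: "'a set" and \<phi> :: "'a \<Rightarrow> 'o::alg_closed_field"
  assumes A: "0 \<in> A" "1 \<in> A" "\<And>a b. a \<in> A \<Longrightarrow> b \<in> A \<Longrightarrow> a + b \<in> A" "\<And>a b. a \<in> A \<Longrightarrow> b \<in> A \<Longrightarrow> a * b \<in> A"
      "\<And>a. a \<in> A \<Longrightarrow> - a \<in> A"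
    and P: "prime_ideal P"
    and \<phi>: "\<phi> 0 = 0" "\<And>a b. a \<in> A \<Longrightarrow> b \<in> A \<Longrightarrow> \<phi> (a + b) = \<phi> a + \<phi> b"
      "\<And>a b. a \<in> A \<Longrightarrow> b \<in> A \<Longrightarrow> \<phi> (a * b) = \<phi> a * \<phi> b"
      "\<And>a. a \<in> A \<Longrightarrow> \<phi> a = 0 \<longleftrightarrow> a \<in> P"
begin

definition AX :: "'a poly set" where "AX = {p. \<forall>i. Polynomial.coeff p i \<in> A}"

abbreviation \<Phi> :: "'a poly \<Rightarrow> 'o poly" where "\<Phi> \<equiv> map_poly \<phi>"

lemma coeff_\<Phi>: "Polynomial.coeff (\<Phi> p) i = \<phi> (Polynomial.coeff p i)"
  by (rule map_poly_coeff[of \<phi>, OF \<phi>(1)])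

lemma A_diff: "a \<in> A \<Longrightarrow> b \<in> A \<Longrightarrow> a - b \<in> A"
  using A(3)[of a "- b"] A(5) by simp

lemma A_sum: "(\<And>i. i \<in> S \<Longrightarrow> f i \<in> A) \<Longrightarrow> sum f S \<in> A"
  by (induction S rule: infinite_finite_induct) (auto intro: A)

lemma \<phi>_sum: "(\<And>i. i \<in> S \<Longrightarrow> f i \<in> A) \<Longrightarrow> \<phi> (sum f S) = (\<Sum>i\<in>S. \<phi> (f i))"
  by (induction S rule: infinite_finite_induct) (auto simp: \<phi>(1,2) A_sum)

lemma AX_mult: "p \<in> AX \<Longrightarrow> q \<in> AX \<Longrightarrow> p * q \<in> AX"
  by (auto simp: AX_def Polynomial.coeff_mult intro!: A_sum A(4))

lemma AX_diff: "p \<in> AX \<Longrightarrow> q \<in> AX \<Longrightarrow> p - q \<in> AX"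
  by (auto simp: AX_def intro: A_diff)

lemma AX_add: "p \<in> AX \<Longrightarrow> q \<in> AX \<Longrightarrow> p + q \<in> AX"
  by (auto simp: AX_def intro: A)

lemma AX_monom: "c \<in> A \<Longrightarrow> Polynomial.monom c k \<in> AX"
  by (auto simp: AX_def A(1))

lemma AX_smult: "c \<in> A \<Longrightarrow> p \<in> AX \<Longrightarrow> Polynomial.smult c p \<in> AX"
  by (auto simp: AX_def intro: A)

lemma \<Phi>_add: "p \<in> AX \<Longrightarrow> q \<in> AX \<Longrightarrow> \<Phi> (p + q) = \<Phi> p + \<Phi> q"
  by (rule poly_eqI) (auto simp: coeff_\<Phi> AX_def \<phi>(2))

lemma \<Phi>_mult: "p \<in> AX \<Longrightarrow> q \<in> AX \<Longrightarrow> \<Phi> (p * q) = \<Phi> p * \<Phi> q"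
  by (rule poly_eqI) (auto simp: coeff_\<Phi> Polynomial.coeff_mult AX_def \<phi>_sum \<phi>(3) A(4))

lemma \<Phi>_smult: "c \<in> A \<Longrightarrow> p \<in> AX \<Longrightarrow> \<Phi> (Polynomial.smult c p) = Polynomial.smult (\<phi> c) (\<Phi> p)"
  by (rule poly_eqI) (auto simp: coeff_\<Phi> AX_def \<phi>(3))

lemma lc_AX: "p \<in> AX \<Longrightarrow> Polynomial.coeff p i \<in> A"
  by (simp add: AX_def)

text \<open>Degree exactly \<open>n\<close> after reduction modulo \<open>P\<close>: the coefficient
  at \<open>n\<close> survives, and there is nothing above it even before reduction.\<close>

definition lead :: "nat \<Rightarrow> 'a poly \<Rightarrow> bool" where
  "lead n p \<longleftrightarrow> p \<in> AX \<and> (\<forall>i>n. Polynomial.coeff p i = 0) \<and> Polynomial.coeff p n \<notin> P"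

text \<open>Dropping leading coefficients in \<open>P\<close> does not change residues.\<close>

lemma strip:
  assumes "p \<in> AX" "\<forall>i>n. Polynomial.coeff p i = 0"
  shows "(\<forall>i. Polynomial.coeff p i \<in> P) \<or>
    (\<exists>m q. m \<le> n \<and> lead m q \<and> \<Phi> q = \<Phi> p \<and> (\<forall>z. poly p z - poly q z \<in> P))"
  using assms
proof (induction n arbitrary: p)
  case 0
  have id: "is_ideal P" using P by (simp add: prime_ideal_def)
  show ?case
  proof (cases "Polynomial.coeff p 0 \<in> P")
    case True
    then have "Polynomial.coeff p i \<in> P" for i using 0 ideal_closed(1)[OF id] by (cases "i = 0") auto
    then show ?thesis by blast
  next
    case False
    then have "lead 0 p" using 0 by (simp add: lead_def)
    then show ?thesis using ideal_closed(1)[OF id] by (intro disjI2 exI[of _ 0] exI[of _ p]) simp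
  qed
next
  case (Suc n)
  have id: "is_ideal P" using P by (simp add: prime_ideal_def)
  show ?case
  proof (cases "Polynomial.coeff p (Suc n) \<in> P")
    case True
    define c where "c = Polynomial.coeff p (Suc n)"
    define p' where "p' = p - Polynomial.monom c (Suc n)"
    have cA: "c \<in> A" unfolding c_def by (rule lc_AX[OF Suc.prems(1)])
    have c0: "\<phi> c = 0" using \<phi>(4)[OF cA] True by (simp add: c_def)
    have p': "p' \<in> AX" unfolding p'_def by (intro AX_diff Suc.prems AX_monom cA)
    have "Polynomial.coeff p' i = 0" if "i > n" for i
      using Suc.prems(2) that by (cases "i = Suc n") (auto simp: p'_def c_def)
    then have IH: "(\<forall>i. Polynomial.coeff p' i \<in> P) \<or>
      (\<exists>m q. m \<le> n \<and> lead m q \<and> \<Phi> q = \<Phi> p' \<and> (\<forall>z. poly p' z - poly q z \<in> P))"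
      by (intro Suc.IH p') blast
    have ph: "\<Phi> p' = \<Phi> p"
      by (rule poly_eqI) (use c0 \<phi>(1) in \<open>auto simp: coeff_\<Phi> p'_def c_def\<close>)
    from IH show ?thesis
    proof
      assume a: "\<forall>i. Polynomial.coeff p' i \<in> P"
      have "Polynomial.coeff p i \<in> P" for i
        using True a[rule_format, of i] by (cases "i = Suc n") (auto simp: p'_def)
      then show ?thesis by blast
    next
      assume "\<exists>m q. m \<le> n \<and> lead m q \<and> \<Phi> q = \<Phi> p' \<and> (\<forall>z. poly p' z - poly q z \<in> P)"
      then obtain m q where q: "m \<le> n" "lead m q" "\<Phi> q = \<Phi> p'" "\<And>z. poly p' z - poly q z \<in> P" by blast
      have "poly p z - poly q z \<in> P" for z
      proof -
        have "poly p z - poly q z = (poly p' z - poly q z) + z ^ Suc n * c"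
          by (simp add: p'_def poly_monom algebra_simps)
        moreover have "z ^ Suc n * c \<in> P" using ideal_closed(3)[OF id True] by (simp add: c_def)
        ultimately show ?thesis using ideal_closed(2)[OF id q(4)] by metis
      qed
      then show ?thesis using q ph by (intro disjI2 exI[of _ m] exI[of _ q]) auto
    qed
  next
    case False
    then have "lead (Suc n) p" using Suc.prems by (simp add: lead_def)
    then show ?thesis using ideal_closed(1)[OF id] by (intro disjI2 exI[of _ "Suc n"] exI[of _ p]) simp
  qed
qed

lemma reduce_step:
  assumes f: "lead d f" and p: "p \<in> AX" "\<forall>i>n. Polynomial.coeff p i = 0" and n: "d \<le> n" "n \<ge> 1"
  defines "p' \<equiv> Polynomial.smult (Polynomial.coeff f d) p - Polynomial.monom (Polynomial.coeff p n) (n - d) * f"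
  shows "p' \<in> AX" "\<forall>i>n-1. Polynomial.coeff p' i = 0"
proof -
  have fA: "f \<in> AX" using f by (simp add: lead_def)
  show "p' \<in> AX" unfolding p'_def by (intro AX_diff AX_smult AX_mult AX_monom lc_AX fA p(1))
  show "\<forall>i>n-1. Polynomial.coeff p' i = 0"
  proof (intro allI impI)
    fix i assume i: "i > n - 1"
    have m: "Polynomial.coeff (Polynomial.monom (Polynomial.coeff p n) (n - d) * f) i = Polynomial.coeff p n * Polynomial.coeff f (i - (n - d))"
      using i n by (subst coeff_monom_mult) auto
    show "Polynomial.coeff p' i = 0"
    proof (cases "i = n")
      case True
      then have "i - (n - d) = d" using n by simp
      then show ?thesis using True m by (simp add: p'_def mult.commute)
    next
      case False
      then have "i > n" "i - (n - d) > d" using i n by auto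
      then show ?thesis using f p(2) m by (simp add: p'_def lead_def)
    qed
  qed
qed

text \<open>Pseudo-division. Elements outside \<open>P\<close> play the role of units, and the
  factors \<open>s\<close> that accumulate stay outside \<open>P\<close> because \<open>P\<close> is
  prime.\<close>

lemma lead_reduce:
  assumes f: "lead d f" "d \<ge> 1" and p: "p \<in> AX" "\<forall>i>n. Polynomial.coeff p i = 0"
  shows "\<exists>s a r. s \<notin> P \<and> s \<in> A \<and> a \<in> AX \<and> r \<in> AX \<and> Polynomial.smult s p = a * f + r \<and>
     (\<forall>i\<ge>d. Polynomial.coeff r i = 0) \<and> (\<forall>i. i + d > n \<longrightarrow> Polynomial.coeff a i = 0)"
  using p
proof (induction n arbitrary: p)
  case 0
  have "1 \<notin> P" using P ideal_eq_UNIV by (auto simp: prime_ideal_def)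
  then show ?case using 0 f(2) A
    by (intro exI[of _ 1] exI[of _ 0] exI[of _ p]) (auto simp: AX_def)
next
  case (Suc n)
  have one: "1 \<notin> P" using P ideal_eq_UNIV by (auto simp: prime_ideal_def)
  show ?case
  proof (cases "d \<le> Suc n")
    case False
    then show ?thesis using one Suc.prems A
      by (intro exI[of _ 1] exI[of _ 0] exI[of _ p]) (auto simp: AX_def)
  next
    case True
    define c where "c = Polynomial.coeff f d"
    define m where "m = Polynomial.monom (Polynomial.coeff p (Suc n)) (Suc n - d)"
    define p' where "p' = Polynomial.smult c p - m * f"
    have fA: "f \<in> AX" and c: "c \<notin> P" using f by (auto simp: lead_def c_def)
    have cA: "c \<in> A" unfolding c_def by (rule lc_AX[OF fA])
    have mA: "m \<in> AX" unfolding m_def by (intro AX_monom lc_AX Suc.prems)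
    have p': "p' \<in> AX" "\<forall>i>n. Polynomial.coeff p' i = 0"
      using reduce_step[OF f(1) Suc.prems True] unfolding p'_def c_def m_def by auto
    obtain s a r where IH: "s \<notin> P" "s \<in> A" "a \<in> AX" "r \<in> AX" "Polynomial.smult s p' = a * f + r"
      "\<forall>i\<ge>d. Polynomial.coeff r i = 0" "\<forall>i. i + d > n \<longrightarrow> Polynomial.coeff a i = 0"
      using Suc.IH[OF p'] by blast
    have "Polynomial.smult (s * c) p = Polynomial.smult s (p' + m * f)" by (simp add: p'_def)
    also have "\<dots> = (a + Polynomial.smult s m) * f + r" using IH(5) by (simp add: smult_add_right algebra_simps)
    finally have "Polynomial.smult (s * c) p = (a + Polynomial.smult s m) * f + r" .
    moreover have "s * c \<notin> P" using P IH(1) c by (auto simp: prime_ideal_def)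
    moreover have "\<forall>i. i + d > Suc n \<longrightarrow> Polynomial.coeff (a + Polynomial.smult s m) i = 0"
      using IH(7) True by (auto simp: m_def)
    ultimately show ?thesis using IH mA cA A(4)[OF IH(2) cA]
      by (intro exI[of _ "s * c"] exI[of _ "a + Polynomial.smult s m"] exI[of _ r]) (auto intro: AX_add AX_smult)
  qed
qed

text \<open>\<open>f\<close> is a minimal polynomial of \<open>z\<close> over the residue field with
  denominators cleared, and \<open>\<zeta>\<close> is a root of its image. Vanishing at
  \<open>z\<close> passes to \<open>\<zeta>\<close> by division by \<open>f\<close>; conversely, a
  counterexample of least degree would divide \<open>f\<close> modulo \<open>P\<close>.\<close>

theorem extend_algebraic:
  assumes alg: "p0 \<in> AX" "poly p0 z \<in> P" "Polynomial.coeff p0 j0 \<notin> P"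
  shows "\<exists>\<zeta>. \<forall>p\<in>AX. poly (\<Phi> p) \<zeta> = 0 \<longleftrightarrow> poly p z \<in> P"
proof -
  have id: "is_ideal P" using P by (simp add: prime_ideal_def)
  have Pdiff: "poly q z \<in> P" if "poly p z \<in> P" "\<And>z. poly p z - poly q z \<in> P" for p q
  proof -
    have "poly p z - (poly p z - poly q z) \<in> P" using that ideal_closed(6)[OF id] by blast
    then show ?thesis by simp
  qed
  have Pdiff': "poly p z \<in> P" if "poly q z \<in> P" "\<And>z. poly p z - poly q z \<in> P" for p q
  proof -
    have "poly q z + (poly p z - poly q z) \<in> P" using that ideal_closed(2)[OF id] by blast
    then show ?thesis by simp
  qed
  have all_P: "poly p z \<in> P" if "\<forall>i. Polynomial.coeff p i \<in> P" for p
    unfolding poly_altdef by (intro ideal_sum[OF id] ideal_closed(4)[OF id]) (use that in blast)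
  have all_P': "\<Phi> p = 0" if "p \<in> AX" "\<forall>i. Polynomial.coeff p i \<in> P" for p
    by (rule poly_eqI) (use that \<phi>(4) in \<open>auto simp: coeff_\<Phi> AX_def\<close>)
  define Q where "Q d \<longleftrightarrow> (\<exists>f. lead d f \<and> poly f z \<in> P)" for d
  have hi: "\<forall>i>Polynomial.degree p. Polynomial.coeff p i = 0" for p :: "'a poly" by (auto simp: coeff_eq_0)
  obtain m0 f0 where "lead m0 f0" "\<And>z. poly p0 z - poly f0 z \<in> P"
    using strip[OF alg(1) hi] alg(3) by blast
  then have "Q m0" unfolding Q_def using Pdiff[OF alg(2)] by blast
  define d where "d = (LEAST d. Q d)"
  have "Q d" unfolding d_def by (rule LeastI) (rule \<open>Q m0\<close>)
  then obtain f where f: "lead d f" "poly f z \<in> P" unfolding Q_def by blast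
  have min: "d \<le> e" if "lead e g" "poly g z \<in> P" for e g
    unfolding d_def by (rule Least_le) (use that in \<open>auto simp: Q_def\<close>)
  have fA: "f \<in> AX" using f(1) by (simp add: lead_def)
  have d1: "d \<ge> 1"
  proof (rule ccontr)
    assume "\<not> d \<ge> 1"
    then have d0: "d = 0" by simp
    have "f = Polynomial.monom (Polynomial.coeff f 0) 0"
      by (rule poly_eqI) (use f(1) d0 in \<open>auto simp: lead_def\<close>)
    then have "poly f z = Polynomial.coeff f 0" by (metis poly_monom power_0 mult.right_neutral)
    then show False using f d0 by (simp add: lead_def)
  qed
  \<comment> \<open>By minimality of \<open>d\<close>, a polynomial of degree below \<open>d\<close>
    that vanishes at \<open>z\<close> modulo \<open>P\<close> is zero modulo
    \<open>P\<close>.\<close>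
  have small: "\<forall>i. Polynomial.coeff p i \<in> P" if p: "p \<in> AX" "poly p z \<in> P" "\<forall>i\<ge>d. Polynomial.coeff p i = 0" for p
  proof (rule ccontr)
    assume "\<not> ?thesis"
    moreover have "\<forall>i>d-1. Polynomial.coeff p i = 0" using p(3) d1 by auto
    ultimately obtain m q where q: "m \<le> d - 1" "lead m q" "\<And>z. poly p z - poly q z \<in> P"
      using strip[OF p(1), of "d - 1"] by blast
    have "d \<le> m" by (rule min[OF q(2)]) (rule Pdiff[OF p(2) q(3)])
    then show False using q(1) d1 by simp
  qed
  have "Polynomial.coeff (\<Phi> f) d \<noteq> 0"
    using f(1) \<phi>(4)[OF lc_AX[OF fA]] by (simp add: coeff_\<Phi> lead_def)
  then have "Polynomial.degree (\<Phi> f) \<ge> d" by (rule le_degree)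
  then have "Polynomial.degree (\<Phi> f) > 0" using d1 by simp
  then obtain \<zeta> where \<zeta>: "poly (\<Phi> f) \<zeta> = 0" using alg_closed_imp_poly_has_root by blast
  have fwd: "poly (\<Phi> p) \<zeta> = 0" if p: "p \<in> AX" "poly p z \<in> P" for p
  proof -
    obtain s a r where sr: "s \<notin> P" "s \<in> A" "a \<in> AX" "r \<in> AX" "Polynomial.smult s p = a * f + r" "\<forall>i\<ge>d. Polynomial.coeff r i = 0"
      using lead_reduce[OF f(1) d1 p(1) hi] by blast
    have "poly r z = s * poly p z - poly a z * poly f z" using arg_cong[OF sr(5), of "\<lambda>q. poly q z"] by simp
    then have "poly r z \<in> P" using p(2) f(2) ideal_closed(3,6)[OF id] by simp
    then have "\<Phi> r = 0" using all_P'[OF sr(4) small[OF sr(4) _ sr(6)]] by blast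
    moreover have "Polynomial.smult (\<phi> s) (\<Phi> p) = \<Phi> a * \<Phi> f + \<Phi> r"
      using sr fA p(1) by (simp add: AX_mult flip: \<Phi>_smult \<Phi>_mult \<Phi>_add)
    ultimately have "\<phi> s * poly (\<Phi> p) \<zeta> = 0"
      using \<zeta> by (metis add.right_neutral mult_zero_right poly_mult poly_smult)
    then show ?thesis using sr(1,2) \<phi>(4) by simp
  qed
  have bwd: "poly p z \<in> P" if p: "p \<in> AX" "poly (\<Phi> p) \<zeta> = 0" for p
  proof (rule ccontr)
    assume neg: "poly p z \<notin> P"
    define R where "R n \<longleftrightarrow> (\<exists>g. lead n g \<and> poly (\<Phi> g) \<zeta> = 0 \<and> poly g z \<notin> P)" for n
    have bad: "\<exists>m\<le>k. R m" if b: "p \<in> AX" "poly (\<Phi> p) \<zeta> = 0" "poly p z \<notin> P" "\<forall>i>k. Polynomial.coeff p i = 0" for p k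
    proof -
      obtain m q where q: "m \<le> k" "lead m q" "\<Phi> q = \<Phi> p" "\<And>z. poly p z - poly q z \<in> P"
        using strip[OF b(1,4)] all_P b(3) by blast
      then have "R m" unfolding R_def using b Pdiff' by metis
      then show ?thesis using q(1) by blast
    qed
    obtain m1 where "R m1" using bad[OF p neg hi] by blast
    define n where "n = (LEAST n. R n)"
    have "R n" unfolding n_def by (rule LeastI) (rule \<open>R m1\<close>)
    then obtain g where g: "lead n g" "poly (\<Phi> g) \<zeta> = 0" "poly g z \<notin> P" unfolding R_def by blast
    have minR: "n \<le> k" if "R k" for k unfolding n_def by (rule Least_le) (rule that)
    have gA: "g \<in> AX" using g(1) by (simp add: lead_def)
    have n1: "n \<ge> 1"
    proof (rule ccontr)
      assume "\<not> n \<ge> 1"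
      then have n0: "n = 0" by simp
      have e: "g = Polynomial.monom (Polynomial.coeff g 0) 0"
        by (rule poly_eqI) (use g(1) n0 in \<open>auto simp: lead_def\<close>)
      have "\<Phi> g = Polynomial.monom (\<phi> (Polynomial.coeff g 0)) 0"
        by (rule poly_eqI) (use g(1) n0 \<phi>(1) in \<open>auto simp: lead_def coeff_\<Phi>\<close>)
      then have "\<phi> (Polynomial.coeff g 0) = 0" using g(2) by (simp add: poly_monom)
      then have "Polynomial.coeff g 0 \<in> P" using \<phi>(4)[OF lc_AX[OF gA]] by blast
      then show False using g(1) n0 by (simp add: lead_def)
    qed
    \<comment> \<open>Otherwise the remainder on division by \<open>f\<close> would be a smaller
      counterexample.\<close>
    have nd: "n < d"
    proof (rule ccontr)
      assume "\<not> n < d"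
      obtain s a r where sr: "s \<notin> P" "s \<in> A" "a \<in> AX" "r \<in> AX" "Polynomial.smult s g = a * f + r" "\<forall>i\<ge>d. Polynomial.coeff r i = 0"
        using lead_reduce[OF f(1) d1 gA hi] by blast
      have "poly r z = s * poly g z - poly a z * poly f z" using arg_cong[OF sr(5), of "\<lambda>q. poly q z"] by simp
      moreover have "poly a z * poly f z \<in> P" using f(2) ideal_closed(3)[OF id] by blast
      moreover have "s * poly g z \<notin> P" using P sr(1) g(3) by (auto simp: prime_ideal_def)
      ultimately have rz: "poly r z \<notin> P" using ideal_closed(2)[OF id, of "poly r z" "poly a z * poly f z"] by auto
      have "Polynomial.smult (\<phi> s) (\<Phi> g) = \<Phi> a * \<Phi> f + \<Phi> r"
        using sr fA gA by (simp add: AX_mult flip: \<Phi>_smult \<Phi>_mult \<Phi>_add)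
      then have "poly (\<Phi> r) \<zeta> = 0"
        using \<zeta> g(2) by (metis add_cancel_right_left mult_zero_right poly_add poly_mult poly_smult)
      moreover have "\<forall>i>d-1. Polynomial.coeff r i = 0" using sr(6) d1 by auto
      ultimately obtain k where "k \<le> d - 1" "R k" using bad[OF sr(4) _ rz] by blast
      then show False using minR \<open>\<not> n < d\<close> d1 by fastforce
    qed
    have fhi: "\<forall>i>d. Polynomial.coeff f i = 0" using f(1) by (simp add: lead_def)
    \<comment> \<open>Divide \<open>f\<close> by the counterexample \<open>g\<close>. The remainder
      vanishes at \<open>\<zeta>\<close> and is too small for a counterexample, so it vanishes at
      \<open>z\<close> modulo \<open>P\<close>, and so does the product of \<open>a\<close> and
      \<open>g\<close>, hence \<open>a\<close>. Then \<open>a\<close> is zero modulo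
      \<open>P\<close>, which contradicts the leading coefficient of \<open>f\<close>.\<close>
    obtain s a r where sr: "s \<notin> P" "s \<in> A" "a \<in> AX" "r \<in> AX" "Polynomial.smult s f = a * g + r"
      "\<forall>i\<ge>n. Polynomial.coeff r i = 0" "\<forall>i. i + n > d \<longrightarrow> Polynomial.coeff a i = 0"
      using lead_reduce[OF g(1) n1 fA fhi] by blast
    have "Polynomial.smult (\<phi> s) (\<Phi> f) = \<Phi> a * \<Phi> g + \<Phi> r"
      using sr fA gA by (simp add: AX_mult flip: \<Phi>_smult \<Phi>_mult \<Phi>_add)
    then have rz0: "poly (\<Phi> r) \<zeta> = 0"
      using \<zeta> g(2) by (metis add_cancel_right_left mult_zero_right poly_add poly_mult poly_smult)
    have rP: "poly r z \<in> P"
    proof (rule ccontr)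
      assume "poly r z \<notin> P"
      moreover have "\<forall>i>n-1. Polynomial.coeff r i = 0" using sr(6) n1 by auto
      ultimately obtain k where "k \<le> n - 1" "R k" using bad[OF sr(4) rz0] by blast
      then show False using minR n1 by fastforce
    qed
    have "poly a z * poly g z = s * poly f z - poly r z" using arg_cong[OF sr(5), of "\<lambda>q. poly q z"] by simp
    then have "poly a z * poly g z \<in> P" using rP f(2) ideal_closed(3,6)[OF id] by simp
    then have aP: "poly a z \<in> P" using P g(3) by (auto simp: prime_ideal_def)
    have "\<forall>i\<ge>d. Polynomial.coeff a i = 0" using sr(7) n1 by auto
    then have aall: "\<forall>i. Polynomial.coeff a i \<in> P" by (rule small[OF sr(3) aP])
    have "Polynomial.coeff (a * g) d \<in> P"
      unfolding Polynomial.coeff_mult by (intro ideal_sum[OF id] ideal_closed(4)[OF id]) (use aall in blast)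
    moreover have "Polynomial.coeff (Polynomial.smult s f) d = Polynomial.coeff (a * g) d"
      using sr(5,6) nd by simp
    ultimately have "s * Polynomial.coeff f d \<in> P" by simp
    then show False using P sr(1) f(1) by (auto simp: prime_ideal_def lead_def)
  qed
  show ?thesis using fwd bwd by blast
qed

end

section \<open>Fraction fields and a universal field for generic points\<close>

definition fract_of :: "'a::idom \<Rightarrow> 'a fract" where "fract_of a = Fraction_Field.Fract a 1"

lemma fract_of_hom:
  shows "fract_of (a + b) = fract_of a + fract_of b" "fract_of (a * b) = fract_of a * fract_of b"
    "fract_of 1 = 1" "fract_of 0 = 0"
  by (simp_all add: fract_of_def One_fract_def Zero_fract_def)

lemma fract_of_eq_iff [simp]: "fract_of a = fract_of b \<longleftrightarrow> a = b"
  by (simp add: fract_of_def eq_fract)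

lemma fract_of_eq_0 [simp]: "fract_of a = 0 \<longleftrightarrow> a = 0"
  by (metis fract_of_eq_iff fract_of_hom(4))

lemma fract_of_sum: "fract_of (sum f A) = (\<Sum>i\<in>A. fract_of (f i))"
  by (induction A rule: infinite_finite_induct) (auto simp: fract_of_hom)

lemma fract_of_power: "fract_of (a ^ n) = fract_of a ^ n"
  by (induction n) (auto simp: fract_of_hom)

lemma fract_of_nat: "fract_of (of_nat n) = of_nat n"
  by (induction n) (auto simp: fract_of_hom)

lemma fract_as_quotient: "\<exists>a b. b \<noteq> 0 \<and> q = fract_of a / fract_of b"
  by (cases q) (auto simp: fract_of_def)

lemma CHAR_fract: "CHAR('a::idom fract) = CHAR('a)"
proof (rule CHAR_eqI)
  show "of_nat CHAR('a) = (0 :: 'a fract)" using fract_of_nat[of "CHAR('a)", where 'a = 'a] by (simp add: fract_of_hom)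
  show "CHAR('a) dvd n" if "of_nat n = (0 :: 'a fract)" for n
    using that fract_of_nat[of n, where 'a = 'a] by (metis fract_of_eq_0 of_nat_eq_0_iff_char_dvd)
qed

lemma common_denominator_fract:
  fixes c :: "nat \<Rightarrow> 'a::idom fract"
  shows "\<exists>g C. g \<noteq> 0 \<and> (\<forall>i<r. fract_of g * c i = fract_of (C i))"
proof (induction r)
  case 0
  then show ?case by (intro exI[of _ 1]) simp
next
  case (Suc r)
  then obtain g C where g: "g \<noteq> 0" "\<forall>i<r. fract_of g * c i = fract_of (C i)" by blast
  obtain a b where ab: "b \<noteq> 0" "c r = fract_of a / fract_of b" using fract_as_quotient by blast
  have "fract_of (g * b) * c i = fract_of ((\<lambda>i. if i < r then b * C i else g * a) i)" if "i < Suc r" for i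
  proof (cases "i < r")
    case True
    have "fract_of (g * b) * c i = fract_of b * (fract_of g * c i)" by (simp add: fract_of_hom)
    then show ?thesis using True g(2) by (simp add: fract_of_hom)
  next
    case False
    then have "i = r" using that by simp
    then show ?thesis using ab by (simp add: fract_of_hom)
  qed
  then have "\<forall>i<Suc r. fract_of (g * b) * c i = fract_of ((\<lambda>i. if i < r then b * C i else g * a) i)" by blast
  moreover have "g * b \<noteq> 0" using g(1) ab(1) by simp
  ultimately show ?case by (intro exI conjI)
qed

lemma infinite_rational_functions: "infinite (UNIV :: 'a::idom poly fract set)"
proof -
  have "inj (\<lambda>n::nat. fract_of (Polynomial.monom (1::'a) n))"
  proof (rule injI)
    fix m n :: nat assume "fract_of (Polynomial.monom (1::'a) m) = fract_of (Polynomial.monom 1 n)"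
    then have "Polynomial.degree (Polynomial.monom (1::'a) m) = Polynomial.degree (Polynomial.monom (1::'a) n)" by simp
    then show "m = n" by (simp add: degree_monom_eq)
  qed
  then have "infinite (range (\<lambda>n::nat. fract_of (Polynomial.monom (1::'a) n)))" by (rule range_inj_infinite)
  then show ?thesis by (rule infinite_super[rotated]) (rule subset_UNIV)
qed

text \<open>A type cannot depend on \<open>P\<close>, so one field receives the generic points of
  all primes: it has countably many independent elements and all elements algebraic over them,
  whatever the finite set of variables.\<close>

type_synonym 'k univ_ext = "((nat \<Rightarrow>\<^sub>0 nat) \<Rightarrow>\<^sub>0 'k) fract alg_closure"

definition coord_fun :: "((nat \<Rightarrow>\<^sub>0 nat) \<Rightarrow>\<^sub>0 'k::field) \<Rightarrow> 'k univ_ext" where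
  "coord_fun q = to_ac (fract_of q)"

lemma coord_fun_hom:
  shows "coord_fun (a + b) = coord_fun a + coord_fun b" "coord_fun (a * b) = coord_fun a * coord_fun b"
    "coord_fun 1 = 1" "coord_fun 0 = 0"
  by (simp_all add: coord_fun_def fract_of_hom)

lemma coord_fun_eq_0: "coord_fun a = 0 \<longleftrightarrow> a = 0"
  by (simp add: coord_fun_def)

lemma coord_fun_sum: "coord_fun (sum f A) = (\<Sum>i\<in>A. coord_fun (f i))"
  by (induction A rule: infinite_finite_induct) (auto simp: coord_fun_hom)

lemma coord_fun_prod: "coord_fun (prod f A) = (\<Prod>i\<in>A. coord_fun (f i))"
  by (induction A rule: infinite_finite_induct) (auto simp: coord_fun_hom)

lemma coord_fun_power: "coord_fun (a ^ n) = coord_fun a ^ n"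
  by (induction n) (auto simp: coord_fun_hom)

definition scalar_ext :: "'k::field \<Rightarrow> 'k univ_ext" where
  "scalar_ext c = coord_fun (single 0 c)"

lemma field_embedding_scalar_ext: "field_embedding (scalar_ext :: 'k::field \<Rightarrow> 'k univ_ext)"
proof
  show "scalar_ext (a + b) = scalar_ext a + scalar_ext b" for a b :: 'k
    by (simp add: scalar_ext_def single_add coord_fun_hom)
  show "scalar_ext (a * b) = scalar_ext a * scalar_ext b" for a b :: 'k
    by (simp add: scalar_ext_def mult_single flip: coord_fun_hom)
  show "scalar_ext 1 = (1 :: 'k univ_ext)"
    by (simp add: scalar_ext_def coord_fun_hom)
qed

interpretation G: field_embedding "scalar_ext :: 'k::field \<Rightarrow> 'k univ_ext"
  by (rule field_embedding_scalar_ext)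

definition gvar :: "'v::finite \<Rightarrow> 'k::field univ_ext" where
  "gvar v = coord_fun (single (single (to_nat v) 1) 1)"

definition rename_mon :: "('v::finite \<Rightarrow>\<^sub>0 nat) \<Rightarrow> nat \<Rightarrow>\<^sub>0 nat" where
  "rename_mon t = (\<Sum>v\<in>UNIV. single (to_nat v) (lookup t v))"

lemma rename_mon_inj: "rename_mon s = rename_mon t \<longleftrightarrow> s = (t :: 'v::finite \<Rightarrow>\<^sub>0 nat)"
proof -
  have "lookup (rename_mon t) (to_nat v) = lookup t v" for t and v :: 'v
    by (simp add: rename_mon_def lookup_sum lookup_single when_def)
  then show ?thesis by (metis poly_mapping_eqI)
qed

lemma single_power: "single t (1::'k::field) ^ n = single (of_nat n * t) 1" for t :: "nat \<Rightarrow>\<^sub>0 nat"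
  by (induction n) (auto simp: mult_single distrib_right)

lemma prod_single: "(\<Prod>v\<in>A. single (g v :: nat \<Rightarrow>\<^sub>0 nat) (1::'k::field)) = single (sum g A) 1"
  by (induction A rule: infinite_finite_induct) (auto simp: mult_single)

lemma of_nat_mult_single: "of_nat n * single a b = (single a (n * b) :: nat \<Rightarrow>\<^sub>0 nat)"
  by (induction n) (auto simp: distrib_right single_add)

lemma mon_gvar: "G.mon gvar t = coord_fun (single (rename_mon t) (1::'k::field))"
proof -
  have "gvar v ^ lookup t v = coord_fun (single (single (to_nat v) (lookup t v)) (1::'k))" for v
    by (simp add: gvar_def single_power of_nat_mult_single flip: coord_fun_power)
  then show ?thesis by (simp add: G.mon_def rename_mon_def prod_single flip: coord_fun_prod)
qed

lemma gvar_independent: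
  fixes f :: "('v::finite, 'k::field) mpoly"
  assumes "G.ev gvar f = 0" shows "f = 0"
proof (rule poly_mapping_eqI)
  fix t0 :: "'v \<Rightarrow>\<^sub>0 nat"
  have "G.ev gvar f = coord_fun (\<Sum>t\<in>keys f. single (rename_mon t) (lookup f t))"
    by (simp add: G.ev_def mon_gvar scalar_ext_def mult_single coord_fun_sum flip: coord_fun_hom)
  then have "(\<Sum>t\<in>keys f. single (rename_mon t) (lookup f t)) = 0" using assms by (simp add: coord_fun_eq_0)
  then have "lookup (\<Sum>t\<in>keys f. single (rename_mon t) (lookup f t)) (rename_mon t0) = 0" by simp
  then have "(\<Sum>t\<in>keys f. if t = t0 then lookup f t0 else 0) = 0"
    by (simp add: lookup_sum lookup_single when_def rename_mon_inj cong: if_cong sum.cong)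
  then show "lookup f t0 = lookup 0 t0" by (simp add: in_keys_iff split: if_splits)
qed

lemma vars_in_add: "f \<in> vars_in S \<Longrightarrow> g \<in> vars_in S \<Longrightarrow> f + g \<in> (vars_in S :: ('v, 'k::field) mpoly set)"
  using Poly_Mapping.keys_add[of f g] by (auto simp: vars_in_def)

lemma vars_in_zero: "0 \<in> vars_in S"
  by (simp add: vars_in_def)

lemma vars_in_sum: "(\<And>i. i \<in> A \<Longrightarrow> f i \<in> vars_in S) \<Longrightarrow> sum f A \<in> (vars_in S :: ('v, 'k::field) mpoly set)"
  by (induction A rule: infinite_finite_induct) (auto intro: vars_in_add vars_in_zero)

lemma single_remove_var:
  "single (t - single v (lookup t v)) c * pvar v ^ lookup t v = (single t c :: ('v::finite, 'k::field) mpoly)"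
proof -
  have p: "pvar v ^ n = single (single v n) (1::'k)" for n
    by (induction n) (auto simp: pvar_def mult_single simp flip: single_add)
  have "t - single v (lookup t v) + single v (lookup t v) = t"
    by (rule poly_mapping_eqI) (simp add: lookup_add lookup_minus lookup_single when_def)
  then show ?thesis by (simp add: p mult_single)
qed

lemma poly_in_var:
  fixes f :: "('v::finite, 'k::field) mpoly"
  assumes "f \<in> vars_in (insert v U)" "v \<notin> U"
  shows "\<exists>p. (\<forall>i. Polynomial.coeff p i \<in> vars_in U) \<and> poly p (pvar v) = f"
proof -
  define p where "p = (\<Sum>t\<in>keys f. Polynomial.monom (single (t - single v (lookup t v)) (lookup f t)) (lookup t v))"
  have "Polynomial.coeff p i \<in> vars_in U" for i
    unfolding p_def coeff_sum
  proof (rule vars_in_sum)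
    fix t assume "t \<in> keys f"
    then have t: "keys t \<subseteq> insert v U" using assms by (auto simp: vars_in_def)
    have "keys (t - single v (lookup t v)) \<subseteq> U"
    proof
      fix w assume "w \<in> keys (t - single v (lookup t v))"
      then have "lookup t w - (if w = v then lookup t v else 0) \<noteq> 0"
        by (simp add: in_keys_iff lookup_minus lookup_single when_def eq_commute[of v])
      then have "w \<noteq> v" "w \<in> keys t" by (auto simp: in_keys_iff split: if_splits)
      then show "w \<in> U" using t by blast
    qed
    then show "Polynomial.coeff (Polynomial.monom (single (t - single v (lookup t v)) (lookup f t)) (lookup t v)) i \<in> vars_in U"
      by (auto simp: vars_in_def)
  qed
  moreover have "poly p (pvar v) = f"
    unfolding p_def poly_sum poly_monom single_remove_var by (rule mpoly_eq_sum_single[symmetric])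
  ultimately show ?thesis by blast
qed

lemma ev_poly_in_var:
  fixes p :: "('v::finite, 'k::field) mpoly poly"
  assumes "\<forall>i. Polynomial.coeff p i \<in> vars_in U" "v \<notin> U"
  shows "G.ev (\<xi>(v := \<zeta>)) (poly p (pvar v)) = poly (map_poly (G.ev \<xi>) p) \<zeta>"
proof -
  define \<eta> where "\<eta> = \<xi>(v := \<zeta>)"
  have "G.ev \<eta> (poly p (pvar v)) = poly (map_poly (G.ev \<xi>) p) \<zeta>" using assms(1)
  proof (induction p)
    case (pCons a p)
    have a: "a \<in> vars_in U" using pCons.prems[rule_format, of 0] by simp
    have "\<forall>i. Polynomial.coeff p i \<in> vars_in U"
    proof
      fix i show "Polynomial.coeff p i \<in> vars_in U" using pCons.prems[rule_format, of "Suc i"] by simp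
    qed
    then have IH: "G.ev \<eta> (poly p (pvar v)) = poly (map_poly (G.ev \<xi>) p) \<zeta>" by (rule pCons.IH)
    have e1: "G.ev \<eta> a = G.ev \<xi> a" by (rule G.ev_cong_vars_in[OF a]) (use assms(2) in \<open>auto simp: \<eta>_def\<close>)
    have e2: "G.ev \<eta> (pvar v) = \<zeta>" unfolding pvar_def G.ev_pvar by (simp add: \<eta>_def)
    have "G.ev \<eta> (poly (pCons a p) (pvar v)) = G.ev \<eta> a + G.ev \<eta> (pvar v) * G.ev \<eta> (poly p (pvar v))"
      unfolding poly_pCons G.ev_add G.ev_mult ..
    also have "\<dots> = poly (pCons (G.ev \<xi> a) (map_poly (G.ev \<xi>) p)) \<zeta>" unfolding e1 e2 IH poly_pCons ..
    also have "pCons (G.ev \<xi> a) (map_poly (G.ev \<xi>) p) = map_poly (G.ev \<xi>) (pCons a p)"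
      by (rule map_poly_pCons[symmetric]) (rule G.ev_zero)
    finally show ?case .
  qed simp
  then show ?thesis unfolding \<eta>_def .
qed

text \<open>Let \<open>S\<close> be maximal such that \<open>P\<close> contains no nonzero
  polynomial in the variables \<open>S\<close>. These form a transcendence basis of the function
  field and receive independent values; by maximality every further variable is algebraic over them,
  so the map extends one variable at a time.\<close>

theorem generic_point:
  fixes P :: "('v::finite, 'k::field) mpoly set"
  assumes P: "prime_ideal P"
  shows "\<exists>\<xi> :: 'v \<Rightarrow> 'k univ_ext. \<forall>f. G.ev \<xi> f = 0 \<longleftrightarrow> f \<in> P"
proof -
  have id: "is_ideal P" and nU: "1 \<notin> P" using P ideal_eq_UNIV by (auto simp: prime_ideal_def)
  let ?C = "{S :: 'v set. \<forall>f\<in>P \<inter> vars_in S. f = 0}"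
  have "{} \<in> ?C"
  proof (rule CollectI, rule ballI, rule ccontr)
    fix f :: "('v, 'k) mpoly" assume f: "f \<in> P \<inter> vars_in {}" "f \<noteq> 0"
    have k: "keys f \<subseteq> {0}" using f by (auto simp: vars_in_def)
    have fc: "f = const (lookup f 0)"
      by (rule poly_mapping_eqI) (use k in \<open>auto simp: const_def lookup_single when_def in_keys_iff\<close>)
    then have nz: "lookup f 0 \<noteq> 0" using f(2) by (auto simp: const_def)
    have "const (inverse (lookup f 0)) * f \<in> P" using f ideal_closed(3)[OF id] by blast
    moreover have "const (inverse (lookup f 0)) * const (lookup f 0) = (1 :: ('v, 'k) mpoly)"
      using nz by (simp add: const_def mult_single)
    ultimately show False using nU fc by metis
  qed
  then obtain S where S: "S \<in> ?C" and max: "\<And>S'. S' \<in> ?C \<Longrightarrow> S \<subseteq> S' \<Longrightarrow> S = S'"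
    using finite_has_maximal[of ?C] by (metis (no_types, lifting) empty_iff finite_code)
  have "\<exists>\<xi> :: 'v \<Rightarrow> 'k univ_ext. \<forall>f\<in>vars_in (S \<union> B). G.ev \<xi> f = 0 \<longleftrightarrow> f \<in> P" if "finite B" for B :: "'v set"
    using that
  proof (induction B rule: finite_induct)
    case empty
    show ?case
    proof (intro exI[of _ gvar] ballI iffI)
      fix f :: "('v, 'k) mpoly" assume f: "f \<in> vars_in (S \<union> {})"
      show "f \<in> P" if "G.ev gvar f = 0" using gvar_independent[OF that] ideal_closed(1)[OF id] by simp
      show "G.ev gvar f = 0" if "f \<in> P"
      proof -
        have "f = 0" using S f that by simp
        then show ?thesis by simp
      qed
    qed
  next
    case (insert v B)
    define U where "U = S \<union> B"
    obtain \<xi> :: "'v \<Rightarrow> 'k univ_ext" where \<xi>: "\<And>f. f \<in> vars_in U \<Longrightarrow> G.ev \<xi> f = 0 \<longleftrightarrow> f \<in> P"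
      using insert.IH unfolding U_def by blast
    show ?case
    proof (cases "v \<in> U")
      case True
      then have "S \<union> insert v B = U" by (auto simp: U_def)
      then show ?thesis using \<xi> by (intro exI[of _ \<xi>]) simp
    next
      case False
      interpret residue_hom "vars_in U" P "G.ev \<xi>"
        by unfold_locales
          (use P \<xi> in \<open>auto simp: G.ev_add G.ev_mult vars_in_one intro!: vars_in_add vars_in_times\<close>,
           auto simp: vars_in_def)
      have "v \<notin> S" using False by (simp add: U_def)
      then have "insert v S \<notin> ?C" using max[of "insert v S"] by blast
      then obtain f where f: "f \<in> P" "f \<in> vars_in (insert v S)" "f \<noteq> 0" by blast
      obtain p where p: "\<forall>i. Polynomial.coeff p i \<in> vars_in S" "poly p (pvar v) = f"
        using poly_in_var[OF f(2) \<open>v \<notin> S\<close>] by blast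
      have "p \<noteq> 0" using p(2) f(3) by auto
      then obtain j where j: "Polynomial.coeff p j \<noteq> 0" by (metis leading_coeff_0_iff)
      \<comment> \<open>The coefficients involve only variables of \<open>S\<close>, where
        \<open>P\<close> contains nothing but 0; so the equation for \<open>v\<close> stays
        nontrivial modulo \<open>P\<close>.\<close>
      have "Polynomial.coeff p j \<notin> P" using j p(1) S by blast
      moreover have "p \<in> AX"
      proof -
        have "vars_in S \<subseteq> (vars_in U :: ('v, 'k) mpoly set)" unfolding vars_in_def U_def by blast
        then show ?thesis unfolding AX_def using p(1) by blast
      qed
      moreover have "poly p (pvar v) \<in> P" using p(2) f(1) by simp
      ultimately obtain \<zeta> where \<zeta>: "\<And>q. q \<in> AX \<Longrightarrow> poly (\<Phi> q) \<zeta> = 0 \<longleftrightarrow> poly q (pvar v) \<in> P"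
        using extend_algebraic[of p "pvar v" j] by blast
      have "G.ev (\<xi>(v := \<zeta>)) h = 0 \<longleftrightarrow> h \<in> P" if h: "h \<in> vars_in (S \<union> insert v B)" for h
      proof -
        have "h \<in> vars_in (insert v U)" using h by (simp add: U_def)
        then obtain q where q: "\<forall>i. Polynomial.coeff q i \<in> vars_in U" "poly q (pvar v) = h"
          using poly_in_var[OF _ False] by blast
        have "q \<in> AX" using q(1) by (simp add: AX_def)
        then show ?thesis using \<zeta> ev_poly_in_var[OF q(1) False, of \<xi> \<zeta>] q(2) by simp
      qed
      then show ?thesis by blast
    qed
  qed
  from this[of UNIV] show ?thesis by (simp add: vars_in_def)
qed

section \<open>Base change to rational functions\<close>

text \<open>A vanishing derivative leaves only exponents divisible by p; the coefficients have roots
  by perfectness, and the Frobenius map is additive.\<close>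

lemma pth_root_of_constant_derivative:
  fixes C :: "'f::field poly"
  assumes p: "CHAR('f) \<noteq> 0" and perf: "\<forall>y::'f. \<exists>x. x ^ CHAR('f) = y" and C: "pderiv C = 0"
  shows "\<exists>G. C = G ^ CHAR('f)"
proof -
  define q where "q = CHAR('f)"
  have q1: "q \<ge> 1" using p by (simp add: q_def)
  have pr: "Factorial_Ring.prime CHAR('f poly)" using prime_CHAR_semidom[where 'a = 'f] p by simp
  obtain \<rho> where \<rho>: "\<And>y::'f. \<rho> y ^ q = y" using perf unfolding q_def by metis
  define G where "G = (\<Sum>j\<le>Polynomial.degree C. Polynomial.monom (\<rho> (Polynomial.coeff C (q * j))) j)"
  have "G ^ q = (\<Sum>j\<le>Polynomial.degree C. Polynomial.monom (\<rho> (Polynomial.coeff C (q * j))) j ^ q)"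
    unfolding G_def by (rule freshmans_dream_sum[OF pr]) (simp add: q_def)
  also have "\<dots> = (\<Sum>j\<le>Polynomial.degree C. Polynomial.monom (Polynomial.coeff C (q * j)) (q * j))"
    by (simp add: monom_power \<rho> mult.commute)
  also have "\<dots> = C"
  proof (rule poly_eqI)
    fix n
    have e: "Polynomial.coeff (\<Sum>j\<le>Polynomial.degree C. Polynomial.monom (Polynomial.coeff C (q * j)) (q * j)) n =
      (\<Sum>j\<le>Polynomial.degree C. if q * j = n then Polynomial.coeff C n else 0)"
      unfolding coeff_sum by (rule sum.cong) auto
    show "Polynomial.coeff (\<Sum>j\<le>Polynomial.degree C. Polynomial.monom (Polynomial.coeff C (q * j)) (q * j)) n = Polynomial.coeff C n"
    proof (cases "q dvd n")
      case True
      then obtain k where k: "n = q * k" by (rule dvdE)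
      have "(\<Sum>j\<le>Polynomial.degree C. if q * j = n then Polynomial.coeff C n else 0) =
        (\<Sum>j\<le>Polynomial.degree C. if j = k then Polynomial.coeff C n else 0)"
        using q1 k by (intro sum.cong) auto
      also have "\<dots> = (if k \<le> Polynomial.degree C then Polynomial.coeff C n else 0)" by (simp add: sum.delta)
      also have "\<dots> = Polynomial.coeff C n"
      proof -
        have "k \<le> n" using k q1 by simp
        then show ?thesis by (auto simp: coeff_eq_0)
      qed
      finally show ?thesis unfolding e .
    next
      case False
      then obtain m where m: "n = Suc m" by (cases n) auto
      have "of_nat (Suc m) * Polynomial.coeff C (Suc m) = 0" using C coeff_pderiv[of C m] by simp
      moreover have "(of_nat (Suc m) :: 'f) \<noteq> 0" using False m of_nat_eq_0_iff_char_dvd[where 'a = 'f] by (metis q_def)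
      ultimately have "Polynomial.coeff C n = 0" using m by simp
      then show ?thesis unfolding e by (simp cong: if_cong)
    qed
  qed
  finally show ?thesis unfolding q_def by metis
qed

context field_embedding
begin

lemma CHAR_embedding: "CHAR('o) = CHAR('f)"
proof (rule CHAR_eqI)
  show "of_nat CHAR('f) = (0 :: 'o)" using hom_of_nat[of "CHAR('f)"] by simp
  show "CHAR('f) dvd n" if "of_nat n = (0 :: 'o)" for n
    using that hom_of_nat[of n] by (metis hom_eq_0 of_nat_eq_0_iff_char_dvd)
qed

abbreviation \<mu> :: "'f poly \<Rightarrow> 'o poly" where "\<mu> \<equiv> map_poly \<iota>"

lemma coeff_\<mu>: "Polynomial.coeff (\<mu> p) i = \<iota> (Polynomial.coeff p i)"
  by (rule coeff_map_poly) (rule hom_zero)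

lemma \<mu>_hom:
  shows "\<mu> (p + q) = \<mu> p + \<mu> q" "\<mu> (p * q) = \<mu> p * \<mu> q" "\<mu> 1 = 1" "\<mu> 0 = 0"
    "\<mu> (pconst c) = pconst (\<iota> c)" "\<mu> (pderiv p) = pderiv (\<mu> p)"
  by (rule poly_eqI, simp add: coeff_\<mu> hom_add Polynomial.coeff_mult hom_sum hom_mult coeff_pconst coeff_pderiv
      hom_of_nat)+

lemma \<mu>_power: "\<mu> (p ^ n) = \<mu> p ^ n"
  by (induction n) (simp_all add: \<mu>_hom)

lemma \<mu>_eq_0: "\<mu> p = 0 \<longleftrightarrow> p = 0"
  by (simp add: poly_eq_iff coeff_\<mu> hom_eq_0)

text \<open>Derivation with respect to the new variable kills the factors
  \<open>B i ^ CHAR('f)\<close>, so a relation in which some \<open>C i\<close> has nonzero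
  derivative yields a nontrivial one of smaller degree. Once all derivatives vanish, the
  \<open>C i\<close> are p-th powers and the p-th root of the whole relation can be taken.\<close>

lemma maclane_polynomials:
  fixes r :: nat and B :: "nat \<Rightarrow> 'o poly" and C :: "nat \<Rightarrow> 'f poly"
  assumes p: "CHAR('f) \<noteq> 0" and perf: "\<forall>y::'f. \<exists>x. x ^ CHAR('f) = y"
    and "(\<Sum>i<r. \<mu> (C i) * B i ^ CHAR('f)) = 0" "\<exists>i<r. C i \<noteq> 0" "\<forall>i<r. Polynomial.degree (C i) \<le> N"
  shows "\<exists>G. (\<Sum>i<r. \<mu> (G i) * B i) = 0 \<and> (\<exists>i<r. G i \<noteq> 0)"
  using assms(3-5)
proof (induction N arbitrary: C rule: less_induct)
  case (less N)
  have pr: "Factorial_Ring.prime CHAR('o poly)" using prime_CHAR_semidom[where 'a = 'o] p CHAR_embedding by simp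
  show ?case
  proof (cases "\<forall>i<r. pderiv (C i) = 0")
    case True
    then have "\<forall>i. \<exists>G. i < r \<longrightarrow> C i = G ^ CHAR('f)" using pth_root_of_constant_derivative[OF p perf] by blast
    then obtain G where G: "\<And>i. i < r \<Longrightarrow> C i = G i ^ CHAR('f)" by metis
    have "(\<Sum>i<r. \<mu> (G i) * B i) ^ CHAR('f) = (\<Sum>i<r. (\<mu> (G i) * B i) ^ CHAR('f))"
      by (rule freshmans_dream_sum[OF pr]) (simp add: CHAR_embedding)
    also have "\<dots> = (\<Sum>i<r. \<mu> (C i) * B i ^ CHAR('f))"
      by (rule sum.cong) (simp_all add: G \<mu>_power power_mult_distrib)
    finally have "(\<Sum>i<r. \<mu> (G i) * B i) = 0" using less.prems(1) by simp
    moreover obtain i where "i < r" "C i \<noteq> 0" using less.prems(2) by blast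
    then have "\<exists>i<r. G i \<noteq> 0" using G p by (intro exI[of _ i]) (auto simp: zero_power)
    ultimately show ?thesis by (intro exI[of _ G] conjI)
  next
    case False
    then obtain j where j: "j < r" "pderiv (C j) \<noteq> 0" by blast
    have N0: "N \<noteq> 0"
    proof
      assume "N = 0"
      then have "Polynomial.degree (C j) = 0" using less.prems(3) j(1) by simp
      then have "pderiv (C j) = 0" by (intro poly_eqI) (simp add: coeff_pderiv coeff_eq_0)
      then show False using j(2) by contradiction
    qed
    have deg: "Polynomial.degree (pderiv (C i)) \<le> N - 1" if "i < r" for i
    proof (rule degree_le, intro allI impI)
      fix n assume "n > N - 1"
      then have "Suc n > Polynomial.degree (C i)" using less.prems(3) that by fastforce
      then show "Polynomial.coeff (pderiv (C i)) n = 0" by (simp add: coeff_pderiv coeff_eq_0)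
    qed
    have pw: "pderiv (B i ^ CHAR('f)) = 0" for i
    proof -
      obtain n where n: "CHAR('f) = Suc n" using p by (cases "CHAR('f)") auto
      have "(of_nat (Suc n) :: 'o) = 0" using CHAR_embedding n of_nat_CHAR[where 'a = 'o] by simp
      then show ?thesis unfolding n pderiv_power_Suc by simp
    qed
    have "0 = pderiv (\<Sum>i<r. \<mu> (C i) * B i ^ CHAR('f))" using less.prems(1) by simp
    also have "\<dots> = (\<Sum>i<r. \<mu> (pderiv (C i)) * B i ^ CHAR('f))"
      by (simp add: pderiv_sum pderiv_mult pw \<mu>_hom(6) mult.commute)
    finally have z: "(\<Sum>i<r. \<mu> (pderiv (C i)) * B i ^ CHAR('f)) = 0" by simp
    show ?thesis
      by (rule less.IH[of "N - 1" "\<lambda>i. pderiv (C i)"]) (use N0 j deg z in auto)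
  qed
qed

text \<open>The map of fraction fields induced by \<open>\<mu>\<close>; the value does not depend on
  the chosen fraction, because \<open>\<mu>\<close> is an injective ring homomorphism.\<close>

definition rat_ext :: "'f poly fract \<Rightarrow> 'o poly fract" where
  "rat_ext q = (SOME z. \<exists>a b. b \<noteq> 0 \<and> q = fract_of a / fract_of b \<and> z = fract_of (\<mu> a) / fract_of (\<mu> b))"

lemma rat_ext_quotient:
  assumes "b \<noteq> 0" shows "rat_ext (fract_of a / fract_of b) = fract_of (\<mu> a) / fract_of (\<mu> b)"
  unfolding rat_ext_def
proof (rule some_equality)
  show "\<exists>a' b'. b' \<noteq> 0 \<and> fract_of a / fract_of b = fract_of a' / fract_of b' \<and>
      fract_of (\<mu> a) / fract_of (\<mu> b) = fract_of (\<mu> a') / fract_of (\<mu> b')" using assms by blast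
  fix z assume "\<exists>a' b'. b' \<noteq> 0 \<and> fract_of a / fract_of b = fract_of a' / fract_of b' \<and> z = fract_of (\<mu> a') / fract_of (\<mu> b')"
  then obtain a' b' where ab: "b' \<noteq> 0" "fract_of a / fract_of b = fract_of a' / fract_of b'" "z = fract_of (\<mu> a') / fract_of (\<mu> b')"
    by blast
  have "fract_of (a * b') = fract_of (a' * b)" using ab(1,2) assms by (simp add: frac_eq_eq fract_of_hom)
  then have "\<mu> a * \<mu> b' = \<mu> a' * \<mu> b" by (metis fract_of_eq_iff \<mu>_hom(2))
  then have "fract_of (\<mu> a) * fract_of (\<mu> b') = fract_of (\<mu> a') * fract_of (\<mu> b)" by (simp flip: fract_of_hom)
  then show "z = fract_of (\<mu> a) / fract_of (\<mu> b)"
    unfolding ab(3) using assms ab(1) by (simp add: frac_eq_eq \<mu>_eq_0)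
qed

lemma rat_ext_fract_of: "rat_ext (fract_of a) = fract_of (\<mu> a)"
  using rat_ext_quotient[of 1 a] by (simp add: fract_of_hom \<mu>_hom)

lemma field_embedding_rat_ext: "field_embedding rat_ext"
proof
  fix q q' :: "'f poly fract"
  obtain a b where q: "b \<noteq> 0" "q = fract_of a / fract_of b" using fract_as_quotient by blast
  obtain c d where q': "d \<noteq> 0" "q' = fract_of c / fract_of d" using fract_as_quotient by blast
  have bd: "b * d \<noteq> 0" using q q' by simp
  have m: "q * q' = fract_of (a * c) / fract_of (b * d)" by (simp add: q q' fract_of_hom)
  show "rat_ext (q * q') = rat_ext q * rat_ext q'"
    unfolding m rat_ext_quotient[OF bd] unfolding q(2) q'(2) rat_ext_quotient[OF q(1)] rat_ext_quotient[OF q'(1)]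
    by (simp add: \<mu>_hom fract_of_hom)
  have s: "q + q' = fract_of (a * d + c * b) / fract_of (b * d)" using q q' by (simp add: fract_of_hom add_frac_eq)
  show "rat_ext (q + q') = rat_ext q + rat_ext q'"
    unfolding s rat_ext_quotient[OF bd] unfolding q(2) q'(2) rat_ext_quotient[OF q(1)] rat_ext_quotient[OF q'(1)]
    using q(1) q'(1) by (simp add: \<mu>_hom fract_of_hom add_frac_eq \<mu>_eq_0)
next
  show "rat_ext 1 = 1" using rat_ext_fract_of[of 1] by (simp add: fract_of_hom \<mu>_hom)
qed

text \<open>Clearing the denominators of \<open>c\<close> and \<open>b\<close> separately reduces
  the condition to polynomials; the denominator of \<open>b\<close> enters with its p-th
  power.\<close>

theorem maclane_rat_ext:
  assumes perf: "perfect_field TYPE('f)"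
  shows "field_embedding.maclane_separable rat_ext"
proof -
  interpret E: field_embedding rat_ext by (rule field_embedding_rat_ext)
  have ch: "CHAR('f poly fract) = CHAR('f)" by (simp add: CHAR_fract)
  show ?thesis
  proof (cases "CHAR('f) = 0")
    case True
    then show ?thesis by (simp add: E.maclane_separable_def ch)
  next
    case False
    then have pf: "\<forall>y::'f. \<exists>x. x ^ CHAR('f) = y" using perf by (simp add: perfect_field_def)
    have "\<exists>d. (\<Sum>i<r. rat_ext (d i) * b i) = 0 \<and> (\<exists>i<r. d i \<noteq> 0)"
      if rel: "(\<Sum>i<r. rat_ext (c i) * b i ^ CHAR('f)) = 0" and nz: "\<exists>i<r. c i \<noteq> 0" for r :: nat and c b
    proof -
      obtain g C where g: "g \<noteq> 0" "\<And>i. i < r \<Longrightarrow> fract_of g * c i = fract_of (C i)"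
        using common_denominator_fract[of r c] by blast
      obtain h B where h: "h \<noteq> 0" "\<And>i. i < r \<Longrightarrow> fract_of h * b i = fract_of (B i)"
        using common_denominator_fract[of r b] by blast
      have "fract_of (\<mu> (C i) * B i ^ CHAR('f)) =
          rat_ext (fract_of g) * fract_of h ^ CHAR('f) * (rat_ext (c i) * b i ^ CHAR('f))" if i: "i < r" for i
      proof -
        have "fract_of (\<mu> (C i) * B i ^ CHAR('f)) = rat_ext (fract_of (C i)) * fract_of (B i) ^ CHAR('f)"
          by (simp add: fract_of_hom fract_of_power rat_ext_fract_of)
        also have "\<dots> = rat_ext (fract_of g) * rat_ext (c i) * (fract_of h * b i) ^ CHAR('f)"
          unfolding g(2)[OF i, symmetric] h(2)[OF i, symmetric] E.hom_mult ..
        finally show ?thesis by (simp add: power_mult_distrib ac_simps)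
      qed
      then have "fract_of (\<Sum>i<r. \<mu> (C i) * B i ^ CHAR('f)) =
          (\<Sum>i<r. rat_ext (fract_of g) * fract_of h ^ CHAR('f) * (rat_ext (c i) * b i ^ CHAR('f)))"
        unfolding fract_of_sum by (intro sum.cong) auto
      also have "\<dots> = 0" by (simp add: rel flip: sum_distrib_left)
      finally have z: "(\<Sum>i<r. \<mu> (C i) * B i ^ CHAR('f)) = 0" by simp
      obtain i where i: "i < r" "c i \<noteq> 0" using nz by blast
      then have "fract_of (C i) \<noteq> 0" using g(1) by (simp flip: g(2))
      then have "\<exists>i<r. C i \<noteq> 0" using i(1) by auto
      moreover have "\<forall>i<r. Polynomial.degree (C i) \<le> (\<Sum>i<r. Polynomial.degree (C i))"
        by (auto intro: member_le_sum)
      ultimately obtain G where G: "(\<Sum>i<r. \<mu> (G i) * B i) = 0" "\<exists>i<r. G i \<noteq> 0"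
        using maclane_polynomials[OF False pf z] by blast
      have "fract_of h * (\<Sum>i<r. rat_ext (fract_of (G i)) * b i) = (\<Sum>i<r. rat_ext (fract_of (G i)) * (fract_of h * b i))"
        by (simp add: sum_distrib_left mult.left_commute)
      also have "\<dots> = (\<Sum>i<r. fract_of (\<mu> (G i) * B i))"
        by (rule sum.cong) (simp_all add: h(2) rat_ext_fract_of fract_of_hom)
      also have "\<dots> = 0" unfolding fract_of_sum[symmetric] G(1) by (simp add: fract_of_hom)
      finally have "(\<Sum>i<r. rat_ext (fract_of (G i)) * b i) = 0" using h(1) by simp
      then show ?thesis using G(2) by (intro exI[of _ "\<lambda>i. fract_of (G i)"]) simp
    qed
    then show ?thesis unfolding E.maclane_separable_def ch by blast
  qed
qed

text \<open>A basis over the smaller field remains one. For independence, clear denominators and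
  compare the coefficients of each power of the new variable; for spanning, it suffices to expand
  monomials.\<close>

lemma hdim_base_change:
  fixes x :: "'v::finite \<Rightarrow> 'o"
  shows "scalar_hom.hdim rat_ext (scalar_hom.V rat_ext (\<lambda>v. fract_of (pconst (x v))) m) {0} = hdim (V x m) {0}"
proof -
  interpret E: field_embedding rat_ext by (rule field_embedding_rat_ext)
  define e where "e z = fract_of (pconst z)" for z :: 'o
  define k where "k c = fract_of (pconst c)" for c :: 'f
  have e: "e (a + b) = e a + e b" "e (a * b) = e a * e b" "e 1 = 1" "e 0 = 0" for a b
    by (simp_all add: e_def pconst_hom pconst_one fract_of_hom) (simp add: pconst_def)
  have esum: "e (sum f A) = (\<Sum>i\<in>A. e (f i))" for f :: "'i \<Rightarrow> 'o" and A
    by (induction A rule: infinite_finite_induct) (auto simp: e)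
  have eprod: "e (prod f A) = (\<Prod>i\<in>A. e (f i))" for f :: "'i \<Rightarrow> 'o" and A
    by (induction A rule: infinite_finite_induct) (auto simp: e)
  have epow: "e (a ^ n) = e a ^ n" for a n by (induction n) (auto simp: e)
  have ek: "rat_ext (k c) = e (\<iota> c)" for c by (simp add: k_def e_def rat_ext_fract_of \<mu>_hom)
  let ?x = "\<lambda>v. e (x v)"
  have emon: "E.mon ?x t = e (mon x t)" for t by (simp add: E.mon_def mon_def eprod epow)
  have monV: "E.mon ?x t \<in> E.V ?x m" if "mdeg t \<le> m" for t
  proof -
    have "E.ev ?x (single t 1) = E.mon ?x t" by (simp add: E.ev_single)
    moreover have "single t 1 \<in> deg_le m" using that by (auto intro!: deg_leI)
    ultimately show ?thesis unfolding E.V_def by (metis imageI)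
  qed
  obtain u where u: "basis_mod (V x m) {0} (hdim (V x m) {0}) u"
    using basis_mod_exists[OF linsub_zero fin_span_V] .
  define r where "r = hdim (V x m) {0}"
  have u1: "u i \<in> V x m" if "i < r" for i using u that by (simp add: basis_mod_def r_def)
  have u2: "a i = 0" if "(\<Sum>i<r. \<iota> (a i) * u i) = 0" "i < r" for a i
    using u that unfolding basis_mod_def indep_mod_def r_def by auto
  have u3: "\<exists>a. z = (\<Sum>i<r. \<iota> (a i) * u i)" if "z \<in> V x m" for z
    using u that unfolding basis_mod_def spans_mod_def r_def by auto
  have mem: "e (u i) \<in> E.V ?x m" if "i < r" for i
  proof -
    obtain f where f: "f \<in> deg_le m" "u i = ev x f" using u1[OF \<open>i < r\<close>] by (auto simp: V_def)
    have "e (u i) = (\<Sum>t\<in>keys f. rat_ext (k (lookup f t)) * E.mon ?x t)"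
      unfolding f(2) ev_def esum e(2) emon ek ..
    also have "\<dots> \<in> E.V ?x m"
      by (intro E.V_sum E.linsub_closed(3)[OF E.linsub_V] monV deg_leD[OF f(1)])
    finally show ?thesis .
  qed
  have "E.indep_mod {0} r (\<lambda>i. e (u i))"
    unfolding E.indep_mod_def
  proof (intro allI impI)
    fix a i assume z: "(\<Sum>i<r. rat_ext (a i) * e (u i)) \<in> {0}" and i: "i < r"
    obtain g C where g: "g \<noteq> 0" "\<And>i. i < r \<Longrightarrow> fract_of g * a i = fract_of (C i)"
      using common_denominator_fract[of r a] by blast
    have "fract_of (\<Sum>i<r. \<mu> (C i) * pconst (u i)) = (\<Sum>i<r. rat_ext (fract_of g * a i) * e (u i))"
      unfolding fract_of_sum by (rule sum.cong) (simp_all add: g(2) rat_ext_fract_of fract_of_hom e_def)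
    also have "\<dots> = rat_ext (fract_of g) * (\<Sum>i<r. rat_ext (a i) * e (u i))"
      by (simp add: E.hom_mult sum_distrib_left mult.assoc)
    also have "\<dots> = 0" using z by simp
    finally have z': "(\<Sum>i<r. \<mu> (C i) * pconst (u i)) = 0" by simp
    have "Polynomial.coeff (C i) n = 0" for n
    proof (rule u2[of "\<lambda>i. Polynomial.coeff (C i) n", OF _ i])
      have "Polynomial.coeff (\<Sum>i<r. \<mu> (C i) * pconst (u i)) n = (\<Sum>i<r. \<iota> (Polynomial.coeff (C i) n) * u i)"
        unfolding coeff_sum by (rule sum.cong) (simp_all add: coeff_\<mu> mult.commute[of _ "pconst _"] mult.commute)
      then show "(\<Sum>i<r. \<iota> (Polynomial.coeff (C i) n) * u i) = 0" unfolding z' by simp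
    qed
    then have "C i = 0" by (simp add: poly_eq_iff)
    then have "fract_of g * a i = 0" using g(2)[OF i] by (simp add: fract_of_hom)
    then show "a i = 0" using g(1) by simp
  qed
  moreover have "E.spans_mod (E.V ?x m) {0} r (\<lambda>i. e (u i))"
    unfolding E.spans_mod_def
  proof
    fix z assume "z \<in> E.V ?x m"
    then obtain f where f: "f \<in> deg_le m" "z = E.ev ?x f" by (auto simp: E.V_def)
    have "\<exists>a. mon x t = (\<Sum>i<r. \<iota> (a i) * u i)" if "t \<in> keys f" for t
    proof (rule u3)
      have "ev x (single t 1) = mon x t" by (simp add: ev_single)
      moreover have "single t 1 \<in> deg_le m" using deg_leD[OF f(1) that] by (auto intro!: deg_leI)
      ultimately show "mon x t \<in> V x m" unfolding V_def by (metis imageI)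
    qed
    then obtain a where a: "\<And>t. t \<in> keys f \<Longrightarrow> mon x t = (\<Sum>i<r. \<iota> (a t i) * u i)" by metis
    define A where "A i = (\<Sum>t\<in>keys f. lookup f t * k (a t i))" for i
    have "z = (\<Sum>t\<in>keys f. rat_ext (lookup f t) * (\<Sum>i<r. rat_ext (k (a t i)) * e (u i)))"
      unfolding f(2) E.ev_def emon by (intro sum.cong refl) (simp add: a esum e(2) ek)
    also have "\<dots> = (\<Sum>t\<in>keys f. \<Sum>i<r. rat_ext (lookup f t * k (a t i)) * e (u i))"
      by (simp add: sum_distrib_left E.hom_mult mult.assoc)
    also have "\<dots> = (\<Sum>i<r. rat_ext (A i) * e (u i))"
      unfolding A_def E.hom_sum sum_distrib_right by (rule sum.swap)
    finally show "\<exists>a. z - (\<Sum>i<r. rat_ext (a i) * e (u i)) \<in> {0}" by (intro exI[of _ A]) simp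
  qed
  ultimately have "E.basis_mod (E.V ?x m) {0} r (\<lambda>i. e (u i))" using mem by (simp add: E.basis_mod_def)
  then have "E.hdim (E.V ?x m) {0} = r" by (rule E.hdim_eqI[OF E.linsub_zero])
  then show ?thesis unfolding e_def r_def .
qed

end

section \<open>The degree bound\<close>

text \<open>The variable \<open>v0\<close> is nonzero at the generic point and serves to
  dehomogenize. The exponent \<open>T\<close> comes from the normalization and is not yet tied to
  the dimension of \<open>P\<close>.\<close>

theorem homogeneous_prime_bounds:
  fixes P :: "('v::finite, 'k::field) mpoly set"
  assumes perf: "perfect_field TYPE('k)" and P: "prime_ideal P" and v0: "pvar v0 \<notin> P"
  shows "\<exists>T D c. D \<ge> 1 \<and> (\<forall>m. hf P m \<le> (\<Sum>j<D. (m + j + T) choose T)) \<and>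
    (\<forall>m. D * ((m + T) choose T) \<le> hf P (m + c))"
proof -
  obtain \<xi> :: "'v \<Rightarrow> 'k univ_ext" where \<xi>: "\<And>f. G.ev \<xi> f = 0 \<longleftrightarrow> f \<in> P"
    using generic_point[OF P] by blast
  have nz: "\<xi> v0 \<noteq> 0" using \<xi>[of "pvar v0"] v0 unfolding pvar_def G.ev_pvar by simp
  define x where "x v = \<xi> v / \<xi> v0" for v
  have x0: "x v0 = 1" using nz by (simp add: x_def)
  have mon: "G.mon \<xi> t = \<xi> v0 ^ mdeg t * G.mon x t" for t
  proof -
    have "G.mon \<xi> t = (\<Prod>v\<in>UNIV. \<xi> v0 ^ lookup t v * x v ^ lookup t v)"
      unfolding G.mon_def by (rule prod.cong) (use nz in \<open>simp_all add: x_def flip: power_mult_distrib\<close>)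
    then show ?thesis by (simp add: prod.distrib mdeg_def power_sum G.mon_def)
  qed
  have ker: "G.ev x f = 0 \<longleftrightarrow> f \<in> P" if "f \<in> graded_piece m" for f m
  proof -
    have "G.ev \<xi> f = \<xi> v0 ^ m * G.ev x f"
      unfolding G.ev_def sum_distrib_left
      by (rule sum.cong) (use that in \<open>auto simp: mon graded_piece_def\<close>)
    then show ?thesis using \<xi>[of f] nz by simp
  qed
  have V: "G.ev x ` graded_piece m = G.V x m" for m
  proof
    show "G.ev x ` graded_piece m \<subseteq> G.V x m"
      unfolding G.V_def by (intro image_mono subsetI deg_leI) (simp add: graded_piece_def)
    show "G.V x m \<subseteq> G.ev x ` graded_piece m"
    proof
      fix z assume "z \<in> G.V x m"
      then obtain f where f: "f \<in> deg_le m" "z = G.ev x f" by (auto simp: G.V_def)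
      have "G.linsub (G.ev x ` graded_piece m)" by (rule G.linsub_ev_image) (rule linsub_graded)
      moreover have "G.mon x t \<in> G.ev x ` graded_piece m" if t: "t \<in> keys f" for t
      proof -
        \<comment> \<open>Since \<open>x v0 = 1\<close>, a monomial of lower degree can be padded
          with powers of the variable \<open>v0\<close> up to degree \<open>m\<close> without
          changing its value.\<close>
        define s where "s = t + single v0 (m - mdeg t)"
        have "G.mon x s = G.mon x t" by (simp add: s_def G.mon_add G.mon_single x0)
        then have "G.mon x t = G.ev x (single s 1)" by (simp add: G.ev_single)
        moreover have "single s 1 \<in> graded_piece m"
          using deg_leD[OF f(1) t] by (auto simp: graded_piece_def s_def mdeg_add)
        ultimately show ?thesis by blast
      qed
      ultimately show "z \<in> G.ev x ` graded_piece m"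
        unfolding f(2) G.ev_def[of x f] by (intro G.linsub_sum G.linsub_closed(3))
    qed
  qed
  have hf: "hf P m = G.hdim (G.V x m) {0}" for m
    using G.hdim_ev_image[OF fin_span_graded ideal_linsub[OF prime_ideal_is_ideal[OF P]], of m x] ker
    unfolding V by simp
  interpret E: field_embedding "G.rat_ext :: 'k poly fract \<Rightarrow> 'k univ_ext poly fract"
    by (rule G.field_embedding_rat_ext)
  define x' where "x' v = fract_of (pconst (x v))" for v
  have hf': "hf P m = E.hdim (E.V x' m) {0}" for m
    unfolding hf x'_def by (rule G.hdim_base_change[symmetric])
  obtain T D c :: nat where "D \<ge> 1" "\<And>m. E.hdim (E.V x' m) {0} \<le> (\<Sum>j<D. (m + j + T) choose T)"
    "\<And>m. D * ((m + T) choose T) \<le> E.hdim (E.V x' (m + c)) {0}"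
    by (rule E.filtration_bounds[OF infinite_rational_functions G.maclane_rat_ext[OF perf], of x']) (rule that, assumption+)
  then show ?thesis unfolding hf' by blast
qed

section \<open>Identifying the exponent with the dimension\<close>

lemma choose_upper_growth:
  "\<exists>C m0. \<forall>m\<ge>m0. real (\<Sum>j<D. (m + j + T) choose T) \<le> C * real m ^ T"
proof (intro exI allI impI)
  fix m assume m: "m \<ge> D + T"
  have "real ((m + j + T) choose T) \<le> 2 ^ T * real m ^ T" if "j < D" for j
  proof -
    have "(m + j + T) choose T \<le> (m + j + T) ^ T" by (rule binomial_le_pow) simp
    also have "\<dots> \<le> (2 * m) ^ T" using m that by (intro power_mono) auto
    finally have "real ((m + j + T) choose T) \<le> real ((2 * m) ^ T)" by (simp only: of_nat_le_iff)
    then show ?thesis by (simp add: power_mult_distrib)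
  qed
  then have "(\<Sum>j<D. real ((m + j + T) choose T)) \<le> (\<Sum>j<D. 2 ^ T * real m ^ T)" by (intro sum_mono) simp
  then show "real (\<Sum>j<D. (m + j + T) choose T) \<le> real D * 2 ^ T * real m ^ T" by simp
qed

text \<open>The two bounds force \<open>hf P\<close> to grow like \<open>m ^ T\<close>, hence
  \<open>cum P\<close> like \<open>m ^ Suc T\<close>, while \<open>growth\<close> prescribes the
  exponent \<open>Suc d\<close>.\<close>

lemma exponent_eq:
  fixes P :: "('v::finite, 'k::field) mpoly set"
  assumes gr: "growth P (Suc d)" and D: "D \<ge> 1" and up: "\<And>m. hf P m \<le> (\<Sum>j<D. (m + j + T) choose T)"
    and low: "\<And>m. D * ((m + T) choose T) \<le> hf P (m + c)"
  shows "T = d"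
proof (rule antisym)
  obtain C m0 where "\<forall>m\<ge>m0. real (\<Sum>j<D. (m + j + T) choose T) \<le> C * real m ^ T"
    using choose_upper_growth by blast
  then have "\<forall>m\<ge>m0. real (hf P m) \<le> C * real m ^ T" using up by (meson le_trans of_nat_le_iff order_trans)
  then obtain C' m1 where "\<forall>m\<ge>m1. real (cum P m) \<le> C' * real m ^ Suc T" using cum_bound_from_hf by blast
  then have "Suc d \<le> Suc T" using growth_le[OF gr] by blast
  then show "d \<le> T" by simp
next
  obtain C m0 where C: "\<And>m. m \<ge> m0 \<Longrightarrow> real (cum P m) \<le> C * real m ^ Suc d"
    using gr unfolding growth_def by blast
  define k where "k = Suc T"
  have "(1 / real k) ^ k * real m ^ k \<le> \<bar>C\<bar> * 2 ^ Suc d * real m ^ Suc d" if m: "m \<ge> m0 + c + 1" for m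
  proof -
    have "(1 / real k) ^ k * real m ^ k = (real m / real k) ^ k" by (simp add: power_divide)
    also have "\<dots> \<le> (real (m + k) / real k) ^ k" by (intro power_mono divide_right_mono) auto
    also have "\<dots> \<le> real ((m + k) choose k)" by (rule binomial_ge_n_over_k_pow_k) simp
    \<comment> \<open>The hockey-stick identity sums the lower bounds in degrees up to
      \<open>m\<close> into one binomial coefficient of order \<open>T + 1\<close>.\<close>
    also have "(m + k) choose k = (\<Sum>i\<le>m. (T + i) choose T)"
      unfolding choose_rising_sum(1) k_def by (simp add: add.commute)
    also have "real \<dots> \<le> real (\<Sum>i\<le>m. hf P (i + c))"
    proof (intro of_nat_mono sum_mono)
      fix i
      have "(T + i) choose T \<le> D * ((i + T) choose T)" using D by (simp add: add.commute)
      then show "(T + i) choose T \<le> hf P (i + c)" using low[of i] by (rule le_trans)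
    qed
    also have "(\<Sum>i\<le>m. hf P (i + c)) = sum (hf P) ((\<lambda>i. i + c) ` {..m})"
      by (subst sum.reindex) (auto simp: o_def)
    also have "real \<dots> \<le> real (cum P (m + c))"
      unfolding cum_def by (intro of_nat_mono sum_mono2) auto
    also have "\<dots> \<le> C * real (m + c) ^ Suc d" using m by (intro C) simp
    also have "\<dots> \<le> \<bar>C\<bar> * (2 * real m) ^ Suc d" using m by (intro mult_mono power_mono) auto
    also have "\<dots> = \<bar>C\<bar> * 2 ^ Suc d * real m ^ Suc d" by (simp add: power_mult_distrib)
    finally show ?thesis .
  qed
  moreover have "(1 / real k) ^ k > 0" unfolding k_def by (intro zero_less_power) simp
  ultimately have "k \<le> Suc d" by (intro power_compare[of "(1 / real k) ^ k"])
  then show "T \<le> d" by (simp add: k_def)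
qed

lemma prime_component_bounds:
  fixes P :: "('v::finite, 'k::field) mpoly set"
  assumes perf: "perfect_field TYPE('k)" and P: "prime_ideal P" and gr: "growth P (Suc d)"
  shows "\<exists>D c. (\<forall>m. hf P m \<le> (\<Sum>j<D. (m + j + d) choose d)) \<and> (\<forall>m. D * ((m + d) choose d) \<le> hf P (m + c))"
proof -
  have "\<exists>v. pvar v \<notin> P"
  proof (rule ccontr)
    assume "\<not> ?thesis"
    then have hf0: "hf P m = 0" if "m \<ge> 1" for m using hf_all_vars[OF prime_ideal_is_ideal[OF P] _ that] by blast
    have "cum P m = hf P 0" for m
      unfolding cum_def using hf0 by (subst sum.remove[of _ 0]) (auto intro!: sum.neutral)
    then have "Suc d \<le> 0" by (intro growth_le[OF gr, of 0 "real (hf P 0)"]) simp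
    then show False by simp
  qed
  then obtain v where v: "pvar v \<notin> P" by blast
  obtain T D c where b: "D \<ge> 1" "\<And>m. hf P m \<le> (\<Sum>j<D. (m + j + T) choose T)" "\<And>m. D * ((m + T) choose T) \<le> hf P (m + c)"
    using homogeneous_prime_bounds[OF perf P v] by blast
  have "T = d" by (rule exponent_eq[OF gr b])
  then show ?thesis using b(2,3) by blast
qed

text \<open>Laying the blocks end to end moves their terms to larger indices, where the increasing
  \<open>f\<close> is at least as large.\<close>

lemma sum_blocks_le:
  fixes f :: "nat \<Rightarrow> nat" and D :: "'i \<Rightarrow> nat"
  assumes "mono f"
  shows "(\<Sum>p\<in>A. \<Sum>j<D p. f j) \<le> (\<Sum>j<(\<Sum>p\<in>A. D p). f j)"
proof (induction A rule: infinite_finite_induct)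
  case (insert p A)
  define s where "s = (\<Sum>p\<in>A. D p)"
  have "(\<Sum>j<D p + s. f j) = (\<Sum>i<D p + s. if i < D p then f i else (\<lambda>i. f (D p + i)) (i - D p))"
    by (rule sum.cong) auto
  also have "\<dots> = (\<Sum>j<D p. f j) + (\<Sum>j<s. f (D p + j))" by (rule R.sum_lessThan_append)
  also have "\<dots> \<ge> (\<Sum>j<D p. f j) + (\<Sum>j<s. f j)" by (intro add_mono order_refl sum_mono monoD[OF assms]) simp
  finally show ?case using insert by (simp add: s_def)
qed simp_all

section \<open>Asymptotics and the leading coefficient of the Hilbert polynomial\<close>

lemma shift_ratio: "(\<lambda>m. real (m + a) / real m) \<longlonglongrightarrow> 1"
proof -
  have "(\<lambda>m. 1 + real a / real m) \<longlonglongrightarrow> 1 + 0" by (intro tendsto_add tendsto_const lim_const_over_n)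
  then have "(\<lambda>m. 1 + real a / real m) \<longlonglongrightarrow> 1" by simp
  moreover have "\<forall>\<^sub>F m in sequentially. 1 + real a / real m = real (m + a) / real m"
    using eventually_gt_at_top[of 0] by eventually_elim (simp add: field_simps)
  ultimately show ?thesis by (rule Lim_transform_eventually)
qed

lemma choose_ratio: "(\<lambda>m. real ((m + a + d) choose d) / real m ^ d) \<longlonglongrightarrow> 1 / fact d"
proof (induction d)
  case (Suc d)
  have "real ((m + a + Suc d) choose Suc d) / real m ^ Suc d =
      (real ((m + a + d) choose d) / real m ^ d) * (real (m + (a + d + 1)) / real m) / real (Suc d)" for m
  proof -
    have "Suc d * (Suc (m + a + d) choose Suc d) = Suc (m + a + d) * ((m + a + d) choose d)"
      by (rule Suc_times_binomial)
    then have "real (Suc d) * real ((m + a + Suc d) choose Suc d) = real (m + (a + d + 1)) * real ((m + a + d) choose d)"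
      by (metis add_Suc_right of_nat_mult add.assoc Suc_eq_plus1)
    then have "real ((m + a + Suc d) choose Suc d) = real (m + (a + d + 1)) * real ((m + a + d) choose d) / real (Suc d)"
      by (simp add: field_simps del: of_nat_Suc)
    then show ?thesis by (simp only: power_Suc times_divide_eq_left times_divide_eq_right divide_divide_eq_left mult.commute mult.left_commute)
  qed
  moreover have "(\<lambda>m. (real ((m + a + d) choose d) / real m ^ d) * (real (m + (a + d + 1)) / real m) / real (Suc d))
      \<longlonglongrightarrow> 1 / fact d * 1 / real (Suc d)"
    by (intro tendsto_divide tendsto_mult Suc.IH shift_ratio tendsto_const) simp
  ultimately show ?case by (simp add: mult.commute)
qed simp

lemma poly_ratio: "(\<lambda>m. poly p (real m) / real m ^ Polynomial.degree p) \<longlonglongrightarrow> Polynomial.lead_coeff p"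
proof -
  let ?n = "Polynomial.degree p"
  have "(\<lambda>m. \<Sum>i\<le>?n. Polynomial.coeff p i * (1 / real m) ^ (?n - i)) \<longlonglongrightarrow> (\<Sum>i\<le>?n. Polynomial.coeff p i * 0 ^ (?n - i))"
    by (intro tendsto_sum tendsto_mult tendsto_power tendsto_const lim_const_over_n)
  also have "(\<Sum>i\<le>?n. Polynomial.coeff p i * 0 ^ (?n - i)) = (\<Sum>i\<le>?n. if i = ?n then Polynomial.lead_coeff p else 0)"
    by (intro sum.cong) (auto simp: power_0_left)
  also have "\<dots> = Polynomial.lead_coeff p" by simp
  finally have lim: "(\<lambda>m. \<Sum>i\<le>?n. Polynomial.coeff p i * (1 / real m) ^ (?n - i)) \<longlonglongrightarrow> Polynomial.lead_coeff p" .
  have "\<forall>\<^sub>F m in sequentially. (\<Sum>i\<le>?n. Polynomial.coeff p i * (1 / real m) ^ (?n - i)) = poly p (real m) / real m ^ ?n"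
    using eventually_gt_at_top[of 0]
  proof eventually_elim
    case (elim m)
    show ?case unfolding poly_altdef sum_divide_distrib
    proof (rule sum.cong)
      fix i assume "i \<in> {..?n}"
      then have "real m ^ ?n = real m ^ i * real m ^ (?n - i)" by (simp flip: power_add)
      then show "Polynomial.coeff p i * (1 / real m) ^ (?n - i) = Polynomial.coeff p i * real m ^ i / real m ^ ?n"
        using elim by (simp add: power_divide)
    qed simp
  qed
  with lim show ?thesis by (rule Lim_transform_eventually)
qed

text \<open>The degree of \<open>p\<close> is not known beforehand. A degree below \<open>d\<close>
  forces the limit 0, and a degree above \<open>d\<close> would make the leading coefficient
  0.\<close>

lemma coeff_of_ratio_limit:
  assumes lim: "(\<lambda>m. poly p (real m) / real m ^ d) \<longlonglongrightarrow> L"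
  shows "Polynomial.coeff p d = L"
proof -
  let ?n = "Polynomial.degree p"
  have z: "(\<lambda>m. (1 / real m) ^ k) \<longlonglongrightarrow> 0" if "k > 0" for k
  proof -
    have "(\<lambda>m. (1 / real m) ^ k) \<longlonglongrightarrow> 0 ^ k" by (intro tendsto_power lim_const_over_n)
    then show ?thesis using that by (simp add: zero_power)
  qed
  consider "?n = d" | "?n < d" | "d < ?n" by linarith
  then show ?thesis
  proof cases
    case 1
    then show ?thesis using LIMSEQ_unique[OF lim] poly_ratio[of p] by simp
  next
    case 2
    have "\<forall>\<^sub>F m in sequentially. (poly p (real m) / real m ^ ?n) * (1 / real m) ^ (d - ?n) = poly p (real m) / real m ^ d"
      using 2 by (intro always_eventually allI) (simp add: power_divide flip: power_add)
    then have "(\<lambda>m. poly p (real m) / real m ^ d) \<longlonglongrightarrow> Polynomial.lead_coeff p * 0"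
      by (rule Lim_transform_eventually[rotated]) (intro tendsto_mult poly_ratio z, use 2 in simp)
    then show ?thesis using LIMSEQ_unique[OF lim] 2 by (simp add: coeff_eq_0)
  next
    case 3
    have "\<forall>\<^sub>F m in sequentially. (poly p (real m) / real m ^ d) * (1 / real m) ^ (?n - d) = poly p (real m) / real m ^ ?n"
      using 3 by (intro always_eventually allI) (simp add: power_divide flip: power_add)
    then have "(\<lambda>m. poly p (real m) / real m ^ ?n) \<longlonglongrightarrow> L * 0"
      by (rule Lim_transform_eventually[rotated]) (intro tendsto_mult lim z, use 3 in simp)
    then have "Polynomial.lead_coeff p = 0" using LIMSEQ_unique[OF poly_ratio[of p]] by simp
    then show ?thesis using 3 by simp
  qed
qed

text \<open>Two polynomials that agree at all large natural numbers are equal, which makes the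
  definite description denote \<open>p\<close>.\<close>

lemma hilbert_poly_unique:
  assumes "is_hilbert_poly I p" shows "hilbert_poly I = p"
  unfolding hilbert_poly_def
proof (rule the_equality)
  show "is_hilbert_poly I p" by (rule assms)
  fix q assume "is_hilbert_poly I q"
  then obtain m0 m1 where m: "\<And>m. m \<ge> m0 \<Longrightarrow> real (hilbert_fun I m) = poly q (real m)"
    "\<And>m. m \<ge> m1 \<Longrightarrow> real (hilbert_fun I m) = poly p (real m)"
    using assms unfolding is_hilbert_poly_def by blast
  have "real ` {max m0 m1..} \<subseteq> {x. poly (q - p) x = 0}"
  proof
    fix x assume "x \<in> real ` {max m0 m1..}"
    then obtain n where n: "x = real n" "n \<ge> m0" "n \<ge> m1" by auto
    have "poly (q - p) x = 0" unfolding n(1) poly_diff m(1)[OF n(2), symmetric] m(2)[OF n(3), symmetric] by simp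
    then show "x \<in> {x. poly (q - p) x = 0}" by (rule CollectI)
  qed
  moreover have "infinite (real ` {max m0 m1..})" using finite_imageD[of real] infinite_Ici by (auto simp: inj_on_def)
  ultimately have "infinite {x. poly (q - p) x = 0}" using infinite_super by blast
  then have "q - p = 0" using poly_roots_finite by blast
  then show "q = p" by simp
qed

text \<open>The sum telescopes by Pascal's rule. The generalized binomial coefficient is there
  because the degree is defined as a real number.\<close>

lemma hockey_stick:
  "real (\<Sum>j<D. (m + j + d) choose d) =
    ((real m + real D + real d) gchoose (d + 1)) - ((real m + real d) gchoose (d + 1))"
proof -
  have "(\<Sum>j<D. (m + j + d) choose d) + ((m + d) choose (d + 1)) = (m + D + d) choose (d + 1)"
  proof (induction D)
    case (Suc D)
    have "(m + Suc D + d) choose (d + 1) = ((m + D + d) choose d) + ((m + D + d) choose (d + 1))" by simp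
    then show ?case using Suc by simp
  qed simp
  then have "real (\<Sum>j<D. (m + j + d) choose d) + real ((m + d) choose (d + 1)) = real ((m + D + d) choose (d + 1))"
    by (metis of_nat_add)
  then show ?thesis by (simp add: binomial_gbinomial del: of_nat_sum)
qed

theorem theorem2p2:
  fixes I :: "('v::finite, 'k::field) mpoly set" and d :: nat
  assumes "perfect_field TYPE('k)"
    and "homogeneous_ideal I" and "unmixed I" and "radical_ideal I"
    and "proj_dim I = int d"
  shows "\<forall>m::nat. m \<ge> 1 \<longrightarrow>
    real (hilbert_fun I m) \<le>
      ((real m + ideal_degree I + real d) gchoose (d + 1)) - ((real m + real d) gchoose (d + 1))"
proof -
  have idI: "is_ideal I" using assms(2) by (rule homogeneous_ideal_is_ideal)
  obtain \<P> where P: "finite \<P>" "\<P> \<noteq> {}" "antichain \<P>" "I = \<Inter>\<P>"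
    "\<And>P. P \<in> \<P> \<Longrightarrow> homogeneous_ideal P \<and> prime_ideal P \<and> growth P (Suc d)"
    by (rule unmixed_radical_decomposition[OF assms(2-5)]) (rule that, assumption+)
  have "\<forall>P\<in>\<P>. \<exists>D c. (\<forall>m. hf P m \<le> (\<Sum>j<D. (m + j + d) choose d)) \<and> (\<forall>m. D * ((m + d) choose d) \<le> hf P (m + c))"
    using prime_component_bounds[OF assms(1)] P(5) by blast
  then obtain D c where D: "\<And>P m. P \<in> \<P> \<Longrightarrow> hf P m \<le> (\<Sum>j<D P. (m + j + d) choose d)"
    "\<And>P m. P \<in> \<P> \<Longrightarrow> D P * ((m + d) choose d) \<le> hf P (m + c P)" by metis
  \<comment> \<open>Only the final limit shows that \<open>N\<close> is the degree of
    \<open>I\<close>; until then it is the constant shared by both bounds.\<close>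
  define N where "N = (\<Sum>P\<in>\<P>. D P)"
  have upper: "hf I m \<le> (\<Sum>j<N. (m + j + d) choose d)" for m
  proof -
    have "hf I m \<le> (\<Sum>P\<in>\<P>. hf P m)"
      unfolding P(4) by (rule hf_Inter_le[OF P(1)]) (use P(5) prime_ideal_is_ideal in blast)
    also have "\<dots> \<le> (\<Sum>P\<in>\<P>. \<Sum>j<D P. (m + j + d) choose d)" by (intro sum_mono D)
    also have "\<dots> \<le> (\<Sum>j<N. (m + j + d) choose d)"
      unfolding N_def by (rule sum_blocks_le) (auto intro!: monoI binomial_right_mono)
    finally show ?thesis .
  qed
  have "homogeneous_ideal P \<and> prime_ideal P" if "P \<in> \<P>" for P using P(5)[OF that] by blast
  then have "\<exists>\<gamma>. \<forall>m. (\<forall>P\<in>\<P>. \<gamma> P \<le> m) \<longrightarrow> (\<Sum>P\<in>\<P>. hf P (m - \<gamma> P)) \<le> hf I m"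
    unfolding P(4) by (rule hf_Inter_ge[OF P(1,3)])
  then obtain \<gamma> where "\<forall>m. (\<forall>P\<in>\<P>. \<gamma> P \<le> m) \<longrightarrow> (\<Sum>P\<in>\<P>. hf P (m - \<gamma> P)) \<le> hf I m" ..
  note \<gamma> = mp[OF spec[OF this]]
  \<comment> \<open>A single shift that absorbs, for every component, the shift of the intersection
    bound and that of the component's own lower bound.\<close>
  define M where "M = (\<Sum>P\<in>\<P>. \<gamma> P + c P)"
  have M: "\<gamma> P + c P \<le> M" if "P \<in> \<P>" for P
    unfolding M_def using P(1) that by (intro member_le_sum) auto
  have lower: "N * ((m + d) choose d) \<le> hf I (m + M)" for m
  proof -
    have "D P * ((m + d) choose d) \<le> hf P (m + M - \<gamma> P)" if p: "P \<in> \<P>" for P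
    proof -
      have e: "m + M - \<gamma> P = (m + (M - (\<gamma> P + c P))) + c P" using M[OF p] by simp
      have "D P * ((m + d) choose d) \<le> D P * (((m + (M - (\<gamma> P + c P))) + d) choose d)"
        by (intro mult_left_mono binomial_right_mono) auto
      also have "\<dots> \<le> hf P (m + M - \<gamma> P)" unfolding e by (rule D(2)[OF p])
      finally show ?thesis .
    qed
    then have "N * ((m + d) choose d) \<le> (\<Sum>P\<in>\<P>. hf P (m + M - \<gamma> P))"
      unfolding N_def sum_distrib_right by (intro sum_mono)
    also have "\<dots> \<le> hf I (m + M)" by (rule \<gamma>) (use M in fastforce)
    finally show ?thesis .
  qed
  have upper_lim: "(\<lambda>m. real (\<Sum>j<N. (m + M + j + d) choose d) / real m ^ d) \<longlonglongrightarrow> real N / fact d"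
  proof -
    have "(\<lambda>m. \<Sum>j<N. real ((m + (M + j) + d) choose d) / real m ^ d) \<longlonglongrightarrow> (\<Sum>j<N. 1 / fact d)"
      by (intro tendsto_sum choose_ratio)
    then show ?thesis by (simp add: sum_divide_distrib add.assoc)
  qed
  have lower_lim: "(\<lambda>m. real (N * ((m + d) choose d)) / real m ^ d) \<longlonglongrightarrow> real N / fact d"
    using tendsto_mult[OF tendsto_const[of "real N"] choose_ratio[of 0 d]] by simp
  \<comment> \<open>Divided by \<open>m ^ d\<close>, both bounds tend to the same limit, so the
    constants lost in shifts do not matter.\<close>
  have "(\<lambda>m. real (hf I (m + M)) / real m ^ d) \<longlonglongrightarrow> real N / fact d"
  proof (rule tendsto_sandwich[OF _ _ lower_lim upper_lim])
    show "\<forall>\<^sub>F m in sequentially. real (N * ((m + d) choose d)) / real m ^ d \<le> real (hf I (m + M)) / real m ^ d"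
      by (intro always_eventually allI divide_right_mono of_nat_mono lower) simp
    show "\<forall>\<^sub>F m in sequentially. real (hf I (m + M)) / real m ^ d \<le> real (\<Sum>j<N. (m + M + j + d) choose d) / real m ^ d"
      by (intro always_eventually allI divide_right_mono of_nat_mono upper) simp
  qed
  then have "(\<lambda>m. real (hf I (m + M)) / real m ^ d / (real (m + M) / real m) ^ d) \<longlonglongrightarrow> real N / fact d / 1 ^ d"
    by (rule tendsto_divide[OF _ tendsto_power[OF shift_ratio]]) simp
  moreover have "\<forall>\<^sub>F m in sequentially. real (hf I (m + M)) / real m ^ d / (real (m + M) / real m) ^ d =
      real (hf I (m + M)) / real (m + M) ^ d"
    using eventually_gt_at_top[of 0] by eventually_elim (simp add: power_divide)
  ultimately have "(\<lambda>m. real (hf I (m + M)) / real (m + M) ^ d) \<longlonglongrightarrow> real N / fact d / 1 ^ d"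
    by (rule Lim_transform_eventually)
  then have "(\<lambda>m. real (hf I m) / real m ^ d) \<longlonglongrightarrow> real N / fact d / 1 ^ d" by (rule LIMSEQ_offset)
  then have lim: "(\<lambda>m. real (hf I m) / real m ^ d) \<longlonglongrightarrow> real N / fact d" by simp
  obtain p m0 where p: "\<And>m. m \<ge> m0 \<Longrightarrow> real (hf I m) = poly p (real m)"
    using evpoly_hf[OF assms(2)] unfolding evpoly_def by blast
  have "\<forall>\<^sub>F m in sequentially. real (hf I m) / real m ^ d = poly p (real m) / real m ^ d"
    using eventually_ge_at_top[of m0] by eventually_elim (simp add: p)
  with lim have "(\<lambda>m. poly p (real m) / real m ^ d) \<longlonglongrightarrow> real N / fact d"
    by (rule Lim_transform_eventually)
  then have "Polynomial.coeff p d = real N / fact d" by (rule coeff_of_ratio_limit)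
  moreover have "is_hilbert_poly I p"
    unfolding is_hilbert_poly_def hilbert_fun_eq_hdim[OF idI] using p by blast
  then have "hilbert_poly I = p" by (rule hilbert_poly_unique)
  ultimately have deg: "ideal_degree I = real N" by (simp add: ideal_degree_def assms(5))
  show ?thesis
  proof (intro allI impI)
    fix m :: nat
    have "real (hilbert_fun I m) \<le> real (\<Sum>j<N. (m + j + d) choose d)"
      unfolding hilbert_fun_eq_hdim[OF idI] by (rule of_nat_mono) (rule upper)
    then show "real (hilbert_fun I m) \<le>
      ((real m + ideal_degree I + real d) gchoose (d + 1)) - ((real m + real d) gchoose (d + 1))"
      unfolding hockey_stick deg .
  qed
qed

end
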